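(* Let $\mathbb{K}$ be a field and let $\mathcal{T}$ be a Lawvere theory such that $[\mathcal{T},\mathsf{Set}]$ and $[\mathcal{T},\mathsf{Coalg}_{coc}]$ are pointed. Suppose that there are a positive integer $n$, binary terms $\alpha^1,\dots,\alpha^n\colon T^2\to T$ and an $(n+1)$-ary term $\beta\colon T^{n+1}\to T$ in $\mathcal{T}$ such that for every $\mathbf{H}$ in $[\mathcal{T},\mathsf{Coalg}_{coc}]$, with $H=\mathbf{H}(T)$, $$\alpha^i_H\circ\Delta_H=0_{HH}\quad\text{for all } i=1,\dots,n,$$ $$\beta_H\circ\bigl(\alpha^1_H\otimes\dots\otimes\alpha^n_H\otimes(\epsilon_H\otimes\mathrm{id}_H)\bigr)\circ\Delta^{(n)}_{H\otimes H}=\mathrm{id}_H\otimes\epsilon_H .$$ Then $[\mathcal{T},\mathsf{Coalg}_{coc}]$ is protomodular.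
   Context: $\mathsf{Coalg}_{coc}$ is the category of coassociative, counital, cocommutative coalgebras over $\mathbb{K}$ and coalgebra homomorphisms; its finite products are given by $\otimes_{\mathbb{K}}$ and its terminal object is $\mathbb{K}$. A Lawvere theory $\mathcal{T}$ is a small category with finite products whose objects are the powers $T^0,T^1=T,T^2,\dots$ of one object $T$. $[\mathcal{T},\mathsf{Set}]$ and $[\mathcal{T},\mathsf{Coalg}_{coc}]$ are the categories of finite-product-preserving functors from $\mathcal{T}$ to $\mathsf{Set}$, respectively $\mathsf{Coalg}_{coc}$, with natural transformations. For $\mathbf{H}$ in $[\mathcal{T},\mathsf{Coalg}_{coc}]$ put $H=\mathbf{H}(T)$, so $\mathbf{H}(T^m)\cong H^{\otimes m}$; a morphism $t\colon T^m\to T$ (an $m$-ary term) induces the coalgebra map $t_H=\mathbf{H}(t)\colon H^{\otimes m}\to H$, called the linearized term. $\Delta_H,\epsilon_H$ are the comultiplication and counit of $H$; $\Delta_{H\otimes H}^{(n)}\colon H\otimes H\to(H\otimes H)^{\otimes n+1}$ is the $n$-fold iterated comultiplication of the coalgebra $H\otimes H$. Since $[\mathcal{T},\mathsf{Coalg}_{coc}]$ is pointed (with zero object having underlying coalgebra $\mathbb{K}$), there is a unique morphism from the zero object to $\mathbf{H}$, with underlying map $u_H\colon\mathbb{K}\to H$; $0_{HH'}:=u_{H'}\circ\epsilon_H\colon H\to H'$. In a pointed category with finite limits, protomodularity (in the sense of Bourn) amounts to the Split Short Five Lemma. *)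

theory Defs
  imports "HOL-Algebra.Module" "HOL-Library.FuncSet" "HOL-Library.Equipollence"
begin

section \<open>Categories\<close>

text \<open>Hom sets of different pairs of objects need not be disjoint, so composition is indexed by
  the three objects: \<^term>\<open>Cmp C X Y Z g f\<close> is the composite of \<open>f : X \<rightarrow> Y\<close> and \<open>g : Y \<rightarrow> Z\<close>.\<close>

record ('o, 'm) cat =
  Ob :: "'o set"
  Hom :: "'o \<Rightarrow> 'o \<Rightarrow> 'm set"
  Idn :: "'o \<Rightarrow> 'm"
  Cmp :: "'o \<Rightarrow> 'o \<Rightarrow> 'o \<Rightarrow> 'm \<Rightarrow> 'm \<Rightarrow> 'm"

locale category =
  fixes C :: "('o, 'm, 'z) cat_scheme"
  assumes Idn_in_Hom: "X \<in> Ob C \<Longrightarrow> Idn C X \<in> Hom C X X"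
    and Cmp_in_Hom: "\<lbrakk>X \<in> Ob C; Y \<in> Ob C; Z \<in> Ob C; f \<in> Hom C X Y; g \<in> Hom C Y Z\<rbrakk>
      \<Longrightarrow> Cmp C X Y Z g f \<in> Hom C X Z"
    and Cmp_Idn_right: "\<lbrakk>X \<in> Ob C; Y \<in> Ob C; f \<in> Hom C X Y\<rbrakk> \<Longrightarrow> Cmp C X X Y f (Idn C X) = f"
    and Cmp_Idn_left: "\<lbrakk>X \<in> Ob C; Y \<in> Ob C; f \<in> Hom C X Y\<rbrakk> \<Longrightarrow> Cmp C X Y Y (Idn C Y) f = f"
    and Cmp_assoc: "\<lbrakk>W \<in> Ob C; X \<in> Ob C; Y \<in> Ob C; Z \<in> Ob C;
        f \<in> Hom C W X; g \<in> Hom C X Y; h \<in> Hom C Y Z\<rbrakk>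
      \<Longrightarrow> Cmp C W X Z (Cmp C X Y Z h g) f = Cmp C W Y Z h (Cmp C W X Y g f)"

definition isomorphism :: "('o, 'm, 'z) cat_scheme \<Rightarrow> 'o \<Rightarrow> 'o \<Rightarrow> 'm \<Rightarrow> bool" where
  "isomorphism C X Y f \<longleftrightarrow> f \<in> Hom C X Y \<and>
     (\<exists>g \<in> Hom C Y X. Cmp C X Y X g f = Idn C X \<and> Cmp C Y X Y f g = Idn C Y)"

definition terminal_object :: "('o, 'm, 'z) cat_scheme \<Rightarrow> 'o \<Rightarrow> bool" where
  "terminal_object C Z \<longleftrightarrow> Z \<in> Ob C \<and> (\<forall>X \<in> Ob C. \<exists>!f. f \<in> Hom C X Z)"

definition initial_object :: "('o, 'm, 'z) cat_scheme \<Rightarrow> 'o \<Rightarrow> bool" where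
  "initial_object C Z \<longleftrightarrow> Z \<in> Ob C \<and> (\<forall>X \<in> Ob C. \<exists>!f. f \<in> Hom C Z X)"

definition zero_object :: "('o, 'm, 'z) cat_scheme \<Rightarrow> 'o \<Rightarrow> bool" where
  "zero_object C Z \<longleftrightarrow> initial_object C Z \<and> terminal_object C Z"

definition pointed :: "('o, 'm, 'z) cat_scheme \<Rightarrow> bool" where
  "pointed C \<longleftrightarrow> (\<exists>Z. zero_object C Z)"

definition product_cone ::
  "('o, 'm, 'z) cat_scheme \<Rightarrow> nat set \<Rightarrow> (nat \<Rightarrow> 'o) \<Rightarrow> 'o \<Rightarrow> (nat \<Rightarrow> 'm) \<Rightarrow> bool" where
  "product_cone C I A P p \<longleftrightarrow>
     P \<in> Ob C \<and> (\<forall>i \<in> I. A i \<in> Ob C \<and> p i \<in> Hom C P (A i)) \<and>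
     (\<forall>X \<in> Ob C. \<forall>f. (\<forall>i \<in> I. f i \<in> Hom C X (A i)) \<longrightarrow>
        (\<exists>!h. h \<in> Hom C X P \<and> (\<forall>i \<in> I. Cmp C X P (A i) (p i) h = f i)))"

text \<open>\<open>P\<close> with \<open>a : P \<rightarrow> A\<close> and \<open>e : P \<rightarrow> E\<close> is a pullback of \<open>f : A \<rightarrow> B\<close> and \<open>g : E \<rightarrow> B\<close>.\<close>

definition pullback ::
  "('o, 'm, 'z) cat_scheme \<Rightarrow> 'o \<Rightarrow> 'o \<Rightarrow> 'o \<Rightarrow> 'm \<Rightarrow> 'm \<Rightarrow> 'o \<Rightarrow> 'm \<Rightarrow> 'm \<Rightarrow> bool" where
  "pullback C A E B f g P a e \<longleftrightarrow>
     P \<in> Ob C \<and> a \<in> Hom C P A \<and> e \<in> Hom C P E \<and> Cmp C P A B f a = Cmp C P E B g e \<and>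
     (\<forall>X \<in> Ob C. \<forall>x \<in> Hom C X A. \<forall>y \<in> Hom C X E. Cmp C X A B f x = Cmp C X E B g y \<longrightarrow>
        (\<exists>!h. h \<in> Hom C X P \<and> Cmp C X P A a h = x \<and> Cmp C X P E e h = y))"

definition finitely_complete :: "('o, 'm, 'z) cat_scheme \<Rightarrow> bool" where
  "finitely_complete C \<longleftrightarrow> (\<exists>Z. terminal_object C Z) \<and>
     (\<forall>A \<in> Ob C. \<forall>E \<in> Ob C. \<forall>B \<in> Ob C. \<forall>f \<in> Hom C A B. \<forall>g \<in> Hom C E B.
        \<exists>P a e. pullback C A E B f g P a e)"

text \<open>Bourn's fibration of points. A point over \<open>B\<close> is a split epimorphism \<open>p : A \<rightarrow> B\<close> with a
  chosen section \<open>s\<close>; a morphism of points over \<open>B\<close> commutes with the epimorphisms and with the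
  sections.\<close>

definition point_over :: "('o, 'm, 'z) cat_scheme \<Rightarrow> 'o \<Rightarrow> 'o \<Rightarrow> 'm \<Rightarrow> 'm \<Rightarrow> bool" where
  "point_over C B A p s \<longleftrightarrow> A \<in> Ob C \<and> B \<in> Ob C \<and> p \<in> Hom C A B \<and> s \<in> Hom C B A \<and>
     Cmp C B A B p s = Idn C B"

definition point_morphism ::
  "('o, 'm, 'z) cat_scheme \<Rightarrow> 'o \<Rightarrow> 'o \<Rightarrow> 'm \<Rightarrow> 'm \<Rightarrow> 'o \<Rightarrow> 'm \<Rightarrow> 'm \<Rightarrow> 'm \<Rightarrow> bool" where
  "point_morphism C B A p s A' p' s' f \<longleftrightarrow> f \<in> Hom C A A' \<and>
     Cmp C A A' B p' f = p \<and> Cmp C B A A' f s = s'"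

text \<open>Protomodularity in the sense of Bourn: finite limits exist, and each change-of-base functor
  \<open>v\<^sup>* : Pt(B) \<rightarrow> Pt(E)\<close> along \<open>v : E \<rightarrow> B\<close> reflects isomorphisms. Below, \<open>P\<close> and \<open>P'\<close> are the images
  of two points under \<open>v\<^sup>*\<close>, and \<open>g\<close> is the image of \<open>f\<close>. The section of \<open>e : P \<rightarrow> E\<close> is induced by
  \<open>s \<circ> v\<close> and the identity, and \<open>g\<close> is automatically compatible with the sections; a morphism of
  points is invertible iff its underlying morphism is.\<close>

definition protomodular :: "('o, 'm, 'z) cat_scheme \<Rightarrow> bool" where
  "protomodular C \<longleftrightarrow> finitely_complete C \<and>
     (\<forall>B E v A p s A' p' s' f P a e P' a' e' g.
        E \<in> Ob C \<and> v \<in> Hom C E B \<and>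
        point_over C B A p s \<and> point_over C B A' p' s' \<and> point_morphism C B A p s A' p' s' f \<and>
        pullback C A E B p v P a e \<and> pullback C A' E B p' v P' a' e' \<and>
        g \<in> Hom C P P' \<and> Cmp C P P' A' a' g = Cmp C P A A' f a \<and> Cmp C P P' E e' g = e \<and>
        isomorphism C P P' g
        \<longrightarrow> isomorphism C A A' f)"


section \<open>Lawvere theories and their models\<close>

text \<open>\<^term>\<open>pow L n\<close> is the power \<open>T\<^sup>n\<close> of \<open>T = pow L 1\<close>, with projections \<^term>\<open>proj L n i\<close> for \<open>i < n\<close>.
  All finite products exist, since every object is a power and the product of \<open>T\<^sup>m\<close> and \<open>T\<^sup>n\<close> is
  \<open>T\<close> to the power \<open>m + n\<close>.\<close>

record ('o, 'm) lawvere = "('o, 'm) cat" +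
  pow :: "nat \<Rightarrow> 'o"
  proj :: "nat \<Rightarrow> nat \<Rightarrow> 'm"

locale lawvere_theory = category L for L :: "('o, 'm, 'z) lawvere_scheme" +
  assumes Ob_eq_powers: "Ob L = range (pow L)"
    and pow_product: "product_cone L {..<n} (\<lambda>_. pow L 1) (pow L n) (proj L n)"
    and proj_1: "proj L 1 0 = Idn L (pow L 1)"

record ('o, 'm, 'p, 'n) cfunctor =
  Fo :: "'o \<Rightarrow> 'p"
  Fm :: "'o \<Rightarrow> 'o \<Rightarrow> 'm \<Rightarrow> 'n"

definition is_functor ::
  "('o, 'm, 'y) cat_scheme \<Rightarrow> ('p, 'n, 'z) cat_scheme \<Rightarrow> ('o, 'm, 'p, 'n) cfunctor \<Rightarrow> bool" where
  "is_functor C D F \<longleftrightarrow>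
     (\<forall>X \<in> Ob C. Fo F X \<in> Ob D \<and> Fm F X X (Idn C X) = Idn D (Fo F X)) \<and>
     (\<forall>X \<in> Ob C. \<forall>Y \<in> Ob C. \<forall>f \<in> Hom C X Y. Fm F X Y f \<in> Hom D (Fo F X) (Fo F Y)) \<and>
     (\<forall>X \<in> Ob C. \<forall>Y \<in> Ob C. \<forall>Z \<in> Ob C. \<forall>f \<in> Hom C X Y. \<forall>g \<in> Hom C Y Z.
        Fm F X Z (Cmp C X Y Z g f) = Cmp D (Fo F X) (Fo F Y) (Fo F Z) (Fm F Y Z g) (Fm F X Y f))"

definition preserves_finite_products ::
  "('o, 'm, 'y) cat_scheme \<Rightarrow> ('p, 'n, 'z) cat_scheme \<Rightarrow> ('o, 'm, 'p, 'n) cfunctor \<Rightarrow> bool" where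
  "preserves_finite_products C D F \<longleftrightarrow>
     (\<forall>I A P p. finite I \<and> product_cone C I A P p \<longrightarrow>
        product_cone D I (\<lambda>i. Fo F (A i)) (Fo F P) (\<lambda>i. Fm F P (A i) (p i)))"

text \<open>Natural transformations are extensional families of components, so that equality of
  morphisms is equality of all components.\<close>

definition nat_trans ::
  "('o, 'm, 'y) cat_scheme \<Rightarrow> ('p, 'n, 'z) cat_scheme \<Rightarrow>
   ('o, 'm, 'p, 'n) cfunctor \<Rightarrow> ('o, 'm, 'p, 'n) cfunctor \<Rightarrow> ('o \<Rightarrow> 'n) set" where
  "nat_trans C D F G = {\<eta>. \<eta> \<in> (\<Pi>\<^sub>E X \<in> Ob C. Hom D (Fo F X) (Fo G X)) \<and>
     (\<forall>X \<in> Ob C. \<forall>Y \<in> Ob C. \<forall>f \<in> Hom C X Y.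
        Cmp D (Fo F X) (Fo G X) (Fo G Y) (Fm G X Y f) (\<eta> X) =
        Cmp D (Fo F X) (Fo F Y) (Fo G Y) (\<eta> Y) (Fm F X Y f))}"

definition models ::
  "('o, 'm, 'y) cat_scheme \<Rightarrow> ('p, 'n, 'z) cat_scheme \<Rightarrow> (('o, 'm, 'p, 'n) cfunctor, 'o \<Rightarrow> 'n) cat" where
  "models C D =
     \<lparr>Ob = {F. is_functor C D F \<and> preserves_finite_products C D F},
      Hom = nat_trans C D,
      Idn = (\<lambda>F. \<lambda>X \<in> Ob C. Idn D (Fo F X)),
      Cmp = (\<lambda>F G H \<theta> \<eta>. \<lambda>X \<in> Ob C. Cmp D (Fo F X) (Fo G X) (Fo H X) (\<theta> X) (\<eta> X))\<rparr>"

text \<open>The sets contained in the universe \<^typ>\<open>'u\<close>.\<close>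

definition Set_cat :: "('u set, 'u \<Rightarrow> 'u) cat" where
  "Set_cat =
     \<lparr>Ob = UNIV,
      Hom = (\<lambda>A B. A \<rightarrow>\<^sub>E B),
      Idn = (\<lambda>A. \<lambda>x \<in> A. x),
      Cmp = (\<lambda>A B C g f. compose A g f)\<rparr>"


section \<open>Tensor products of finite lists of vector spaces\<close>

text \<open>A list \<open>[(c\<^sub>1, xs\<^sub>1), \<dots>, (c\<^sub>r, xs\<^sub>r)]\<close>, where each \<open>xs\<^sub>j\<close> is a list of vectors, one from each factor,
  stands for the formal sum of the \<open>c\<^sub>j xs\<^sub>j\<close>. The tensor product consists of the formal sums modulo
  the congruence that makes them a module and makes the pure tensors multilinear. The empty list
  of factors gives the ground field.\<close>

definition formal_sums ::
  "('k, 'r) ring_scheme \<Rightarrow> ('k, 'v, 'z) module_scheme list \<Rightarrow> ('k \<times> 'v list) list set" where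
  "formal_sums K Ms = lists (carrier K \<times> listset (map carrier Ms))"

inductive tensor_rel ::
  "('k, 'r) ring_scheme \<Rightarrow> ('k, 'v, 'z) module_scheme list \<Rightarrow>
   ('k \<times> 'v list) list \<Rightarrow> ('k \<times> 'v list) list \<Rightarrow> bool"
  for K :: "('k, 'r) ring_scheme" and Ms :: "('k, 'v, 'z) module_scheme list" where
  refl: "r \<in> formal_sums K Ms \<Longrightarrow> tensor_rel K Ms r r"
| sym: "tensor_rel K Ms r s \<Longrightarrow> tensor_rel K Ms s r"
| trans: "tensor_rel K Ms r s \<Longrightarrow> tensor_rel K Ms s t \<Longrightarrow> tensor_rel K Ms r t"
| cong: "tensor_rel K Ms r r' \<Longrightarrow> tensor_rel K Ms s s' \<Longrightarrow> tensor_rel K Ms (r @ s) (r' @ s')"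
| comm: "r \<in> formal_sums K Ms \<Longrightarrow> s \<in> formal_sums K Ms \<Longrightarrow> tensor_rel K Ms (r @ s) (s @ r)"
| coeff_zero: "xs \<in> listset (map carrier Ms) \<Longrightarrow> tensor_rel K Ms [(\<zero>\<^bsub>K\<^esub>, xs)] []"
| coeff_add: "c \<in> carrier K \<Longrightarrow> d \<in> carrier K \<Longrightarrow> xs \<in> listset (map carrier Ms) \<Longrightarrow>
    tensor_rel K Ms [(c \<oplus>\<^bsub>K\<^esub> d, xs)] [(c, xs), (d, xs)]"
| vector_add: "c \<in> carrier K \<Longrightarrow> xs \<in> listset (map carrier Ms) \<Longrightarrow> i < length Ms \<Longrightarrow>
    x \<in> carrier (Ms ! i) \<Longrightarrow> y \<in> carrier (Ms ! i) \<Longrightarrow>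
    tensor_rel K Ms [(c, xs[i := x \<oplus>\<^bsub>Ms ! i\<^esub> y])] [(c, xs[i := x]), (c, xs[i := y])]"
| vector_smult: "c \<in> carrier K \<Longrightarrow> xs \<in> listset (map carrier Ms) \<Longrightarrow> i < length Ms \<Longrightarrow>
    a \<in> carrier K \<Longrightarrow> x \<in> carrier (Ms ! i) \<Longrightarrow>
    tensor_rel K Ms [(c, xs[i := a \<odot>\<^bsub>Ms ! i\<^esub> x])] [(c \<otimes>\<^bsub>K\<^esub> a, xs[i := x])]"

type_synonym ('k, 'v) tensor = "('k \<times> 'v list) list set"

definition tensor_class ::
  "('k, 'r) ring_scheme \<Rightarrow> ('k, 'v, 'z) module_scheme list \<Rightarrow> ('k \<times> 'v list) list \<Rightarrow> ('k, 'v) tensor" where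
  "tensor_class K Ms r = {s. tensor_rel K Ms r s}"

text \<open>The fields \<open>mult\<close> and \<open>one\<close> of a module record carry no meaning.\<close>

definition tensor ::
  "('k, 'r) ring_scheme \<Rightarrow> ('k, 'v, 'z) module_scheme list \<Rightarrow> ('k, ('k, 'v) tensor) module" where
  "tensor K Ms =
     \<lparr>carrier = tensor_class K Ms ` formal_sums K Ms,
      mult = undefined,
      one = undefined,
      zero = tensor_class K Ms [],
      add = (\<lambda>X Y. \<Union>r \<in> X. \<Union>s \<in> Y. tensor_class K Ms (r @ s)),
      smult = (\<lambda>a X. \<Union>r \<in> X. tensor_class K Ms (map (\<lambda>(c, xs). (a \<otimes>\<^bsub>K\<^esub> c, xs)) r))\<rparr>"

definition pure_tensor ::
  "('k, 'r) ring_scheme \<Rightarrow> ('k, 'v, 'z) module_scheme list \<Rightarrow> 'v list \<Rightarrow> ('k, 'v) tensor" where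
  "pure_tensor K Ms xs = tensor_class K Ms [(\<one>\<^bsub>K\<^esub>, xs)]"

text \<open>The linear map into \<open>N\<close> on a tensor product induced by a multilinear map \<open>\<phi>\<close>. For multilinear
  \<open>\<phi>\<close> the value does not depend on the chosen formal sum.\<close>

definition tensor_lift ::
  "('k, 'w, 'z) module_scheme \<Rightarrow> ('v list \<Rightarrow> 'w) \<Rightarrow> ('k, 'v) tensor \<Rightarrow> 'w" where
  "tensor_lift N \<phi> X =
     foldr (\<lambda>(c, xs) z. (c \<odot>\<^bsub>N\<^esub> \<phi> xs) \<oplus>\<^bsub>N\<^esub> z) (SOME r. r \<in> X) \<zero>\<^bsub>N\<^esub>"

abbreviation tensor_lift2 ::
  "('k, 'w, 'z) module_scheme \<Rightarrow> ('v \<Rightarrow> 'v \<Rightarrow> 'w) \<Rightarrow> ('k, 'v) tensor \<Rightarrow> 'w" where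
  "tensor_lift2 N \<phi> \<equiv> tensor_lift N (\<lambda>xs. \<phi> (xs ! 0) (xs ! 1))"

text \<open>\<open>f\<^sub>1 \<otimes> \<dots> \<otimes> f\<^sub>m\<close>, with codomain the tensor product of the list \<open>Ns\<close>.\<close>

definition tensor_map ::
  "('k, 'r) ring_scheme \<Rightarrow> ('k, 'w, 'z) module_scheme list \<Rightarrow> ('v \<Rightarrow> 'w) list \<Rightarrow>
   ('k, 'v) tensor \<Rightarrow> ('k, 'w) tensor" where
  "tensor_map K Ns fs =
     tensor_lift (tensor K Ns) (\<lambda>xs. pure_tensor K Ns (map2 (\<lambda>f x. f x) fs xs))"


section \<open>Coalgebras\<close>

definition linear_map ::
  "('k, 'r) ring_scheme \<Rightarrow> ('k, 'v, 'y) module_scheme \<Rightarrow> ('k, 'w, 'z) module_scheme \<Rightarrow> ('v \<Rightarrow> 'w) \<Rightarrow> bool" where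
  "linear_map K M N f \<longleftrightarrow> f \<in> carrier M \<rightarrow> carrier N \<and>
     (\<forall>x \<in> carrier M. \<forall>y \<in> carrier M. f (x \<oplus>\<^bsub>M\<^esub> y) = f x \<oplus>\<^bsub>N\<^esub> f y) \<and>
     (\<forall>a \<in> carrier K. \<forall>x \<in> carrier M. f (a \<odot>\<^bsub>M\<^esub> x) = a \<odot>\<^bsub>N\<^esub> f x)"

definition ground_module :: "('k, 'r) ring_scheme \<Rightarrow> ('k, 'k) module" where
  "ground_module K =
     \<lparr>carrier = carrier K, mult = mult K, one = one K, zero = zero K, add = add K, smult = mult K\<rparr>"

record ('k, 'v) coalgebra = "('k, 'v) module" +
  comult :: "'v \<Rightarrow> ('k, 'v) tensor"
  counit :: "'v \<Rightarrow> 'k"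

text \<open>Coassociativity is stated in the threefold tensor power, which identifies both bracketings.\<close>

locale cocommutative_coalgebra = module K H
  for K :: "('k, 'r) ring_scheme" and H :: "('k, 'v, 'z) coalgebra_scheme" +
  assumes comult_linear: "linear_map K H (tensor K [H, H]) (comult H)"
    and counit_linear: "linear_map K H (ground_module K) (counit H)"
    and coassociative: "h \<in> carrier H \<Longrightarrow>
      tensor_lift2 (tensor K [H, H, H])
        (\<lambda>x y. tensor_lift2 (tensor K [H, H, H]) (\<lambda>a b. pure_tensor K [H, H, H] [a, b, y]) (comult H x))
        (comult H h) =
      tensor_lift2 (tensor K [H, H, H])
        (\<lambda>x y. tensor_lift2 (tensor K [H, H, H]) (\<lambda>a b. pure_tensor K [H, H, H] [x, a, b]) (comult H y))
        (comult H h)"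
    and counital_left: "h \<in> carrier H \<Longrightarrow>
      tensor_lift2 H (\<lambda>x y. counit H x \<odot>\<^bsub>H\<^esub> y) (comult H h) = h"
    and counital_right: "h \<in> carrier H \<Longrightarrow>
      tensor_lift2 H (\<lambda>x y. counit H y \<odot>\<^bsub>H\<^esub> x) (comult H h) = h"
    and cocommutative: "h \<in> carrier H \<Longrightarrow>
      tensor_lift2 (tensor K [H, H]) (\<lambda>x y. pure_tensor K [H, H] [y, x]) (comult H h) = comult H h"

definition coalgebra_hom ::
  "('k, 'r) ring_scheme \<Rightarrow> ('k, 'v, 'y) coalgebra_scheme \<Rightarrow> ('k, 'w, 'z) coalgebra_scheme \<Rightarrow>
   ('v \<Rightarrow> 'w) \<Rightarrow> bool" where
  "coalgebra_hom K A B f \<longleftrightarrow> linear_map K A B f \<and>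
     (\<forall>x \<in> carrier A. comult B (f x) = tensor_map K [B, B] [f, f] (comult A x)) \<and>
     (\<forall>x \<in> carrier A. counit B (f x) = counit A x)"

text \<open>The coalgebras whose carrier is a subset of the universe \<^typ>\<open>'u\<close>.\<close>

definition Coalg_coc :: "('k, 'r) ring_scheme \<Rightarrow> (('k, 'u) coalgebra, 'u \<Rightarrow> 'u) cat" where
  "Coalg_coc K =
     \<lparr>Ob = {A. cocommutative_coalgebra K A},
      Hom = (\<lambda>A B. {f \<in> carrier A \<rightarrow>\<^sub>E carrier B. coalgebra_hom K A B f}),
      Idn = (\<lambda>A. \<lambda>x \<in> carrier A. x),
      Cmp = (\<lambda>A B C g f. compose (carrier A) g f)\<rparr>"

text \<open>The coalgebra \<open>A \<otimes> B\<close>, with comultiplication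
  \<open>a \<otimes> b \<mapsto> \<Sum> (a\<^sub>1 \<otimes> b\<^sub>1) \<otimes> (a\<^sub>2 \<otimes> b\<^sub>2)\<close> and counit \<open>a \<otimes> b \<mapsto> \<epsilon>(a) \<epsilon>(b)\<close>.\<close>

definition tensor_coalgebra ::
  "('k, 'r) ring_scheme \<Rightarrow> ('k, 'v) coalgebra \<Rightarrow> ('k, 'v) coalgebra \<Rightarrow> ('k, ('k, 'v) tensor) coalgebra" where
  "tensor_coalgebra K A B =
     (let P = tensor K [A, B]; PP = tensor K [P, P] in
      module.extend P (coalgebra.fields
        (tensor_lift2 PP (\<lambda>a b.
           tensor_lift2 PP (\<lambda>a1 a2.
             tensor_lift2 PP (\<lambda>b1 b2.
               pure_tensor K [P, P] [pure_tensor K [A, B] [a1, b1], pure_tensor K [A, B] [a2, b2]])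
             (comult B b))
           (comult A a)))
        (tensor_lift2 (ground_module K) (\<lambda>a b. counit A a \<otimes>\<^bsub>K\<^esub> counit B b))))"

text \<open>The iterated comultiplication \<open>\<Delta>\<^sup>(\<^sup>n\<^sup>)\<close> from \<open>C\<close> to its tensor power with \<open>n + 1\<close> factors:
  \<open>\<Delta>\<^sup>(\<^sup>0\<^sup>)\<close> is the identity, and \<open>\<Delta>\<^sup>(\<^sup>n\<^sup>+\<^sup>1\<^sup>) = (\<Delta>\<^sup>(\<^sup>n\<^sup>) \<otimes> id) \<circ> \<Delta>\<close>.\<close>

primrec iterated_comult ::
  "('k, 'r) ring_scheme \<Rightarrow> ('k, 'v, 'z) coalgebra_scheme \<Rightarrow> nat \<Rightarrow> 'v \<Rightarrow> ('k, 'v) tensor" where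
  "iterated_comult K C 0 x = pure_tensor K [C] [x]"
| "iterated_comult K C (Suc n) x =
     (let Q = replicate (n + 2) C in
      tensor_lift2 (tensor K Q)
        (\<lambda>y z. tensor_lift (tensor K Q) (\<lambda>ys. pure_tensor K Q (ys @ [z])) (iterated_comult K C n y))
        (comult C x))"

text \<open>\<open>\<epsilon> \<otimes> id\<close> and \<open>id \<otimes> \<epsilon>\<close> as maps from \<open>H \<otimes> H\<close> to \<open>H\<close>.\<close>

definition counit_id :: "('k, 'v, 'z) coalgebra_scheme \<Rightarrow> ('k, 'v) tensor \<Rightarrow> 'v" where
  "counit_id H = tensor_lift2 H (\<lambda>x y. counit H x \<odot>\<^bsub>H\<^esub> y)"

definition id_counit :: "('k, 'v, 'z) coalgebra_scheme \<Rightarrow> ('k, 'v) tensor \<Rightarrow> 'v" where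
  "id_counit H = tensor_lift2 H (\<lambda>x y. counit H y \<odot>\<^bsub>H\<^esub> x)"


section \<open>Linearized terms\<close>

type_synonym ('o, 'm, 'k, 'u) coalgebra_model =
  "('o, 'm, ('k, 'u) coalgebra, 'u \<Rightarrow> 'u) cfunctor"

abbreviation underlying ::
  "('o, 'm, 'z) lawvere_scheme \<Rightarrow> ('o, 'm, 'k, 'u) coalgebra_model \<Rightarrow> ('k, 'u) coalgebra" where
  "underlying L F \<equiv> Fo F (pow L 1)"

text \<open>The canonical isomorphism of the value of \<open>F\<close> at the power \<open>T\<^sup>m\<close> with the \<open>m\<close>-th tensor power
  of \<open>H = F(T)\<close>, for \<open>m \<ge> 1\<close>. The \<open>m\<close>-th tensor power is the product of \<open>m\<close> copies of \<open>H\<close>, and the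
  coalgebra map with components \<open>f\<^sub>1, \<dots>, f\<^sub>m\<close> into it is \<open>(f\<^sub>1 \<otimes> \<dots> \<otimes> f\<^sub>m) \<circ> \<Delta>\<^sup>(\<^sup>m\<^sup>-\<^sup>1\<^sup>)\<close>; here the
  \<open>f\<^sub>i\<close> are the images of the projections.\<close>

definition power_comparison ::
  "('k, 'r) ring_scheme \<Rightarrow> ('o, 'm, 'z) lawvere_scheme \<Rightarrow> ('o, 'm, 'k, 'u) coalgebra_model \<Rightarrow> nat \<Rightarrow>
   'u \<Rightarrow> ('k, 'u) tensor" where
  "power_comparison K L F m x =
     tensor_map K (replicate m (underlying L F))
       (map (\<lambda>i. Fm F (pow L m) (pow L 1) (proj L m i)) [0..<m])
       (iterated_comult K (Fo F (pow L m)) (m - 1) x)"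

text \<open>The linearized term of an \<open>m\<close>-ary term \<open>t\<close>, for \<open>m \<ge> 1\<close>.\<close>

definition linearized_term ::
  "('k, 'r) ring_scheme \<Rightarrow> ('o, 'm, 'z) lawvere_scheme \<Rightarrow> ('o, 'm, 'k, 'u) coalgebra_model \<Rightarrow> nat \<Rightarrow>
   'm \<Rightarrow> ('k, 'u) tensor \<Rightarrow> 'u" where
  "linearized_term K L F m t X =
     Fm F (pow L m) (pow L 1) t
       (inv_into (carrier (Fo F (pow L m))) (power_comparison K L F m) X)"

text \<open>The zero object \<open>Z\<close> of the category of models has the ground field as underlying coalgebra,
  and the isomorphism from \<open>Z(T)\<close> to the field is the counit.\<close>

definition unit_map ::
  "('k, 'r) ring_scheme \<Rightarrow> ('o, 'm, 'z) lawvere_scheme \<Rightarrow> ('o, 'm, 'k, 'u) coalgebra_model \<Rightarrow> 'k \<Rightarrow> 'u" where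
  "unit_map K L F c =
     (let M = models L (Coalg_coc K);
          Z = (SOME Z. zero_object M Z);
          \<eta> = (THE \<eta>. \<eta> \<in> Hom M Z F)
      in \<eta> (pow L 1) (inv_into (carrier (underlying L Z)) (counit (underlying L Z)) c))"

definition zero_map ::
  "('k, 'r) ring_scheme \<Rightarrow> ('o, 'm, 'z) lawvere_scheme \<Rightarrow> ('o, 'm, 'k, 'u) coalgebra_model \<Rightarrow>
   ('o, 'm, 'k, 'u) coalgebra_model \<Rightarrow> 'u \<Rightarrow> 'u" where
  "zero_map K L F G x = unit_map K L G (counit (underlying L F) x)"

end

theory Submission
  imports Defs
begin

text \<open>Cocommutative coalgebras form a category in which the product of \<open>A\<close> and \<open>B\<close> is \<open>A \<otimes> B\<close>, with
  projections \<open>id \<otimes> \<epsilon>\<close> and \<open>\<epsilon> \<otimes> id\<close>, and in which \<open>(f \<otimes> g) \<circ> \<Delta>\<close> is the morphism with components \<open>f\<close> and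
  \<open>g\<close>. Hence the two linear hypotheses are equations between generalised elements: for a model with
  underlying coalgebra \<open>H\<close> and all coalgebra homomorphisms \<open>x, y : W \<rightarrow> H\<close>,
    \<open>\<alpha>\<^sub>i(x, x) = 0\<close> and \<open>\<beta>(\<alpha>\<^sub>1(x, y), \<dots>, \<alpha>\<^sub>n(x, y), y) = x\<close>.
  The first is the hypothesis on \<open>\<alpha>\<^sub>i\<close> composed with \<open>x\<close>, because \<open>(x, x)\<close> factors through \<open>\<Delta>\<close>
  (\<open>power_comparison_diagonal\<close>, \<open>zero_map_eq\<close>); the second is the hypothesis on \<open>\<beta>\<close>, because the
  iterated comultiplication of \<open>H \<otimes> H\<close> followed by maps \<open>f\<^sub>1 \<otimes> \<dots> \<otimes> f\<^sub>m\<close> is an \<open>m\<close>-tuple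
  (\<open>power_comparison_tuple\<close>). The translation requires that \<open>H(T\<^sup>m)\<close>, which is a categorical power of
  \<open>H\<close>, embeds into the \<open>m\<close>-th tensor power (\<open>tuple_map_inj\<close>).

  From there on the proof is the one for varieties (\<open>protomodular_models\<close>). Let \<open>f : A \<rightarrow> A'\<close> be a
  morphism of points \<open>p, s\<close> and \<open>p', s'\<close> over \<open>B\<close> whose pullback along \<open>v : E \<rightarrow> B\<close> is invertible. An
  element \<open>k\<close> of \<open>A\<close> with \<open>p(k) = 0\<close> gives the element \<open>(k, 0)\<close> of the pullback, so \<open>f\<close> is bijective
  between the kernels of \<open>p\<close> and \<open>p'\<close>. If \<open>f(x) = f(y)\<close>, then \<open>p(x) = p(y)\<close>, so \<open>\<alpha>\<^sub>i(x, y)\<close> is in the kernel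
  of \<open>p\<close> and is mapped to \<open>\<alpha>\<^sub>i(f(x), f(x)) = 0\<close>; so \<open>\<alpha>\<^sub>i(x, y) = 0 = \<alpha>\<^sub>i(y, y)\<close>, and applying \<open>\<beta>\<close> gives
  \<open>x = y\<close>. For \<open>x'\<close> in \<open>A'\<close> put \<open>y = s(p'(x'))\<close>. Then \<open>\<alpha>\<^sub>i(x', f(y))\<close> is in the kernel of \<open>p'\<close>, hence of the form
  \<open>f(z\<^sub>i)\<close>, and \<open>x' = f(\<beta>(z\<^sub>1, \<dots>, z\<^sub>n, y))\<close>. So \<open>f\<close> is bijective on generalised elements and therefore
  invertible (\<open>isomorphism_models\<close>).

  Protomodularity also asks for finite limits. Pullbacks of models are computed pointwise
  (\<open>pullback_models\<close>) from pullbacks of coalgebras (\<open>pullback_coalgebra\<close>). These are equalizers in tensor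
  products, and an equalizer of coalgebras is the largest subcoalgebra on which the two maps agree
  (\<open>equalizer_coalgebra\<close>). The field enters here: a subspace \<open>D\<close> of \<open>C\<close> has a linear retraction, so that
  \<open>D \<otimes> D\<close> is a subspace of \<open>C \<otimes> C\<close>. As the universe is infinite and at least as large as the field, it
  contains a copy of the tensor product of two coalgebras that it contains (\<open>tensor_injection\<close>).\<close>

section \<open>Linear and multilinear maps\<close>

lemma linear_mapI:
  assumes "\<And>x. x \<in> carrier M \<Longrightarrow> f x \<in> carrier N"
    and "\<And>x y. x \<in> carrier M \<Longrightarrow> y \<in> carrier M \<Longrightarrow> f (x \<oplus>\<^bsub>M\<^esub> y) = f x \<oplus>\<^bsub>N\<^esub> f y"
    and "\<And>a x. a \<in> carrier K \<Longrightarrow> x \<in> carrier M \<Longrightarrow> f (a \<odot>\<^bsub>M\<^esub> x) = a \<odot>\<^bsub>N\<^esub> f x"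
  shows "linear_map K M N f"
  using assms by (auto simp: linear_map_def)

lemma linear_map_closed: "linear_map K M N f \<Longrightarrow> x \<in> carrier M \<Longrightarrow> f x \<in> carrier N"
  by (auto simp: linear_map_def)

lemma linear_map_add:
  "linear_map K M N f \<Longrightarrow> x \<in> carrier M \<Longrightarrow> y \<in> carrier M \<Longrightarrow> f (x \<oplus>\<^bsub>M\<^esub> y) = f x \<oplus>\<^bsub>N\<^esub> f y"
  by (auto simp: linear_map_def)

lemma linear_map_smult:
  "linear_map K M N f \<Longrightarrow> a \<in> carrier K \<Longrightarrow> x \<in> carrier M \<Longrightarrow> f (a \<odot>\<^bsub>M\<^esub> x) = a \<odot>\<^bsub>N\<^esub> f x"
  by (auto simp: linear_map_def)

lemma linear_map_zero:
  assumes "linear_map K M N f" "module K M" "module K N"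
  shows "f \<zero>\<^bsub>M\<^esub> = \<zero>\<^bsub>N\<^esub>"
proof -
  interpret M: module K M by fact
  interpret N: module K N by fact
  have "f (\<zero>\<^bsub>K\<^esub> \<odot>\<^bsub>M\<^esub> \<zero>\<^bsub>M\<^esub>) = \<zero>\<^bsub>K\<^esub> \<odot>\<^bsub>N\<^esub> f \<zero>\<^bsub>M\<^esub>"
    using assms(1) by (intro linear_map_smult) auto
  then show ?thesis
    using linear_map_closed[OF assms(1) M.M.zero_closed] by simp
qed

lemma linear_map_id: "linear_map K M M (\<lambda>x. x)"
  by (rule linear_mapI) auto

lemma linear_map_comp:
  "linear_map K N P g \<Longrightarrow> linear_map K M N f \<Longrightarrow> linear_map K M P (\<lambda>x. g (f x))"
  unfolding linear_map_def by (auto simp: Pi_iff)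

lemma linear_map_cong:
  assumes "module K M" "\<And>x. x \<in> carrier M \<Longrightarrow> f x = g x"
  shows "linear_map K M N f \<longleftrightarrow> linear_map K M N g"
proof -
  interpret module K M by fact
  show ?thesis
    unfolding linear_map_def using assms(2)
    by (auto simp: Pi_iff)
qed

lemma linear_map_smult_left:
  assumes "module K N" "linear_map K M (ground_module K) f" "y \<in> carrier N"
  shows "linear_map K M N (\<lambda>x. f x \<odot>\<^bsub>N\<^esub> y)"
proof -
  interpret N: module K N by fact
  show ?thesis
    using assms(2,3)
    by (auto simp: linear_map_def ground_module_def Pi_iff N.smult_l_distr N.smult_assoc1)
qed

lemma linear_map_smult_right:
  assumes "module K N" "linear_map K M N f" "a \<in> carrier K"
  shows "linear_map K M N (\<lambda>x. a \<odot>\<^bsub>N\<^esub> f x)"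
proof -
  interpret N: module K N by fact
  show ?thesis
    using assms(2,3)
    by (auto simp: linear_map_def Pi_iff N.smult_r_distr N.smult_assoc1[symmetric] N.R.m_comm)
qed

lemma module_ground:
  assumes "cring K" shows "module K (ground_module K)"
proof -
  interpret cring K by fact
  show ?thesis
    by (rule moduleI)
      (auto simp: ground_module_def l_distr r_distr m_assoc cring_axioms a_ac
        intro!: abelian_groupI bexI[of _ "\<ominus>\<^bsub>K\<^esub> _"] l_neg)
qed

lemma listset_iff:
  "xs \<in> listset As \<longleftrightarrow> length xs = length As \<and> (\<forall>i < length As. xs ! i \<in> As ! i)"
proof (induction As arbitrary: xs)
  case Nil
  then show ?case by auto
next
  case (Cons A As)
  show ?case
    by (cases xs) (auto simp: set_Cons_def Cons nth_Cons' less_Suc_eq_0_disj)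
qed

abbreviation vectors :: "('k, 'v, 'z) module_scheme list \<Rightarrow> 'v list set" where
  "vectors Ms \<equiv> listset (map carrier Ms)"

lemma vectors_iff:
  "xs \<in> vectors Ms \<longleftrightarrow> length xs = length Ms \<and> (\<forall>i < length Ms. xs ! i \<in> carrier (Ms ! i))"
  by (auto simp: listset_iff)

lemma vectors_update: "xs \<in> vectors Ms \<Longrightarrow> x \<in> carrier (Ms ! i) \<Longrightarrow> xs[i := x] \<in> vectors Ms"
  by (cases "i < length xs") (auto simp: vectors_iff nth_list_update)

definition multilinear ::
  "('k, 'r) ring_scheme \<Rightarrow> ('k, 'v, 'y) module_scheme list \<Rightarrow> ('k, 'w, 'z) module_scheme \<Rightarrow>
   ('v list \<Rightarrow> 'w) \<Rightarrow> bool" where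
  "multilinear K Ms N \<phi> \<longleftrightarrow>
     (\<forall>xs \<in> vectors Ms. \<forall>i < length Ms. linear_map K (Ms ! i) N (\<lambda>x. \<phi> (xs[i := x]))) \<and>
     (\<forall>xs \<in> vectors Ms. \<phi> xs \<in> carrier N)"

lemma multilinear_closed: "multilinear K Ms N \<phi> \<Longrightarrow> xs \<in> vectors Ms \<Longrightarrow> \<phi> xs \<in> carrier N"
  by (auto simp: multilinear_def)

lemma multilinearD:
  "multilinear K Ms N \<phi> \<Longrightarrow> xs \<in> vectors Ms \<Longrightarrow> i < length Ms \<Longrightarrow>
    linear_map K (Ms ! i) N (\<lambda>x. \<phi> (xs[i := x]))"
  by (simp add: multilinear_def)

section \<open>The tensor product as a module\<close>

text \<open>The linear extension of \<open>\<phi>\<close> evaluated at a given formal sum. The map \<^const>\<open>tensor_lift\<close> does the same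
  with a representative of its own choice.\<close>

definition eval_sum ::
  "('k, 'w, 'z) module_scheme \<Rightarrow> ('v list \<Rightarrow> 'w) \<Rightarrow> ('k \<times> 'v list) list \<Rightarrow> 'w" where
  "eval_sum N \<phi> r = foldr (\<lambda>(c, xs) z. (c \<odot>\<^bsub>N\<^esub> \<phi> xs) \<oplus>\<^bsub>N\<^esub> z) r \<zero>\<^bsub>N\<^esub>"

lemma eval_sum_simps [simp]:
  "eval_sum N \<phi> [] = \<zero>\<^bsub>N\<^esub>"
  "eval_sum N \<phi> ((c, xs) # r) = (c \<odot>\<^bsub>N\<^esub> \<phi> xs) \<oplus>\<^bsub>N\<^esub> eval_sum N \<phi> r"
  by (auto simp: eval_sum_def)

lemma formal_sums_simps [simp]:
  "[] \<in> formal_sums K Ms"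
  "(c, xs) # r \<in> formal_sums K Ms \<longleftrightarrow> c \<in> carrier K \<and> xs \<in> vectors Ms \<and> r \<in> formal_sums K Ms"
  "r @ s \<in> formal_sums K Ms \<longleftrightarrow> r \<in> formal_sums K Ms \<and> s \<in> formal_sums K Ms"
  by (auto simp: formal_sums_def)

lemma formal_sums_induct [consumes 1, case_names Nil Cons]:
  assumes "r \<in> formal_sums K Ms" "P []"
    and "\<And>c xs r. c \<in> carrier K \<Longrightarrow> xs \<in> vectors Ms \<Longrightarrow> r \<in> formal_sums K Ms \<Longrightarrow> P r \<Longrightarrow> P ((c, xs) # r)"
  shows "P r"
  using assms(1)
proof (induction r)
  case (Cons p r)
  then show ?case by (cases p) (auto intro: assms(3))
qed (simp add: assms(2))

lemma eval_sum_cong: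
  "r \<in> formal_sums K Ms \<Longrightarrow> (\<And>xs. xs \<in> vectors Ms \<Longrightarrow> \<phi> xs = \<psi> xs) \<Longrightarrow> eval_sum N \<phi> r = eval_sum N \<psi> r"
  by (induction r rule: formal_sums_induct) auto

lemma eval_sum_closed:
  assumes "module K N" "r \<in> formal_sums K Ms" "\<And>xs. xs \<in> vectors Ms \<Longrightarrow> \<phi> xs \<in> carrier N"
  shows "eval_sum N \<phi> r \<in> carrier N"
proof -
  interpret module K N by fact
  show ?thesis
    using assms(2) by (induction rule: formal_sums_induct) (auto simp: assms(3))
qed

lemma eval_sum_append:
  assumes "module K N" "r \<in> formal_sums K Ms" "s \<in> formal_sums K Ms"
    "\<And>xs. xs \<in> vectors Ms \<Longrightarrow> \<phi> xs \<in> carrier N"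
  shows "eval_sum N \<phi> (r @ s) = eval_sum N \<phi> r \<oplus>\<^bsub>N\<^esub> eval_sum N \<phi> s"
proof -
  interpret module K N by fact
  have [simp]: "\<And>r. r \<in> formal_sums K Ms \<Longrightarrow> eval_sum N \<phi> r \<in> carrier N"
    using assms by (auto intro: eval_sum_closed)
  note [simp] = assms(3,4)
  show ?thesis
    using assms(2) by (induction rule: formal_sums_induct) (auto simp: M.a_assoc)
qed

abbreviation scale_sum :: "('k, 'r) ring_scheme \<Rightarrow> 'k \<Rightarrow> ('k \<times> 'v list) list \<Rightarrow> ('k \<times> 'v list) list" where
  "scale_sum K a \<equiv> map (\<lambda>(c, xs). (a \<otimes>\<^bsub>K\<^esub> c, xs))"

lemma scale_sum_closed:
  assumes "cring K" "a \<in> carrier K" "r \<in> formal_sums K Ms"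
  shows "scale_sum K a r \<in> formal_sums K Ms"
proof -
  interpret cring K by fact
  show ?thesis
    using assms(3,2) by (induction rule: formal_sums_induct) auto
qed

lemma eval_sum_scale:
  assumes "module K N" "r \<in> formal_sums K Ms" "a \<in> carrier K" "\<And>xs. xs \<in> vectors Ms \<Longrightarrow> \<phi> xs \<in> carrier N"
  shows "eval_sum N \<phi> (scale_sum K a r) = a \<odot>\<^bsub>N\<^esub> eval_sum N \<phi> r"
proof -
  interpret module K N by fact
  have [simp]: "\<And>r. r \<in> formal_sums K Ms \<Longrightarrow> eval_sum N \<phi> r \<in> carrier N"
    using assms by (auto intro: eval_sum_closed)
  note [simp] = assms(3,4)
  show ?thesis
    using assms(2) by (induction rule: formal_sums_induct) (auto simp: smult_r_distr smult_assoc1)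
qed

lemma linear_map_eval_sum:
  assumes "module K N" "module K P" "linear_map K N P g" "r \<in> formal_sums K Ms"
    "\<And>xs. xs \<in> vectors Ms \<Longrightarrow> \<phi> xs \<in> carrier N"
  shows "g (eval_sum N \<phi> r) = eval_sum P (\<lambda>xs. g (\<phi> xs)) r"
proof -
  interpret N: module K N by fact
  interpret P: module K P by fact
  have [simp]: "\<And>r. r \<in> formal_sums K Ms \<Longrightarrow> eval_sum N \<phi> r \<in> carrier N"
    using assms by (auto intro: eval_sum_closed)
  note [simp] = assms(5)
  show ?thesis
    using assms(4)
    by (induction rule: formal_sums_induct)
      (auto simp: linear_map_zero[OF assms(3,1,2)] linear_map_add[OF assms(3)]
        linear_map_smult[OF assms(3)])
qed

lemma linear_map_sum:
  assumes "module K N" "linear_map K M N f" "linear_map K M N g"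
  shows "linear_map K M N (\<lambda>x. f x \<oplus>\<^bsub>N\<^esub> g x)"
proof -
  interpret N: module K N by fact
  have [simp]: "x \<in> carrier M \<Longrightarrow> f x \<in> carrier N" "x \<in> carrier M \<Longrightarrow> g x \<in> carrier N" for x
    using assms by (auto intro: linear_map_closed)
  show ?thesis
    by (rule linear_mapI)
      (auto simp: linear_map_add[OF assms(2)] linear_map_add[OF assms(3)]
        linear_map_smult[OF assms(2)] linear_map_smult[OF assms(3)] N.smult_r_distr N.M.a_ac)
qed

lemma linear_map_0:
  assumes "module K N" shows "linear_map K M N (\<lambda>x. \<zero>\<^bsub>N\<^esub>)"
proof -
  interpret N: module K N by fact
  show ?thesis by (rule linear_mapI) auto
qed

lemma eval_sum_linear_param:
  assumes "module K N" "r \<in> formal_sums K Ms"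
    "\<And>xs. xs \<in> vectors Ms \<Longrightarrow> linear_map K M N (\<lambda>x. \<phi> x xs)"
  shows "linear_map K M N (\<lambda>x. eval_sum N (\<phi> x) r)"
  using assms(2)
  by (induction rule: formal_sums_induct)
    (auto intro!: linear_map_0 linear_map_sum linear_map_smult_right assms)

text \<open>An interchange of finite sums; it becomes Fubini's rule for nested sums over comultiplications.\<close>

lemma eval_sum_swap:
  assumes N: "module K N" and r: "r \<in> formal_sums K Ms" and s: "s \<in> formal_sums K Ns"
    and \<phi>: "\<And>xs ys. xs \<in> vectors Ms \<Longrightarrow> ys \<in> vectors Ns \<Longrightarrow> \<phi> xs ys \<in> carrier N"
  shows "eval_sum N (\<lambda>xs. eval_sum N (\<phi> xs) s) r = eval_sum N (\<lambda>ys. eval_sum N (\<lambda>xs. \<phi> xs ys) r) s"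
proof -
  interpret N: module K N by fact
  have 0: "eval_sum N (\<lambda>ys. \<zero>\<^bsub>N\<^esub>) s = \<zero>\<^bsub>N\<^esub>"
    using s by (induction rule: formal_sums_induct) auto
  have add: "eval_sum N (\<lambda>ys. f ys \<oplus>\<^bsub>N\<^esub> g ys) s = eval_sum N f s \<oplus>\<^bsub>N\<^esub> eval_sum N g s"
    if "\<And>ys. ys \<in> vectors Ns \<Longrightarrow> f ys \<in> carrier N" "\<And>ys. ys \<in> vectors Ns \<Longrightarrow> g ys \<in> carrier N" for f g
    using s
  proof (induction rule: formal_sums_induct)
    case (Cons c xs r)
    then show ?case
      using that eval_sum_closed[OF N Cons(3), of f] eval_sum_closed[OF N Cons(3), of g]
      by (simp add: N.smult_r_distr N.M.a_ac)
  qed auto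
  have smult: "eval_sum N (\<lambda>ys. c \<odot>\<^bsub>N\<^esub> f ys) s = c \<odot>\<^bsub>N\<^esub> eval_sum N f s"
    if "c \<in> carrier K" "\<And>ys. ys \<in> vectors Ns \<Longrightarrow> f ys \<in> carrier N" for c f
    using linear_map_eval_sum[OF N N linear_map_smult_right[OF N linear_map_id that(1)] s that(2)]
    by simp
  show ?thesis
    using r
  proof (induction rule: formal_sums_induct)
    case Nil
    then show ?case by (simp add: 0)
  next
    case (Cons c xs r)
    have cl: "\<And>ys. ys \<in> vectors Ns \<Longrightarrow> eval_sum N (\<lambda>xs. \<phi> xs ys) r \<in> carrier N"
      by (rule eval_sum_closed[OF N Cons(3)]) (auto intro: \<phi>)
    show ?case
      using Cons cl by (simp add: add smult \<phi>)
  qed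
qed

text \<open>Each generator of the congruence is an identity that multilinear maps satisfy.\<close>

lemma eval_sum_respects:
  assumes N: "module K N" and Ms: "\<forall>M \<in> set Ms. module K M" and \<phi>: "multilinear K Ms N \<phi>"
    and r: "tensor_rel K Ms r s"
  shows "r \<in> formal_sums K Ms \<and> s \<in> formal_sums K Ms \<and> eval_sum N \<phi> r = eval_sum N \<phi> s"
proof -
  interpret N: module K N by fact
  have M: "module K (Ms ! i)" if "i < length Ms" for i
    using Ms that by auto
  note cl [simp] = multilinear_closed[OF \<phi>]
  have ecl [simp]: "\<And>r. r \<in> formal_sums K Ms \<Longrightarrow> eval_sum N \<phi> r \<in> carrier N"
    using cl by (auto intro: eval_sum_closed[OF N])
  have app: "eval_sum N \<phi> (r @ s) = eval_sum N \<phi> r \<oplus>\<^bsub>N\<^esub> eval_sum N \<phi> s"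
    if "r \<in> formal_sums K Ms" "s \<in> formal_sums K Ms" for r s
    using that cl by (auto intro: eval_sum_append[OF N])
  show ?thesis
    using r
  proof induction
    case (cong r r' s s')
    then show ?case by (simp add: app)
  next
    case (comm r s)
    then show ?case by (simp add: app N.M.a_comm)
  next
    case (coeff_add c d xs)
    then show ?case
      by (simp add: N.smult_l_distr N.M.a_assoc)
  next
    case (vector_add c xs i x y)
    interpret M: module K "Ms ! i" by (rule M) fact
    have "linear_map K (Ms ! i) N (\<lambda>x. \<phi> (xs[i := x]))"
      using \<phi> vector_add by (auto simp: multilinear_def)
    from linear_map_add[OF this vector_add(4,5)] show ?case
      using vector_add by (simp add: vectors_update N.smult_r_distr N.M.a_assoc)
  next
    case (vector_smult c xs i a x)
    interpret M: module K "Ms ! i" by (rule M) fact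
    have "linear_map K (Ms ! i) N (\<lambda>x. \<phi> (xs[i := x]))"
      using \<phi> vector_smult by (auto simp: multilinear_def)
    from linear_map_smult[OF this vector_smult(4,5)] show ?case
      using vector_smult by (simp add: vectors_update N.smult_assoc1)
  qed (auto simp: N.M.a_assoc)
qed

locale tensor_product = cring K for K :: "('k, 'r) ring_scheme" +
  fixes Ms :: "('k, 'v, 'z) module_scheme list"
  assumes modules: "\<forall>M \<in> set Ms. module K M"
begin

abbreviation "FS \<equiv> formal_sums K Ms"
abbreviation "cls \<equiv> tensor_class K Ms"
abbreviation "rel \<equiv> tensor_rel K Ms"
abbreviation "T \<equiv> tensor K Ms"

lemma rel_formal_sums: "rel r s \<Longrightarrow> r \<in> FS \<and> s \<in> FS"
proof -
  assume "rel r s"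
  moreover have "multilinear K Ms (ground_module K) (\<lambda>_. \<zero>\<^bsub>K\<^esub>)"
    by (auto simp: multilinear_def ground_module_def linear_map_def)
  ultimately show ?thesis
    using eval_sum_respects[OF module_ground[OF is_cring] modules] by blast
qed

lemma class_eq_iff: "r \<in> FS \<Longrightarrow> cls r = cls s \<longleftrightarrow> rel r s"
proof
  assume "r \<in> FS" "cls r = cls s"
  then have "r \<in> cls s" by (auto simp: tensor_class_def intro: tensor_rel.refl)
  then show "rel r s" by (auto simp: tensor_class_def intro: tensor_rel.sym)
qed (auto simp: tensor_class_def intro: tensor_rel.sym tensor_rel.trans)

lemma class_self: "r \<in> FS \<Longrightarrow> r \<in> cls r"
  by (auto simp: tensor_class_def intro: tensor_rel.refl)

lemma in_class: "s \<in> cls r \<longleftrightarrow> rel r s"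
  by (auto simp: tensor_class_def)

lemma class_eqI: "rel r s \<Longrightarrow> cls r = cls s"
  using class_eq_iff rel_formal_sums by blast

lemma add_class: "r \<in> FS \<Longrightarrow> s \<in> FS \<Longrightarrow> cls r \<oplus>\<^bsub>T\<^esub> cls s = cls (r @ s)"
proof -
  assume rs: "r \<in> FS" "s \<in> FS"
  have "cls (r' @ s') = cls (r @ s)" if "r' \<in> cls r" "s' \<in> cls s" for r' s'
    using that by (intro class_eqI) (auto simp: in_class intro: tensor_rel.cong tensor_rel.sym)
  moreover have "r \<in> cls r" "s \<in> cls s" using rs by (auto intro: class_self)
  ultimately have "(\<Union>r \<in> cls r. \<Union>s \<in> cls s. cls (r @ s)) = cls (r @ s)"
    by blast
  then show ?thesis by (simp add: tensor_def)
qed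

lemma rel_scale: "rel r s \<Longrightarrow> a \<in> carrier K \<Longrightarrow> rel (scale_sum K a r) (scale_sum K a s)"
proof (induction rule: tensor_rel.induct)
  case (trans r s t)
  then show ?case by (blast intro: tensor_rel.trans)
qed (auto simp: r_distr m_assoc[symmetric]
    intro: tensor_rel.intros tensor_rel.refl[OF scale_sum_closed[OF is_cring]]
      scale_sum_closed[OF is_cring])

lemma smult_class: "a \<in> carrier K \<Longrightarrow> r \<in> FS \<Longrightarrow> a \<odot>\<^bsub>T\<^esub> cls r = cls (scale_sum K a r)"
proof -
  assume ar: "a \<in> carrier K" "r \<in> FS"
  have "cls (scale_sum K a r') = cls (scale_sum K a r)" if "r' \<in> cls r" for r'
    using that ar by (intro class_eqI rel_scale) (auto simp: in_class intro: tensor_rel.sym)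
  moreover have "r \<in> cls r" using ar by (auto intro: class_self)
  ultimately have "(\<Union>r \<in> cls r. cls (scale_sum K a r)) = cls (scale_sum K a r)"
    by blast
  then show ?thesis by (simp add: tensor_def)
qed

lemma carrier_tensor: "carrier T = cls ` FS" and zero_tensor: "\<zero>\<^bsub>T\<^esub> = cls []"
  by (auto simp: tensor_def)

text \<open>The generators split the coefficient of a single term only, so a formal sum is split term by term and
  the terms are then reordered.\<close>

lemma rel_scale_add:
  assumes "r \<in> FS" "a \<in> carrier K" "b \<in> carrier K"
  shows "rel (scale_sum K (a \<oplus>\<^bsub>K\<^esub> b) r) (scale_sum K a r @ scale_sum K b r)"
  using assms(1)
proof (induction rule: formal_sums_induct)
  case Nil
  show ?case by (auto intro: tensor_rel.refl)
next
  case (Cons c xs r)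
  let ?a = "scale_sum K a r" and ?b = "scale_sum K b r"
  have cl: "?a \<in> FS" "?b \<in> FS" using Cons assms by (auto intro: scale_sum_closed[OF is_cring])
  have "rel ([((a \<oplus>\<^bsub>K\<^esub> b) \<otimes>\<^bsub>K\<^esub> c, xs)] @ scale_sum K (a \<oplus>\<^bsub>K\<^esub> b) r)
      ([(a \<otimes>\<^bsub>K\<^esub> c, xs), (b \<otimes>\<^bsub>K\<^esub> c, xs)] @ (?a @ ?b))"
    using Cons assms by (intro tensor_rel.cong) (auto simp: l_distr intro: tensor_rel.coeff_add)
  moreover have "rel ([(a \<otimes>\<^bsub>K\<^esub> c, xs)] @ (([(b \<otimes>\<^bsub>K\<^esub> c, xs)] @ ?a) @ ?b))
      ([(a \<otimes>\<^bsub>K\<^esub> c, xs)] @ ((?a @ [(b \<otimes>\<^bsub>K\<^esub> c, xs)]) @ ?b))"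
    using Cons assms cl
    by (intro tensor_rel.cong tensor_rel.comm tensor_rel.refl) auto
  ultimately show ?case
    by (auto intro: tensor_rel.trans)
qed

lemma rel_scale_zero: "r \<in> FS \<Longrightarrow> rel (scale_sum K \<zero>\<^bsub>K\<^esub> r) []"
proof (induction rule: formal_sums_induct)
  case (Cons c xs r)
  then show ?case
    using tensor_rel.cong[OF tensor_rel.coeff_zero Cons(4)] by simp
qed (auto intro: tensor_rel.refl)

lemma scale_one: "r \<in> FS \<Longrightarrow> scale_sum K \<one>\<^bsub>K\<^esub> r = r"
  by (induction rule: formal_sums_induct) auto

lemma scale_scale:
  "r \<in> FS \<Longrightarrow> a \<in> carrier K \<Longrightarrow> b \<in> carrier K \<Longrightarrow> scale_sum K (a \<otimes>\<^bsub>K\<^esub> b) r = scale_sum K a (scale_sum K b r)"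
  by (induction rule: formal_sums_induct) (auto simp: m_assoc)

lemma class_commute: "r \<in> FS \<Longrightarrow> s \<in> FS \<Longrightarrow> cls (r @ s) = cls (s @ r)"
  by (intro class_eqI tensor_rel.comm)

text \<open>The negative of a class is its multiple by \<open>-1\<close>: adding the two coefficients gives multiples by \<open>0\<close>.\<close>

lemma module_tensor: "module K T"
proof -
  note [simp] = carrier_tensor zero_tensor add_class smult_class scale_sum_closed[OF is_cring]
  show ?thesis
  proof (rule moduleI)
    show "abelian_group T"
    proof (rule abelian_groupI)
      fix X assume "X \<in> carrier T"
      then obtain r where r: "X = cls r" "r \<in> FS" by auto
      have "rel (scale_sum K (\<ominus>\<^bsub>K\<^esub> \<one>\<^bsub>K\<^esub>) r @ scale_sum K \<one>\<^bsub>K\<^esub> r) []"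
        using tensor_rel.trans[OF tensor_rel.sym rel_scale_zero[of r]]
          rel_scale_add[of r "\<ominus>\<^bsub>K\<^esub> \<one>\<^bsub>K\<^esub>" "\<one>\<^bsub>K\<^esub>"] r
        by (simp add: l_neg)
      then show "\<exists>Y \<in> carrier T. Y \<oplus>\<^bsub>T\<^esub> X = \<zero>\<^bsub>T\<^esub>"
        using r by (intro bexI[of _ "cls (scale_sum K (\<ominus>\<^bsub>K\<^esub> \<one>\<^bsub>K\<^esub>) r)"]) (auto simp: scale_one class_eqI)
    next
      fix X Y assume "X \<in> carrier T" "Y \<in> carrier T"
      then show "X \<oplus>\<^bsub>T\<^esub> Y = Y \<oplus>\<^bsub>T\<^esub> X"
        using class_commute by auto
    qed auto
  qed (auto simp: scale_one scale_scale is_cring class_eqI[OF rel_scale_add])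
qed

sublocale T: module K T
  by (rule module_tensor)

lemma rep_tensor: "X \<in> carrier T \<Longrightarrow> (SOME r. r \<in> X) \<in> FS \<and> X = cls (SOME r. r \<in> X)"
proof -
  assume "X \<in> carrier T"
  then obtain r where r: "X = cls r" "r \<in> FS" by (auto simp: carrier_tensor)
  have "(SOME r. r \<in> X) \<in> X"
    using class_self[OF r(2)] r(1) by (auto intro: someI)
  then have "rel r (SOME r. r \<in> X)" by (simp add: r(1) in_class)
  then show ?thesis
    using class_eqI rel_formal_sums r(1) by blast
qed

lemma pure_closed: "xs \<in> vectors Ms \<Longrightarrow> pure_tensor K Ms xs \<in> carrier T"
  by (auto simp: pure_tensor_def carrier_tensor)

lemma class_Cons:
  "c \<in> carrier K \<Longrightarrow> xs \<in> vectors Ms \<Longrightarrow> r \<in> FS \<Longrightarrow>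
    cls ((c, xs) # r) = (c \<odot>\<^bsub>T\<^esub> pure_tensor K Ms xs) \<oplus>\<^bsub>T\<^esub> cls r"
  by (simp add: pure_tensor_def smult_class add_class)

lemma class_eq_eval: "r \<in> FS \<Longrightarrow> cls r = eval_sum T (pure_tensor K Ms) r"
  by (induction rule: formal_sums_induct) (auto simp: zero_tensor class_Cons)

lemma tensor_induct [consumes 1, case_names zero step]:
  assumes "X \<in> carrier T" "P \<zero>\<^bsub>T\<^esub>"
    and "\<And>c xs X. c \<in> carrier K \<Longrightarrow> xs \<in> vectors Ms \<Longrightarrow> X \<in> carrier T \<Longrightarrow> P X \<Longrightarrow>
      P ((c \<odot>\<^bsub>T\<^esub> pure_tensor K Ms xs) \<oplus>\<^bsub>T\<^esub> X)"
  shows "P X"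
proof -
  have "P (cls r)" if "r \<in> FS" for r
    using that
  proof (induction rule: formal_sums_induct)
    case Nil
    then show ?case using assms(2) by (simp add: zero_tensor)
  next
    case (Cons c xs r)
    then show ?case using assms(3)[of c xs "cls r"] by (auto simp: class_Cons carrier_tensor)
  qed
  then show ?thesis using assms(1) by (auto simp: carrier_tensor)
qed

lemma linear_map_ext:
  assumes N: "module K N" and f: "linear_map K T N f" and g: "linear_map K T N g"
    and eq: "\<And>xs. xs \<in> vectors Ms \<Longrightarrow> f (pure_tensor K Ms xs) = g (pure_tensor K Ms xs)"
    and X: "X \<in> carrier T"
  shows "f X = g X"
  using X
  by (induction rule: tensor_induct)
    (auto simp: linear_map_zero[OF f module_tensor N] linear_map_zero[OF g module_tensor N]
      linear_map_add[OF f] linear_map_add[OF g] linear_map_smult[OF f] linear_map_smult[OF g]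
      pure_closed eq)

lemma lift_eval: "tensor_lift N \<phi> X = eval_sum N \<phi> (SOME r. r \<in> X)"
  by (simp add: tensor_lift_def eval_sum_def)

lemma lift_class:
  assumes "module K N" "multilinear K Ms N \<phi>" "r \<in> FS"
  shows "tensor_lift N \<phi> (cls r) = eval_sum N \<phi> r"
proof -
  have "cls r \<in> carrier T" using assms by (auto simp: carrier_tensor)
  then have "rel r (SOME s. s \<in> cls r)"
    using rep_tensor assms(3) class_eq_iff by blast
  then show ?thesis
    using eval_sum_respects[OF assms(1) modules assms(2)] by (auto simp: lift_eval)
qed

lemma lift_pure:
  assumes "module K N" "multilinear K Ms N \<phi>" "xs \<in> vectors Ms"
  shows "tensor_lift N \<phi> (pure_tensor K Ms xs) = \<phi> xs"
proof -
  interpret N: module K N by fact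
  show ?thesis
    using assms multilinear_closed[OF assms(2,3)] by (simp add: pure_tensor_def lift_class)
qed

lemma lift_linear:
  assumes "module K N" "multilinear K Ms N \<phi>"
  shows "linear_map K T N (tensor_lift N \<phi>)"
proof (rule linear_mapI)
  note cl = multilinear_closed[OF assms(2)]
  note [simp] = lift_class[OF assms] eval_sum_append[OF assms(1) _ _ cl] add_class smult_class
    eval_sum_scale[OF assms(1) _ _ cl]  eval_sum_closed[OF assms(1) _ cl]
    scale_sum_closed[OF is_cring]
  show "\<And>X. X \<in> carrier T \<Longrightarrow> tensor_lift N \<phi> X \<in> carrier N"
    by (auto simp: carrier_tensor)
  show "\<And>X Y. X \<in> carrier T \<Longrightarrow> Y \<in> carrier T \<Longrightarrow>
      tensor_lift N \<phi> (X \<oplus>\<^bsub>T\<^esub> Y) = tensor_lift N \<phi> X \<oplus>\<^bsub>N\<^esub> tensor_lift N \<phi> Y"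
    by (auto simp: carrier_tensor)
  show "\<And>a X. a \<in> carrier K \<Longrightarrow> X \<in> carrier T \<Longrightarrow>
      tensor_lift N \<phi> (a \<odot>\<^bsub>T\<^esub> X) = a \<odot>\<^bsub>N\<^esub> tensor_lift N \<phi> X"
    by (auto simp: carrier_tensor)
qed

lemma lift_cong:
  "X \<in> carrier T \<Longrightarrow> (\<And>xs. xs \<in> vectors Ms \<Longrightarrow> \<phi> xs = \<psi> xs) \<Longrightarrow> tensor_lift N \<phi> X = tensor_lift N \<psi> X"
  using rep_tensor by (auto simp: lift_eval intro!: eval_sum_cong)

lemma lift_closed:
  "X \<in> carrier T \<Longrightarrow> module K N \<Longrightarrow> (\<And>xs. xs \<in> vectors Ms \<Longrightarrow> \<phi> xs \<in> carrier N) \<Longrightarrow>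
    tensor_lift N \<phi> X \<in> carrier N"
  using rep_tensor by (auto simp: lift_eval intro!: eval_sum_closed)

lemma lift_comp:
  "X \<in> carrier T \<Longrightarrow> module K N \<Longrightarrow> module K P \<Longrightarrow> linear_map K N P g \<Longrightarrow>
    (\<And>xs. xs \<in> vectors Ms \<Longrightarrow> \<phi> xs \<in> carrier N) \<Longrightarrow>
    g (tensor_lift N \<phi> X) = tensor_lift P (\<lambda>xs. g (\<phi> xs)) X"
  using rep_tensor by (auto simp: lift_eval intro!: linear_map_eval_sum)

lemma lift_linear_param:
  "X \<in> carrier T \<Longrightarrow> module K N \<Longrightarrow> (\<And>xs. xs \<in> vectors Ms \<Longrightarrow> linear_map K M N (\<lambda>x. \<phi> x xs)) \<Longrightarrow>
    linear_map K M N (\<lambda>x. tensor_lift N (\<phi> x) X)"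
  using rep_tensor by (auto simp: lift_eval intro!: eval_sum_linear_param)

lemma multilinear_pure: "multilinear K Ms T (pure_tensor K Ms)"
proof -
  have "linear_map K (Ms ! i) T (\<lambda>x. pure_tensor K Ms (xs[i := x]))"
    if "xs \<in> vectors Ms" "i < length Ms" for i xs
  proof (rule linear_mapI)
    have M: "module K (Ms ! i)" using modules that by auto
    show "pure_tensor K Ms (xs[i := x \<oplus>\<^bsub>Ms ! i\<^esub> y]) =
        pure_tensor K Ms (xs[i := x]) \<oplus>\<^bsub>T\<^esub> pure_tensor K Ms (xs[i := y])"
      if "x \<in> carrier (Ms ! i)" "y \<in> carrier (Ms ! i)" for x y
      using that \<open>i < _\<close> \<open>xs \<in> _\<close>
      by (auto simp: pure_tensor_def add_class vectors_update intro!: class_eqI tensor_rel.vector_add)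
    show "pure_tensor K Ms (xs[i := a \<odot>\<^bsub>Ms ! i\<^esub> x]) = a \<odot>\<^bsub>T\<^esub> pure_tensor K Ms (xs[i := x])"
      if "a \<in> carrier K" "x \<in> carrier (Ms ! i)" for a x
    proof -
      have "rel [(\<one>\<^bsub>K\<^esub>, xs[i := a \<odot>\<^bsub>Ms ! i\<^esub> x])] [(\<one>\<^bsub>K\<^esub> \<otimes>\<^bsub>K\<^esub> a, xs[i := x])]"
        using that \<open>i < _\<close> \<open>xs \<in> _\<close> by (intro tensor_rel.vector_smult) auto
      then show ?thesis
        using that \<open>i < _\<close> \<open>xs \<in> _\<close>
        by (auto simp: pure_tensor_def smult_class vectors_update intro!: class_eqI)
    qed
  qed (use that in \<open>auto intro: pure_closed vectors_update\<close>)
  then show ?thesis by (auto simp: multilinear_def intro: pure_closed)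
qed

lemma lift_pure_id: "X \<in> carrier T \<Longrightarrow> tensor_lift T (pure_tensor K Ms) X = X"
  using rep_tensor class_eq_eval by (metis lift_eval)

end

lemma lift_swap:
  assumes "tensor_product K Ms" "tensor_product K Ns" "module K N"
    "X \<in> carrier (tensor K Ms)" "Y \<in> carrier (tensor K Ns)"
    "\<And>xs ys. xs \<in> vectors Ms \<Longrightarrow> ys \<in> vectors Ns \<Longrightarrow> \<phi> xs ys \<in> carrier N"
  shows "tensor_lift N (\<lambda>xs. tensor_lift N (\<phi> xs) Y) X = tensor_lift N (\<lambda>ys. tensor_lift N (\<lambda>xs. \<phi> xs ys) X) Y"
proof -
  interpret M: tensor_product K Ms by fact
  interpret N: tensor_product K Ns by fact
  show ?thesis
    unfolding M.lift_eval
    by (rule eval_sum_swap[OF assms(3) conjunct1[OF M.rep_tensor] conjunct1[OF N.rep_tensor]])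
      (use assms in auto)
qed

text \<open>The congruence only refers to the carriers, additions and scalar multiplications of the factors.
  So a coalgebra and its underlying vector space have the same tensor powers.\<close>

lemma tensor_rel_cong:
  assumes "tensor_rel K Ms r s"
    and "map carrier Ms = map carrier Ns" "map add Ms = map add Ns" "map smult Ms = map smult Ns"
  shows "tensor_rel K Ns r s"
proof -
  have len: "length Ms = length Ns" using assms(2) map_eq_imp_length_eq by blast
  have eq: "carrier (Ms ! i) = carrier (Ns ! i)" "add (Ms ! i) = add (Ns ! i)" "smult (Ms ! i) = smult (Ns ! i)"
    if "i < length Ns" for i
    using assms(2-4) that len by (metis nth_map)+
  have FS: "formal_sums K Ms = formal_sums K Ns" by (simp add: formal_sums_def assms)
  show ?thesis
    using assms(1)
  proof induction
    case (trans r s t)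
    then show ?case by (blast intro: tensor_rel.trans)
  next
    case (vector_add c xs i x y)
    then show ?case
      using tensor_rel.vector_add[of c K xs Ns i x y] by (simp add: len eq assms(2))
  next
    case (vector_smult c xs i a x)
    then show ?case
      using tensor_rel.vector_smult[of c K xs Ns i a x] by (simp add: len eq assms(2))
  qed (auto simp: FS assms(2) intro: tensor_rel.intros)
qed

lemma tensor_cong:
  assumes "map carrier Ms = map carrier Ns" "map add Ms = map add Ns" "map smult Ms = map smult Ns"
  shows "tensor K Ms = tensor K Ns" "pure_tensor K Ms = pure_tensor K Ns"
    "tensor_class K Ms = tensor_class K Ns"
proof -
  have rel: "tensor_rel K Ms r s \<longleftrightarrow> tensor_rel K Ns r s" for r s
    using tensor_rel_cong[OF _ assms] tensor_rel_cong[OF _ assms[symmetric]] by blast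
  then show c: "tensor_class K Ms = tensor_class K Ns"
    by (intro ext) (simp add: tensor_class_def)
  have FS: "formal_sums K Ms = formal_sums K Ns" by (simp add: formal_sums_def assms)
  show "tensor K Ms = tensor K Ns" by (simp add: tensor_def c FS)
  show "pure_tensor K Ms = pure_tensor K Ns" by (intro ext) (simp add: pure_tensor_def c)
qed

section \<open>Bilinear maps and binary tensor products\<close>

definition bilinear ::
  "('k, 'r) ring_scheme \<Rightarrow> ('k, 'v, 'x) module_scheme \<Rightarrow> ('k, 'w, 'y) module_scheme \<Rightarrow>
   ('k, 'u, 'z) module_scheme \<Rightarrow> ('v \<Rightarrow> 'w \<Rightarrow> 'u) \<Rightarrow> bool" where
  "bilinear K A B N \<phi> \<longleftrightarrow>
     (\<forall>a \<in> carrier A. linear_map K B N (\<phi> a)) \<and> (\<forall>b \<in> carrier B. linear_map K A N (\<lambda>a. \<phi> a b))"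

definition trilinear ::
  "('k, 'r) ring_scheme \<Rightarrow> ('k, 'v, 'z) module_scheme \<Rightarrow> ('k, 'u, 'y) module_scheme \<Rightarrow>
   ('v \<Rightarrow> 'v \<Rightarrow> 'v \<Rightarrow> 'u) \<Rightarrow> bool" where
  "trilinear K A N \<phi> \<longleftrightarrow>
     (\<forall>a \<in> carrier A. bilinear K A A N (\<phi> a)) \<and>
     (\<forall>b \<in> carrier A. \<forall>c \<in> carrier A. linear_map K A N (\<lambda>a. \<phi> a b c))"

lemma bilinearI:
  "(\<And>a. a \<in> carrier A \<Longrightarrow> linear_map K B N (\<phi> a)) \<Longrightarrow>
   (\<And>b. b \<in> carrier B \<Longrightarrow> linear_map K A N (\<lambda>a. \<phi> a b)) \<Longrightarrow> bilinear K A B N \<phi>"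
  by (auto simp: bilinear_def)

lemma bilinearD:
  assumes "bilinear K A B N \<phi>"
  shows "a \<in> carrier A \<Longrightarrow> linear_map K B N (\<phi> a)" "b \<in> carrier B \<Longrightarrow> linear_map K A N (\<lambda>a. \<phi> a b)"
    "a \<in> carrier A \<Longrightarrow> b \<in> carrier B \<Longrightarrow> \<phi> a b \<in> carrier N"
  using assms by (auto simp: bilinear_def intro: linear_map_closed)

lemma trilinearI:
  "(\<And>a b. a \<in> carrier A \<Longrightarrow> b \<in> carrier A \<Longrightarrow> linear_map K A N (\<lambda>c. \<phi> a b c)) \<Longrightarrow>
   (\<And>a c. a \<in> carrier A \<Longrightarrow> c \<in> carrier A \<Longrightarrow> linear_map K A N (\<lambda>b. \<phi> a b c)) \<Longrightarrow>
   (\<And>b c. b \<in> carrier A \<Longrightarrow> c \<in> carrier A \<Longrightarrow> linear_map K A N (\<lambda>a. \<phi> a b c)) \<Longrightarrow> trilinear K A N \<phi>"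
  by (auto simp: trilinear_def bilinear_def)

lemma trilinearD:
  assumes "trilinear K A N \<phi>"
  shows "a \<in> carrier A \<Longrightarrow> b \<in> carrier A \<Longrightarrow> linear_map K A N (\<lambda>c. \<phi> a b c)"
    "a \<in> carrier A \<Longrightarrow> c \<in> carrier A \<Longrightarrow> linear_map K A N (\<lambda>b. \<phi> a b c)"
    "b \<in> carrier A \<Longrightarrow> c \<in> carrier A \<Longrightarrow> linear_map K A N (\<lambda>a. \<phi> a b c)"
    "a \<in> carrier A \<Longrightarrow> b \<in> carrier A \<Longrightarrow> c \<in> carrier A \<Longrightarrow> \<phi> a b c \<in> carrier N"
  using assms by (auto simp: trilinear_def bilinear_def intro: linear_map_closed)

lemma bilinear_precomp:
  "bilinear K A B N \<phi> \<Longrightarrow> linear_map K C A f \<Longrightarrow> linear_map K D B g \<Longrightarrow>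
    bilinear K C D N (\<lambda>x y. \<phi> (f x) (g y))"
  unfolding bilinear_def
  by (auto intro: linear_map_comp[of K A N "\<lambda>a. \<phi> a _"] linear_map_comp[of K B N "\<phi> _"] linear_map_closed)

lemma vectors2: "xs \<in> vectors [A, B] \<longleftrightarrow> (\<exists>a \<in> carrier A. \<exists>b \<in> carrier B. xs = [a, b])"
  by (auto simp: set_Cons_def)

lemma vectors2_set_Cons [simp]:
  "xs \<in> set_Cons A ((\<lambda>b. [b]) ` B) \<longleftrightarrow> (\<exists>a \<in> A. \<exists>b \<in> B. xs = [a, b])"
  by (auto simp: set_Cons_def)

lemma vectors3_set_Cons [simp]:
  "xs \<in> set_Cons A (set_Cons B ((\<lambda>b. [b]) ` C)) \<longleftrightarrow> (\<exists>a \<in> A. \<exists>b \<in> B. \<exists>c \<in> C. xs = [a, b, c])"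
  by (auto simp: set_Cons_def)

lemma bilinear_multilinear:
  "bilinear K A B N \<phi> \<Longrightarrow> multilinear K [A, B] N (\<lambda>xs. \<phi> (xs ! 0) (xs ! 1))"
  unfolding multilinear_def vectors2
  by (auto simp: less_Suc_eq bilinearD)

lemma trilinear_multilinear:
  "trilinear K A N \<phi> \<Longrightarrow> multilinear K [A, A, A] N (\<lambda>xs. \<phi> (xs ! 0) (xs ! 1) (xs ! 2))"
  unfolding multilinear_def
  by (auto simp: less_Suc_eq numeral_2_eq_2 trilinearD)

lemma trilinear_pure_tensor:
  assumes K: "cring K" and A: "module K A"
  shows "trilinear K A (tensor K [A, A, A]) (\<lambda>a b c. pure_tensor K [A, A, A] [a, b, c])"
proof -
  interpret A: module K A by fact
  interpret AAA: tensor_product K "[A, A, A]"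
    by (intro tensor_product.intro tensor_product_axioms.intro K) (simp add: A)
  note m = multilinearD[OF AAA.multilinear_pure]
  show ?thesis
  proof (rule trilinearI)
    fix a b assume ab: "a \<in> carrier A" "b \<in> carrier A"
    show "linear_map K A AAA.T (\<lambda>c. pure_tensor K [A, A, A] [a, b, c])"
      using m[of "[a, b, \<zero>\<^bsub>A\<^esub>]" 2] ab by simp
    show "linear_map K A AAA.T (\<lambda>c. pure_tensor K [A, A, A] [a, c, b])"
      using m[of "[a, \<zero>\<^bsub>A\<^esub>, b]" 1] ab by simp
    show "linear_map K A AAA.T (\<lambda>c. pure_tensor K [A, A, A] [c, a, b])"
      using m[of "[\<zero>\<^bsub>A\<^esub>, a, b]" 0] ab by simp
  qed
qed

locale binary_tensor = cring K for K :: "('k, 'r) ring_scheme" +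
  fixes A :: "('k, 'v, 'z) module_scheme" and B :: "('k, 'v, 'z) module_scheme"
  assumes A: "module K A" and B: "module K B"
begin

sublocale tensor_product K "[A, B]"
  by (intro tensor_product.intro tensor_product_axioms.intro is_cring) (simp add: A B)

abbreviation "pt a b \<equiv> pure_tensor K [A, B] [a, b]"

lemma pt_closed: "a \<in> carrier A \<Longrightarrow> b \<in> carrier B \<Longrightarrow> pt a b \<in> carrier T"
  by (rule pure_closed) (simp add: vectors2)

lemma bilinear_pt: "bilinear K A B T pt"
proof (rule bilinearI)
  note m = multilinearD[OF multilinear_pure]
  show "linear_map K B T (pt a)" if a: "a \<in> carrier A" for a
  proof -
    interpret B: module K B by (rule B)
    show ?thesis using m[of "[a, \<zero>\<^bsub>B\<^esub>]" 1] a by (simp add: vectors2)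
  qed
  show "linear_map K A T (\<lambda>a. pt a b)" if b: "b \<in> carrier B" for b
  proof -
    interpret A: module K A by (rule A)
    show ?thesis using m[of "[\<zero>\<^bsub>A\<^esub>, b]" 0] b by (simp add: vectors2)
  qed
qed

lemma lift2_pt:
  "module K N \<Longrightarrow> bilinear K A B N \<phi> \<Longrightarrow> a \<in> carrier A \<Longrightarrow> b \<in> carrier B \<Longrightarrow>
    tensor_lift2 N \<phi> (pt a b) = \<phi> a b"
  by (subst lift_pure[OF _ bilinear_multilinear]) (auto simp: vectors2)

lemma lift2_linear: "module K N \<Longrightarrow> bilinear K A B N \<phi> \<Longrightarrow> linear_map K T N (tensor_lift2 N \<phi>)"
  by (rule lift_linear[OF _ bilinear_multilinear])

lemma lift2_cong:
  "X \<in> carrier T \<Longrightarrow> (\<And>a b. a \<in> carrier A \<Longrightarrow> b \<in> carrier B \<Longrightarrow> \<phi> a b = \<psi> a b) \<Longrightarrow>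
    tensor_lift2 N \<phi> X = tensor_lift2 N \<psi> X"
  by (rule lift_cong) (auto simp: vectors2)

lemma lift2_closed:
  "X \<in> carrier T \<Longrightarrow> module K N \<Longrightarrow> (\<And>a b. a \<in> carrier A \<Longrightarrow> b \<in> carrier B \<Longrightarrow> \<phi> a b \<in> carrier N) \<Longrightarrow>
    tensor_lift2 N \<phi> X \<in> carrier N"
  by (rule lift_closed) (auto simp: vectors2)

lemma lift2_comp:
  "X \<in> carrier T \<Longrightarrow> module K N \<Longrightarrow> module K P \<Longrightarrow> linear_map K N P g \<Longrightarrow>
    (\<And>a b. a \<in> carrier A \<Longrightarrow> b \<in> carrier B \<Longrightarrow> \<phi> a b \<in> carrier N) \<Longrightarrow>
    g (tensor_lift2 N \<phi> X) = tensor_lift2 P (\<lambda>a b. g (\<phi> a b)) X"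
  by (rule lift_comp) (auto simp: vectors2)

lemma lift2_linear_param:
  "X \<in> carrier T \<Longrightarrow> module K N \<Longrightarrow>
    (\<And>a b. a \<in> carrier A \<Longrightarrow> b \<in> carrier B \<Longrightarrow> linear_map K M N (\<lambda>x. \<phi> x a b)) \<Longrightarrow>
    linear_map K M N (\<lambda>x. tensor_lift2 N (\<phi> x) X)"
  by (rule lift_linear_param) (auto simp: vectors2)

lemma lift2_pt_id: "X \<in> carrier T \<Longrightarrow> tensor_lift2 T pt X = X"
  by (subst lift_cong[where \<psi> = "pure_tensor K [A, B]"]) (auto simp: lift_pure_id)

lemma linear_map_ext2:
  assumes "module K N" "linear_map K T N f" "linear_map K T N g"
    "\<And>a b. a \<in> carrier A \<Longrightarrow> b \<in> carrier B \<Longrightarrow> f (pt a b) = g (pt a b)" "X \<in> carrier T"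
  shows "f X = g X"
proof (rule linear_map_ext[OF assms(1-3) _ assms(5)])
  fix xs assume "xs \<in> vectors [A, B]"
  then show "f (pure_tensor K [A, B] xs) = g (pure_tensor K [A, B] xs)"
    unfolding vectors2 using assms(4) by blast
qed

end

lemma lift2_swap:
  assumes "binary_tensor K A B" "binary_tensor K C D" "module K N"
    "X \<in> carrier (tensor K [A, B])" "Y \<in> carrier (tensor K [C, D])"
    "\<And>a b c d. a \<in> carrier A \<Longrightarrow> b \<in> carrier B \<Longrightarrow> c \<in> carrier C \<Longrightarrow> d \<in> carrier D \<Longrightarrow>
      \<phi> a b c d \<in> carrier N"
  shows "tensor_lift2 N (\<lambda>a b. tensor_lift2 N (\<phi> a b) Y) X =
    tensor_lift2 N (\<lambda>c d. tensor_lift2 N (\<lambda>a b. \<phi> a b c d) X) Y"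
proof -
  interpret AB: binary_tensor K A B by fact
  interpret CD: binary_tensor K C D by fact
  have "\<phi> (xs ! 0) (xs ! 1) (ys ! 0) (ys ! 1) \<in> carrier N"
    if xs: "xs \<in> vectors [A, B]" and ys: "ys \<in> vectors [C, D]" for xs ys
  proof -
    obtain a b c d where "xs = [a, b]" "ys = [c, d]" "a \<in> carrier A" "b \<in> carrier B"
      "c \<in> carrier C" "d \<in> carrier D"
      using xs ys unfolding vectors2 by blast
    then show ?thesis using assms(6)[of a b c d] by simp
  qed
  from lift_swap[where \<phi> = "\<lambda>xs ys. \<phi> (xs ! 0) (xs ! 1) (ys ! 0) (ys ! 1)",
      OF AB.tensor_product_axioms CD.tensor_product_axioms assms(3-5) this]
  show ?thesis .
qed

section \<open>Sums over the comultiplication\<close>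

text \<open>In Sweedler's notation \<open>\<Delta>(h) = \<Sum> h\<^sub>1 \<otimes> h\<^sub>2\<close> this is \<open>\<Sum> \<phi>(h\<^sub>1, h\<^sub>2)\<close>. Nested sums stand for the values of
  iterated comultiplications, so equations between maps into multiple tensor powers can be proved by
  rewriting \<open>\<phi>\<close>, without maps between those powers.\<close>

definition sw :: "('k, 'v, 'y) coalgebra_scheme \<Rightarrow> ('k, 'w, 'z) module_scheme \<Rightarrow> ('v \<Rightarrow> 'v \<Rightarrow> 'w) \<Rightarrow> 'v \<Rightarrow> 'w"
  where "sw C N \<phi> h = tensor_lift2 N \<phi> (comult C h)"

context cocommutative_coalgebra
begin

lemma is_module: "module K H" ..

sublocale HH: binary_tensor K H H
  by (intro binary_tensor.intro binary_tensor_axioms.intro is_module R.is_cring)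

lemma comult_closed: "h \<in> carrier H \<Longrightarrow> comult H h \<in> carrier (tensor K [H, H])"
  by (rule linear_map_closed[OF comult_linear])

lemma counit_closed: "h \<in> carrier H \<Longrightarrow> counit H h \<in> carrier K"
  using linear_map_closed[OF counit_linear] by (simp add: ground_module_def)

lemma sw_closed:
  "h \<in> carrier H \<Longrightarrow> module K N \<Longrightarrow> (\<And>a b. a \<in> carrier H \<Longrightarrow> b \<in> carrier H \<Longrightarrow> \<phi> a b \<in> carrier N) \<Longrightarrow>
    sw H N \<phi> h \<in> carrier N"
  unfolding sw_def by (rule HH.lift2_closed[OF comult_closed])

lemma sw_cong:
  "h \<in> carrier H \<Longrightarrow> (\<And>a b. a \<in> carrier H \<Longrightarrow> b \<in> carrier H \<Longrightarrow> \<phi> a b = \<psi> a b) \<Longrightarrow>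
    sw H N \<phi> h = sw H N \<psi> h"
  unfolding sw_def by (rule HH.lift2_cong[OF comult_closed])

lemma sw_linear: "module K N \<Longrightarrow> bilinear K H H N \<phi> \<Longrightarrow> linear_map K H N (sw H N \<phi>)"
  unfolding sw_def[abs_def] by (rule linear_map_comp[OF HH.lift2_linear comult_linear])

lemma sw_linear_param:
  "h \<in> carrier H \<Longrightarrow> module K N \<Longrightarrow>
    (\<And>a b. a \<in> carrier H \<Longrightarrow> b \<in> carrier H \<Longrightarrow> linear_map K M N (\<lambda>x. \<phi> x a b)) \<Longrightarrow>
    linear_map K M N (\<lambda>x. sw H N (\<phi> x) h)"
  unfolding sw_def by (rule HH.lift2_linear_param[OF comult_closed])

lemma sw_comp:
  "h \<in> carrier H \<Longrightarrow> module K N \<Longrightarrow> module K P \<Longrightarrow> linear_map K N P g \<Longrightarrow>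
    (\<And>a b. a \<in> carrier H \<Longrightarrow> b \<in> carrier H \<Longrightarrow> \<phi> a b \<in> carrier N) \<Longrightarrow>
    g (sw H N \<phi> h) = sw H P (\<lambda>a b. g (\<phi> a b)) h"
  unfolding sw_def by (rule HH.lift2_comp[OF comult_closed])

lemma sw_pt: "h \<in> carrier H \<Longrightarrow> sw H HH.T HH.pt h = comult H h"
  unfolding sw_def by (rule HH.lift2_pt_id[OF comult_closed])

text \<open>Cocommutativity is assumed for the universal bilinear map, and \<open>\<phi>\<close> factors through it.\<close>

lemma sw_commute:
  assumes "h \<in> carrier H" "module K N" "bilinear K H H N \<phi>"
  shows "sw H N \<phi> h = sw H N (\<lambda>a b. \<phi> b a) h"
proof -
  have "sw H N \<phi> h = tensor_lift2 N \<phi> (sw H HH.T (\<lambda>a b. HH.pt b a) h)"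
    using cocommutative[OF assms(1)] by (simp add: sw_def)
  also have "\<dots> = sw H N (\<lambda>a b. tensor_lift2 N \<phi> (HH.pt b a)) h"
    by (rule sw_comp[OF assms(1) HH.module_tensor assms(2) HH.lift2_linear[OF assms(2,3)] HH.pt_closed])
  also have "\<dots> = sw H N (\<lambda>a b. \<phi> b a) h"
    by (intro sw_cong HH.lift2_pt assms)
  finally show ?thesis .
qed

lemma sw_counit_left:
  assumes "h \<in> carrier H" "module K N" "linear_map K H N f"
  shows "sw H N (\<lambda>a b. counit H a \<odot>\<^bsub>N\<^esub> f b) h = f h"
proof -
  have "f h = f (sw H H (\<lambda>a b. counit H a \<odot>\<^bsub>H\<^esub> b) h)"
    using counital_left[OF assms(1)] by (simp add: sw_def)
  also have "\<dots> = sw H N (\<lambda>a b. f (counit H a \<odot>\<^bsub>H\<^esub> b)) h"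
    by (rule sw_comp[OF assms(1) is_module assms(2,3)]) (auto simp: counit_closed)
  also have "\<dots> = sw H N (\<lambda>a b. counit H a \<odot>\<^bsub>N\<^esub> f b) h"
    by (intro sw_cong linear_map_smult[OF assms(3)] assms counit_closed)
  finally show ?thesis ..
qed

lemma bilinear_counit_left:
  "module K N \<Longrightarrow> linear_map K M N f \<Longrightarrow> bilinear K H M N (\<lambda>a b. counit H a \<odot>\<^bsub>N\<^esub> f b)"
  by (intro bilinearI linear_map_smult_left linear_map_smult_right counit_linear counit_closed)
    (auto intro: linear_map_closed)

lemma sw_counit_right:
  assumes "h \<in> carrier H" "module K N" "linear_map K H N f"
  shows "sw H N (\<lambda>a b. counit H b \<odot>\<^bsub>N\<^esub> f a) h = f h"
  using sw_commute[OF assms(1,2) bilinear_counit_left[OF assms(2,3)]] sw_counit_left[OF assms]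
  by simp

lemma sw_swap:
  assumes "cocommutative_coalgebra K C" "h \<in> carrier H" "c \<in> carrier C" "module K N"
    "\<And>a b u v. a \<in> carrier H \<Longrightarrow> b \<in> carrier H \<Longrightarrow> u \<in> carrier C \<Longrightarrow> v \<in> carrier C \<Longrightarrow> \<phi> a b u v \<in> carrier N"
  shows "sw H N (\<lambda>a b. sw C N (\<phi> a b) c) h = sw C N (\<lambda>u v. sw H N (\<lambda>a b. \<phi> a b u v) h) c"
proof -
  interpret C: cocommutative_coalgebra K C by fact
  show ?thesis
    unfolding sw_def
    by (rule lift2_swap[OF HH.binary_tensor_axioms C.HH.binary_tensor_axioms assms(4) comult_closed
      C.comult_closed]) (use assms in auto)
qed

sublocale HHH: tensor_product K "[H, H, H]"
  by (intro tensor_product.intro tensor_product_axioms.intro R.is_cring) (simp add: is_module)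

lemmas trilinear_pure3 = trilinear_pure_tensor[OF R.is_cring is_module]

lemma pure3_closed:
  "a \<in> carrier H \<Longrightarrow> b \<in> carrier H \<Longrightarrow> c \<in> carrier H \<Longrightarrow> pure_tensor K [H, H, H] [a, b, c] \<in> carrier HHH.T"
  using trilinearD(4)[OF trilinear_pure3] .

text \<open>Both sides are images of the twofold comultiplication in \<open>H \<otimes> H \<otimes> H\<close>, formed in the two possible
  ways, under the linear map that \<open>\<phi>\<close> induces.\<close>

lemma sw_coassoc:
  assumes h: "h \<in> carrier H" and N: "module K N" and \<phi>: "trilinear K H N \<phi>"
  shows "sw H N (\<lambda>x c. sw H N (\<lambda>a b. \<phi> a b c) x) h = sw H N (\<lambda>a x. sw H N (\<lambda>b c. \<phi> a b c) x) h"
proof -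
  define L where "L = tensor_lift N (\<lambda>xs. \<phi> (xs ! 0) (xs ! 1) (xs ! 2))"
  have L: "linear_map K HHH.T N L"
    unfolding L_def by (rule HHH.lift_linear[OF N trilinear_multilinear[OF \<phi>]])
  have pure: "L (pure_tensor K [H, H, H] [a, b, c]) = \<phi> a b c"
    if "a \<in> carrier H" "b \<in> carrier H" "c \<in> carrier H" for a b c
    unfolding L_def using that
    by (subst HHH.lift_pure[OF N trilinear_multilinear[OF \<phi>]]) auto
  have L_sw: "L (sw H HHH.T g x) = sw H N (\<lambda>a b. L (g a b)) x"
    if "x \<in> carrier H" "\<And>a b. a \<in> carrier H \<Longrightarrow> b \<in> carrier H \<Longrightarrow> g a b \<in> carrier HHH.T" for g x
    by (rule sw_comp[OF that(1) HHH.module_tensor N L that(2)])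
  have cl: "sw H HHH.T (\<lambda>a b. pure_tensor K [H, H, H] [a, b, c]) x \<in> carrier HHH.T"
    "sw H HHH.T (\<lambda>a b. pure_tensor K [H, H, H] [c, a, b]) x \<in> carrier HHH.T"
    if "c \<in> carrier H" "x \<in> carrier H" for c x
    using that by (auto intro!: sw_closed HHH.module_tensor pure3_closed)
  have "sw H N (\<lambda>x c. sw H N (\<lambda>a b. \<phi> a b c) x) h =
      sw H N (\<lambda>x c. L (sw H HHH.T (\<lambda>a b. pure_tensor K [H, H, H] [a, b, c]) x)) h"
    by (intro sw_cong h) (simp add: L_sw pure3_closed pure cong: sw_cong)
  also have "\<dots> = L (sw H HHH.T (\<lambda>x c. sw H HHH.T (\<lambda>a b. pure_tensor K [H, H, H] [a, b, c]) x) h)"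
    by (rule L_sw[OF h, symmetric]) (rule cl)
  also have "\<dots> = L (sw H HHH.T (\<lambda>a x. sw H HHH.T (\<lambda>b c. pure_tensor K [H, H, H] [a, b, c]) x) h)"
    using coassociative[OF h] by (simp add: sw_def)
  also have "\<dots> = sw H N (\<lambda>a x. L (sw H HHH.T (\<lambda>b c. pure_tensor K [H, H, H] [a, b, c]) x)) h"
    by (rule L_sw[OF h]) (rule cl)
  also have "\<dots> = sw H N (\<lambda>a x. sw H N (\<lambda>b c. \<phi> a b c) x) h"
    by (intro sw_cong h) (simp add: L_sw pure3_closed pure cong: sw_cong)
  finally show ?thesis .
qed

end

text \<open>The right counit law follows from the left one by cocommutativity.\<close>

lemma cocommutative_coalgebraI:
  assumes "module K H"
    and "linear_map K H (tensor K [H, H]) (comult H)"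
    and "linear_map K H (ground_module K) (counit H)"
    and "\<And>h. h \<in> carrier H \<Longrightarrow>
      sw H (tensor K [H, H, H]) (\<lambda>x c. sw H (tensor K [H, H, H]) (\<lambda>a b. pure_tensor K [H, H, H] [a, b, c]) x) h =
      sw H (tensor K [H, H, H]) (\<lambda>a x. sw H (tensor K [H, H, H]) (\<lambda>b c. pure_tensor K [H, H, H] [a, b, c]) x) h"
    and "\<And>h. h \<in> carrier H \<Longrightarrow> sw H H (\<lambda>a b. counit H a \<odot>\<^bsub>H\<^esub> b) h = h"
    and "\<And>h. h \<in> carrier H \<Longrightarrow>
      sw H (tensor K [H, H]) (\<lambda>a b. pure_tensor K [H, H] [b, a]) h = comult H h"
  shows "cocommutative_coalgebra K H"
proof -
  interpret module K H by fact
  interpret HH: binary_tensor K H H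
    by (intro binary_tensor.intro binary_tensor_axioms.intro R.is_cring assms)
  have b: "bilinear K H H H (\<lambda>a b. counit H a \<odot>\<^bsub>H\<^esub> b)"
    by (intro bilinearI linear_map_smult_left linear_map_smult_right linear_map_id assms)
      (use linear_map_closed[OF assms(3)] in \<open>auto simp: ground_module_def\<close>)
  have right: "tensor_lift2 H (\<lambda>x y. counit H y \<odot>\<^bsub>H\<^esub> x) (comult H h) = h" if h: "h \<in> carrier H" for h
  proof -
    note c = linear_map_closed[OF assms(2) h]
    have "tensor_lift2 H (\<lambda>a b. counit H a \<odot>\<^bsub>H\<^esub> b) (sw H HH.T (\<lambda>a b. HH.pt b a) h) =
        tensor_lift2 H (\<lambda>a b. tensor_lift2 H (\<lambda>a b. counit H a \<odot>\<^bsub>H\<^esub> b) (HH.pt b a)) (comult H h)"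
      unfolding sw_def
      by (rule HH.lift2_comp[OF c HH.module_tensor assms(1) HH.lift2_linear[OF assms(1) b]])
        (rule HH.pt_closed)
    also have "\<dots> = tensor_lift2 H (\<lambda>x y. counit H y \<odot>\<^bsub>H\<^esub> x) (comult H h)"
      by (intro HH.lift2_cong[OF c] HH.lift2_pt assms b)
    finally show ?thesis using assms(5,6)[OF h] by (simp add: sw_def)
  qed
  show ?thesis
    by unfold_locales (use assms right in \<open>auto simp: sw_def\<close>)
qed

section \<open>Coalgebra homomorphisms\<close>

lemma tensor_map2:
  assumes "binary_tensor K A B" "X \<in> carrier (tensor K [A, B])"
  shows "tensor_map K [C, D] [f, g] X = tensor_lift2 (tensor K [C, D]) (\<lambda>a b. pure_tensor K [C, D] [f a, g b]) X"
proof -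
  interpret binary_tensor K A B by fact
  show ?thesis
    unfolding tensor_map_def by (rule lift_cong[OF assms(2)]) (auto simp: vectors2)
qed

lemma coalgebra_hom_iff:
  assumes "cocommutative_coalgebra K A"
  shows "coalgebra_hom K A B f \<longleftrightarrow> linear_map K A B f \<and>
    (\<forall>x \<in> carrier A. comult B (f x) = sw A (tensor K [B, B]) (\<lambda>a b. pure_tensor K [B, B] [f a, f b]) x) \<and>
    (\<forall>x \<in> carrier A. counit B (f x) = counit A x)"
proof -
  interpret cocommutative_coalgebra K A by fact
  show ?thesis
    unfolding coalgebra_hom_def sw_def
    by (simp add: tensor_map2[OF HH.binary_tensor_axioms comult_closed])
qed

lemma coalgebra_hom_linear: "coalgebra_hom K A B f \<Longrightarrow> linear_map K A B f"
  by (simp add: coalgebra_hom_def)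

lemma coalgebra_hom_closed: "coalgebra_hom K A B f \<Longrightarrow> x \<in> carrier A \<Longrightarrow> f x \<in> carrier B"
  by (rule linear_map_closed[OF coalgebra_hom_linear])

lemma coalgebra_hom_counit: "coalgebra_hom K A B f \<Longrightarrow> x \<in> carrier A \<Longrightarrow> counit B (f x) = counit A x"
  by (simp add: coalgebra_hom_def)

lemma sw_hom:
  assumes A: "cocommutative_coalgebra K A" and B: "cocommutative_coalgebra K B"
    and f: "coalgebra_hom K A B f" and x: "x \<in> carrier A"
    and N: "module K N" and \<phi>: "bilinear K B B N \<phi>"
  shows "sw B N \<phi> (f x) = sw A N (\<lambda>a b. \<phi> (f a) (f b)) x"
proof -
  interpret A: cocommutative_coalgebra K A by fact
  interpret B: cocommutative_coalgebra K B by fact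
  note cl = coalgebra_hom_closed[OF f]
  have "sw B N \<phi> (f x) = tensor_lift2 N \<phi> (sw A B.HH.T (\<lambda>a b. B.HH.pt (f a) (f b)) x)"
    using f x by (simp add: coalgebra_hom_iff[OF A] sw_def[of B])
  also have "\<dots> = sw A N (\<lambda>a b. tensor_lift2 N \<phi> (B.HH.pt (f a) (f b))) x"
    by (rule A.sw_comp[OF x B.HH.module_tensor N B.HH.lift2_linear[OF N \<phi>]])
      (intro B.HH.pt_closed cl)
  also have "\<dots> = sw A N (\<lambda>a b. \<phi> (f a) (f b)) x"
    by (intro A.sw_cong x B.HH.lift2_pt N \<phi> cl)
  finally show ?thesis .
qed

lemma coalgebra_hom_comp:
  assumes A: "cocommutative_coalgebra K A" and B: "cocommutative_coalgebra K B"
    and C: "cocommutative_coalgebra K C"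
    and f: "coalgebra_hom K A B f" and g: "coalgebra_hom K B C g"
  shows "coalgebra_hom K A C (\<lambda>x. g (f x))"
proof -
  interpret C: cocommutative_coalgebra K C by fact
  note g' = g[unfolded coalgebra_hom_iff[OF B]]
  show ?thesis
    unfolding coalgebra_hom_iff[OF A]
    using g' sw_hom[OF A B f _ C.HH.module_tensor bilinear_precomp[OF C.HH.bilinear_pt]]
      linear_map_comp[of K B C g A f] coalgebra_hom_closed[OF f] coalgebra_hom_counit[OF f]
      coalgebra_hom_linear[OF f] by auto
qed

lemma coalgebra_hom_cong:
  assumes A: "cocommutative_coalgebra K A" and eq: "\<And>x. x \<in> carrier A \<Longrightarrow> f x = g x"
  shows "coalgebra_hom K A B f \<longleftrightarrow> coalgebra_hom K A B g"
proof -
  interpret A: cocommutative_coalgebra K A by fact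
  have "sw A (tensor K [B, B]) (\<lambda>a b. pure_tensor K [B, B] [f a, f b]) x =
      sw A (tensor K [B, B]) (\<lambda>a b. pure_tensor K [B, B] [g a, g b]) x" if "x \<in> carrier A" for x
    using that by (intro A.sw_cong) (auto simp: eq)
  then show ?thesis
    unfolding coalgebra_hom_iff[OF A]
    using linear_map_cong[of K A f g B, OF A.is_module eq] eq by simp
qed

lemma coalgebra_hom_id:
  assumes A: "cocommutative_coalgebra K A"
  shows "coalgebra_hom K A A (\<lambda>x. x)"
proof -
  interpret A: cocommutative_coalgebra K A by fact
  show ?thesis
    unfolding coalgebra_hom_iff[OF A] by (simp add: linear_map_id A.sw_pt)
qed

section \<open>The tensor product of two coalgebras\<close>

lemma module_cong:
  assumes "module K M" "carrier N = carrier M" "add N = add M" "zero N = zero M" "smult N = smult M"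
  shows "module K N"
proof -
  interpret M: module K M by fact
  show ?thesis
    by (rule moduleI)
      (auto intro!: abelian_groupI M.R.is_cring M.M.l_neg bexI[of _ "\<ominus>\<^bsub>M\<^esub> _"]
        simp: assms M.M.a_ac M.smult_l_distr M.smult_r_distr M.smult_assoc1)
qed

lemma linear_map_cong_modules:
  assumes "carrier M = carrier M'" "add M = add M'" "smult M = smult M'"
    and "carrier N = carrier N'" "add N = add N'" "smult N = smult N'"
  shows "linear_map K M N f \<longleftrightarrow> linear_map K M' N' f"
  by (simp add: linear_map_def assms)

lemma quadrilinear_trilinear:
  assumes C: "cocommutative_coalgebra K C" and N: "module K N"
    and 1: "\<And>b c d. b \<in> carrier C \<Longrightarrow> c \<in> carrier C \<Longrightarrow> d \<in> carrier C \<Longrightarrow> linear_map K C N (\<lambda>a. \<Psi> a b c d)"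
    and 2: "\<And>a c d. a \<in> carrier C \<Longrightarrow> c \<in> carrier C \<Longrightarrow> d \<in> carrier C \<Longrightarrow> linear_map K C N (\<lambda>b. \<Psi> a b c d)"
    and 3: "\<And>a b d. a \<in> carrier C \<Longrightarrow> b \<in> carrier C \<Longrightarrow> d \<in> carrier C \<Longrightarrow> linear_map K C N (\<lambda>c. \<Psi> a b c d)"
    and 4: "\<And>a b c. a \<in> carrier C \<Longrightarrow> b \<in> carrier C \<Longrightarrow> c \<in> carrier C \<Longrightarrow> linear_map K C N (\<lambda>d. \<Psi> a b c d)"
  shows "trilinear K C N (\<lambda>a b c. sw C N (\<Psi> a b) c)"
    and "a \<in> carrier C \<Longrightarrow> trilinear K C N (\<lambda>b c d. \<Psi> a b c d)"
proof -
  interpret C: cocommutative_coalgebra K C by fact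
  show "trilinear K C N (\<lambda>a b c. sw C N (\<Psi> a b) c)"
    by (intro trilinearI C.sw_linear C.sw_linear_param bilinearI N 1 2 3 4)
  show "a \<in> carrier C \<Longrightarrow> trilinear K C N (\<lambda>b c d. \<Psi> a b c d)"
    by (intro trilinearI 2 3 4)
qed

text \<open>Coassociativity brings the two middle factors of \<open>h\<^sub>1 \<otimes> h\<^sub>2 \<otimes> h\<^sub>3 \<otimes> h\<^sub>4\<close> under one comultiplication,
  where cocommutativity exchanges them. In other words, the comultiplication of a cocommutative
  coalgebra is a coalgebra homomorphism.\<close>

lemma sw_middle_swap:
  assumes C: "cocommutative_coalgebra K C" and h: "h \<in> carrier C" and N: "module K N"
    and 1: "\<And>b c d. b \<in> carrier C \<Longrightarrow> c \<in> carrier C \<Longrightarrow> d \<in> carrier C \<Longrightarrow> linear_map K C N (\<lambda>a. \<Psi> a b c d)"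
    and 2: "\<And>a c d. a \<in> carrier C \<Longrightarrow> c \<in> carrier C \<Longrightarrow> d \<in> carrier C \<Longrightarrow> linear_map K C N (\<lambda>b. \<Psi> a b c d)"
    and 3: "\<And>a b d. a \<in> carrier C \<Longrightarrow> b \<in> carrier C \<Longrightarrow> d \<in> carrier C \<Longrightarrow> linear_map K C N (\<lambda>c. \<Psi> a b c d)"
    and 4: "\<And>a b c. a \<in> carrier C \<Longrightarrow> b \<in> carrier C \<Longrightarrow> c \<in> carrier C \<Longrightarrow> linear_map K C N (\<lambda>d. \<Psi> a b c d)"
  shows "sw C N (\<lambda>x y. sw C N (\<lambda>a b. sw C N (\<lambda>c d. \<Psi> a b c d) y) x) h =
    sw C N (\<lambda>x y. sw C N (\<lambda>a b. sw C N (\<lambda>c d. \<Psi> a c b d) y) x) h"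
proof -
  interpret C: cocommutative_coalgebra K C by fact
  note tri = quadrilinear_trilinear[OF C N, where \<Psi> = \<Psi>, OF 1 2 3 4]
  note tri' = quadrilinear_trilinear[OF C N, where \<Psi> = "\<lambda>a b c d. \<Psi> a c b d", OF 1 3 2 4]
  have "sw C N (\<lambda>x y. sw C N (\<lambda>a b. sw C N (\<lambda>c d. \<Psi> a b c d) y) x) h =
      sw C N (\<lambda>a x. sw C N (\<lambda>b y. sw C N (\<lambda>c d. \<Psi> a b c d) y) x) h"
    by (rule C.sw_coassoc[OF h N tri(1)])
  also have "\<dots> = sw C N (\<lambda>a x. sw C N (\<lambda>y d. sw C N (\<lambda>b c. \<Psi> a b c d) y) x) h"
    by (intro C.sw_cong h C.sw_coassoc[OF _ N tri(2), symmetric])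
  also have "\<dots> = sw C N (\<lambda>a x. sw C N (\<lambda>y d. sw C N (\<lambda>b c. \<Psi> a c b d) y) x) h"
    by (intro C.sw_cong h C.sw_commute N bilinearI 2 3)
  also have "\<dots> = sw C N (\<lambda>a x. sw C N (\<lambda>b y. sw C N (\<lambda>c d. \<Psi> a c b d) y) x) h"
    by (intro C.sw_cong h C.sw_coassoc[OF _ N tri'(2)])
  also have "\<dots> = sw C N (\<lambda>x y. sw C N (\<lambda>a b. sw C N (\<lambda>c d. \<Psi> a c b d) y) x) h"
    by (rule C.sw_coassoc[OF h N tri'(1), symmetric])
  finally show ?thesis .
qed

locale coalgebra_pair =
  A: cocommutative_coalgebra K A + B: cocommutative_coalgebra K B
  for K :: "('k, 'r) ring_scheme" and A :: "('k, 'v) coalgebra" and B :: "('k, 'v) coalgebra"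
begin

sublocale AB: binary_tensor K A B
  by (intro binary_tensor.intro binary_tensor_axioms.intro A.is_module B.is_module A.R.is_cring)

abbreviation "P \<equiv> tensor K [A, B]"
abbreviation "C \<equiv> tensor_coalgebra K A B"
abbreviation pt (infixl "\<otimes>\<^sub>t" 70) where "a \<otimes>\<^sub>t b \<equiv> pure_tensor K [A, B] [a, b]"

lemma C_simps: "carrier C = carrier P" "add C = add P" "zero C = zero P" "smult C = smult P"
  by (simp_all add: tensor_coalgebra_def Let_def module.defs coalgebra.defs)

lemma module_C: "module K C"
  by (rule module_cong[OF AB.module_tensor]) (simp_all add: C_simps)

sublocale PP: binary_tensor K C C
  by (intro binary_tensor.intro binary_tensor_axioms.intro module_C A.R.is_cring)

lemma tensor_PP: "tensor K [P, P] = PP.T" "pure_tensor K [P, P] = pure_tensor K [C, C]"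
  by (rule tensor_cong; simp add: C_simps)+

lemma linear_from_C: "linear_map K C N f \<longleftrightarrow> linear_map K P N f"
  by (rule linear_map_cong_modules) (simp_all add: C_simps)

lemma bilinear_pt: "bilinear K A B C (\<lambda>a b. a \<otimes>\<^sub>t b)"
  using AB.bilinear_pt by (simp add: bilinear_def linear_map_def C_simps)

lemma pt_closed: "a \<in> carrier A \<Longrightarrow> b \<in> carrier B \<Longrightarrow> a \<otimes>\<^sub>t b \<in> carrier C"
  by (simp add: C_simps AB.pt_closed)

lemma ext:
  assumes "module K N" "linear_map K C N f" "linear_map K C N g"
    "\<And>a b. a \<in> carrier A \<Longrightarrow> b \<in> carrier B \<Longrightarrow> f (a \<otimes>\<^sub>t b) = g (a \<otimes>\<^sub>t b)" "x \<in> carrier C"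
  shows "f x = g x"
  using AB.linear_map_ext2[OF assms(1)] assms by (simp add: linear_from_C C_simps)

lemma lift_linear:
  "module K N \<Longrightarrow> bilinear K A B N \<phi> \<Longrightarrow> linear_map K C N (tensor_lift2 N \<phi>)"
  using AB.lift2_linear by (simp add: linear_from_C)

lemma linear_pt:
  assumes "linear_map K C N f"
  shows "b \<in> carrier B \<Longrightarrow> linear_map K A N (\<lambda>a. f (a \<otimes>\<^sub>t b))"
    and "a \<in> carrier A \<Longrightarrow> linear_map K B N (\<lambda>b. f (a \<otimes>\<^sub>t b))"
  using linear_map_comp[OF assms] bilinearD[OF bilinear_pt] by blast+

abbreviation double_sw :: "('k, 'w, 'y) module_scheme \<Rightarrow> ('v \<Rightarrow> 'v \<Rightarrow> 'v \<Rightarrow> 'v \<Rightarrow> 'w) \<Rightarrow> 'v \<Rightarrow> 'v \<Rightarrow> 'w" where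
  "double_sw N \<Psi> a b \<equiv> sw A N (\<lambda>a1 a2. sw B N (\<lambda>b1 b2. \<Psi> a1 b1 a2 b2) b) a"

lemma bilinear_double_sw:
  assumes N: "module K N" and \<phi>: "bilinear K C C N \<phi>"
  shows "bilinear K A B N (double_sw N (\<lambda>a1 b1 a2 b2. \<phi> (a1 \<otimes>\<^sub>t b1) (a2 \<otimes>\<^sub>t b2)))"
  by (intro bilinearI A.sw_linear B.sw_linear A.sw_linear_param B.sw_linear_param N
      linear_pt[of N "\<lambda>x. \<phi> x _"] linear_pt bilinearD[OF \<phi>] pt_closed)

lemma comult_C: "comult C = tensor_lift2 PP.T (double_sw PP.T (\<lambda>a1 b1 a2 b2. PP.pt (a1 \<otimes>\<^sub>t b1) (a2 \<otimes>\<^sub>t b2)))"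
proof -
  have "comult C = tensor_lift2 (tensor K [P, P])
    (double_sw (tensor K [P, P]) (\<lambda>a1 b1 a2 b2. pure_tensor K [P, P] [a1 \<otimes>\<^sub>t b1, a2 \<otimes>\<^sub>t b2]))"
    by (simp add: tensor_coalgebra_def Let_def module.defs coalgebra.defs sw_def)
  then show ?thesis by (simp only: tensor_PP)
qed

lemma comult_linear: "linear_map K C PP.T (comult C)"
  unfolding comult_C
  by (intro lift_linear PP.module_tensor bilinear_double_sw PP.bilinear_pt)

lemma comult_closed: "x \<in> carrier C \<Longrightarrow> comult C x \<in> carrier PP.T"
  by (rule linear_map_closed[OF comult_linear])

lemma sw_linear: "module K N \<Longrightarrow> bilinear K C C N \<phi> \<Longrightarrow> linear_map K C N (sw C N \<phi>)"
  unfolding sw_def[abs_def] by (rule linear_map_comp[OF PP.lift2_linear comult_linear])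

lemma comult_pt:
  assumes "a \<in> carrier A" "b \<in> carrier B"
  shows "comult C (a \<otimes>\<^sub>t b) = double_sw PP.T (\<lambda>a1 b1 a2 b2. PP.pt (a1 \<otimes>\<^sub>t b1) (a2 \<otimes>\<^sub>t b2)) a b"
  unfolding comult_C
  by (intro AB.lift2_pt PP.module_tensor bilinear_double_sw PP.bilinear_pt assms)

lemma sw_pt:
  assumes N: "module K N" and \<phi>: "bilinear K C C N \<phi>" and ab: "a \<in> carrier A" "b \<in> carrier B"
  shows "sw C N \<phi> (a \<otimes>\<^sub>t b) = double_sw N (\<lambda>a1 b1 a2 b2. \<phi> (a1 \<otimes>\<^sub>t b1) (a2 \<otimes>\<^sub>t b2)) a b"
proof -
  note L = PP.lift2_linear[OF N \<phi>]
  have "sw C N \<phi> (a \<otimes>\<^sub>t b) =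
      tensor_lift2 N \<phi> (double_sw PP.T (\<lambda>a1 b1 a2 b2. PP.pt (a1 \<otimes>\<^sub>t b1) (a2 \<otimes>\<^sub>t b2)) a b)"
    by (simp add: sw_def[of C] comult_pt ab)
  also have "\<dots> = sw A N (\<lambda>a1 a2. tensor_lift2 N \<phi> (sw B PP.T (\<lambda>b1 b2. PP.pt (a1 \<otimes>\<^sub>t b1) (a2 \<otimes>\<^sub>t b2)) b)) a"
    by (intro A.sw_comp[OF ab(1) PP.module_tensor N L] B.sw_closed ab PP.module_tensor PP.pt_closed pt_closed)
  also have "\<dots> = double_sw N (\<lambda>a1 b1 a2 b2. tensor_lift2 N \<phi> (PP.pt (a1 \<otimes>\<^sub>t b1) (a2 \<otimes>\<^sub>t b2))) a b"
    by (intro A.sw_cong[OF ab(1)] B.sw_comp[OF ab(2) PP.module_tensor N L] PP.pt_closed pt_closed)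
  also have "\<dots> = double_sw N (\<lambda>a1 b1 a2 b2. \<phi> (a1 \<otimes>\<^sub>t b1) (a2 \<otimes>\<^sub>t b2)) a b"
    by (intro A.sw_cong B.sw_cong ab PP.lift2_pt N \<phi> pt_closed)
  finally show ?thesis .
qed

lemma sw_linear_param:
  "h \<in> carrier C \<Longrightarrow> module K N \<Longrightarrow>
    (\<And>a b. a \<in> carrier C \<Longrightarrow> b \<in> carrier C \<Longrightarrow> linear_map K M N (\<lambda>x. \<phi> x a b)) \<Longrightarrow>
    linear_map K M N (\<lambda>x. sw C N (\<phi> x) h)"
  unfolding sw_def by (rule PP.lift2_linear_param[OF comult_closed])

lemma counit_bilinear: "bilinear K A B (ground_module K) (\<lambda>a b. counit A a \<otimes>\<^bsub>K\<^esub> counit B b)"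
proof -
  note g = module_ground[OF A.R.is_cring]
  have "bilinear K A B (ground_module K) (\<lambda>a b. counit A a \<odot>\<^bsub>ground_module K\<^esub> counit B b)"
    by (rule A.bilinear_counit_left[OF g B.counit_linear])
  then show ?thesis by (simp add: ground_module_def)
qed

lemma counit_C: "counit C = tensor_lift2 (ground_module K) (\<lambda>a b. counit A a \<otimes>\<^bsub>K\<^esub> counit B b)"
  by (simp add: tensor_coalgebra_def Let_def module.defs coalgebra.defs)

lemma counit_linear: "linear_map K C (ground_module K) (counit C)"
  unfolding counit_C by (intro lift_linear counit_bilinear module_ground A.R.is_cring)

lemma counit_pt: "a \<in> carrier A \<Longrightarrow> b \<in> carrier B \<Longrightarrow> counit C (a \<otimes>\<^sub>t b) = counit A a \<otimes>\<^bsub>K\<^esub> counit B b"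
  unfolding counit_C by (intro AB.lift2_pt counit_bilinear module_ground A.R.is_cring)

text \<open>Fubini's rule brings the two sums over \<open>a\<close> together and the two sums over \<open>b\<close> together, so that
  coassociativity of \<open>A\<close> and of \<open>B\<close> applies.\<close>

lemma coassoc_pt:
  assumes N: "module K N" and \<phi>: "trilinear K C N \<phi>" and ab: "a \<in> carrier A" "b \<in> carrier B"
  shows "sw C N (\<lambda>x w. sw C N (\<lambda>u v. \<phi> u v w) x) (a \<otimes>\<^sub>t b) =
    sw C N (\<lambda>u x. sw C N (\<lambda>v w. \<phi> u v w) x) (a \<otimes>\<^sub>t b)"
proof -
  note lin = trilinearD(1-3)[OF \<phi>] linear_pt[of N "\<lambda>x. \<phi> x _ _"] linear_pt[of N "\<lambda>x. \<phi> _ x _"]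
    linear_pt[of N "\<lambda>x. \<phi> _ _ x"] pt_closed
  note cl = trilinearD(4)[OF \<phi>] pt_closed
  let ?\<psi> = "\<lambda>a b c a' b' c'. \<phi> (a \<otimes>\<^sub>t a') (b \<otimes>\<^sub>t b') (c \<otimes>\<^sub>t c')"
  have "sw C N (\<lambda>x w. sw C N (\<lambda>u v. \<phi> u v w) x) (a \<otimes>\<^sub>t b) =
      double_sw N (\<lambda>a1 b1 a2 b2. sw C N (\<lambda>u v. \<phi> u v (a2 \<otimes>\<^sub>t b2)) (a1 \<otimes>\<^sub>t b1)) a b"
    by (intro sw_pt N ab bilinearI sw_linear sw_linear_param lin)
  also have "\<dots> = double_sw N (\<lambda>a1 b1 a2 b2. double_sw N (\<lambda>a11 b11 a12 b12. ?\<psi> a11 a12 a2 b11 b12 b2) a1 b1) a b"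
    by (intro A.sw_cong B.sw_cong sw_pt N ab bilinearI lin)
  also have "\<dots> = sw A N (\<lambda>a1 a2. sw A N (\<lambda>a11 a12.
      sw B N (\<lambda>b1 b2. sw B N (\<lambda>b11 b12. ?\<psi> a11 a12 a2 b11 b12 b2) b1) b) a1) a"
    by (intro A.sw_cong B.sw_swap A.cocommutative_coalgebra_axioms N ab B.sw_closed cl)
  also have "\<dots> = sw A N (\<lambda>a1 a2. sw A N (\<lambda>a21 a22.
      sw B N (\<lambda>b1 b2. sw B N (\<lambda>b11 b12. ?\<psi> a1 a21 a22 b11 b12 b2) b1) b) a2) a"
    by (intro A.sw_coassoc N ab trilinearI B.sw_linear_param lin)
  also have "\<dots> = sw A N (\<lambda>a1 a2. sw A N (\<lambda>a21 a22.
      sw B N (\<lambda>b1 b2. sw B N (\<lambda>b21 b22. ?\<psi> a1 a21 a22 b1 b21 b22) b2) b) a2) a"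
    by (intro A.sw_cong B.sw_coassoc N ab trilinearI lin)
  also have "\<dots> = double_sw N (\<lambda>a1 b1 a2 b2. double_sw N (\<lambda>a21 b21 a22 b22. ?\<psi> a1 a21 a22 b1 b21 b22) a2 b2) a b"
    by (intro A.sw_cong B.sw_swap[symmetric] A.cocommutative_coalgebra_axioms N ab B.sw_closed cl)
  also have "\<dots> = double_sw N (\<lambda>a1 b1 a2 b2. sw C N (\<lambda>v w. \<phi> (a1 \<otimes>\<^sub>t b1) v w) (a2 \<otimes>\<^sub>t b2)) a b"
    by (intro A.sw_cong B.sw_cong sw_pt[symmetric] N ab bilinearI lin)
  also have "\<dots> = sw C N (\<lambda>u x. sw C N (\<lambda>v w. \<phi> u v w) x) (a \<otimes>\<^sub>t b)"
    by (rule sw_pt[OF N _ ab, symmetric]) (intro N bilinearI sw_linear sw_linear_param lin)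
  finally show ?thesis .
qed

lemma bilinear_counit_smult: "bilinear K C C C (\<lambda>x y. counit C x \<odot>\<^bsub>C\<^esub> y)"
  by (intro bilinearI linear_map_smult_left linear_map_smult_right module_C counit_linear linear_map_id)
    (use linear_map_closed[OF counit_linear] in \<open>simp_all add: ground_module_def\<close>)

text \<open>The axioms are equations between linear maps on \<open>A \<otimes> B\<close>, hence can be checked on pure tensors, where
  they reduce to the axioms of \<open>A\<close> and \<open>B\<close>.\<close>

lemma coalgebra_C: "cocommutative_coalgebra K C"
proof (rule cocommutative_coalgebraI)
  interpret PPP: tensor_product K "[C, C, C]"
    by (intro tensor_product.intro tensor_product_axioms.intro A.R.is_cring) (simp add: module_C)
  note N = PPP.module_tensor
  show "module K C" by (rule module_C)
  show "linear_map K C PP.T (comult C)" by (rule comult_linear)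
  show "linear_map K C (ground_module K) (counit C)" by (rule counit_linear)
  show "sw C PPP.T (\<lambda>x w. sw C PPP.T (\<lambda>u v. pure_tensor K [C, C, C] [u, v, w]) x) h =
      sw C PPP.T (\<lambda>u x. sw C PPP.T (\<lambda>v w. pure_tensor K [C, C, C] [u, v, w]) x) h"
    if h: "h \<in> carrier C" for h
  proof -
    note \<phi> = trilinear_pure_tensor[OF A.R.is_cring module_C]
    have "linear_map K C PPP.T (sw C PPP.T (\<lambda>x w. sw C PPP.T (\<lambda>u v. pure_tensor K [C, C, C] [u, v, w]) x))"
      "linear_map K C PPP.T (sw C PPP.T (\<lambda>u x. sw C PPP.T (\<lambda>v w. pure_tensor K [C, C, C] [u, v, w]) x))"
      subgoal by (intro bilinearI sw_linear sw_linear_param N trilinearD[OF \<phi>])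
      subgoal by (rule sw_linear[OF N bilinearI]; intro bilinearI sw_linear sw_linear_param N trilinearD[OF \<phi>])
      done
    from ext[OF N this coassoc_pt[OF N \<phi>] h] show ?thesis .
  qed
  show "sw C C (\<lambda>x y. counit C x \<odot>\<^bsub>C\<^esub> y) h = h" if h: "h \<in> carrier C" for h
  proof (rule ext[OF module_C _ linear_map_id _ h])
    show "linear_map K C C (sw C C (\<lambda>x y. counit C x \<odot>\<^bsub>C\<^esub> y))"
      by (intro sw_linear module_C bilinear_counit_smult)
    fix a b assume ab: "a \<in> carrier A" "b \<in> carrier B"
    have lin: "linear_map K B C (\<lambda>b. counit A a1 \<odot>\<^bsub>C\<^esub> (a2 \<otimes>\<^sub>t b))" if "a1 \<in> carrier A" "a2 \<in> carrier A" for a1 a2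
      using that by (intro linear_map_smult_right module_C bilinearD(1)[OF bilinear_pt] A.counit_closed)
    interpret C: module K C by (rule module_C)
    have "sw C C (\<lambda>x y. counit C x \<odot>\<^bsub>C\<^esub> y) (a \<otimes>\<^sub>t b) =
        double_sw C (\<lambda>a1 b1 a2 b2. counit C (a1 \<otimes>\<^sub>t b1) \<odot>\<^bsub>C\<^esub> (a2 \<otimes>\<^sub>t b2)) a b"
      by (intro sw_pt module_C bilinear_counit_smult ab)
    also have "\<dots> = double_sw C (\<lambda>a1 b1 a2 b2. counit B b1 \<odot>\<^bsub>C\<^esub> (counit A a1 \<odot>\<^bsub>C\<^esub> (a2 \<otimes>\<^sub>t b2))) a b"
      by (intro A.sw_cong B.sw_cong ab)
        (simp add: counit_pt A.counit_closed B.counit_closed pt_closed C.smult_assoc1[symmetric] A.R.m_comm)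
    also have "\<dots> = sw A C (\<lambda>a1 a2. counit A a1 \<odot>\<^bsub>C\<^esub> (a2 \<otimes>\<^sub>t b)) a"
      by (intro A.sw_cong B.sw_counit_left ab module_C lin)
    also have "\<dots> = a \<otimes>\<^sub>t b"
      by (intro A.sw_counit_left ab module_C bilinearD(2)[OF bilinear_pt])
    finally show "sw C C (\<lambda>x y. counit C x \<odot>\<^bsub>C\<^esub> y) (a \<otimes>\<^sub>t b) = a \<otimes>\<^sub>t b" .
  qed
  show "sw C PP.T (\<lambda>a b. PP.pt b a) h = comult C h" if h: "h \<in> carrier C" for h
  proof (rule ext[OF PP.module_tensor _ comult_linear _ h])
    have b: "bilinear K C C PP.T (\<lambda>a b. PP.pt b a)"
      using PP.bilinear_pt by (simp add: bilinear_def)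
    show "linear_map K C PP.T (sw C PP.T (\<lambda>a b. PP.pt b a))"
      by (intro sw_linear PP.module_tensor b)
    note lin = bilinearD[OF PP.bilinear_pt] linear_pt[of PP.T "\<lambda>x. PP.pt x _"] linear_pt[of PP.T "\<lambda>x. PP.pt _ x"]
      pt_closed
    fix a b assume ab: "a \<in> carrier A" "b \<in> carrier B"
    have "sw C PP.T (\<lambda>a b. PP.pt b a) (a \<otimes>\<^sub>t b) =
        double_sw PP.T (\<lambda>a1 b1 a2 b2. PP.pt (a2 \<otimes>\<^sub>t b2) (a1 \<otimes>\<^sub>t b1)) a b"
      by (intro sw_pt PP.module_tensor \<open>bilinear K C C PP.T (\<lambda>a b. PP.pt b a)\<close> ab)
    also have "\<dots> = double_sw PP.T (\<lambda>a1 b1 a2 b2. PP.pt (a1 \<otimes>\<^sub>t b2) (a2 \<otimes>\<^sub>t b1)) a b"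
      by (intro A.sw_commute PP.module_tensor ab bilinearI B.sw_linear_param lin)
    also have "\<dots> = double_sw PP.T (\<lambda>a1 b1 a2 b2. PP.pt (a1 \<otimes>\<^sub>t b1) (a2 \<otimes>\<^sub>t b2)) a b"
      by (intro A.sw_cong B.sw_commute PP.module_tensor ab bilinearI lin)
    finally show "sw C PP.T (\<lambda>a b. PP.pt b a) (a \<otimes>\<^sub>t b) = comult C (a \<otimes>\<^sub>t b)"
      by (simp add: comult_pt ab)
  qed
qed

end

section \<open>The universal property of the tensor product\<close>

context coalgebra_pair
begin

text \<open>The maps \<open>id \<otimes> \<epsilon>\<close> and \<open>\<epsilon> \<otimes> id\<close>.\<close>

definition "\<pi>1 = tensor_lift2 A (\<lambda>a b. counit B b \<odot>\<^bsub>A\<^esub> a)"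
definition "\<pi>2 = tensor_lift2 B (\<lambda>a b. counit A a \<odot>\<^bsub>B\<^esub> b)"

lemma sw_into_C: "sw X C \<phi> x = sw X P \<phi> x"
  by (simp add: sw_def tensor_lift_def C_simps)

lemma bilinear_projections:
  "bilinear K A B A (\<lambda>a b. counit B b \<odot>\<^bsub>A\<^esub> a)" "bilinear K A B B (\<lambda>a b. counit A a \<odot>\<^bsub>B\<^esub> b)"
  by (intro bilinearI linear_map_smult_left linear_map_smult_right linear_map_id A.is_module B.is_module
    A.counit_linear B.counit_linear A.counit_closed B.counit_closed; assumption)+

lemma linear_projections: "linear_map K C A \<pi>1" "linear_map K C B \<pi>2"
  unfolding \<pi>1_def \<pi>2_def
  by (intro lift_linear bilinear_projections A.is_module B.is_module)+

lemma projections_pt: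
  assumes "a \<in> carrier A" "b \<in> carrier B"
  shows "\<pi>1 (a \<otimes>\<^sub>t b) = counit B b \<odot>\<^bsub>A\<^esub> a" "\<pi>2 (a \<otimes>\<^sub>t b) = counit A a \<odot>\<^bsub>B\<^esub> b"
  unfolding \<pi>1_def \<pi>2_def
  by (intro AB.lift2_pt bilinear_projections A.is_module B.is_module assms)+

lemma counit_smult:
  "c \<in> carrier K \<Longrightarrow> a \<in> carrier A \<Longrightarrow> counit A (c \<odot>\<^bsub>A\<^esub> a) = c \<otimes>\<^bsub>K\<^esub> counit A a"
  "c \<in> carrier K \<Longrightarrow> b \<in> carrier B \<Longrightarrow> counit B (c \<odot>\<^bsub>B\<^esub> b) = c \<otimes>\<^bsub>K\<^esub> counit B b"
  using linear_map_smult[OF A.counit_linear] linear_map_smult[OF B.counit_linear]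
  by (simp_all add: ground_module_def)

lemma bilinear_smult_both:
  assumes "bilinear K M M' N \<phi>" "module K M" "module K M'" "module K N"
    "c \<in> carrier K" "d \<in> carrier K" "a \<in> carrier M" "b \<in> carrier M'"
  shows "\<phi> (c \<odot>\<^bsub>M\<^esub> a) (d \<odot>\<^bsub>M'\<^esub> b) = c \<odot>\<^bsub>N\<^esub> (d \<odot>\<^bsub>N\<^esub> \<phi> a b)"
proof -
  interpret M': module K M' by fact
  show ?thesis
    using linear_map_smult[OF bilinearD(2)[OF assms(1)], of "d \<odot>\<^bsub>M'\<^esub> b" c a]
      linear_map_smult[OF bilinearD(1)[OF assms(1)], of a d b] assms by simp
qed

text \<open>By the counit law of \<open>B\<close>, both sides of the compatibility with comultiplications are
  \<open>\<epsilon>(b) \<Delta>(a)\<close> on a pure tensor \<open>a \<otimes> b\<close>.\<close>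

lemma projection1_hom: "coalgebra_hom K C A \<pi>1"
  unfolding coalgebra_hom_iff[OF coalgebra_C]
proof (intro conjI ballI)
  interpret C: cocommutative_coalgebra K C by (rule coalgebra_C)
  show "linear_map K C A \<pi>1" by (rule linear_projections)
  note N = A.HH.module_tensor
  note bil = bilinear_precomp[OF A.HH.bilinear_pt linear_projections(1) linear_projections(1)]
  fix x assume x: "x \<in> carrier C"
  show "comult A (\<pi>1 x) = sw C A.HH.T (\<lambda>a b. A.HH.pt (\<pi>1 a) (\<pi>1 b)) x"
  proof (rule ext[OF N linear_map_comp[OF A.comult_linear linear_projections(1)] C.sw_linear[OF N bil] _ x])
    fix a b assume ab: "a \<in> carrier A" "b \<in> carrier B"
    have "sw C A.HH.T (\<lambda>a b. A.HH.pt (\<pi>1 a) (\<pi>1 b)) (a \<otimes>\<^sub>t b) =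
        double_sw A.HH.T (\<lambda>a1 b1 a2 b2. A.HH.pt (\<pi>1 (a1 \<otimes>\<^sub>t b1)) (\<pi>1 (a2 \<otimes>\<^sub>t b2))) a b"
      by (intro sw_pt N bil ab)
    also have "\<dots> = double_sw A.HH.T (\<lambda>a1 b1 a2 b2. counit B b1 \<odot>\<^bsub>A.HH.T\<^esub> (counit B b2 \<odot>\<^bsub>A.HH.T\<^esub> A.HH.pt a1 a2)) a b"
      by (intro A.sw_cong B.sw_cong ab) (simp add: projections_pt
          bilinear_smult_both[OF A.HH.bilinear_pt A.is_module A.is_module N] B.counit_closed)
    also have "\<dots> = sw A A.HH.T (\<lambda>a1 a2. counit B b \<odot>\<^bsub>A.HH.T\<^esub> A.HH.pt a1 a2) a"
      by (intro A.sw_cong B.sw_counit_left ab N linear_map_smult_left B.counit_linear A.HH.pt_closed)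
    also have "\<dots> = counit B b \<odot>\<^bsub>A.HH.T\<^esub> sw A A.HH.T A.HH.pt a"
      by (rule A.sw_comp[OF ab(1) N N linear_map_smult_right[OF N linear_map_id], symmetric])
        (intro B.counit_closed ab A.HH.pt_closed; assumption)+
    also have "\<dots> = comult A (\<pi>1 (a \<otimes>\<^sub>t b))"
      using linear_map_smult[OF A.comult_linear B.counit_closed[OF ab(2)] ab(1)]
      by (simp add: A.sw_pt projections_pt ab)
    finally show "comult A (\<pi>1 (a \<otimes>\<^sub>t b)) = sw C A.HH.T (\<lambda>a b. A.HH.pt (\<pi>1 a) (\<pi>1 b)) (a \<otimes>\<^sub>t b)" ..
  qed
  show "counit A (\<pi>1 x) = counit C x"
    by (rule ext[OF module_ground[OF A.R.is_cring] linear_map_comp[OF A.counit_linear linear_projections(1)]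
          counit_linear _ x])
      (simp add: projections_pt counit_pt counit_smult A.counit_closed B.counit_closed A.R.m_comm)
qed

lemma projection2_hom: "coalgebra_hom K C B \<pi>2"
  unfolding coalgebra_hom_iff[OF coalgebra_C]
proof (intro conjI ballI)
  interpret C: cocommutative_coalgebra K C by (rule coalgebra_C)
  show "linear_map K C B \<pi>2" by (rule linear_projections)
  note N = B.HH.module_tensor
  note bil = bilinear_precomp[OF B.HH.bilinear_pt linear_projections(2) linear_projections(2)]
  fix x assume x: "x \<in> carrier C"
  show "comult B (\<pi>2 x) = sw C B.HH.T (\<lambda>a b. B.HH.pt (\<pi>2 a) (\<pi>2 b)) x"
  proof (rule ext[OF N linear_map_comp[OF B.comult_linear linear_projections(2)] C.sw_linear[OF N bil] _ x])
    fix a b assume ab: "a \<in> carrier A" "b \<in> carrier B"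
    have "sw C B.HH.T (\<lambda>a b. B.HH.pt (\<pi>2 a) (\<pi>2 b)) (a \<otimes>\<^sub>t b) =
        double_sw B.HH.T (\<lambda>a1 b1 a2 b2. B.HH.pt (\<pi>2 (a1 \<otimes>\<^sub>t b1)) (\<pi>2 (a2 \<otimes>\<^sub>t b2))) a b"
      by (intro sw_pt N bil ab)
    also have "\<dots> = double_sw B.HH.T (\<lambda>a1 b1 a2 b2. counit A a1 \<odot>\<^bsub>B.HH.T\<^esub> (counit A a2 \<odot>\<^bsub>B.HH.T\<^esub> B.HH.pt b1 b2)) a b"
      by (intro A.sw_cong B.sw_cong ab) (simp add: projections_pt
          bilinear_smult_both[OF B.HH.bilinear_pt B.is_module B.is_module N] A.counit_closed)
    also have "\<dots> = sw A B.HH.T (\<lambda>a1 a2. counit A a1 \<odot>\<^bsub>B.HH.T\<^esub> (counit A a2 \<odot>\<^bsub>B.HH.T\<^esub> sw B B.HH.T B.HH.pt b)) a"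
      by (intro A.sw_cong ab B.sw_comp[OF ab(2) N N, symmetric] linear_map_smult_right N linear_map_id
          A.counit_closed B.HH.pt_closed)
    also have "\<dots> = counit A a \<odot>\<^bsub>B.HH.T\<^esub> sw B B.HH.T B.HH.pt b"
      by (intro A.sw_counit_left ab N linear_map_smult_left A.counit_linear B.sw_closed B.HH.pt_closed)
    also have "\<dots> = comult B (\<pi>2 (a \<otimes>\<^sub>t b))"
      using linear_map_smult[OF B.comult_linear A.counit_closed[OF ab(1)] ab(2)]
      by (simp add: B.sw_pt projections_pt ab)
    finally show "comult B (\<pi>2 (a \<otimes>\<^sub>t b)) = sw C B.HH.T (\<lambda>a b. B.HH.pt (\<pi>2 a) (\<pi>2 b)) (a \<otimes>\<^sub>t b)" ..
  qed
  show "counit B (\<pi>2 x) = counit C x"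
    by (rule ext[OF module_ground[OF A.R.is_cring] linear_map_comp[OF B.counit_linear linear_projections(2)]
          counit_linear _ x])
      (simp add: projections_pt counit_pt counit_smult A.counit_closed B.counit_closed)
qed

text \<open>On \<open>a \<otimes> b\<close> the sum is \<open>\<Sum> \<epsilon>(b\<^sub>1) a\<^sub>1 \<otimes> \<epsilon>(a\<^sub>2) b\<^sub>2\<close>. Applied to the values of a homomorphism into
  \<open>A \<otimes> B\<close>, the identity shows that the homomorphism is determined by its two components.\<close>

lemma pairing_projections:
  assumes "x \<in> carrier C"
  shows "sw C C (\<lambda>u v. \<pi>1 u \<otimes>\<^sub>t \<pi>2 v) x = x"
proof -
  interpret C: cocommutative_coalgebra K C by (rule coalgebra_C)
  note bil = bilinear_precomp[OF bilinear_pt linear_projections]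
  show ?thesis
  proof (rule ext[OF module_C C.sw_linear[OF module_C bil] linear_map_id _ assms])
    fix a b assume ab: "a \<in> carrier A" "b \<in> carrier B"
    have "sw C C (\<lambda>u v. \<pi>1 u \<otimes>\<^sub>t \<pi>2 v) (a \<otimes>\<^sub>t b) =
        double_sw C (\<lambda>a1 b1 a2 b2. \<pi>1 (a1 \<otimes>\<^sub>t b1) \<otimes>\<^sub>t \<pi>2 (a2 \<otimes>\<^sub>t b2)) a b"
      by (intro sw_pt module_C bil ab)
    also have "\<dots> = double_sw C (\<lambda>a1 b1 a2 b2. counit B b1 \<odot>\<^bsub>C\<^esub> (counit A a2 \<odot>\<^bsub>C\<^esub> (a1 \<otimes>\<^sub>t b2))) a b"
      by (intro A.sw_cong B.sw_cong ab) (simp add: projections_pt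
          bilinear_smult_both[OF bilinear_pt A.is_module B.is_module module_C] A.counit_closed B.counit_closed)
    also have "\<dots> = sw A C (\<lambda>a1 a2. counit A a2 \<odot>\<^bsub>C\<^esub> (a1 \<otimes>\<^sub>t b)) a"
      by (intro A.sw_cong B.sw_counit_left ab module_C linear_map_smult_right bilinearD(1)[OF bilinear_pt]
          A.counit_closed)
    also have "\<dots> = a \<otimes>\<^sub>t b"
      by (intro A.sw_counit_right ab module_C bilinearD(2)[OF bilinear_pt])
    finally show "sw C C (\<lambda>u v. \<pi>1 u \<otimes>\<^sub>t \<pi>2 v) (a \<otimes>\<^sub>t b) = a \<otimes>\<^sub>t b" .
  qed
qed

text \<open>The comultiplication of the image of \<open>x\<close> involves \<open>f(x\<^sub>1) \<otimes> g(x\<^sub>3) \<otimes> f(x\<^sub>2) \<otimes> g(x\<^sub>4)\<close>, whereas the image of the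
  comultiplication of \<open>x\<close> involves \<open>f(x\<^sub>1) \<otimes> g(x\<^sub>2) \<otimes> f(x\<^sub>3) \<otimes> g(x\<^sub>4)\<close>. Cocommutativity of \<open>X\<close> identifies the two.\<close>

lemma pairing:
  assumes X: "cocommutative_coalgebra K X" and f: "coalgebra_hom K X A f" and g: "coalgebra_hom K X B g"
  shows "coalgebra_hom K X C (sw X C (\<lambda>x y. f x \<otimes>\<^sub>t g y))"
    and "x \<in> carrier X \<Longrightarrow> \<pi>1 (sw X C (\<lambda>x y. f x \<otimes>\<^sub>t g y) x) = f x"
    and "x \<in> carrier X \<Longrightarrow> \<pi>2 (sw X C (\<lambda>x y. f x \<otimes>\<^sub>t g y) x) = g x"
proof -
  interpret X: cocommutative_coalgebra K X by fact
  let ?p = "sw X C (\<lambda>x y. f x \<otimes>\<^sub>t g y)"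
  note fl = coalgebra_hom_linear[OF f] and gl = coalgebra_hom_linear[OF g]
  note fc = coalgebra_hom_closed[OF f] and gc = coalgebra_hom_closed[OF g]
  note bil = bilinear_precomp[OF bilinear_pt fl gl]
  note p = X.sw_linear[OF module_C bil]
  note N = PP.module_tensor
  have cl: "f x \<otimes>\<^sub>t g y \<in> carrier C" if "x \<in> carrier X" "y \<in> carrier X" for x y
    using that by (intro pt_closed fc gc)
  have counit_f: "\<And>x. x \<in> carrier X \<Longrightarrow> counit A (f x) = counit X x"
    and counit_g: "\<And>x. x \<in> carrier X \<Longrightarrow> counit B (g x) = counit X x"
    using coalgebra_hom_counit[OF f] coalgebra_hom_counit[OF g] by auto
  show "\<pi>1 (?p x) = f x" if x: "x \<in> carrier X"
  proof -
    have "\<pi>1 (?p x) = sw X A (\<lambda>x y. \<pi>1 (f x \<otimes>\<^sub>t g y)) x"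
      by (rule X.sw_comp[OF x module_C A.is_module linear_projections(1) cl])
    also have "\<dots> = sw X A (\<lambda>x y. counit X y \<odot>\<^bsub>A\<^esub> f x) x"
      by (intro X.sw_cong x) (simp add: projections_pt fc gc counit_g)
    also have "\<dots> = f x"
      by (intro X.sw_counit_right x A.is_module fl)
    finally show ?thesis .
  qed
  show "\<pi>2 (?p x) = g x" if x: "x \<in> carrier X"
  proof -
    have "\<pi>2 (?p x) = sw X B (\<lambda>x y. \<pi>2 (f x \<otimes>\<^sub>t g y)) x"
      by (rule X.sw_comp[OF x module_C B.is_module linear_projections(2) cl])
    also have "\<dots> = sw X B (\<lambda>x y. counit X x \<odot>\<^bsub>B\<^esub> g y) x"
      by (intro X.sw_cong x) (simp add: projections_pt fc gc counit_f)
    also have "\<dots> = g x"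
      by (intro X.sw_counit_left x B.is_module gl)
    finally show ?thesis .
  qed
  show "coalgebra_hom K X C ?p"
    unfolding coalgebra_hom_iff[OF X]
  proof (intro conjI ballI p)
    fix x assume x: "x \<in> carrier X"
    let ?\<Psi> = "\<lambda>a b c d. PP.pt (f a \<otimes>\<^sub>t g b) (f c \<otimes>\<^sub>t g d)"
    note lin = bilinearD(1,2)[OF PP.bilinear_pt, THEN linear_map_comp] bilinearD(1,2)[OF bil] cl
    have "comult C (?p x) = sw X PP.T (\<lambda>x y. comult C (f x \<otimes>\<^sub>t g y)) x"
      by (rule X.sw_comp[OF x module_C N comult_linear cl])
    also have "\<dots> = sw X PP.T (\<lambda>x y. double_sw PP.T (\<lambda>a1 b1 a2 b2. PP.pt (a1 \<otimes>\<^sub>t b1) (a2 \<otimes>\<^sub>t b2)) (f x) (g y)) x"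
      by (intro X.sw_cong x comult_pt fc gc)
    also have "\<dots> = sw X PP.T (\<lambda>x y. sw X PP.T (\<lambda>a c.
        sw B PP.T (\<lambda>b1 b2. PP.pt (f a \<otimes>\<^sub>t b1) (f c \<otimes>\<^sub>t b2)) (g y)) x) x"
      by (intro X.sw_cong x sw_hom[OF X A.cocommutative_coalgebra_axioms f] N bilinearI B.sw_linear_param gc
          linear_pt[of PP.T "\<lambda>x. PP.pt x _"] linear_pt[of PP.T "\<lambda>x. PP.pt _ x"]
          bilinearD[OF PP.bilinear_pt] pt_closed)
    also have "\<dots> = sw X PP.T (\<lambda>x y. sw X PP.T (\<lambda>a c. sw X PP.T (\<lambda>b d. ?\<Psi> a b c d) y) x) x"
      by (intro X.sw_cong x sw_hom[OF X B.cocommutative_coalgebra_axioms g] N bilinearI gc fc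
          linear_pt[of PP.T "\<lambda>x. PP.pt x _"] linear_pt[of PP.T "\<lambda>x. PP.pt _ x"]
          bilinearD[OF PP.bilinear_pt] pt_closed)
    also have "\<dots> = sw X PP.T (\<lambda>x y. sw X PP.T (\<lambda>a b. sw X PP.T (\<lambda>c d. ?\<Psi> a b c d) y) x) x"
      by (rule sw_middle_swap[OF X x N]; intro lin; assumption)
    also have "\<dots> = sw X PP.T (\<lambda>x y. sw X PP.T (\<lambda>a b. PP.pt (f a \<otimes>\<^sub>t g b) (?p y)) x) x"
      by (intro X.sw_cong x X.sw_comp[OF _ module_C N bilinearD(1)[OF PP.bilinear_pt], symmetric] cl)
    also have "\<dots> = sw X PP.T (\<lambda>x y. PP.pt (?p x) (?p y)) x"
      by (intro X.sw_cong x X.sw_comp[OF _ module_C N bilinearD(2)[OF PP.bilinear_pt], symmetric] cl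
          linear_map_closed[OF p])
    finally show "comult C (?p x) = sw X PP.T (\<lambda>x y. PP.pt (?p x) (?p y)) x" .
    have "counit C (?p x) = sw X (ground_module K) (\<lambda>x y. counit C (f x \<otimes>\<^sub>t g y)) x"
      by (rule X.sw_comp[OF x module_C module_ground[OF A.R.is_cring] counit_linear cl])
    also have "\<dots> = sw X (ground_module K) (\<lambda>x y. counit X x \<odot>\<^bsub>ground_module K\<^esub> counit X y) x"
      by (intro X.sw_cong x) (simp add: counit_pt fc gc counit_f counit_g ground_module_def)
    also have "\<dots> = counit X x"
      by (intro X.sw_counit_left x module_ground[OF A.R.is_cring] X.counit_linear)
    finally show "counit C (?p x) = counit X x" .
  qed
qed

lemma pairing_unique:
  assumes X: "cocommutative_coalgebra K X" and h: "coalgebra_hom K X C h" and x: "x \<in> carrier X"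
  shows "h x = sw X C (\<lambda>x y. \<pi>1 (h x) \<otimes>\<^sub>t \<pi>2 (h y)) x"
  using sw_hom[OF X coalgebra_C h x module_C bilinear_precomp[OF bilinear_pt linear_projections]]
    pairing_projections[OF coalgebra_hom_closed[OF h x]] by simp

end

section \<open>Retracts of coalgebras and transport of structure\<close>

text \<open>If the idempotent \<open>\<iota> \<circ> \<pi>\<close> of \<open>C\<close> fixes the comultiplications of the elements in the image of \<open>\<iota>\<close>, then this
  image is a subcoalgebra, and its structure can be moved to \<open>M\<close>. With bijective \<open>\<iota>\<close> this is transport of
  structure; with an inclusion \<open>\<iota>\<close> it makes a subspace with a retraction a subcoalgebra.\<close>

lemma retract_coalgebra:
  fixes C :: "('k, 'v) coalgebra" and M :: "('k, 'w) module"
  assumes C: "cocommutative_coalgebra K C" and M: "module K M"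
    and \<pi>: "linear_map K C M \<pi>" and \<iota>: "linear_map K M C \<iota>"
    and \<pi>\<iota>: "\<And>x. x \<in> carrier M \<Longrightarrow> \<pi> (\<iota> x) = x"
    and stable: "\<And>x. x \<in> carrier M \<Longrightarrow>
      sw C (tensor K [C, C]) (\<lambda>a b. pure_tensor K [C, C] [\<iota> (\<pi> a), \<iota> (\<pi> b)]) (\<iota> x) = comult C (\<iota> x)"
  obtains D :: "('k, 'w) coalgebra" where "cocommutative_coalgebra K D" "carrier D = carrier M"
    "coalgebra_hom K D C \<iota>"
    "\<forall>X h. cocommutative_coalgebra K (X :: ('k, 'v) coalgebra) \<longrightarrow> coalgebra_hom K X C h \<longrightarrow>
      (\<forall>x \<in> carrier X. \<iota> (\<pi> (h x)) = h x) \<longrightarrow> coalgebra_hom K X D (\<lambda>x. \<pi> (h x))"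
proof -
  interpret C: cocommutative_coalgebra K C by fact
  define D :: "('k, 'w) coalgebra" where
    "D = module.extend M (coalgebra.fields
      (\<lambda>x. sw C (tensor K [M, M]) (\<lambda>a b. pure_tensor K [M, M] [\<pi> a, \<pi> b]) (\<iota> x)) (\<lambda>x. counit C (\<iota> x)))"
  have D_simps: "carrier D = carrier M" "zero D = zero M" "add D = add M" "smult D = smult M"
    and counit_D: "counit D = (\<lambda>x. counit C (\<iota> x))"
    by (simp_all add: D_def module.defs coalgebra.defs)
  have T: "tensor K [M, M] = tensor K [D, D]" "pure_tensor K [M, M] = pure_tensor K [D, D]"
    by (rule tensor_cong; simp add: D_simps)+
  have "comult D = (\<lambda>x. sw C (tensor K [M, M]) (\<lambda>a b. pure_tensor K [M, M] [\<pi> a, \<pi> b]) (\<iota> x))"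
    by (simp add: D_def module.defs coalgebra.defs)
  then have comult_D: "comult D = (\<lambda>x. sw C (tensor K [D, D]) (\<lambda>a b. pure_tensor K [D, D] [\<pi> a, \<pi> b]) (\<iota> x))"
    by (simp only: T)
  have D: "module K D" by (rule module_cong[OF M]) (simp_all add: D_simps)
  have \<pi>: "linear_map K C D \<pi>" and \<iota>: "linear_map K D C \<iota>"
    using \<pi> \<iota> by (simp_all add: linear_map_def D_simps)
  have \<pi>\<iota>: "\<pi> (\<iota> x) = x" if "x \<in> carrier D" for x using \<pi>\<iota> that by (simp add: D_simps)
  interpret DD: binary_tensor K D D
    by (intro binary_tensor.intro binary_tensor_axioms.intro D C.R.is_cring)
  note \<pi>c = linear_map_closed[OF \<pi>] and \<iota>c = linear_map_closed[OF \<iota>]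
  note \<iota>\<pi> = linear_map_comp[OF \<iota> \<pi>]
  have sw_D: "sw D N \<phi> x = sw C N (\<lambda>a b. \<phi> (\<pi> a) (\<pi> b)) (\<iota> x)"
    if "module K N" "bilinear K D D N \<phi>" "x \<in> carrier D" for N :: "('k, 'x, 'y) module_scheme" and \<phi> x
  proof -
    have "sw D N \<phi> x = sw C N (\<lambda>a b. tensor_lift2 N \<phi> (DD.pt (\<pi> a) (\<pi> b))) (\<iota> x)"
      unfolding sw_def[of D] comult_D
      by (rule C.sw_comp[OF \<iota>c[OF that(3)] DD.module_tensor that(1) DD.lift2_linear[OF that(1,2)]])
        (intro DD.pt_closed \<pi>c)
    also have "\<dots> = sw C N (\<lambda>a b. \<phi> (\<pi> a) (\<pi> b)) (\<iota> x)"
      by (intro C.sw_cong DD.lift2_pt \<iota>c \<pi>c that)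
    finally show ?thesis .
  qed
  have sw_\<iota>: "sw C N (\<lambda>a b. \<phi> (\<iota> (\<pi> a)) (\<iota> (\<pi> b))) (\<iota> x) = sw C N \<phi> (\<iota> x)"
    if N: "module K N" and \<phi>: "bilinear K C C N \<phi>" and x: "x \<in> carrier D" for N :: "('k, 'x, 'y) module_scheme" and \<phi> x
  proof -
    have "sw C N (\<lambda>a b. \<phi> (\<iota> (\<pi> a)) (\<iota> (\<pi> b))) (\<iota> x) =
        sw C N (\<lambda>a b. tensor_lift2 N \<phi> (C.HH.pt (\<iota> (\<pi> a)) (\<iota> (\<pi> b)))) (\<iota> x)"
      by (intro C.sw_cong C.HH.lift2_pt[symmetric] \<iota>c \<pi>c N \<phi> x)
    also have "\<dots> = tensor_lift2 N \<phi> (sw C C.HH.T (\<lambda>a b. C.HH.pt (\<iota> (\<pi> a)) (\<iota> (\<pi> b))) (\<iota> x))"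
      by (rule C.sw_comp[OF \<iota>c[OF x] C.HH.module_tensor N C.HH.lift2_linear[OF N \<phi>], symmetric])
        (intro C.HH.pt_closed \<iota>c \<pi>c)
    also have "\<dots> = sw C N \<phi> (\<iota> x)" using stable x by (simp add: sw_def[of C N] D_simps)
    finally show ?thesis .
  qed
  \<comment> \<open>As \<open>\<iota> \<circ> \<pi>\<close> is idempotent, it can be inserted into one argument alone.\<close>
  have sw_\<iota>1: "sw C N (\<lambda>a b. \<phi> (\<iota> (\<pi> a)) b) (\<iota> x) = sw C N \<phi> (\<iota> x)"
    and sw_\<iota>2: "sw C N (\<lambda>a b. \<phi> a (\<iota> (\<pi> b))) (\<iota> x) = sw C N \<phi> (\<iota> x)"
    if N: "module K N" and \<phi>: "bilinear K C C N \<phi>" and x: "x \<in> carrier D" for N :: "('k, 'x, 'y) module_scheme" and \<phi> x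
  proof -
    have *: "sw C N (\<lambda>a b. \<phi> (\<iota> (\<pi> (\<iota> (\<pi> a)))) (\<iota> (\<pi> b))) (\<iota> x) = sw C N (\<lambda>a b. \<phi> (\<iota> (\<pi> a)) (\<iota> (\<pi> b))) (\<iota> x)"
      "sw C N (\<lambda>a b. \<phi> (\<iota> (\<pi> a)) (\<iota> (\<pi> (\<iota> (\<pi> b))))) (\<iota> x) = sw C N (\<lambda>a b. \<phi> (\<iota> (\<pi> a)) (\<iota> (\<pi> b))) (\<iota> x)"
      by (intro C.sw_cong \<iota>c x; simp only: \<pi>\<iota> \<pi>c)+
    show "sw C N (\<lambda>a b. \<phi> (\<iota> (\<pi> a)) b) (\<iota> x) = sw C N \<phi> (\<iota> x)"
      using sw_\<iota>[OF N bilinear_precomp[OF \<phi> \<iota>\<pi> linear_map_id] x] sw_\<iota>[OF N \<phi> x] by (simp only: *)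
    show "sw C N (\<lambda>a b. \<phi> a (\<iota> (\<pi> b))) (\<iota> x) = sw C N \<phi> (\<iota> x)"
      using sw_\<iota>[OF N bilinear_precomp[OF \<phi> linear_map_id \<iota>\<pi>] x] sw_\<iota>[OF N \<phi> x] by (simp only: *)
  qed
  have comult_lin: "linear_map K D DD.T (comult D)"
    unfolding comult_D
    by (rule linear_map_comp[OF C.sw_linear[OF DD.module_tensor bilinear_precomp[OF DD.bilinear_pt \<pi> \<pi>]] \<iota>])
  have counit_lin: "linear_map K D (ground_module K) (counit D)"
    unfolding counit_D by (rule linear_map_comp[OF C.counit_linear \<iota>])
  have coalgebra: "cocommutative_coalgebra K D"
  proof (rule cocommutative_coalgebraI[OF D comult_lin counit_lin])
    interpret DDD: tensor_product K "[D, D, D]"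
      by (intro tensor_product.intro tensor_product_axioms.intro C.R.is_cring) (simp add: D)
    let ?\<phi> = "\<lambda>a b c. pure_tensor K [D, D, D] [a, b, c]"
    note N = DDD.module_tensor
    note \<phi> = trilinear_pure_tensor[OF C.R.is_cring D]
    have \<psi>: "trilinear K C DDD.T (\<lambda>a b c. ?\<phi> (\<pi> a) (\<pi> b) (\<pi> c))"
      by (intro trilinearI; intro linear_map_comp[OF _ \<pi>] trilinearD(1-3)[OF \<phi>] \<pi>c)
    note lin = trilinearD[OF \<psi>]
    have sw_lin: "linear_map K D DDD.T (sw D DDD.T \<phi>')" if "bilinear K D D DDD.T \<phi>'" for \<phi>'
      unfolding sw_def[abs_def] by (rule linear_map_comp[OF DD.lift2_linear[OF N that] comult_lin])
    have sw_par: "linear_map K D DDD.T (\<lambda>x. sw D DDD.T (\<phi>' x) y)"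
      if "y \<in> carrier D" "\<And>a b. a \<in> carrier D \<Longrightarrow> b \<in> carrier D \<Longrightarrow> linear_map K D DDD.T (\<lambda>x. \<phi>' x a b)" for \<phi>' y
      unfolding sw_def by (rule DD.lift2_linear_param[OF linear_map_closed[OF comult_lin that(1)] N that(2)])
    have 1: "bilinear K C C DDD.T (\<lambda>x c. sw C DDD.T (\<lambda>a b. ?\<phi> (\<pi> a) (\<pi> b) (\<pi> c)) x)"
      by (rule bilinearI; intro C.sw_linear C.sw_linear_param bilinearI N lin)
    have 2: "bilinear K C C DDD.T (\<lambda>a x. sw C DDD.T (\<lambda>b c. ?\<phi> (\<pi> a) (\<pi> b) (\<pi> c)) x)"
      by (rule bilinearI; intro C.sw_linear C.sw_linear_param bilinearI N lin)
    have 3: "bilinear K D D DDD.T (\<lambda>x c. sw D DDD.T (\<lambda>a b. ?\<phi> a b c) x)"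
      by (rule bilinearI; intro sw_lin sw_par bilinearI trilinearD[OF \<phi>])
    have 4: "bilinear K D D DDD.T (\<lambda>a x. sw D DDD.T (\<lambda>b c. ?\<phi> a b c) x)"
      by (rule bilinearI; intro sw_lin sw_par bilinearI trilinearD[OF \<phi>])
    have b1: "bilinear K D D DDD.T (\<lambda>a b. ?\<phi> a b c)" if "c \<in> carrier D" for c
      by (rule bilinearI; intro trilinearD[OF \<phi>] that)
    have b2: "bilinear K D D DDD.T (?\<phi> c)" if "c \<in> carrier D" for c
      by (rule bilinearI; intro trilinearD[OF \<phi>] that)
    fix h assume h: "h \<in> carrier D"
    have "sw D DDD.T (\<lambda>x c. sw D DDD.T (\<lambda>a b. ?\<phi> a b c) x) h =
        sw C DDD.T (\<lambda>x c. sw D DDD.T (\<lambda>a b. ?\<phi> a b (\<pi> c)) (\<pi> x)) (\<iota> h)"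
      by (rule sw_D[OF N 3 h])
    also have "\<dots> = sw C DDD.T (\<lambda>x c. sw C DDD.T (\<lambda>a b. ?\<phi> (\<pi> a) (\<pi> b) (\<pi> c)) (\<iota> (\<pi> x))) (\<iota> h)"
      by (intro C.sw_cong \<iota>c h sw_D N b1 \<pi>c)
    also have "\<dots> = sw C DDD.T (\<lambda>x c. sw C DDD.T (\<lambda>a b. ?\<phi> (\<pi> a) (\<pi> b) (\<pi> c)) x) (\<iota> h)"
      by (rule sw_\<iota>1[OF N 1 h])
    also have "\<dots> = sw C DDD.T (\<lambda>a x. sw C DDD.T (\<lambda>b c. ?\<phi> (\<pi> a) (\<pi> b) (\<pi> c)) x) (\<iota> h)"
      by (rule C.sw_coassoc[OF \<iota>c[OF h] N \<psi>])
    also have "\<dots> = sw C DDD.T (\<lambda>a x. sw C DDD.T (\<lambda>b c. ?\<phi> (\<pi> a) (\<pi> b) (\<pi> c)) (\<iota> (\<pi> x))) (\<iota> h)"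
      by (rule sw_\<iota>2[OF N 2 h, symmetric])
    also have "\<dots> = sw C DDD.T (\<lambda>a x. sw D DDD.T (\<lambda>b c. ?\<phi> (\<pi> a) b c) (\<pi> x)) (\<iota> h)"
      by (intro C.sw_cong \<iota>c h sw_D[symmetric] N b2 \<pi>c)
    also have "\<dots> = sw D DDD.T (\<lambda>a x. sw D DDD.T (\<lambda>b c. ?\<phi> a b c) x) h"
      by (rule sw_D[OF N 4 h, symmetric])
    finally show "sw D DDD.T (\<lambda>x c. sw D DDD.T (\<lambda>a b. ?\<phi> a b c) x) h =
        sw D DDD.T (\<lambda>a x. sw D DDD.T (\<lambda>b c. ?\<phi> a b c) x) h" .
  next
    fix h assume h: "h \<in> carrier D"
    have b: "bilinear K D D D (\<lambda>a b. counit D a \<odot>\<^bsub>D\<^esub> b)"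
      unfolding counit_D
      by (intro bilinearI linear_map_smult_left linear_map_smult_right D linear_map_id
          linear_map_comp[OF C.counit_linear \<iota>] C.counit_closed \<iota>c)
    have b': "bilinear K D D DD.T (\<lambda>a b. DD.pt b a)"
      using DD.bilinear_pt by (simp add: bilinear_def)
    have "sw D D (\<lambda>a b. counit D a \<odot>\<^bsub>D\<^esub> b) h = sw C D (\<lambda>a b. counit C (\<iota> (\<pi> a)) \<odot>\<^bsub>D\<^esub> \<pi> b) (\<iota> h)"
      unfolding sw_D[OF D b h] by (simp only: counit_D)
    also have "\<dots> = sw C D (\<lambda>a b. counit C a \<odot>\<^bsub>D\<^esub> \<pi> b) (\<iota> h)"
      by (rule sw_\<iota>1[OF D C.bilinear_counit_left[OF D \<pi>] h])
    also have "\<dots> = h"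
      using C.sw_counit_left[OF \<iota>c[OF h] D \<pi>] \<pi>\<iota>[OF h] by simp
    finally show "sw D D (\<lambda>a b. counit D a \<odot>\<^bsub>D\<^esub> b) h = h" .
    have "sw D DD.T (\<lambda>a b. DD.pt b a) h = sw C DD.T (\<lambda>a b. DD.pt (\<pi> b) (\<pi> a)) (\<iota> h)"
      by (rule sw_D[OF DD.module_tensor b' h])
    also have "\<dots> = comult D h"
      unfolding comult_D
      by (intro C.sw_commute[symmetric] \<iota>c h DD.module_tensor bilinear_precomp[OF DD.bilinear_pt \<pi> \<pi>])
    finally show "sw D DD.T (\<lambda>a b. DD.pt b a) h = comult D h" .
  qed
  have incl: "coalgebra_hom K D C \<iota>"
    unfolding coalgebra_hom_iff[OF coalgebra]
  proof (intro conjI ballI \<iota>)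
    fix x assume x: "x \<in> carrier D"
    show "counit C (\<iota> x) = counit D x" by (simp add: counit_D)
    have "sw D C.HH.T (\<lambda>a b. C.HH.pt (\<iota> a) (\<iota> b)) x = sw C C.HH.T (\<lambda>a b. C.HH.pt (\<iota> (\<pi> a)) (\<iota> (\<pi> b))) (\<iota> x)"
      by (rule sw_D[OF C.HH.module_tensor bilinear_precomp[OF C.HH.bilinear_pt \<iota> \<iota>] x])
    then show "comult C (\<iota> x) = sw D C.HH.T (\<lambda>a b. C.HH.pt (\<iota> a) (\<iota> b)) x"
      using stable x by (simp add: D_simps)
  qed
  have corestrict: "coalgebra_hom K X D (\<lambda>x. \<pi> (h x))"
    if X: "cocommutative_coalgebra K X" and h: "coalgebra_hom K X C h" and eq: "\<forall>x \<in> carrier X. \<iota> (\<pi> (h x)) = h x"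
    for X :: "('k, 'v) coalgebra" and h
    unfolding coalgebra_hom_iff[OF X]
  proof (intro conjI ballI linear_map_comp[OF \<pi> coalgebra_hom_linear[OF h]])
    fix x assume x: "x \<in> carrier X"
    show "counit D (\<pi> (h x)) = counit X x" using eq x coalgebra_hom_counit[OF h x] by (simp add: counit_D)
    have "comult D (\<pi> (h x)) = sw C DD.T (\<lambda>a b. DD.pt (\<pi> a) (\<pi> b)) (h x)" using eq x by (simp add: comult_D)
    also have "\<dots> = sw X DD.T (\<lambda>a b. DD.pt (\<pi> (h a)) (\<pi> (h b))) x"
      by (rule sw_hom[OF X C h x DD.module_tensor bilinear_precomp[OF DD.bilinear_pt \<pi> \<pi>]])
    finally show "comult D (\<pi> (h x)) = sw X DD.T (\<lambda>a b. DD.pt (\<pi> (h a)) (\<pi> (h b))) x" .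
  qed
  show thesis
    by (rule that[OF coalgebra D_simps(1) incl]) (use corestrict in blast)
qed

lemma transport_coalgebra:
  fixes C :: "('k, 'v) coalgebra" and j :: "'v \<Rightarrow> 'w"
  assumes C: "cocommutative_coalgebra K C" and j: "inj_on j (carrier C)"
  defines "i \<equiv> inv_into (carrier C) j"
  obtains C' :: "('k, 'w) coalgebra" where "cocommutative_coalgebra K C'" "carrier C' = j ` carrier C"
    "coalgebra_hom K C C' j" "coalgebra_hom K C' C i"
proof -
  interpret C: cocommutative_coalgebra K C by fact
  define M :: "('k, 'w) module" where
    "M = \<lparr>carrier = j ` carrier C, mult = undefined, one = undefined, zero = j \<zero>\<^bsub>C\<^esub>,
      add = (\<lambda>x y. j (i x \<oplus>\<^bsub>C\<^esub> i y)), smult = (\<lambda>a x. j (a \<odot>\<^bsub>C\<^esub> i x))\<rparr>"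
  have M_simps: "carrier M = j ` carrier C" "zero M = j \<zero>\<^bsub>C\<^esub>" "add M = (\<lambda>x y. j (i x \<oplus>\<^bsub>C\<^esub> i y))"
    "smult M = (\<lambda>a x. j (a \<odot>\<^bsub>C\<^esub> i x))"
    by (simp_all add: M_def)
  have ij [simp]: "x \<in> carrier C \<Longrightarrow> i (j x) = x" for x
    using j by (simp add: i_def)
  have "abelian_group M"
    by (rule abelian_groupI)
      (auto simp: M_simps C.M.a_ac intro!: C.M.l_neg bexI[of _ "\<ominus>\<^bsub>C\<^esub> _"] arg_cong[of _ _ j])
  then have M: "module K M"
    by (intro moduleI C.R.is_cring)
      (auto simp: M_simps C.smult_l_distr C.smult_r_distr C.smult_assoc1)
  have jl: "linear_map K C M j" and il: "linear_map K M C i"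
    by (auto intro!: linear_mapI simp: M_simps)
  have ic: "i x \<in> carrier C" if "x \<in> carrier M" for x using that by (auto simp: M_simps)
  have ji: "j (i x) = x" if "x \<in> carrier M" for x using that by (auto simp: M_simps)
  have "sw C C.HH.T (\<lambda>a b. C.HH.pt (i (j a)) (i (j b))) (i x) = sw C C.HH.T C.HH.pt (i x)" if "x \<in> carrier M" for x
    by (intro C.sw_cong ic that) simp
  then have "sw C C.HH.T (\<lambda>a b. C.HH.pt (i (j a)) (i (j b))) (i x) = comult C (i x)" if "x \<in> carrier M" for x
    using that C.sw_pt[OF ic[OF that]] by simp
  from retract_coalgebra[OF C M jl il ji this] obtain D :: "('k, 'w) coalgebra" where
    D: "cocommutative_coalgebra K D" "carrier D = carrier M" "coalgebra_hom K D C i"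
    and hom: "\<forall>X h. cocommutative_coalgebra K (X :: ('k, 'v) coalgebra) \<longrightarrow> coalgebra_hom K X C h \<longrightarrow>
      (\<forall>x \<in> carrier X. i (j (h x)) = h x) \<longrightarrow> coalgebra_hom K X D (\<lambda>x. j (h x))" .
  have "coalgebra_hom K C D j"
    using hom[rule_format, OF C coalgebra_hom_id[OF C]] by simp
  then show thesis using that D by (simp add: M_simps)
qed

section \<open>The category of coalgebras and its terminal object\<close>

lemma Ob_Coalg [simp]: "A \<in> Ob (Coalg_coc K) \<longleftrightarrow> cocommutative_coalgebra K A"
  by (simp add: Coalg_coc_def)

lemma Hom_Coalg: "f \<in> Hom (Coalg_coc K) A B \<longleftrightarrow> f \<in> extensional (carrier A) \<and> coalgebra_hom K A B f"
  by (auto simp: Coalg_coc_def PiE_def Pi_iff dest: coalgebra_hom_closed)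

lemma Idn_Coalg [simp]: "Idn (Coalg_coc K) A = (\<lambda>x \<in> carrier A. x)"
  by (simp add: Coalg_coc_def)

lemma Cmp_Coalg [simp]: "Cmp (Coalg_coc K) A B C g f = compose (carrier A) g f"
  by (simp add: Coalg_coc_def)

lemma restrict_in_Hom:
  "cocommutative_coalgebra K A \<Longrightarrow> coalgebra_hom K A B f \<Longrightarrow> restrict f (carrier A) \<in> Hom (Coalg_coc K) A B"
  by (simp add: Hom_Coalg coalgebra_hom_cong[of K A "restrict f (carrier A)" f])

lemma Hom_Coalg_eqI:
  "f \<in> Hom (Coalg_coc K) A B \<Longrightarrow> g \<in> Hom (Coalg_coc K) A B' \<Longrightarrow> (\<And>x. x \<in> carrier A \<Longrightarrow> f x = g x) \<Longrightarrow> f = g"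
  by (auto simp: Hom_Coalg intro: extensionalityI)

lemma Hom_Coalg_hom: "f \<in> Hom (Coalg_coc K) A B \<Longrightarrow> coalgebra_hom K A B f"
  by (simp add: Hom_Coalg)

lemma Hom_Coalg_closed: "f \<in> Hom (Coalg_coc K) A B \<Longrightarrow> x \<in> carrier A \<Longrightarrow> f x \<in> carrier B"
  by (auto simp: Hom_Coalg dest: coalgebra_hom_closed)

lemma category_Coalg:
  fixes K :: "('a, 'r) ring_scheme"
  shows "category (Coalg_coc K :: (('a, 'c) coalgebra, 'c \<Rightarrow> 'c) cat)"
proof
  fix A :: "('a, 'c) coalgebra" assume "A \<in> Ob (Coalg_coc K)"
  then show "Idn (Coalg_coc K) A \<in> Hom (Coalg_coc K) A A"
    by (simp add: restrict_in_Hom coalgebra_hom_id)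
next
  fix A B C :: "('a, 'c) coalgebra" and f g
  assume ob: "A \<in> Ob (Coalg_coc K)" "B \<in> Ob (Coalg_coc K)" "C \<in> Ob (Coalg_coc K)"
    and fg: "f \<in> Hom (Coalg_coc K) A B" "g \<in> Hom (Coalg_coc K) B C"
  then show "Cmp (Coalg_coc K) A B C g f \<in> Hom (Coalg_coc K) A C"
    using restrict_in_Hom[OF _ coalgebra_hom_comp[of K A B C f g]]
    by (simp add: compose_def Hom_Coalg)
next
  fix A B :: "('a, 'c) coalgebra" and f
  assume f: "f \<in> Hom (Coalg_coc K) A B"
  then show "Cmp (Coalg_coc K) A A B f (Idn (Coalg_coc K) A) = f"
    by (auto simp: compose_def Hom_Coalg intro!: extensionalityI[of _ "carrier A"])
  show "Cmp (Coalg_coc K) A B B (Idn (Coalg_coc K) B) f = f"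
    using f by (auto simp: compose_def Hom_Coalg coalgebra_hom_closed intro!: extensionalityI[of _ "carrier A"])
next
  fix W X Y Z :: "('a, 'c) coalgebra" and f g h
  assume "f \<in> Hom (Coalg_coc K) W X"
  then show "Cmp (Coalg_coc K) W X Z (Cmp (Coalg_coc K) X Y Z h g) f =
      Cmp (Coalg_coc K) W Y Z h (Cmp (Coalg_coc K) W X Y g f)"
    by (auto simp: compose_def Hom_Coalg coalgebra_hom_closed intro!: extensionalityI[of _ "carrier W"])
qed

definition ground_coalgebra :: "('k, 'r) ring_scheme \<Rightarrow> ('k, 'k) coalgebra" where
  "ground_coalgebra K = module.extend (ground_module K)
    (coalgebra.fields
      (\<lambda>c. c \<odot>\<^bsub>tensor K [ground_module K, ground_module K]\<^esub>
        pure_tensor K [ground_module K, ground_module K] [\<one>\<^bsub>K\<^esub>, \<one>\<^bsub>K\<^esub>])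
      (\<lambda>c. c))"

lemma ground_coalgebra:
  fixes K :: "('a, 'r) ring_scheme"
  assumes "cring K"
  shows "cocommutative_coalgebra K (ground_coalgebra K)"
    and "\<And>X :: ('a, 'v) coalgebra. cocommutative_coalgebra K X \<Longrightarrow> coalgebra_hom K X (ground_coalgebra K) (counit X)"
proof -
  interpret cring K by fact
  let ?G = "ground_coalgebra K"
  have simps: "carrier ?G = carrier K" "add ?G = add K" "zero ?G = zero K" "smult ?G = mult K"
    "counit ?G = (\<lambda>c. c)"
    by (simp_all add: ground_coalgebra_def ground_module_def module.defs coalgebra.defs)
  have G: "module K ?G"
    by (rule module_cong[OF module_ground[OF is_cring]]) (simp_all add: simps ground_module_def)
  interpret G: module K ?G by (rule G)
  interpret GG: binary_tensor K ?G ?G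
    by (intro binary_tensor.intro binary_tensor_axioms.intro G is_cring)
  have T: "tensor K [ground_module K, ground_module K] = GG.T"
    "pure_tensor K [ground_module K, ground_module K] = pure_tensor K [?G, ?G]"
    by (rule tensor_cong; simp add: simps; simp add: ground_module_def)+
  have comult: "comult ?G = (\<lambda>c. c \<odot>\<^bsub>GG.T\<^esub> GG.pt \<one>\<^bsub>K\<^esub> \<one>\<^bsub>K\<^esub>)"
    unfolding T[symmetric] by (simp add: ground_coalgebra_def module.defs coalgebra.defs)
  have one: "GG.pt \<one>\<^bsub>K\<^esub> \<one>\<^bsub>K\<^esub> \<in> carrier GG.T" by (rule GG.pt_closed) (simp_all add: simps)
  have sw_G: "sw ?G N \<phi> c = c \<odot>\<^bsub>N\<^esub> \<phi> \<one>\<^bsub>K\<^esub> \<one>\<^bsub>K\<^esub>"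
    if "module K N" "bilinear K ?G ?G N \<phi>" "c \<in> carrier K" for N :: "('a, 'x, 'y) module_scheme" and \<phi> c
    unfolding sw_def comult
    using linear_map_smult[OF GG.lift2_linear[OF that(1,2)] that(3) one] GG.lift2_pt[OF that(1,2)]
    by (simp add: simps)
  have comult_lin: "linear_map K ?G GG.T (comult ?G)"
    unfolding comult
    by (rule linear_map_smult_left[OF GG.module_tensor _ one])
      (simp add: linear_map_def simps ground_module_def)
  have counit_lin: "linear_map K ?G (ground_module K) (counit ?G)"
    by (simp add: linear_map_def simps ground_module_def)
  show coalgebra: "cocommutative_coalgebra K ?G"
  proof (rule cocommutative_coalgebraI[OF G comult_lin counit_lin])
    interpret GGG: tensor_product K "[?G, ?G, ?G]"
      by (intro tensor_product.intro tensor_product_axioms.intro is_cring) (simp add: G)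
    let ?\<phi> = "\<lambda>a b c. pure_tensor K [?G, ?G, ?G] [a, b, c]"
    note N = GGG.module_tensor
    note \<phi> = trilinear_pure_tensor[OF is_cring G]
    have sw_lin: "linear_map K ?G GGG.T (sw ?G GGG.T \<phi>')" if "bilinear K ?G ?G GGG.T \<phi>'" for \<phi>'
      unfolding sw_def[abs_def] by (rule linear_map_comp[OF GG.lift2_linear[OF N that] comult_lin])
    have sw_par: "linear_map K ?G GGG.T (\<lambda>x. sw ?G GGG.T (\<phi>' x) y)"
      if "y \<in> carrier ?G" "\<And>a b. a \<in> carrier ?G \<Longrightarrow> b \<in> carrier ?G \<Longrightarrow> linear_map K ?G GGG.T (\<lambda>x. \<phi>' x a b)" for \<phi>' y
      unfolding sw_def by (rule GG.lift2_linear_param[OF linear_map_closed[OF comult_lin that(1)] N that(2)])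
    have inner: "sw ?G GGG.T (\<lambda>a b. ?\<phi> a b c) \<one>\<^bsub>K\<^esub> = ?\<phi> \<one>\<^bsub>K\<^esub> \<one>\<^bsub>K\<^esub> c"
      "sw ?G GGG.T (\<lambda>a b. ?\<phi> c a b) \<one>\<^bsub>K\<^esub> = ?\<phi> c \<one>\<^bsub>K\<^esub> \<one>\<^bsub>K\<^esub>" if "c \<in> carrier ?G" for c
      subgoal using that by (subst sw_G[OF N bilinearI]) (simp_all add: trilinearD[OF \<phi>] trilinearD[OF \<phi>, unfolded simps] simps)
      subgoal using that by (subst sw_G[OF N bilinearI]) (simp_all add: trilinearD[OF \<phi>] trilinearD[OF \<phi>, unfolded simps] simps)
      done
    fix h assume h: "h \<in> carrier ?G"
    have "sw ?G GGG.T (\<lambda>x c. sw ?G GGG.T (\<lambda>a b. ?\<phi> a b c) x) h = h \<odot>\<^bsub>GGG.T\<^esub> ?\<phi> \<one>\<^bsub>K\<^esub> \<one>\<^bsub>K\<^esub> \<one>\<^bsub>K\<^esub>"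
      by (subst sw_G[OF N]; (intro bilinearI sw_lin sw_par trilinearD[OF \<phi>])?)
        (use h in \<open>simp_all add: simps inner\<close>)
    moreover have "bilinear K ?G ?G GGG.T (\<lambda>a x. sw ?G GGG.T (\<lambda>b c. ?\<phi> a b c) x)"
      by (rule bilinearI; intro bilinearI sw_lin sw_par trilinearD[OF \<phi>])
    then have "sw ?G GGG.T (\<lambda>a x. sw ?G GGG.T (\<lambda>b c. ?\<phi> a b c) x) h = h \<odot>\<^bsub>GGG.T\<^esub> ?\<phi> \<one>\<^bsub>K\<^esub> \<one>\<^bsub>K\<^esub> \<one>\<^bsub>K\<^esub>"
      using h by (subst sw_G[OF N]) (simp_all add: simps inner)
    ultimately show "sw ?G GGG.T (\<lambda>x c. sw ?G GGG.T (\<lambda>a b. ?\<phi> a b c) x) h =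
        sw ?G GGG.T (\<lambda>a x. sw ?G GGG.T (\<lambda>b c. ?\<phi> a b c) x) h" by simp
  next
    fix h assume h: "h \<in> carrier ?G"
    have b: "bilinear K ?G ?G ?G (\<lambda>a b. counit ?G a \<odot>\<^bsub>?G\<^esub> b)"
      by (intro bilinearI linear_map_smult_left linear_map_smult_right G counit_lin linear_map_id)
        (simp_all add: simps)
    have b': "bilinear K ?G ?G GG.T (\<lambda>a b. GG.pt b a)"
      using GG.bilinear_pt by (simp add: bilinear_def)
    show "sw ?G ?G (\<lambda>a b. counit ?G a \<odot>\<^bsub>?G\<^esub> b) h = h"
      using sw_G[OF G b] h by (simp add: simps)
    show "sw ?G GG.T (\<lambda>a b. GG.pt b a) h = comult ?G h"
      using sw_G[OF GG.module_tensor b'] h by (simp add: simps comult)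
  qed
  fix X :: "('a, 'v) coalgebra" assume X: "cocommutative_coalgebra K X"
  then interpret X: cocommutative_coalgebra K X .
  have lin: "linear_map K X ?G (counit X)"
    using X.counit_linear by (simp add: linear_map_def simps ground_module_def)
  show "coalgebra_hom K X ?G (counit X)"
    unfolding coalgebra_hom_iff[OF X]
  proof (intro conjI ballI lin)
    fix x assume x: "x \<in> carrier X"
    have eq: "GG.pt (counit X a) (counit X b) = counit X a \<odot>\<^bsub>GG.T\<^esub> GG.pt \<one>\<^bsub>K\<^esub> (counit X b)"
      if "a \<in> carrier X" "b \<in> carrier X" for a b
      using linear_map_smult[OF bilinearD(2)[OF GG.bilinear_pt, of "counit X b"], of "counit X a" "\<one>\<^bsub>K\<^esub>"] that
      by (simp add: simps X.counit_closed)
    have "sw X GG.T (\<lambda>a b. GG.pt (counit X a) (counit X b)) x =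
        sw X GG.T (\<lambda>a b. counit X a \<odot>\<^bsub>GG.T\<^esub> GG.pt \<one>\<^bsub>K\<^esub> (counit X b)) x"
      by (intro X.sw_cong x eq)
    also have "\<dots> = GG.pt \<one>\<^bsub>K\<^esub> (counit X x)"
      by (rule X.sw_counit_left[OF x GG.module_tensor linear_map_comp[OF bilinearD(1)[OF GG.bilinear_pt] lin]])
        (simp add: simps)
    also have "\<dots> = comult ?G (counit X x)"
      using linear_map_smult[OF bilinearD(1)[OF GG.bilinear_pt, of "\<one>\<^bsub>K\<^esub>"], of "counit X x" "\<one>\<^bsub>K\<^esub>"] x
      by (simp add: comult simps X.counit_closed)
    finally show "comult ?G (counit X x) = sw X GG.T (\<lambda>a b. GG.pt (counit X a) (counit X b)) x" ..
  qed (simp add: simps)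
qed

text \<open>The only homomorphism from a coalgebra to the ground field is the counit, since homomorphisms preserve
  counits and the counit of the ground field is the identity.\<close>

lemma terminal_coalgebra:
  assumes "cring K" and "carrier K \<lesssim> (UNIV :: 'u set)"
  obtains Z :: "('k, 'u) coalgebra" where "terminal_object (Coalg_coc K) Z" "inj_on (counit Z) (carrier Z)"
proof -
  let ?G = "ground_coalgebra K"
  have simps: "carrier ?G = carrier K" "counit ?G = (\<lambda>c. c)"
    by (simp_all add: ground_coalgebra_def ground_module_def module.defs coalgebra.defs)
  obtain j :: "'k \<Rightarrow> 'u" where j: "inj_on j (carrier ?G)"
    using assms(2) by (auto simp: lepoll_def simps)
  note G = ground_coalgebra[OF assms(1)]
  let ?i = "inv_into (carrier ?G) j"
  from transport_coalgebra[OF G(1) j]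
  obtain Z :: "('k, 'u) coalgebra" where Z: "cocommutative_coalgebra K Z" "carrier Z = j ` carrier ?G"
    "coalgebra_hom K ?G Z j" "coalgebra_hom K Z ?G ?i" .
  have counit_Z: "counit Z x = ?i x" if "x \<in> carrier Z" for x
    using coalgebra_hom_counit[OF Z(4) that] by (simp add: simps)
  have inj: "inj_on (counit Z) (carrier Z)"
    using inj_on_inv_into[of "carrier Z" j "carrier ?G"] inj_on_cong[of "carrier Z" "counit Z" ?i] counit_Z
    by (simp add: Z(2))
  have "terminal_object (Coalg_coc K) Z"
    unfolding terminal_object_def
  proof (intro conjI ballI)
    fix X :: "('k, 'u) coalgebra" assume "X \<in> Ob (Coalg_coc K)"
    then have X: "cocommutative_coalgebra K X" by simp
    have "restrict (\<lambda>x. j (counit X x)) (carrier X) \<in> Hom (Coalg_coc K) X Z"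
      by (intro restrict_in_Hom X coalgebra_hom_comp[OF X G(1) Z(1) G(2)[OF X] Z(3)])
    moreover have "f = g" if fg: "f \<in> Hom (Coalg_coc K) X Z" "g \<in> Hom (Coalg_coc K) X Z" for f g
    proof (rule Hom_Coalg_eqI[OF fg])
      fix x assume x: "x \<in> carrier X"
      have "counit Z (f x) = counit Z (g x)"
        using coalgebra_hom_counit[OF Hom_Coalg_hom[OF fg(1)] x] coalgebra_hom_counit[OF Hom_Coalg_hom[OF fg(2)] x] by simp
      then show "f x = g x"
        using inj Hom_Coalg_closed[OF fg(1) x] Hom_Coalg_closed[OF fg(2) x] by (auto dest: inj_onD)
    qed
    ultimately show "\<exists>!f. f \<in> Hom (Coalg_coc K) X Z" by blast
  qed (simp add: Z)
  then show thesis by (rule that[OF _ inj])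
qed

text \<open>A terminal coalgebra is isomorphic to a copy of the ground field, whose counit is injective.\<close>

lemma terminal_counit_inj:
  fixes Z :: "('k, 'u) coalgebra"
  assumes "cring K" "carrier K \<lesssim> (UNIV :: 'u set)" and Z: "terminal_object (Coalg_coc K) Z"
  shows "inj_on (counit Z) (carrier Z)"
proof -
  interpret category "Coalg_coc K :: (('k, 'u) coalgebra, 'u \<Rightarrow> 'u) cat" by (rule category_Coalg)
  obtain Z' :: "('k, 'u) coalgebra" where Z': "terminal_object (Coalg_coc K) Z'" "inj_on (counit Z') (carrier Z')"
    using terminal_coalgebra[OF assms(1,2)] .
  have ob: "Z \<in> Ob (Coalg_coc K)" "Z' \<in> Ob (Coalg_coc K)"
    using Z Z'(1) by (auto simp: terminal_object_def)
  obtain u v where u: "u \<in> Hom (Coalg_coc K) Z Z'" and v: "v \<in> Hom (Coalg_coc K) Z' Z"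
    using Z Z'(1) ob unfolding terminal_object_def by blast
  have "Cmp (Coalg_coc K) Z Z' Z v u = Idn (Coalg_coc K) Z"
    using Z ob Cmp_in_Hom[OF ob(1,2,1) u v] Idn_in_Hom[OF ob(1)] unfolding terminal_object_def by blast
  then have vu: "compose (carrier Z) v u = (\<lambda>x \<in> carrier Z. x)" by simp
  have "v (u x) = x" if "x \<in> carrier Z" for x
    using fun_cong[OF vu, of x] that by (simp add: compose_def)
  then have "inj_on u (carrier Z)" by (metis inj_onI)
  moreover have "counit Z' (u x) = counit Z x" "u x \<in> carrier Z'" if "x \<in> carrier Z" for x
    using coalgebra_hom_counit[OF Hom_Coalg_hom[OF u] that] Hom_Coalg_closed[OF u that] by auto
  ultimately show ?thesis
    using comp_inj_on[of u "carrier Z" "counit Z'"] inj_on_subset[OF Z'(2), of "u ` carrier Z"]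
      inj_on_cong[of "carrier Z" "counit Z' \<circ> u" "counit Z"] by auto
qed

section \<open>Size of tensor products\<close>

text \<open>Lists are folded with a pairing function. Lists of the same length with the same fold are equal, so
  the fold is paired with the length.\<close>

lemma list_injection:
  assumes "infinite (UNIV :: 'u set)"
  obtains e :: "'u list \<Rightarrow> 'u" and f :: "'u \<times> 'u \<Rightarrow> 'u" where "inj e" "inj f"
proof -
  have "(UNIV :: 'u set) \<times> (UNIV :: 'u set) \<approx> (UNIV :: 'u set)"
    unfolding eqpoll_iff_card_of_ordIso by (rule card_of_Times_same_infinite[OF assms])
  then obtain f :: "'u \<times> 'u \<Rightarrow> 'u" where f: "inj f"
    by (auto simp: eqpoll_def bij_betw_def)
  obtain g :: "nat \<Rightarrow> 'u" where g: "inj g"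
    using assms infinite_countable_subset by blast
  define enc where "enc = rec_list undefined (\<lambda>x _ y. f (x, y))"
  have enc: "enc (x # xs) = f (x, enc xs)" for x xs by (simp add: enc_def)
  have "xs = ys" if "length xs = length ys" "enc xs = enc ys" for xs ys
    using that by (induction rule: list_induct2) (auto simp: enc dest: injD[OF f])
  then have "inj (\<lambda>xs. f (g (length xs), enc xs))"
    by (intro injI) (metis Pair_inject injD[OF f] injD[OF g])
  then show thesis using that f by blast
qed

text \<open>Elements of a tensor product are coded by representing formal sums, which are lists of scalars and
  lists of vectors.\<close>

lemma (in tensor_product) tensor_injection:
  assumes "infinite (UNIV :: 'v set)" "carrier K \<lesssim> (UNIV :: 'v set)"
  obtains j :: "('k, 'v) tensor \<Rightarrow> 'v" where "inj_on j (carrier T)"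
proof -
  obtain e :: "'v list \<Rightarrow> 'v" and f :: "'v \<times> 'v \<Rightarrow> 'v" where ef: "inj e" "inj f"
    using list_injection[OF assms(1)] .
  obtain k :: "'k \<Rightarrow> 'v" where k: "inj_on k (carrier K)"
    using assms(2) by (auto simp: lepoll_def)
  let ?m = "map (\<lambda>(c, xs). f (k c, e xs))"
  have inj: "r = s" if "r \<in> FS" "s \<in> FS" "?m r = ?m s" for r s
    using that(1,2,3)
  proof (induction arbitrary: s rule: formal_sums_induct)
    case (Cons c xs r)
    then obtain d ys s' where s: "s = (d, ys) # s'" by (cases s) auto
    from Cons.prems s have eqs: "f (k c, e xs) = f (k d, e ys)" "?m r = ?m s'" and ds: "d \<in> carrier K" "s' \<in> FS"
      by simp_all
    have "(k c, e xs) = (k d, e ys)" by (rule injD[OF ef(2) eqs(1)])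
    then have "k c = k d" "e xs = e ys" by simp_all
    with inj_onD[OF k] Cons.hyps(1) ds(1) injD[OF ef(1)] have "c = d" "xs = ys" by blast+
    moreover have "r = s'" by (rule Cons.IH[OF ds(2) eqs(2)])
    ultimately show ?case by (simp add: s)
  qed simp
  have "inj_on (\<lambda>X. e (?m (SOME r. r \<in> X))) (carrier T)"
  proof (rule inj_onI)
    fix X Y assume XY: "X \<in> carrier T" "Y \<in> carrier T"
      and eq: "e (?m (SOME r. r \<in> X)) = e (?m (SOME r. r \<in> Y))"
    note rep = rep_tensor[OF XY(1)] rep_tensor[OF XY(2)]
    have "(SOME r. r \<in> X) = (SOME r. r \<in> Y)"
      by (rule inj[OF conjunct1[OF rep(1)] conjunct1[OF rep(2)] injD[OF ef(1) eq]])
    then have "cls (SOME r. r \<in> X) = cls (SOME r. r \<in> Y)" by (rule arg_cong)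
    then show "X = Y" unfolding conjunct2[OF rep(1), symmetric] conjunct2[OF rep(2), symmetric] .
  qed
  then show thesis by (rule that)
qed

section \<open>Products, equalizers and pullbacks of coalgebras\<close>

text \<open>Stated for functions modulo equality on the carrier, so that composites of homomorphisms need not be
  made extensional.\<close>

definition coalgebra_product ::
  "('k, 'r) ring_scheme \<Rightarrow> ('k, 'u) coalgebra \<Rightarrow> ('k, 'u) coalgebra \<Rightarrow> ('k, 'u) coalgebra \<Rightarrow>
   ('u \<Rightarrow> 'u) \<Rightarrow> ('u \<Rightarrow> 'u) \<Rightarrow> bool" where
  "coalgebra_product K A B P p q \<longleftrightarrow>
     cocommutative_coalgebra K P \<and> coalgebra_hom K P A p \<and> coalgebra_hom K P B q \<and>
     (\<forall>X f g. cocommutative_coalgebra K (X :: ('k, 'u) coalgebra) \<longrightarrow> coalgebra_hom K X A f \<longrightarrow>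
        coalgebra_hom K X B g \<longrightarrow>
        (\<exists>h. coalgebra_hom K X P h \<and> (\<forall>x \<in> carrier X. p (h x) = f x \<and> q (h x) = g x))) \<and>
     (\<forall>X h h'. cocommutative_coalgebra K (X :: ('k, 'u) coalgebra) \<longrightarrow> coalgebra_hom K X P h \<longrightarrow>
        coalgebra_hom K X P h' \<longrightarrow> (\<forall>x \<in> carrier X. p (h x) = p (h' x) \<and> q (h x) = q (h' x)) \<longrightarrow>
        (\<forall>x \<in> carrier X. h x = h' x))"

lemma coalgebra_productD:
  fixes X :: "('k, 'u) coalgebra" and P :: "('k, 'u) coalgebra"
  assumes "coalgebra_product K A B P p q"
  shows "cocommutative_coalgebra K P" "coalgebra_hom K P A p" "coalgebra_hom K P B q"
    "cocommutative_coalgebra K X \<Longrightarrow> coalgebra_hom K X A f \<Longrightarrow> coalgebra_hom K X B g \<Longrightarrow>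
      \<exists>h. coalgebra_hom K X P h \<and> (\<forall>x \<in> carrier X. p (h x) = f x \<and> q (h x) = g x)"
    "cocommutative_coalgebra K X \<Longrightarrow> coalgebra_hom K X P h \<Longrightarrow> coalgebra_hom K X P h' \<Longrightarrow>
      \<forall>x \<in> carrier X. p (h x) = p (h' x) \<and> q (h x) = q (h' x) \<Longrightarrow> x \<in> carrier X \<Longrightarrow> h x = h' x"
  using assms unfolding coalgebra_product_def by blast+

text \<open>A copy of the tensor product \<open>A \<otimes> B\<close> with carrier in the universe. The linear map \<open>j\<close> is the
  identification of \<open>A \<otimes> B\<close> with the copy; its inverse sends \<open>x\<close> to \<open>\<Sum> p(x\<^sub>1) \<otimes> q(x\<^sub>2)\<close>.\<close>

lemma binary_product:
  fixes A B :: "('k, 'u) coalgebra"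
  assumes inf: "infinite (UNIV :: 'u set)" and small: "carrier K \<lesssim> (UNIV :: 'u set)"
    and A: "cocommutative_coalgebra K A" and B: "cocommutative_coalgebra K B"
  obtains P :: "('k, 'u) coalgebra" and p q j where
    "coalgebra_product K A B P p q"
    "linear_map K (tensor K [A, B]) P j"
    "\<And>x. x \<in> carrier P \<Longrightarrow> j (sw P (tensor K [A, B]) (\<lambda>x y. pure_tensor K [A, B] [p x, q y]) x) = x"
    "\<And>y. y \<in> carrier (tensor K [A, B]) \<Longrightarrow>
      sw P (tensor K [A, B]) (\<lambda>x y. pure_tensor K [A, B] [p x, q y]) (j y) = y"
proof -
  interpret pair: coalgebra_pair K A B by (intro coalgebra_pair.intro A B)
  obtain j0 :: "('k, 'u) tensor \<Rightarrow> 'u" where j0: "inj_on j0 (carrier pair.C)"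
    using pair.AB.tensor_injection[OF inf small] by (auto simp: pair.C_simps)
  let ?i = "inv_into (carrier pair.C) j0"
  obtain P :: "('k, 'u) coalgebra" where P: "cocommutative_coalgebra K P" "carrier P = j0 ` carrier pair.C"
    and j: "coalgebra_hom K pair.C P j0" and i: "coalgebra_hom K P pair.C ?i"
    using transport_coalgebra[OF pair.coalgebra_C j0] .
  interpret P: cocommutative_coalgebra K P by fact
  have ij: "?i (j0 x) = x" if "x \<in> carrier pair.C" for x using that j0 by simp
  have ji: "j0 (?i x) = x" if "x \<in> carrier P" for x using that by (simp add: P(2) f_inv_into_f)
  let ?p = "\<lambda>x. pair.\<pi>1 (?i x)" and ?q = "\<lambda>x. pair.\<pi>2 (?i x)"
  have p: "coalgebra_hom K P A ?p" by (rule coalgebra_hom_comp[OF P(1) pair.coalgebra_C A i pair.projection1_hom])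
  have q: "coalgebra_hom K P B ?q" by (rule coalgebra_hom_comp[OF P(1) pair.coalgebra_C B i pair.projection2_hom])
  show thesis
  proof (rule that)
    show "linear_map K pair.P P j0"
      using coalgebra_hom_linear[OF j] by (simp add: pair.linear_from_C)
    show "j0 (sw P pair.P (\<lambda>x y. pure_tensor K [A, B] [?p x, ?q y]) x) = x" if x: "x \<in> carrier P" for x
      using pair.pairing_unique[OF P(1) i x] ji[OF x] by (simp add: pair.sw_into_C)
    show "sw P pair.P (\<lambda>x y. pure_tensor K [A, B] [?p x, ?q y]) (j0 y) = y" if y: "y \<in> carrier pair.P" for y
      using pair.pairing_unique[OF P(1) i, of "j0 y"] ij[of y] y by (simp add: pair.sw_into_C P(2) pair.C_simps)
    have 1: "\<exists>h. coalgebra_hom K X P h \<and> (\<forall>x \<in> carrier X. ?p (h x) = f x \<and> ?q (h x) = g x)"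
      if X: "cocommutative_coalgebra K X" "coalgebra_hom K X A f" "coalgebra_hom K X B g" for X :: "('k, 'u) coalgebra" and f g
    proof -
      let ?h = "sw X pair.C (\<lambda>x y. pure_tensor K [A, B] [f x, g y])"
      note h = pair.pairing[OF X]
      show ?thesis
        using coalgebra_hom_comp[OF X(1) pair.coalgebra_C P(1) h(1) j] h(2,3) ij coalgebra_hom_closed[OF h(1)]
        by (intro exI[of _ "\<lambda>x. j0 (?h x)"]) simp
    qed
    have 2: "h x = h' x"
      if X: "cocommutative_coalgebra K X" and h: "coalgebra_hom K X P h" and h': "coalgebra_hom K X P h'"
        and eq: "\<forall>x \<in> carrier X. ?p (h x) = ?p (h' x) \<and> ?q (h x) = ?q (h' x)" and x: "x \<in> carrier X"
      for X :: "('k, 'u) coalgebra" and h h' x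
    proof -
      interpret X: cocommutative_coalgebra K X by fact
      have "sw X pair.C (\<lambda>x y. pure_tensor K [A, B] [?p (h x), ?q (h y)]) x =
          sw X pair.C (\<lambda>x y. pure_tensor K [A, B] [?p (h' x), ?q (h' y)]) x"
        by (intro X.sw_cong x) (simp add: eq)
      then have "?i (h x) = ?i (h' x)"
        unfolding pair.pairing_unique[OF X coalgebra_hom_comp[OF X P(1) pair.coalgebra_C h i] x, symmetric]
          pair.pairing_unique[OF X coalgebra_hom_comp[OF X P(1) pair.coalgebra_C h' i] x, symmetric] .
      then have "j0 (?i (h x)) = j0 (?i (h' x))" by (rule arg_cong)
      then show ?thesis
        unfolding ji[OF coalgebra_hom_closed[OF h x]] ji[OF coalgebra_hom_closed[OF h' x]] .
    qed
    show "coalgebra_product K A B P ?p ?q"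
      unfolding coalgebra_product_def
    proof (intro conjI P(1) p q allI impI; (rule 1; assumption)?)
      show "\<forall>x \<in> carrier X. h x = h' x"
        if "cocommutative_coalgebra K X" "coalgebra_hom K X P h" "coalgebra_hom K X P h'"
          "\<forall>x \<in> carrier X. ?p (h x) = ?p (h' x) \<and> ?q (h x) = ?q (h' x)" for X :: "('k, 'u) coalgebra" and h h'
        using 2[OF that] by (rule ballI)
    qed
  qed
qed

lemma (in module) submoduleI_closed:
  assumes "H \<subseteq> carrier M" "\<zero>\<^bsub>M\<^esub> \<in> H"
    and "\<And>a b. a \<in> H \<Longrightarrow> b \<in> H \<Longrightarrow> a \<oplus>\<^bsub>M\<^esub> b \<in> H"
    and smult: "\<And>a x. a \<in> carrier R \<Longrightarrow> x \<in> H \<Longrightarrow> a \<odot>\<^bsub>M\<^esub> x \<in> H"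
  shows "submodule H R M"
proof (rule submoduleI[OF assms(1,2) _ assms(3) smult])
  fix a assume a: "a \<in> H"
  then have "\<ominus>\<^bsub>M\<^esub> a = (\<ominus> \<one>) \<odot>\<^bsub>M\<^esub> a"
    using smult_l_minus[of \<one> a] assms(1) by auto
  then show "\<ominus>\<^bsub>M\<^esub> a \<in> H" using smult[OF _ a] by simp
qed

lemma submoduleD:
  assumes "submodule H K M" "module K M"
  shows "H \<subseteq> carrier M" "\<zero>\<^bsub>M\<^esub> \<in> H" "\<And>a b. a \<in> H \<Longrightarrow> b \<in> H \<Longrightarrow> a \<oplus>\<^bsub>M\<^esub> b \<in> H"
    "\<And>a x. a \<in> carrier K \<Longrightarrow> x \<in> H \<Longrightarrow> a \<odot>\<^bsub>M\<^esub> x \<in> H" "\<And>a. a \<in> H \<Longrightarrow> \<ominus>\<^bsub>M\<^esub> a \<in> H"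
proof -
  interpret module K M by fact
  note E = submoduleE[OF assms(1)]
  show "H \<subseteq> carrier M" "\<And>a b. a \<in> H \<Longrightarrow> b \<in> H \<Longrightarrow> a \<oplus>\<^bsub>M\<^esub> b \<in> H"
    "\<And>a x. a \<in> carrier K \<Longrightarrow> x \<in> H \<Longrightarrow> a \<odot>\<^bsub>M\<^esub> x \<in> H" "\<And>a. a \<in> H \<Longrightarrow> \<ominus>\<^bsub>M\<^esub> a \<in> H"
    using E by blast+
  obtain h where "h \<in> H" using E(2) by blast
  then show "\<zero>\<^bsub>M\<^esub> \<in> H" using E(4)[OF R.zero_closed, of h] E(1) smult_l_null[of h] by auto
qed

text \<open>The retraction is the projection along a complement, and a complement is a maximal subspace \<open>W\<close>
  that meets \<open>D\<close> trivially. If \<open>x\<close> is not in \<open>W + D\<close>, then \<open>W\<close> can be enlarged by the multiples of \<open>x\<close>: an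
  equation \<open>w + cx = d\<close> with \<open>c \<noteq> 0\<close> can be solved for \<open>x\<close> over a field.\<close>

lemma linear_retraction:
  assumes "field K" and M: "module K M" and D: "submodule D K M"
  obtains \<pi> where "linear_map K M (M\<lparr>carrier := D\<rparr>) \<pi>" "\<And>x. x \<in> D \<Longrightarrow> \<pi> x = x"
proof -
  interpret K: field K by fact
  interpret M: module K M by fact
  note D' = submoduleD[OF D M]
  define \<A> where "\<A> = {W. submodule W K M \<and> W \<inter> D = {\<zero>\<^bsub>M\<^esub>}}"
  have zero: "{\<zero>\<^bsub>M\<^esub>} \<in> \<A>"
    unfolding \<A>_def using D'(2) by (auto intro!: M.submoduleI_closed)
  have chain: "\<Union>\<C> \<in> \<A>" if C: "\<C> \<noteq> {}" "subset.chain \<A> \<C>" for \<C>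
  proof -
    have CA: "W \<in> \<A>" if "W \<in> \<C>" for W using C that by (auto simp: subset.chain_def)
    then have sub: "submodule W K M" "W \<inter> D = {\<zero>\<^bsub>M\<^esub>}" if "W \<in> \<C>" for W
      using that by (auto simp: \<A>_def)
    have "submodule (\<Union>\<C>) K M"
    proof (rule M.submoduleI_closed)
      show "\<Union>\<C> \<subseteq> carrier M" using submoduleD(1)[OF sub(1) M] by blast
      show "\<zero>\<^bsub>M\<^esub> \<in> \<Union>\<C>" using C(1) submoduleD(2)[OF sub(1) M] by blast
      show "a \<odot>\<^bsub>M\<^esub> x \<in> \<Union>\<C>" if "a \<in> carrier K" "x \<in> \<Union>\<C>" for a x
        using that submoduleD(4)[OF sub(1) M] by blast
      show "a \<oplus>\<^bsub>M\<^esub> b \<in> \<Union>\<C>" if ab: "a \<in> \<Union>\<C>" "b \<in> \<Union>\<C>" for a b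
      proof -
        obtain V W where VW: "V \<in> \<C>" "a \<in> V" "W \<in> \<C>" "b \<in> W" using ab by blast
        then have "V \<subseteq> W \<or> W \<subseteq> V" using C(2) by (auto simp: subset.chain_def)
        then show ?thesis using VW submoduleD(3)[OF sub(1) M] by blast
      qed
    qed
    moreover have "\<Union>\<C> \<inter> D = {\<zero>\<^bsub>M\<^esub>}" using sub(2) C(1) by blast
    ultimately show ?thesis by (simp add: \<A>_def)
  qed
  obtain W where W: "W \<in> \<A>" "\<And>X. X \<in> \<A> \<Longrightarrow> W \<subseteq> X \<Longrightarrow> X = W"
    using subset_Zorn_nonempty[of \<A>] zero chain by blast
  have W_sub: "submodule W K M" and WD: "W \<inter> D = {\<zero>\<^bsub>M\<^esub>}" using W(1) by (auto simp: \<A>_def)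
  note W' = submoduleD[OF W_sub M]
  have Dc: "d \<in> carrier M" if "d \<in> D" for d using that D'(1) by blast
  have Wc: "w \<in> carrier M" if "w \<in> W" for w using that W'(1) by blast
  have span: "\<exists>w \<in> W. \<exists>d \<in> D. x = w \<oplus>\<^bsub>M\<^esub> d" if x: "x \<in> carrier M" for x
  proof (rule ccontr)
    assume no: "\<not> ?thesis"
    define X where "X = {w \<oplus>\<^bsub>M\<^esub> c \<odot>\<^bsub>M\<^esub> x | w c. w \<in> W \<and> c \<in> carrier K}"
    have "submodule X K M"
    proof (rule M.submoduleI_closed)
      show "X \<subseteq> carrier M" using x Wc by (auto simp: X_def)
      have "\<zero>\<^bsub>M\<^esub> = \<zero>\<^bsub>M\<^esub> \<oplus>\<^bsub>M\<^esub> \<zero>\<^bsub>K\<^esub> \<odot>\<^bsub>M\<^esub> x" using x by simp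
      then show "\<zero>\<^bsub>M\<^esub> \<in> X" using W'(2) by (auto simp: X_def)
      fix a b assume "a \<in> X" "b \<in> X"
      then obtain w c w' c' where *: "a = w \<oplus>\<^bsub>M\<^esub> c \<odot>\<^bsub>M\<^esub> x" "w \<in> W" "c \<in> carrier K"
        "b = w' \<oplus>\<^bsub>M\<^esub> c' \<odot>\<^bsub>M\<^esub> x" "w' \<in> W" "c' \<in> carrier K" unfolding X_def by blast
      have "a \<oplus>\<^bsub>M\<^esub> b = (w \<oplus>\<^bsub>M\<^esub> w') \<oplus>\<^bsub>M\<^esub> (c \<oplus>\<^bsub>K\<^esub> c') \<odot>\<^bsub>M\<^esub> x"
        using * x Wc by (simp add: M.smult_l_distr M.M.a_ac)
      then show "a \<oplus>\<^bsub>M\<^esub> b \<in> X" using * W'(3) K.add.m_closed unfolding X_def by blast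
    next
      fix k a assume k: "k \<in> carrier K" and "a \<in> X"
      then obtain w c where *: "a = w \<oplus>\<^bsub>M\<^esub> c \<odot>\<^bsub>M\<^esub> x" "w \<in> W" "c \<in> carrier K" unfolding X_def by blast
      have "k \<odot>\<^bsub>M\<^esub> a = (k \<odot>\<^bsub>M\<^esub> w) \<oplus>\<^bsub>M\<^esub> (k \<otimes>\<^bsub>K\<^esub> c) \<odot>\<^bsub>M\<^esub> x"
        using * x k Wc by (simp add: M.smult_r_distr M.smult_assoc1)
      then show "k \<odot>\<^bsub>M\<^esub> a \<in> X" using * W'(4) k K.m_closed unfolding X_def by blast
    qed
    moreover have "y = \<zero>\<^bsub>M\<^esub>" if y: "y \<in> X" "y \<in> D" for y
    proof -
      obtain w c where *: "y = w \<oplus>\<^bsub>M\<^esub> c \<odot>\<^bsub>M\<^esub> x" "w \<in> W" "c \<in> carrier K" using y(1) unfolding X_def by blast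
      show ?thesis
      proof (cases "c = \<zero>\<^bsub>K\<^esub>")
        case True
        then have "y = w" using * x Wc by simp
        then show ?thesis using WD y(2) * by blast
      next
        case False
        then have u: "c \<in> Units K" using * K.field_Units by blast
        have cx: "c \<odot>\<^bsub>M\<^esub> x = \<ominus>\<^bsub>M\<^esub> w \<oplus>\<^bsub>M\<^esub> y"
          using * x Wc[OF *(2)] by (simp add: M.M.r_neg1)
        have "x = inv\<^bsub>K\<^esub> c \<odot>\<^bsub>M\<^esub> (c \<odot>\<^bsub>M\<^esub> x)"
          using M.smult_assoc1[of "inv\<^bsub>K\<^esub> c" c x] u x * by simp
        also have "\<dots> = (inv\<^bsub>K\<^esub> c \<odot>\<^bsub>M\<^esub> (\<ominus>\<^bsub>M\<^esub> w)) \<oplus>\<^bsub>M\<^esub> (inv\<^bsub>K\<^esub> c \<odot>\<^bsub>M\<^esub> y)"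
          unfolding cx using u Wc[OF *(2)] Dc[OF y(2)] by (intro M.smult_r_distr) auto
        finally have "\<exists>w \<in> W. \<exists>d \<in> D. x = w \<oplus>\<^bsub>M\<^esub> d"
          using W'(4)[OF K.Units_inv_closed[OF u] W'(5)[OF *(2)]] D'(4)[OF K.Units_inv_closed[OF u] y(2)] by blast
        then show ?thesis using no by blast
      qed
    qed
    ultimately have "X \<in> \<A>"
      using D'(2) by (auto simp: \<A>_def intro: submoduleD(2)[OF _ M])
    moreover have "W \<subseteq> X"
    proof
      fix w assume w: "w \<in> W"
      then have "w = w \<oplus>\<^bsub>M\<^esub> \<zero>\<^bsub>K\<^esub> \<odot>\<^bsub>M\<^esub> x" using x Wc by simp
      then show "w \<in> X" using w K.zero_closed unfolding X_def by blast
    qed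
    ultimately have "X = W" by (rule W(2))
    moreover have "x = \<zero>\<^bsub>M\<^esub> \<oplus>\<^bsub>M\<^esub> \<one>\<^bsub>K\<^esub> \<odot>\<^bsub>M\<^esub> x" using x by simp
    then have "x \<in> X" using W'(2) K.one_closed unfolding X_def by blast
    ultimately have "x \<in> W" by simp
    moreover have "x = x \<oplus>\<^bsub>M\<^esub> \<zero>\<^bsub>M\<^esub>" using x by simp
    ultimately show False using no D'(2) by blast
  qed
  have unique: "d = d'" if "w \<in> W" "w' \<in> W" "d \<in> D" "d' \<in> D" "w \<oplus>\<^bsub>M\<^esub> d = w' \<oplus>\<^bsub>M\<^esub> d'" for w w' d d'
  proof -
    have c: "w \<in> carrier M" "w' \<in> carrier M" "d \<in> carrier M" "d' \<in> carrier M" using that Wc Dc by auto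
    have "\<ominus>\<^bsub>M\<^esub> w' \<oplus>\<^bsub>M\<^esub> w = (\<ominus>\<^bsub>M\<^esub> w' \<oplus>\<^bsub>M\<^esub> (w \<oplus>\<^bsub>M\<^esub> d)) \<oplus>\<^bsub>M\<^esub> \<ominus>\<^bsub>M\<^esub> d"
      using c by (simp add: M.M.a_assoc M.M.r_neg)
    also have "\<dots> = d' \<oplus>\<^bsub>M\<^esub> \<ominus>\<^bsub>M\<^esub> d"
      unfolding that(5) using c by (simp add: M.M.r_neg1)
    finally have eq: "\<ominus>\<^bsub>M\<^esub> w' \<oplus>\<^bsub>M\<^esub> w = d' \<oplus>\<^bsub>M\<^esub> \<ominus>\<^bsub>M\<^esub> d" .
    have "\<ominus>\<^bsub>M\<^esub> w' \<oplus>\<^bsub>M\<^esub> w \<in> W" by (rule W'(3)[OF W'(5)[OF that(2)] that(1)])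
    moreover have "d' \<oplus>\<^bsub>M\<^esub> \<ominus>\<^bsub>M\<^esub> d \<in> D" by (rule D'(3)[OF that(4) D'(5)[OF that(3)]])
    ultimately have "d' \<oplus>\<^bsub>M\<^esub> \<ominus>\<^bsub>M\<^esub> d = \<zero>\<^bsub>M\<^esub>" using WD eq by auto
    then show ?thesis using c by (metis M.M.minus_equality M.M.minus_minus M.M.a_inv_closed)
  qed
  define \<pi> where "\<pi> x = (THE d. d \<in> D \<and> (\<exists>w \<in> W. x = w \<oplus>\<^bsub>M\<^esub> d))" for x
  have \<pi>: "\<pi> (w \<oplus>\<^bsub>M\<^esub> d) = d" if "w \<in> W" "d \<in> D" for w d
    unfolding \<pi>_def using that unique by (intro the_equality) blast+
  have "linear_map K M (M\<lparr>carrier := D\<rparr>) \<pi>"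
  proof (rule linear_mapI)
    fix x assume x: "x \<in> carrier M"
    then show "\<pi> x \<in> carrier (M\<lparr>carrier := D\<rparr>)" using span[OF x] \<pi> by auto
    fix y assume y: "y \<in> carrier M"
    obtain w d w' d' where *: "x = w \<oplus>\<^bsub>M\<^esub> d" "w \<in> W" "d \<in> D" "y = w' \<oplus>\<^bsub>M\<^esub> d'" "w' \<in> W" "d' \<in> D"
      using span[OF x] span[OF y] by blast
    have "x \<oplus>\<^bsub>M\<^esub> y = (w \<oplus>\<^bsub>M\<^esub> w') \<oplus>\<^bsub>M\<^esub> (d \<oplus>\<^bsub>M\<^esub> d')" using * Wc Dc by (simp add: M.M.a_ac)
    then show "\<pi> (x \<oplus>\<^bsub>M\<^esub> y) = \<pi> x \<oplus>\<^bsub>M\<lparr>carrier := D\<rparr>\<^esub> \<pi> y"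
      using \<pi>[OF W'(3) D'(3)] \<pi> * by simp
  next
    fix a x assume a: "a \<in> carrier K" and x: "x \<in> carrier M"
    obtain w d where *: "x = w \<oplus>\<^bsub>M\<^esub> d" "w \<in> W" "d \<in> D" using span[OF x] by blast
    have "a \<odot>\<^bsub>M\<^esub> x = a \<odot>\<^bsub>M\<^esub> w \<oplus>\<^bsub>M\<^esub> a \<odot>\<^bsub>M\<^esub> d" using * Wc Dc a by (simp add: M.smult_r_distr)
    then show "\<pi> (a \<odot>\<^bsub>M\<^esub> x) = a \<odot>\<^bsub>M\<lparr>carrier := D\<rparr>\<^esub> \<pi> x"
      using \<pi>[OF W'(4) D'(4)] \<pi> * a by simp
  qed
  moreover have "\<pi> d = d" if d: "d \<in> D" for d
    using \<pi>[OF W'(2) d] Dc[OF d] by simp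
  ultimately show thesis by (rule that)
qed

lemma submodule_sum:
  assumes "module K M" "submodule V K M" "submodule W K M"
  shows "submodule {v \<oplus>\<^bsub>M\<^esub> w | v w. v \<in> V \<and> w \<in> W} K M" (is "submodule ?S K M")
    and "V \<subseteq> {v \<oplus>\<^bsub>M\<^esub> w | v w. v \<in> V \<and> w \<in> W}" and "W \<subseteq> {v \<oplus>\<^bsub>M\<^esub> w | v w. v \<in> V \<and> w \<in> W}"
proof -
  interpret M: module K M by fact
  note V = submoduleD[OF assms(2,1)] and W = submoduleD[OF assms(3,1)]
  have Vc: "v \<in> carrier M" if "v \<in> V" for v using that V(1) by blast
  have Wc: "v \<in> carrier M" if "v \<in> W" for v using that W(1) by blast
  show "V \<subseteq> ?S"
  proof
    fix v assume v: "v \<in> V"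
    then have "v = v \<oplus>\<^bsub>M\<^esub> \<zero>\<^bsub>M\<^esub>" using Vc by simp
    then show "v \<in> ?S" using v W(2) by blast
  qed
  show "W \<subseteq> ?S"
  proof
    fix v assume v: "v \<in> W"
    then have "v = \<zero>\<^bsub>M\<^esub> \<oplus>\<^bsub>M\<^esub> v" using Wc by simp
    then show "v \<in> ?S" using v V(2) by blast
  qed
  show "submodule ?S K M"
  proof (rule M.submoduleI_closed)
    show "?S \<subseteq> carrier M" using Vc Wc by auto
    show "\<zero>\<^bsub>M\<^esub> \<in> ?S" using \<open>V \<subseteq> ?S\<close> V(2) by blast
    fix a b assume "a \<in> ?S" "b \<in> ?S"
    then obtain v w v' w' where *: "a = v \<oplus>\<^bsub>M\<^esub> w" "b = v' \<oplus>\<^bsub>M\<^esub> w'" "v \<in> V" "w \<in> W" "v' \<in> V" "w' \<in> W"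
      by blast
    have "a \<oplus>\<^bsub>M\<^esub> b = (v \<oplus>\<^bsub>M\<^esub> v') \<oplus>\<^bsub>M\<^esub> (w \<oplus>\<^bsub>M\<^esub> w')" using * Vc Wc by (simp add: M.M.a_ac)
    then show "a \<oplus>\<^bsub>M\<^esub> b \<in> ?S" using * V(3) W(3) by blast
  next
    fix k a assume k: "k \<in> carrier K" and "a \<in> ?S"
    then obtain v w where *: "a = v \<oplus>\<^bsub>M\<^esub> w" "v \<in> V" "w \<in> W" by blast
    have "k \<odot>\<^bsub>M\<^esub> a = (k \<odot>\<^bsub>M\<^esub> v) \<oplus>\<^bsub>M\<^esub> (k \<odot>\<^bsub>M\<^esub> w)" using * k Vc Wc by (simp add: M.smult_r_distr)
    then show "k \<odot>\<^bsub>M\<^esub> a \<in> ?S" using * k V(4) W(4) by blast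
  qed
qed

text \<open>A subcoalgebra of \<open>C\<close>. Its comultiplication is described by formal sums of vectors from \<open>D\<close>, because the
  elements of \<open>D \<otimes> D\<close>, which are congruence classes, are not elements of \<open>C \<otimes> C\<close>.\<close>

definition equalizing_subcoalgebra where
  "equalizing_subcoalgebra K C f g D \<longleftrightarrow> submodule D K C \<and> (\<forall>x \<in> D. f x = g x) \<and>
    (\<forall>x \<in> D. \<exists>r \<in> formal_sums K [C\<lparr>carrier := D\<rparr>, C\<lparr>carrier := D\<rparr>]. comult C x = tensor_class K [C, C] r)"

lemma formal_sums_mono:
  assumes "D \<subseteq> E" "r \<in> formal_sums K [C\<lparr>carrier := D\<rparr>, C\<lparr>carrier := D\<rparr>]"
  shows "r \<in> formal_sums K [C\<lparr>carrier := E\<rparr>, C\<lparr>carrier := E\<rparr>]"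
  using assms(2,1) by (induction r rule: formal_sums_induct) auto

text \<open>The equalizer is the union \<open>E\<close> of all subcoalgebras on which \<open>f\<close> and \<open>g\<close> agree. It is a subspace because the
  sum of two such subcoalgebras is another one, and it contains the image of every homomorphism that
  equalizes \<open>f\<close> and \<open>g\<close>, because such an image is one of them. A retraction onto \<open>E\<close> leaves the
  comultiplication of an element of \<open>E\<close> unchanged, as the latter can be written with vectors in \<open>E\<close>.\<close>

lemma equalizer_coalgebra:
  fixes C :: "('k, 'u) coalgebra" and B :: "('k, 'u) coalgebra"
  assumes "field K" and C: "cocommutative_coalgebra K C" and B: "cocommutative_coalgebra K B"
    and f: "coalgebra_hom K C B f" and g: "coalgebra_hom K C B g"
  obtains D :: "('k, 'u) coalgebra" where "cocommutative_coalgebra K D" "carrier D \<subseteq> carrier C"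
    "coalgebra_hom K D C (\<lambda>x. x)" "\<forall>x \<in> carrier D. f x = g x"
    "\<forall>X h. cocommutative_coalgebra K (X :: ('k, 'u) coalgebra) \<longrightarrow> coalgebra_hom K X C h \<longrightarrow>
      (\<forall>x \<in> carrier X. f (h x) = g (h x)) \<longrightarrow> coalgebra_hom K X D h"
proof -
  interpret K: field K by fact
  interpret C: cocommutative_coalgebra K C by fact
  interpret B: cocommutative_coalgebra K B by fact
  note fl = coalgebra_hom_linear[OF f] and gl = coalgebra_hom_linear[OF g]
  let ?sub = "equalizing_subcoalgebra K C f g"
  define E where "E = \<Union>{D. ?sub D}"
  have sub_zero: "?sub {\<zero>\<^bsub>C\<^esub>}"
  proof -
    have "comult C \<zero>\<^bsub>C\<^esub> = tensor_class K [C, C] []"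
      using linear_map_zero[OF C.comult_linear C.is_module C.HH.module_tensor] by (simp add: C.HH.zero_tensor)
    then show ?thesis
      unfolding equalizing_subcoalgebra_def
      using linear_map_zero[OF fl C.is_module B.is_module] linear_map_zero[OF gl C.is_module B.is_module]
      by (auto intro!: C.submoduleI_closed bexI[of _ "[]"])
  qed
  have sub_sum: "?sub {v \<oplus>\<^bsub>C\<^esub> w | v w. v \<in> V \<and> w \<in> W}" if V: "?sub V" and W: "?sub W" for V W
  proof -
    let ?S = "{v \<oplus>\<^bsub>C\<^esub> w | v w. v \<in> V \<and> w \<in> W}"
    have sV: "submodule V K C" and sW: "submodule W K C" using V W by (auto simp: equalizing_subcoalgebra_def)
    note S = submodule_sum[OF C.is_module sV sW]
    have Vc: "V \<subseteq> carrier C" "W \<subseteq> carrier C" using submoduleD(1)[OF _ C.is_module] sV sW by auto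
    have "f x = g x" if x: "x \<in> ?S" for x
    proof -
      obtain v w where *: "x = v \<oplus>\<^bsub>C\<^esub> w" "v \<in> V" "w \<in> W" using x by blast
      then have "v \<in> carrier C" "w \<in> carrier C" "f v = g v" "f w = g w"
        using Vc V W by (auto simp: equalizing_subcoalgebra_def)
      then show ?thesis using * by (simp add: linear_map_add[OF fl] linear_map_add[OF gl])
    qed
    moreover have "\<exists>r \<in> formal_sums K [C\<lparr>carrier := ?S\<rparr>, C\<lparr>carrier := ?S\<rparr>]. comult C x = tensor_class K [C, C] r"
      if x: "x \<in> ?S" for x
    proof -
      obtain v w where *: "x = v \<oplus>\<^bsub>C\<^esub> w" "v \<in> V" "w \<in> W" using x by blast
      then have c: "v \<in> carrier C" "w \<in> carrier C" using Vc by auto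
      obtain r where r: "r \<in> formal_sums K [C\<lparr>carrier := V\<rparr>, C\<lparr>carrier := V\<rparr>]" "comult C v = tensor_class K [C, C] r"
        using V * unfolding equalizing_subcoalgebra_def by blast
      obtain s where s: "s \<in> formal_sums K [C\<lparr>carrier := W\<rparr>, C\<lparr>carrier := W\<rparr>]" "comult C w = tensor_class K [C, C] s"
        using W * unfolding equalizing_subcoalgebra_def by blast
      have rs: "r \<in> C.HH.FS" "s \<in> C.HH.FS"
        using formal_sums_mono[OF Vc(1) r(1)] formal_sums_mono[OF Vc(2) s(1)] by (simp_all add: formal_sums_def)
      have "comult C x = tensor_class K [C, C] (r @ s)"
        using linear_map_add[OF C.comult_linear c] C.HH.add_class[OF rs] by (simp add: * r s)
      moreover have "r @ s \<in> formal_sums K [C\<lparr>carrier := ?S\<rparr>, C\<lparr>carrier := ?S\<rparr>]"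
        using formal_sums_mono[OF S(2) r(1)] formal_sums_mono[OF S(3) s(1)]
        unfolding formal_sums_simps(3) by blast
      ultimately show ?thesis by blast
    qed
    ultimately show ?thesis using S(1) unfolding equalizing_subcoalgebra_def by blast
  qed
  have E_sub: "submodule E K C"
  proof (rule C.submoduleI_closed)
    show "E \<subseteq> carrier C"
      unfolding E_def equalizing_subcoalgebra_def using submoduleD(1)[OF _ C.is_module] by blast
    show "\<zero>\<^bsub>C\<^esub> \<in> E" using sub_zero by (auto simp: E_def)
    show "a \<odot>\<^bsub>C\<^esub> x \<in> E" if "a \<in> carrier K" "x \<in> E" for a x
      using that submoduleD(4)[OF _ C.is_module] unfolding E_def equalizing_subcoalgebra_def by blast
    show "a \<oplus>\<^bsub>C\<^esub> b \<in> E" if ab: "a \<in> E" "b \<in> E" for a b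
    proof -
      obtain V W where "?sub V" "a \<in> V" "?sub W" "b \<in> W" using ab by (auto simp: E_def)
      then show ?thesis using sub_sum[of V W] unfolding E_def by blast
    qed
  qed
  define Dm :: "('k, 'u) module" where
    "Dm = \<lparr>carrier = E, mult = undefined, one = undefined, zero = zero C, add = add C, smult = smult C\<rparr>"
  have Dm_simps: "carrier Dm = E" "add Dm = add C" "zero Dm = zero C" "smult Dm = smult C"
    by (simp_all add: Dm_def)
  have Dm: "module K Dm"
    by (rule module_cong[OF submodule.submodule_is_module[OF E_sub C.is_module]]) (simp_all add: Dm_simps)
  have FS_Dm: "formal_sums K [Dm, Dm] = formal_sums K [C\<lparr>carrier := E\<rparr>, C\<lparr>carrier := E\<rparr>]"
    by (simp add: formal_sums_def Dm_simps)
  obtain \<pi> where \<pi>: "linear_map K C Dm \<pi>" and \<pi>_id: "\<And>x. x \<in> E \<Longrightarrow> \<pi> x = x"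
  proof -
    obtain \<pi> where "linear_map K C (C\<lparr>carrier := E\<rparr>) \<pi>" "\<And>x. x \<in> E \<Longrightarrow> \<pi> x = x"
      using linear_retraction[OF assms(1) C.is_module E_sub] by blast
    then show thesis by (intro that[of \<pi>]) (simp_all add: linear_map_def Dm_simps)
  qed
  have EC: "E \<subseteq> carrier C" by (rule submoduleD(1)[OF E_sub C.is_module])
  have EC': "x \<in> carrier C" if "x \<in> E" for x using that EC by blast
  have \<iota>: "linear_map K Dm C (\<lambda>x. x)" using EC by (auto intro!: linear_mapI simp: Dm_simps)
  have rep: "\<exists>r \<in> formal_sums K [Dm, Dm]. comult C x = tensor_class K [C, C] r" if x: "x \<in> E" for x
  proof -
    obtain D where D: "?sub D" "x \<in> D" using x by (auto simp: E_def)
    then obtain r where r: "r \<in> formal_sums K [C\<lparr>carrier := D\<rparr>, C\<lparr>carrier := D\<rparr>]" "comult C x = tensor_class K [C, C] r"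
      unfolding equalizing_subcoalgebra_def by blast
    have "D \<subseteq> E" using D by (auto simp: E_def)
    then show ?thesis using formal_sums_mono[OF _ r(1)] r(2) unfolding FS_Dm by blast
  qed
  have "sw C C.HH.T (\<lambda>a b. C.HH.pt (\<pi> a) (\<pi> b)) x = comult C x" if x: "x \<in> E" for x
  proof -
    from rep[OF x]
    obtain r where r: "r \<in> formal_sums K [Dm, Dm]" "comult C x = tensor_class K [C, C] r"
      by blast
    have r': "r \<in> C.HH.FS"
      using formal_sums_mono[OF EC, of r K C] r(1) unfolding FS_Dm by (simp add: formal_sums_def)
    have \<iota>\<pi>: "bilinear K C C C.HH.T (\<lambda>a b. C.HH.pt (\<pi> a) (\<pi> b))"
      by (rule bilinear_precomp[OF C.HH.bilinear_pt]; rule linear_map_comp[OF \<iota> \<pi>])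
    have "sw C C.HH.T (\<lambda>a b. C.HH.pt (\<pi> a) (\<pi> b)) x = eval_sum C.HH.T (\<lambda>xs. C.HH.pt (\<pi> (xs ! 0)) (\<pi> (xs ! 1))) r"
      unfolding sw_def r(2) by (rule C.HH.lift_class[OF C.HH.module_tensor bilinear_multilinear[OF \<iota>\<pi>] r'])
    also have "\<dots> = eval_sum C.HH.T (pure_tensor K [C, C]) r"
      by (rule eval_sum_cong[OF r(1)]) (auto simp: Dm_simps \<pi>_id)
    also have "\<dots> = comult C x" by (simp only: r(2) C.HH.class_eq_eval[OF r'])
    finally show ?thesis .
  qed
  then have stable: "sw C C.HH.T (\<lambda>a b. C.HH.pt (\<pi> a) (\<pi> b)) x = comult C x" if "x \<in> carrier Dm" for x
    using that by (simp add: Dm_simps)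
  have \<pi>_id': "\<pi> x = x" if "x \<in> carrier Dm" for x using \<pi>_id that by (simp add: Dm_simps)
  from retract_coalgebra[OF C Dm \<pi> \<iota> \<pi>_id' stable]
  obtain D :: "('k, 'u) coalgebra" where coalgebra: "cocommutative_coalgebra K D" and D_carrier: "carrier D = carrier Dm"
    and incl: "coalgebra_hom K D C (\<lambda>x. x)"
    and corestrict: "\<forall>X h. cocommutative_coalgebra K (X :: ('k, 'u) coalgebra) \<longrightarrow> coalgebra_hom K X C h \<longrightarrow>
      (\<forall>x \<in> carrier X. \<pi> (h x) = h x) \<longrightarrow> coalgebra_hom K X D (\<lambda>x. \<pi> (h x))" .
  have D_simps: "carrier D = E" by (simp add: D_carrier Dm_simps)
  have eq: "f x = g x" if "x \<in> carrier D" for x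
    using that by (auto simp: D_simps E_def equalizing_subcoalgebra_def)
  have univ: "coalgebra_hom K X D h"
    if X: "cocommutative_coalgebra K X" and h: "coalgebra_hom K X C h"
      and fg: "\<forall>x \<in> carrier X. f (h x) = g (h x)" for X :: "('k, 'u) coalgebra" and h
  proof -
    interpret X: cocommutative_coalgebra K X by fact
    note hl = coalgebra_hom_linear[OF h]
    note hc = coalgebra_hom_closed[OF h]
    let ?I = "h ` carrier X"
    have "submodule ?I K C"
    proof (rule C.submoduleI_closed)
      show "?I \<subseteq> carrier C" using hc by blast
      show "\<zero>\<^bsub>C\<^esub> \<in> ?I" using linear_map_zero[OF hl X.is_module C.is_module] X.M.zero_closed by (metis imageI)
      show "a \<oplus>\<^bsub>C\<^esub> b \<in> ?I" if "a \<in> ?I" "b \<in> ?I" for a b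
        using that by (auto simp: linear_map_add[OF hl, symmetric])
      show "a \<odot>\<^bsub>C\<^esub> b \<in> ?I" if "a \<in> carrier K" "b \<in> ?I" for a b
        using that by (auto simp: linear_map_smult[OF hl, symmetric])
    qed
    moreover have "\<exists>r \<in> formal_sums K [C\<lparr>carrier := ?I\<rparr>, C\<lparr>carrier := ?I\<rparr>]. comult C (h x) = tensor_class K [C, C] r"
      if x: "x \<in> carrier X" for x
    proof -
      let ?m = "map (\<lambda>(c, xs). (c, map h xs))"
      have m: "?m r \<in> formal_sums K [C\<lparr>carrier := ?I\<rparr>, C\<lparr>carrier := ?I\<rparr>] \<and> ?m r \<in> C.HH.FS \<and>
          eval_sum C.HH.T (\<lambda>xs. C.HH.pt (h (xs ! 0)) (h (xs ! 1))) r = tensor_class K [C, C] (?m r)"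
        if "r \<in> X.HH.FS" for r
        using that
      proof (induction rule: formal_sums_induct)
        case Nil
        then show ?case by (simp add: C.HH.zero_tensor)
      next
        case (Cons c xs r)
        then obtain a b where xs: "xs = [a, b]" "a \<in> carrier X" "b \<in> carrier X" unfolding vectors2 by blast
        then show ?case
          using Cons C.HH.class_Cons[of c "[h a, h b]" "?m r"] hc by simp
      qed
      obtain r where r: "r \<in> X.HH.FS" "comult X x = tensor_class K [X, X] r"
        using X.comult_closed[OF x] by (auto simp: X.HH.carrier_tensor)
      have "comult C (h x) = sw X C.HH.T (\<lambda>a b. C.HH.pt (h a) (h b)) x"
        using h x by (simp add: coalgebra_hom_iff[OF X])
      also have "\<dots> = eval_sum C.HH.T (\<lambda>xs. C.HH.pt (h (xs ! 0)) (h (xs ! 1))) r"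
        unfolding sw_def r(2)
        by (rule X.HH.lift_class[OF C.HH.module_tensor
            bilinear_multilinear[OF bilinear_precomp[OF C.HH.bilinear_pt hl hl]] r(1)])
      finally show ?thesis using m[OF r(1)] by (intro bexI[of _ "?m r"]) simp_all
    qed
    ultimately have "?sub ?I"
      using fg unfolding equalizing_subcoalgebra_def by blast
    then have hE: "h x \<in> E" if "x \<in> carrier X" for x using that unfolding E_def by blast
    have \<pi>h: "\<pi> (h x) = h x" if "x \<in> carrier X" for x by (rule \<pi>_id[OF hE[OF that]])
    then have "coalgebra_hom K X D (\<lambda>x. \<pi> (h x))" using corestrict X h by blast
    then show ?thesis using coalgebra_hom_cong[of K X "\<lambda>x. \<pi> (h x)" h D, OF X \<pi>h] by simp
  qed
  show thesis
    by (rule that[OF coalgebra _ incl]) (use univ in \<open>auto simp: D_simps EC intro: eq\<close>)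
qed

text \<open>The pullback is the equalizer of the two composites on the product of \<open>A\<close> and \<open>E\<close>.\<close>

lemma pullback_coalgebra:
  fixes A B E :: "('k, 'u) coalgebra"
  assumes "field K" and inf: "infinite (UNIV :: 'u set)" and small: "carrier K \<lesssim> (UNIV :: 'u set)"
    and A: "A \<in> Ob (Coalg_coc K)" and E: "E \<in> Ob (Coalg_coc K)" and B: "B \<in> Ob (Coalg_coc K)"
    and f: "f \<in> Hom (Coalg_coc K) A B" and g: "g \<in> Hom (Coalg_coc K) E B"
  shows "\<exists>P a e. pullback (Coalg_coc K) A E B f g P a e"
proof -
  have A': "cocommutative_coalgebra K A" and E': "cocommutative_coalgebra K E" and B': "cocommutative_coalgebra K B"
    using A E B by auto
  note f' = Hom_Coalg_hom[OF f] and g' = Hom_Coalg_hom[OF g]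
  obtain P p q where prod: "coalgebra_product K A E P p q"
    using binary_product[OF inf small A' E'] by metis
  note P = coalgebra_productD(1)[OF prod] and p = coalgebra_productD(2)[OF prod]
    and q = coalgebra_productD(3)[OF prod] and univ = coalgebra_productD(4)[OF prod]
    and unique = coalgebra_productD(5)[OF prod]
  note fp = coalgebra_hom_comp[OF P A' B' p f'] and gq = coalgebra_hom_comp[OF P E' B' q g']
  obtain D :: "('k, 'u) coalgebra" where D: "cocommutative_coalgebra K D" "carrier D \<subseteq> carrier P"
    and incl: "coalgebra_hom K D P (\<lambda>x. x)" and eq: "\<forall>x \<in> carrier D. f (p x) = g (q x)"
    and lift: "\<forall>X h. cocommutative_coalgebra K (X :: ('k, 'u) coalgebra) \<longrightarrow> coalgebra_hom K X P h \<longrightarrow>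
      (\<forall>x \<in> carrier X. f (p (h x)) = g (q (h x))) \<longrightarrow> coalgebra_hom K X D h"
    using equalizer_coalgebra[OF assms(1) P B' fp gq] .
  let ?a = "restrict p (carrier D)" and ?e = "restrict q (carrier D)"
  have "pullback (Coalg_coc K) A E B f g D ?a ?e"
    unfolding pullback_def Cmp_Coalg
  proof (intro conjI ballI impI)
    show "D \<in> Ob (Coalg_coc K)" using D by simp
    show "?a \<in> Hom (Coalg_coc K) D A"
      by (rule restrict_in_Hom[OF D(1) coalgebra_hom_comp[OF D(1) P A' incl p]])
    show "?e \<in> Hom (Coalg_coc K) D E"
      by (rule restrict_in_Hom[OF D(1) coalgebra_hom_comp[OF D(1) P E' incl q]])
    show "compose (carrier D) f ?a = compose (carrier D) g ?e"
      by (auto simp: compose_def eq intro!: restrict_ext)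
    fix X :: "('k, 'u) coalgebra" and x y
    assume X: "X \<in> Ob (Coalg_coc K)" and x: "x \<in> Hom (Coalg_coc K) X A" and y: "y \<in> Hom (Coalg_coc K) X E"
      and xy: "compose (carrier X) f x = compose (carrier X) g y"
    have X': "cocommutative_coalgebra K X" using X by simp
    obtain h where h: "coalgebra_hom K X P h" "\<And>z. z \<in> carrier X \<Longrightarrow> p (h z) = x z \<and> q (h z) = y z"
      using univ[OF X' Hom_Coalg_hom[OF x] Hom_Coalg_hom[OF y]] by blast
    have "\<forall>z \<in> carrier X. f (p (h z)) = g (q (h z))"
    proof
      fix z assume z: "z \<in> carrier X"
      show "f (p (h z)) = g (q (h z))"
        using fun_cong[OF xy, of z] h(2)[OF z] z by (simp add: compose_def)
    qed
    from lift[rule_format, OF X' h(1)] this have hD: "coalgebra_hom K X D h" by blast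
    have ext: "compose (carrier X) r k = s"
      if "s \<in> extensional (carrier X)" "\<And>z. z \<in> carrier X \<Longrightarrow> r (k z) = s z" for r k s
      using that by (auto simp: compose_def intro!: extensionalityI[of _ "carrier X"])
    have x_ext: "x \<in> extensional (carrier X)" and y_ext: "y \<in> extensional (carrier X)"
      using x y by (simp_all add: Hom_Coalg)
    show "\<exists>!h. h \<in> Hom (Coalg_coc K) X D \<and> compose (carrier X) ?a h = x \<and> compose (carrier X) ?e h = y"
    proof (intro ex1I[of _ "restrict h (carrier X)"] conjI)
      show "restrict h (carrier X) \<in> Hom (Coalg_coc K) X D" by (rule restrict_in_Hom[OF X' hD])
      show "compose (carrier X) ?a (restrict h (carrier X)) = x"
        by (rule ext[OF x_ext]) (simp add: h coalgebra_hom_closed[OF hD])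
      show "compose (carrier X) ?e (restrict h (carrier X)) = y"
        by (rule ext[OF y_ext]) (simp add: h coalgebra_hom_closed[OF hD])
      fix k assume k: "k \<in> Hom (Coalg_coc K) X D \<and> compose (carrier X) ?a k = x \<and> compose (carrier X) ?e k = y"
      have kD: "coalgebra_hom K X D k" using k by (simp add: Hom_Coalg)
      have kP: "coalgebra_hom K X P k" by (rule coalgebra_hom_comp[OF X' D(1) P kD incl])
      have pq: "p (k z) = p (h z) \<and> q (k z) = q (h z)" if z: "z \<in> carrier X" for z
        using fun_cong[OF conjunct1[OF conjunct2[OF k]], of z] fun_cong[OF conjunct2[OF conjunct2[OF k]], of z]
          z h(2)[OF z] coalgebra_hom_closed[OF kD z] by (simp add: compose_def)
      then have "k z = h z" if "z \<in> carrier X" for z using unique[OF X' kP h(1) _ that] pq by blast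
      then show "k = restrict h (carrier X)"
        using k by (auto simp: Hom_Coalg intro!: extensionalityI[of _ "carrier X"])
    qed
  qed
  then show ?thesis by blast
qed

section \<open>Limits of models\<close>

lemma product_coneD:
  assumes "product_cone C I A P p"
  shows "P \<in> Ob C" "i \<in> I \<Longrightarrow> A i \<in> Ob C" "i \<in> I \<Longrightarrow> p i \<in> Hom C P (A i)"
  using assms by (auto simp: product_cone_def)

lemma product_cone_lift:
  assumes "product_cone C I A P p" "X \<in> Ob C" "\<And>i. i \<in> I \<Longrightarrow> f i \<in> Hom C X (A i)"
  obtains h where "h \<in> Hom C X P" "\<And>i. i \<in> I \<Longrightarrow> Cmp C X P (A i) (p i) h = f i"
  using assms unfolding product_cone_def by blast

lemma (in category) product_cone_ext:
  assumes P: "product_cone C I A P p" and X: "X \<in> Ob C" and h: "h \<in> Hom C X P" "h' \<in> Hom C X P"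
    and eq: "\<And>i. i \<in> I \<Longrightarrow> Cmp C X P (A i) (p i) h = Cmp C X P (A i) (p i) h'"
  shows "h = h'"
proof -
  have "\<And>i. i \<in> I \<Longrightarrow> Cmp C X P (A i) (p i) h' \<in> Hom C X (A i)"
    using product_coneD[OF P] Cmp_in_Hom X h by blast
  then have "\<exists>!k. k \<in> Hom C X P \<and> (\<forall>i \<in> I. Cmp C X P (A i) (p i) k = Cmp C X P (A i) (p i) h')"
    using P[unfolded product_cone_def, THEN conjunct2, THEN conjunct2, rule_format, OF X,
        of "\<lambda>i. Cmp C X P (A i) (p i) h'"] by blast
  then show ?thesis using h eq by blast
qed

lemma pullbackD:
  assumes "pullback C A E B f g P a e"
  shows "P \<in> Ob C" "a \<in> Hom C P A" "e \<in> Hom C P E" "Cmp C P A B f a = Cmp C P E B g e"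
  using assms by (auto simp: pullback_def)

lemma pullback_lift:
  assumes "pullback C A E B f g P a e" "X \<in> Ob C" "x \<in> Hom C X A" "y \<in> Hom C X E"
    "Cmp C X A B f x = Cmp C X E B g y"
  obtains h where "h \<in> Hom C X P" "Cmp C X P A a h = x" "Cmp C X P E e h = y"
  using assms unfolding pullback_def by blast

lemma (in category) pullback_ext:
  assumes P: "pullback C A E B f g P a e" and ob: "A \<in> Ob C" "E \<in> Ob C" "B \<in> Ob C"
    and f: "f \<in> Hom C A B" and g: "g \<in> Hom C E B" and X: "X \<in> Ob C"
    and h: "h \<in> Hom C X P" "h' \<in> Hom C X P"
    and eq: "Cmp C X P A a h = Cmp C X P A a h'" "Cmp C X P E e h = Cmp C X P E e h'"
  shows "h = h'"
proof -
  note P' = pullbackD[OF P]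
  have "Cmp C X A B f (Cmp C X P A a h') = Cmp C X P B (Cmp C P A B f a) h'"
    by (rule Cmp_assoc[symmetric]) (use P' ob f g X h in auto)
  also have "\<dots> = Cmp C X E B g (Cmp C X P E e h')"
    unfolding P'(4) by (rule Cmp_assoc) (use P' ob f g X h in auto)
  finally have "Cmp C X A B f (Cmp C X P A a h') = Cmp C X E B g (Cmp C X P E e h')" .
  then have "\<exists>!k. k \<in> Hom C X P \<and> Cmp C X P A a k = Cmp C X P A a h' \<and> Cmp C X P E e k = Cmp C X P E e h'"
    using P X Cmp_in_Hom[OF X P'(1) ob(1) h(2) P'(2)] Cmp_in_Hom[OF X P'(1) ob(2) h(2) P'(3)]
    unfolding pullback_def by blast
  then show ?thesis using h eq by blast
qed

locale models_in = L: category L + D: category D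
  for L :: "('o, 'm, 'y) cat_scheme" and D :: "('p, 'n, 'z) cat_scheme"
begin

abbreviation "M \<equiv> models L D"

lemma model_ob: "F \<in> Ob M \<Longrightarrow> X \<in> Ob L \<Longrightarrow> Fo F X \<in> Ob D"
  by (simp add: models_def is_functor_def)

lemma model_hom:
  "F \<in> Ob M \<Longrightarrow> X \<in> Ob L \<Longrightarrow> Y \<in> Ob L \<Longrightarrow> f \<in> Hom L X Y \<Longrightarrow> Fm F X Y f \<in> Hom D (Fo F X) (Fo F Y)"
  by (simp add: models_def is_functor_def)

lemma model_idn: "F \<in> Ob M \<Longrightarrow> X \<in> Ob L \<Longrightarrow> Fm F X X (Idn L X) = Idn D (Fo F X)"
  by (simp add: models_def is_functor_def)

lemma model_cmp:
  "F \<in> Ob M \<Longrightarrow> X \<in> Ob L \<Longrightarrow> Y \<in> Ob L \<Longrightarrow> Z \<in> Ob L \<Longrightarrow> f \<in> Hom L X Y \<Longrightarrow> g \<in> Hom L Y Z \<Longrightarrow>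
    Fm F X Z (Cmp L X Y Z g f) = Cmp D (Fo F X) (Fo F Y) (Fo F Z) (Fm F Y Z g) (Fm F X Y f)"
  by (simp add: models_def is_functor_def)

lemma model_product:
  "F \<in> Ob M \<Longrightarrow> finite I \<Longrightarrow> product_cone L I A P p \<Longrightarrow>
    product_cone D I (\<lambda>i. Fo F (A i)) (Fo F P) (\<lambda>i. Fm F P (A i) (p i))"
  by (simp add: models_def preserves_finite_products_def)

lemma nat_hom: "\<eta> \<in> Hom M F G \<Longrightarrow> X \<in> Ob L \<Longrightarrow> \<eta> X \<in> Hom D (Fo F X) (Fo G X)"
  by (auto simp: models_def nat_trans_def)

lemma nat_natural:
  "\<eta> \<in> Hom M F G \<Longrightarrow> X \<in> Ob L \<Longrightarrow> Y \<in> Ob L \<Longrightarrow> f \<in> Hom L X Y \<Longrightarrow>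
    Cmp D (Fo F X) (Fo G X) (Fo G Y) (Fm G X Y f) (\<eta> X) = Cmp D (Fo F X) (Fo F Y) (Fo G Y) (\<eta> Y) (Fm F X Y f)"
  by (auto simp: models_def nat_trans_def)

lemma nat_eqI:
  "\<eta> \<in> Hom M F G \<Longrightarrow> \<theta> \<in> Hom M F' G' \<Longrightarrow> (\<And>X. X \<in> Ob L \<Longrightarrow> \<eta> X = \<theta> X) \<Longrightarrow> \<eta> = \<theta>"
  by (auto simp: models_def nat_trans_def PiE_def intro: extensionalityI)

lemma natI:
  assumes "\<And>X. X \<in> Ob L \<Longrightarrow> \<eta> X \<in> Hom D (Fo F X) (Fo G X)"
    and "\<And>X Y f. X \<in> Ob L \<Longrightarrow> Y \<in> Ob L \<Longrightarrow> f \<in> Hom L X Y \<Longrightarrow>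
      Cmp D (Fo F X) (Fo G X) (Fo G Y) (Fm G X Y f) (\<eta> X) = Cmp D (Fo F X) (Fo F Y) (Fo G Y) (\<eta> Y) (Fm F X Y f)"
  shows "restrict \<eta> (Ob L) \<in> Hom M F G"
  using assms by (auto simp: models_def nat_trans_def)

lemma cmp_M [simp]: "X \<in> Ob L \<Longrightarrow> Cmp M F G H \<theta> \<eta> X = Cmp D (Fo F X) (Fo G X) (Fo H X) (\<theta> X) (\<eta> X)"
  and idn_M [simp]: "X \<in> Ob L \<Longrightarrow> Idn M F X = Idn D (Fo F X)"
  by (simp_all add: models_def)

text \<open>With a generalised element \<open>h\<close> as argument, naturality can be used for rewriting without changing the
  bracketing of composites.\<close>

lemma nat_app:
  assumes F: "F \<in> Ob M" and G: "G \<in> Ob M" and \<eta>: "\<eta> \<in> Hom M F G" and X: "X \<in> Ob L" and Y: "Y \<in> Ob L"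
    and f: "f \<in> Hom L X Y" and W: "W \<in> Ob D" and h: "h \<in> Hom D W (Fo F X)"
  shows "Cmp D W (Fo G X) (Fo G Y) (Fm G X Y f) (Cmp D W (Fo F X) (Fo G X) (\<eta> X) h) =
    Cmp D W (Fo F Y) (Fo G Y) (\<eta> Y) (Cmp D W (Fo F X) (Fo F Y) (Fm F X Y f) h)"
  using D.Cmp_assoc[OF W model_ob[OF F X] model_ob[OF G X] model_ob[OF G Y] h nat_hom[OF \<eta> X] model_hom[OF G X Y f]]
    D.Cmp_assoc[OF W model_ob[OF F X] model_ob[OF F Y] model_ob[OF G Y] h model_hom[OF F X Y f] nat_hom[OF \<eta> Y]]
    nat_natural[OF \<eta> X Y f] by simp

lemma nat_cmp_app:
  assumes F: "F \<in> Ob M" and G: "G \<in> Ob M" and H: "H \<in> Ob M" and \<eta>: "\<eta> \<in> Hom M F G" and \<theta>: "\<theta> \<in> Hom M G H"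
    and X: "X \<in> Ob L" and W: "W \<in> Ob D" and h: "h \<in> Hom D W (Fo F X)"
  shows "Cmp D W (Fo G X) (Fo H X) (\<theta> X) (Cmp D W (Fo F X) (Fo G X) (\<eta> X) h) =
    Cmp D W (Fo F X) (Fo H X) (Cmp M F G H \<theta> \<eta> X) h"
  using D.Cmp_assoc[OF W model_ob[OF F X] model_ob[OF G X] model_ob[OF H X] h nat_hom[OF \<eta> X] nat_hom[OF \<theta> X]] X
  by simp

lemma nat_app_closed:
  assumes "F \<in> Ob M" "G \<in> Ob M" "\<eta> \<in> Hom M F G" "X \<in> Ob L" "W \<in> Ob D" "h \<in> Hom D W (Fo F X)"
  shows "Cmp D W (Fo F X) (Fo G X) (\<eta> X) h \<in> Hom D W (Fo G X)"
  using assms by (intro D.Cmp_in_Hom model_ob nat_hom)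

lemma model_app_closed:
  assumes "F \<in> Ob M" "X \<in> Ob L" "Y \<in> Ob L" "f \<in> Hom L X Y" "W \<in> Ob D" "h \<in> Hom D W (Fo F X)"
  shows "Cmp D W (Fo F X) (Fo F Y) (Fm F X Y f) h \<in> Hom D W (Fo F Y)"
  using assms by (intro D.Cmp_in_Hom model_ob model_hom)

lemma category_models: "category M"
proof
  fix F assume F: "F \<in> Ob M"
  have "restrict (\<lambda>X. Idn D (Fo F X)) (Ob L) \<in> Hom M F F"
    by (rule natI) (simp_all add: D.Idn_in_Hom model_ob[OF F] model_hom[OF F] D.Cmp_Idn_left D.Cmp_Idn_right)
  then show "Idn M F \<in> Hom M F F" by (simp add: models_def)
next
  fix F G H \<eta> \<theta>
  assume F: "F \<in> Ob M" and G: "G \<in> Ob M" and H: "H \<in> Ob M" and \<eta>: "\<eta> \<in> Hom M F G" and \<theta>: "\<theta> \<in> Hom M G H"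
  have "restrict (\<lambda>X. Cmp D (Fo F X) (Fo G X) (Fo H X) (\<theta> X) (\<eta> X)) (Ob L) \<in> Hom M F H"
  proof (rule natI)
    fix X assume X: "X \<in> Ob L"
    show c: "Cmp D (Fo F X) (Fo G X) (Fo H X) (\<theta> X) (\<eta> X) \<in> Hom D (Fo F X) (Fo H X)"
      by (intro D.Cmp_in_Hom model_ob nat_hom F G H \<eta> \<theta> X)
    fix Y f assume Y: "Y \<in> Ob L" and f: "f \<in> Hom L X Y"
    have "Cmp D (Fo F X) (Fo H X) (Fo H Y) (Fm H X Y f) (Cmp D (Fo F X) (Fo G X) (Fo H X) (\<theta> X) (\<eta> X)) =
        Cmp D (Fo F X) (Fo G Y) (Fo H Y) (\<theta> Y) (Cmp D (Fo F X) (Fo G X) (Fo G Y) (Fm G X Y f) (\<eta> X))"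
      by (rule nat_app[OF G H \<theta> X Y f model_ob[OF F X] nat_hom[OF \<eta> X]])
    also have "\<dots> = Cmp D (Fo F X) (Fo F Y) (Fo H Y) (Cmp D (Fo F Y) (Fo G Y) (Fo H Y) (\<theta> Y) (\<eta> Y)) (Fm F X Y f)"
      unfolding nat_natural[OF \<eta> X Y f]
      by (rule D.Cmp_assoc[symmetric]) (intro model_ob nat_hom model_hom F G H \<eta> \<theta> X Y f)+
    finally show "Cmp D (Fo F X) (Fo H X) (Fo H Y) (Fm H X Y f) (Cmp D (Fo F X) (Fo G X) (Fo H X) (\<theta> X) (\<eta> X)) =
        Cmp D (Fo F X) (Fo F Y) (Fo H Y) (Cmp D (Fo F Y) (Fo G Y) (Fo H Y) (\<theta> Y) (\<eta> Y)) (Fm F X Y f)" .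
  qed
  then show c: "Cmp M F G H \<theta> \<eta> \<in> Hom M F H" by (simp add: models_def)
next
  fix F G \<eta> assume F: "F \<in> Ob M" and G: "G \<in> Ob M" and \<eta>: "\<eta> \<in> Hom M F G"
  have ext: "\<eta> = restrict \<eta> (Ob L)" using \<eta> by (auto simp: models_def nat_trans_def PiE_def extensional_restrict)
  have "Cmp M F F G \<eta> (Idn M F) = restrict \<eta> (Ob L)" "Cmp M F G G (Idn M G) \<eta> = restrict \<eta> (Ob L)"
    using nat_hom[OF \<eta>] model_ob[OF F] model_ob[OF G]
    by (auto simp: models_def D.Cmp_Idn_left D.Cmp_Idn_right intro!: restrict_ext)
  then show "Cmp M F F G \<eta> (Idn M F) = \<eta>" "Cmp M F G G (Idn M G) \<eta> = \<eta>"
    using ext by simp_all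
next
  fix F G H J \<eta> \<theta> \<kappa>
  assume "F \<in> Ob M" "G \<in> Ob M" "H \<in> Ob M" "J \<in> Ob M" "\<eta> \<in> Hom M F G" "\<theta> \<in> Hom M G H" "\<kappa> \<in> Hom M H J"
  then show "Cmp M F G J (Cmp M G H J \<kappa> \<theta>) \<eta> = Cmp M F H J \<kappa> (Cmp M F G H \<theta> \<eta>)"
    using nat_hom model_ob by (auto simp: models_def[of L D] D.Cmp_assoc intro!: restrict_ext)
qed

sublocale M: category M
  by (rule category_models)

text \<open>The constant functor with value \<open>U\<close> is a model, since every cone over copies of a terminal object with
  a terminal vertex is a product. So \<open>Z\<close> is a retract of this functor, and a retract of a terminal object is
  terminal.\<close>

lemma terminal_models:
  assumes U: "terminal_object D U" and Z: "terminal_object M Z" and X: "X \<in> Ob L"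
  shows "terminal_object D (Fo Z X)"
proof -
  define c :: "('o, 'm, 'p, 'n) cfunctor" where "c = \<lparr>Fo = (\<lambda>_. U), Fm = (\<lambda>_ _ _. Idn D U)\<rparr>"
  have one_ob: "U \<in> Ob D" using U by (simp add: terminal_object_def)
  have one_eq: "f = g" if "W \<in> Ob D" "f \<in> Hom D W U" "g \<in> Hom D W U" for W f g
    using U that unfolding terminal_object_def by blast
  have "product_cone D I (\<lambda>_. U) U (\<lambda>_. Idn D U)" for I
    unfolding product_cone_def
  proof (intro conjI ballI allI impI one_ob D.Idn_in_Hom)
    fix W f assume W: "W \<in> Ob D" and f: "\<forall>i \<in> I. f i \<in> Hom D W U"
    obtain h where h: "h \<in> Hom D W U" using U W unfolding terminal_object_def by blast
    have "Cmp D W U U (Idn D U) h = f i" if "i \<in> I" for i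
      using one_eq[OF W] f that h D.Cmp_Idn_left[OF W one_ob h] by simp
    then show "\<exists>!h. h \<in> Hom D W U \<and> (\<forall>i \<in> I. Cmp D W U U (Idn D U) h = f i)"
      using h one_eq[OF W] by blast
  qed
  then have c: "c \<in> Ob M"
    by (simp add: models_def is_functor_def preserves_finite_products_def c_def one_ob D.Idn_in_Hom
        D.Cmp_Idn_left[OF one_ob one_ob D.Idn_in_Hom])
  have Z_ob: "Z \<in> Ob M" using Z by (simp add: terminal_object_def)
  have "\<exists>u. \<forall>Y \<in> Ob L. u Y \<in> Hom D (Fo Z Y) U"
    using U model_ob[OF Z_ob] unfolding terminal_object_def by (intro bchoice ballI) blast
  then obtain u where u: "\<And>Y. Y \<in> Ob L \<Longrightarrow> u Y \<in> Hom D (Fo Z Y) U" by blast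
  have u': "restrict u (Ob L) \<in> Hom M Z c"
  proof (rule natI)
    fix X Y f assume X: "X \<in> Ob L" and Y: "Y \<in> Ob L" and f: "f \<in> Hom L X Y"
    note ZX = model_ob[OF Z_ob X] and ZY = model_ob[OF Z_ob Y]
    show "Cmp D (Fo Z X) (Fo c X) (Fo c Y) (Fm c X Y f) (u X) = Cmp D (Fo Z X) (Fo Z Y) (Fo c Y) (u Y) (Fm Z X Y f)"
      using one_eq[OF ZX D.Cmp_in_Hom[OF ZX one_ob one_ob u[OF X] D.Idn_in_Hom[OF one_ob]]
          D.Cmp_in_Hom[OF ZX ZY one_ob model_hom[OF Z_ob X Y f] u[OF Y]]] by (simp add: c_def)
  qed (simp add: c_def u)
  obtain v where v: "v \<in> Hom M c Z" using Z c unfolding terminal_object_def by blast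
  have "Cmp M Z c Z v (restrict u (Ob L)) = Idn M Z"
    using Z M.Cmp_in_Hom[OF Z_ob c Z_ob u' v] M.Idn_in_Hom[OF Z_ob] Z_ob unfolding terminal_object_def by blast
  from fun_cong[OF this, of X] have vu: "Cmp D (Fo Z X) U (Fo Z X) (v X) (u X) = Idn D (Fo Z X)"
    using X by (simp add: c_def)
  have vX: "v X \<in> Hom D U (Fo Z X)" using nat_hom[OF v X] by (simp add: c_def)
  note ZX = model_ob[OF Z_ob X]
  show ?thesis
    unfolding terminal_object_def
  proof (intro conjI ballI ZX)
    fix W assume W: "W \<in> Ob D"
    obtain t where t: "t \<in> Hom D W U" using U W unfolding terminal_object_def by blast
    have "f = g" if fg: "f \<in> Hom D W (Fo Z X)" "g \<in> Hom D W (Fo Z X)" for f g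
    proof -
      have *: "Cmp D W U (Fo Z X) (v X) (Cmp D W (Fo Z X) U (u X) f) = f" if "f \<in> Hom D W (Fo Z X)" for f
        using D.Cmp_assoc[OF W ZX one_ob ZX that u[OF X] vX] D.Cmp_Idn_left[OF W ZX that] by (simp add: vu)
      have "Cmp D W (Fo Z X) U (u X) f = Cmp D W (Fo Z X) U (u X) g"
        by (rule one_eq[OF W]) (rule D.Cmp_in_Hom[OF W ZX one_ob _ u[OF X]], rule fg)+
      then have "Cmp D W U (Fo Z X) (v X) (Cmp D W (Fo Z X) U (u X) f) = Cmp D W U (Fo Z X) (v X) (Cmp D W (Fo Z X) U (u X) g)"
        by (rule arg_cong)
      then show ?thesis unfolding *[OF fg(1)] *[OF fg(2)] .
    qed
    then show "\<exists>!f. f \<in> Hom D W (Fo Z X)"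
      using D.Cmp_in_Hom[OF W one_ob ZX t vX] by blast
  qed
qed

end

locale models_in_pullbacks = models_in +
  assumes pullbacks: "\<And>A E B f g. A \<in> Ob D \<Longrightarrow> E \<in> Ob D \<Longrightarrow> B \<in> Ob D \<Longrightarrow> f \<in> Hom D A B \<Longrightarrow>
    g \<in> Hom D E B \<Longrightarrow> \<exists>P a e. pullback D A E B f g P a e"
begin

text \<open>The pullbacks of the values form a functor by their universal property. It preserves products since
  maps into them and maps into pullbacks are both determined by components, in whichever order the
  components are taken.\<close>

lemma pullback_models:
  assumes F: "F \<in> Ob M" and G: "G \<in> Ob M" and H: "H \<in> Ob M"
    and \<phi>: "\<phi> \<in> Hom M F H" and \<psi>: "\<psi> \<in> Hom M G H"
  obtains Q a e where "pullback M F G H \<phi> \<psi> Q a e"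
    "\<And>X. X \<in> Ob L \<Longrightarrow> pullback D (Fo F X) (Fo G X) (Fo H X) (\<phi> X) (\<psi> X) (Fo Q X) (a X) (e X)"
proof -
  note FX = model_ob[OF F] and GX = model_ob[OF G] and HX = model_ob[OF H]
  note Ff = model_hom[OF F] and Gf = model_hom[OF G] and Hf = model_hom[OF H]
  note \<phi>X = nat_hom[OF \<phi>] and \<psi>X = nat_hom[OF \<psi>]
  have "\<exists>R. \<forall>X \<in> Ob L. pullback D (Fo F X) (Fo G X) (Fo H X) (\<phi> X) (\<psi> X) (fst (R X)) (fst (snd (R X))) (snd (snd (R X)))"
  proof (rule bchoice, rule ballI)
    fix X assume X: "X \<in> Ob L"
    obtain P a e where "pullback D (Fo F X) (Fo G X) (Fo H X) (\<phi> X) (\<psi> X) P a e"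
      using pullbacks[OF FX[OF X] GX[OF X] HX[OF X] \<phi>X[OF X] \<psi>X[OF X]] by blast
    then show "\<exists>R. pullback D (Fo F X) (Fo G X) (Fo H X) (\<phi> X) (\<psi> X) (fst R) (fst (snd R)) (snd (snd R))"
      by (intro exI[of _ "(P, a, e)"]) simp
  qed
  then obtain R where R: "\<forall>X \<in> Ob L. pullback D (Fo F X) (Fo G X) (Fo H X) (\<phi> X) (\<psi> X)
      (fst (R X)) (fst (snd (R X))) (snd (snd (R X)))" ..
  define q where "q X = fst (R X)" for X
  define a where "a X = fst (snd (R X))" for X
  define e where "e X = snd (snd (R X))" for X
  have pb: "pullback D (Fo F X) (Fo G X) (Fo H X) (\<phi> X) (\<psi> X) (q X) (a X) (e X)" if "X \<in> Ob L" for X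
    using R that by (simp add: q_def a_def e_def)
  have qX: "q X \<in> Ob D" and aX: "a X \<in> Hom D (q X) (Fo F X)" and eX: "e X \<in> Hom D (q X) (Fo G X)"
    and ae: "Cmp D (q X) (Fo F X) (Fo H X) (\<phi> X) (a X) = Cmp D (q X) (Fo G X) (Fo H X) (\<psi> X) (e X)"
    if "X \<in> Ob L" for X
    using pullbackD[OF pb[OF that]] by auto
  have lift: "\<exists>h. h \<in> Hom D W (q X) \<and> Cmp D W (q X) (Fo F X) (a X) h = x \<and> Cmp D W (q X) (Fo G X) (e X) h = y"
    if "X \<in> Ob L" "W \<in> Ob D" "x \<in> Hom D W (Fo F X)" "y \<in> Hom D W (Fo G X)"
      "Cmp D W (Fo F X) (Fo H X) (\<phi> X) x = Cmp D W (Fo G X) (Fo H X) (\<psi> X) y" for X W x y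
    using pullback_lift[OF pb[OF that(1)] that(2-5)] by blast
  have ext: "h = h'"
    if "X \<in> Ob L" "W \<in> Ob D" "h \<in> Hom D W (q X)" "h' \<in> Hom D W (q X)"
      "Cmp D W (q X) (Fo F X) (a X) h = Cmp D W (q X) (Fo F X) (a X) h'"
      "Cmp D W (q X) (Fo G X) (e X) h = Cmp D W (q X) (Fo G X) (e X) h'" for X W h h'
    using D.pullback_ext[OF pb[OF that(1)] FX[OF that(1)] GX[OF that(1)] HX[OF that(1)] \<phi>X[OF that(1)]
        \<psi>X[OF that(1)] that(2-6)] .
  have ae_app: "Cmp D W (Fo F X) (Fo H X) (\<phi> X) (Cmp D W (q X) (Fo F X) (a X) h) =
      Cmp D W (Fo G X) (Fo H X) (\<psi> X) (Cmp D W (q X) (Fo G X) (e X) h)"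
    if X: "X \<in> Ob L" and W: "W \<in> Ob D" and h: "h \<in> Hom D W (q X)" for X W h
    using D.Cmp_assoc[OF W qX[OF X] FX[OF X] HX[OF X] h aX[OF X] \<phi>X[OF X]]
      D.Cmp_assoc[OF W qX[OF X] GX[OF X] HX[OF X] h eX[OF X] \<psi>X[OF X]] ae[OF X] by simp
  have "\<exists>m. \<forall>X \<in> Ob L. \<forall>Y \<in> Ob L. \<forall>f \<in> Hom L X Y. m X Y f \<in> Hom D (q X) (q Y) \<and>
      Cmp D (q X) (q Y) (Fo F Y) (a Y) (m X Y f) = Cmp D (q X) (Fo F X) (Fo F Y) (Fm F X Y f) (a X) \<and>
      Cmp D (q X) (q Y) (Fo G Y) (e Y) (m X Y f) = Cmp D (q X) (Fo G X) (Fo G Y) (Fm G X Y f) (e X)"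
  proof -
    have "\<exists>h. h \<in> Hom D (q X) (q Y) \<and>
        Cmp D (q X) (q Y) (Fo F Y) (a Y) h = Cmp D (q X) (Fo F X) (Fo F Y) (Fm F X Y f) (a X) \<and>
        Cmp D (q X) (q Y) (Fo G Y) (e Y) h = Cmp D (q X) (Fo G X) (Fo G Y) (Fm G X Y f) (e X)"
      if X: "X \<in> Ob L" and Y: "Y \<in> Ob L" and f: "f \<in> Hom L X Y" for X Y f
      by (rule lift[OF Y qX[OF X] D.Cmp_in_Hom[OF qX[OF X] FX[OF X] FX[OF Y] aX[OF X] Ff[OF X Y f]]
            D.Cmp_in_Hom[OF qX[OF X] GX[OF X] GX[OF Y] eX[OF X] Gf[OF X Y f]]])
        (simp add: nat_app[OF F H \<phi> X Y f qX[OF X] aX[OF X], symmetric]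
          nat_app[OF G H \<psi> X Y f qX[OF X] eX[OF X], symmetric] ae[OF X])
    then show ?thesis by metis
  qed
  then obtain m where m: "\<forall>X \<in> Ob L. \<forall>Y \<in> Ob L. \<forall>f \<in> Hom L X Y. m X Y f \<in> Hom D (q X) (q Y) \<and>
      Cmp D (q X) (q Y) (Fo F Y) (a Y) (m X Y f) = Cmp D (q X) (Fo F X) (Fo F Y) (Fm F X Y f) (a X) \<and>
      Cmp D (q X) (q Y) (Fo G Y) (e Y) (m X Y f) = Cmp D (q X) (Fo G X) (Fo G Y) (Fm G X Y f) (e X)" ..
  have mh: "m X Y f \<in> Hom D (q X) (q Y)"
    and ma: "Cmp D (q X) (q Y) (Fo F Y) (a Y) (m X Y f) = Cmp D (q X) (Fo F X) (Fo F Y) (Fm F X Y f) (a X)"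
    and me: "Cmp D (q X) (q Y) (Fo G Y) (e Y) (m X Y f) = Cmp D (q X) (Fo G X) (Fo G Y) (Fm G X Y f) (e X)"
    if "X \<in> Ob L" "Y \<in> Ob L" "f \<in> Hom L X Y" for X Y f
    using m that by auto
  have ma_app: "Cmp D W (q Y) (Fo F Y) (a Y) (Cmp D W (q X) (q Y) (m X Y f) h) =
        Cmp D W (Fo F X) (Fo F Y) (Fm F X Y f) (Cmp D W (q X) (Fo F X) (a X) h)"
    and me_app: "Cmp D W (q Y) (Fo G Y) (e Y) (Cmp D W (q X) (q Y) (m X Y f) h) =
        Cmp D W (Fo G X) (Fo G Y) (Fm G X Y f) (Cmp D W (q X) (Fo G X) (e X) h)"
    if X: "X \<in> Ob L" and Y: "Y \<in> Ob L" and f: "f \<in> Hom L X Y" and W: "W \<in> Ob D" and h: "h \<in> Hom D W (q X)"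
    for X Y f W h
  proof -
    show "Cmp D W (q Y) (Fo F Y) (a Y) (Cmp D W (q X) (q Y) (m X Y f) h) =
        Cmp D W (Fo F X) (Fo F Y) (Fm F X Y f) (Cmp D W (q X) (Fo F X) (a X) h)"
      using D.Cmp_assoc[OF W qX[OF X] qX[OF Y] FX[OF Y] h mh[OF X Y f] aX[OF Y]]
        D.Cmp_assoc[OF W qX[OF X] FX[OF X] FX[OF Y] h aX[OF X] Ff[OF X Y f]] ma[OF X Y f] by simp
    show "Cmp D W (q Y) (Fo G Y) (e Y) (Cmp D W (q X) (q Y) (m X Y f) h) =
        Cmp D W (Fo G X) (Fo G Y) (Fm G X Y f) (Cmp D W (q X) (Fo G X) (e X) h)"
      using D.Cmp_assoc[OF W qX[OF X] qX[OF Y] GX[OF Y] h mh[OF X Y f] eX[OF Y]]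
        D.Cmp_assoc[OF W qX[OF X] GX[OF X] GX[OF Y] h eX[OF X] Gf[OF X Y f]] me[OF X Y f] by simp
  qed
  define Q where "Q = \<lparr>Fo = q, Fm = m\<rparr>"
  have Q_simps [simp]: "Fo Q = q" "Fm Q = m" by (simp_all add: Q_def)
  have functorial: "is_functor L D Q"
    unfolding is_functor_def Q_simps
  proof (intro conjI ballI qX mh)
    fix X assume X: "X \<in> Ob L"
    note id = L.Idn_in_Hom[OF X]
    show "m X X (Idn L X) = Idn D (q X)"
      by (rule ext[OF X qX[OF X] mh[OF X X id] D.Idn_in_Hom[OF qX[OF X]]])
        (simp_all add: ma[OF X X id] me[OF X X id] model_idn[OF F X] model_idn[OF G X]
          D.Cmp_Idn_right qX FX GX aX eX X D.Cmp_Idn_left)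
    fix Y Z f g assume Y: "Y \<in> Ob L" and Z: "Z \<in> Ob L" and f: "f \<in> Hom L X Y" and g: "g \<in> Hom L Y Z"
    note gf = L.Cmp_in_Hom[OF X Y Z f g]
    show "m X Z (Cmp L X Y Z g f) = Cmp D (q X) (q Y) (q Z) (m Y Z g) (m X Y f)"
    proof (rule ext[OF Z qX[OF X] mh[OF X Z gf] D.Cmp_in_Hom[OF qX[OF X] qX[OF Y] qX[OF Z] mh[OF X Y f] mh[OF Y Z g]]])
      show "Cmp D (q X) (q Z) (Fo F Z) (a Z) (m X Z (Cmp L X Y Z g f)) =
          Cmp D (q X) (q Z) (Fo F Z) (a Z) (Cmp D (q X) (q Y) (q Z) (m Y Z g) (m X Y f))"
        unfolding ma_app[OF Y Z g qX[OF X] mh[OF X Y f]] ma[OF X Z gf] ma[OF X Y f] model_cmp[OF F X Y Z f g]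
        by (rule D.Cmp_assoc[OF qX[OF X] FX[OF X] FX[OF Y] FX[OF Z] aX[OF X] Ff[OF X Y f] Ff[OF Y Z g]])
      show "Cmp D (q X) (q Z) (Fo G Z) (e Z) (m X Z (Cmp L X Y Z g f)) =
          Cmp D (q X) (q Z) (Fo G Z) (e Z) (Cmp D (q X) (q Y) (q Z) (m Y Z g) (m X Y f))"
        unfolding me_app[OF Y Z g qX[OF X] mh[OF X Y f]] me[OF X Z gf] me[OF X Y f] model_cmp[OF G X Y Z f g]
        by (rule D.Cmp_assoc[OF qX[OF X] GX[OF X] GX[OF Y] GX[OF Z] eX[OF X] Gf[OF X Y f] Gf[OF Y Z g]])
    qed
  qed
  have "preserves_finite_products L D Q"
    unfolding preserves_finite_products_def Q_simps
  proof (intro allI impI)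
    fix I A P p assume "finite I \<and> product_cone L I A P p"
    then have I: "finite I" and P: "product_cone L I A P p" by auto
    note PO = product_coneD(1)[OF P] and AO = product_coneD(2)[OF P] and ph = product_coneD(3)[OF P]
    note PF = model_product[OF F I P] and PG = model_product[OF G I P] and PH = model_product[OF H I P]
    show "product_cone D I (\<lambda>i. q (A i)) (q P) (\<lambda>i. m P (A i) (p i))"
      unfolding product_cone_def
    proof (intro conjI ballI allI impI qX PO AO mh ph)
      fix W f assume W: "W \<in> Ob D" and f: "\<forall>i \<in> I. f i \<in> Hom D W (q (A i))"
      have af: "Cmp D W (q (A i)) (Fo F (A i)) (a (A i)) (f i) \<in> Hom D W (Fo F (A i))"
        and ef: "Cmp D W (q (A i)) (Fo G (A i)) (e (A i)) (f i) \<in> Hom D W (Fo G (A i))" if "i \<in> I" for i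
        using that f W by (auto intro!: D.Cmp_in_Hom qX AO FX GX aX eX)
      obtain x where x: "x \<in> Hom D W (Fo F P)"
        "\<And>i. i \<in> I \<Longrightarrow> Cmp D W (Fo F P) (Fo F (A i)) (Fm F P (A i) (p i)) x = Cmp D W (q (A i)) (Fo F (A i)) (a (A i)) (f i)"
        using product_cone_lift[OF PF W af] by blast
      obtain y where y: "y \<in> Hom D W (Fo G P)"
        "\<And>i. i \<in> I \<Longrightarrow> Cmp D W (Fo G P) (Fo G (A i)) (Fm G P (A i) (p i)) y = Cmp D W (q (A i)) (Fo G (A i)) (e (A i)) (f i)"
        using product_cone_lift[OF PG W ef] by blast
      have "Cmp D W (Fo F P) (Fo H P) (\<phi> P) x = Cmp D W (Fo G P) (Fo H P) (\<psi> P) y"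
        by (rule D.product_cone_ext[OF PH W nat_app_closed[OF F H \<phi> PO W x(1)] nat_app_closed[OF G H \<psi> PO W y(1)]])
          (use f in \<open>simp add: nat_app[OF F H \<phi> PO AO ph W x(1)] nat_app[OF G H \<psi> PO AO ph W y(1)] x(2) y(2) ae_app[OF AO W]\<close>)
      then obtain h where h: "h \<in> Hom D W (q P)" "Cmp D W (q P) (Fo F P) (a P) h = x" "Cmp D W (q P) (Fo G P) (e P) h = y"
        using lift[OF PO W x(1) y(1)] by blast
      have "Cmp D W (q P) (q (A i)) (m P (A i) (p i)) h = f i" if i: "i \<in> I" for i
        by (rule ext[OF AO[OF i] W D.Cmp_in_Hom[OF W qX[OF PO] qX[OF AO[OF i]] h(1) mh[OF PO AO[OF i] ph[OF i]]]])
          (use f i in \<open>simp_all add: ma_app[OF PO AO[OF i] ph[OF i] W h(1)] me_app[OF PO AO[OF i] ph[OF i] W h(1)] h x y\<close>)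
      moreover have "h' = h" if h': "h' \<in> Hom D W (q P)" "\<forall>i \<in> I. Cmp D W (q P) (q (A i)) (m P (A i) (p i)) h' = f i" for h'
      proof (rule ext[OF PO W h'(1) h(1)])
        show "Cmp D W (q P) (Fo F P) (a P) h' = Cmp D W (q P) (Fo F P) (a P) h"
          by (rule D.product_cone_ext[OF PF W D.Cmp_in_Hom[OF W qX[OF PO] FX[OF PO] h'(1) aX[OF PO]]
                D.Cmp_in_Hom[OF W qX[OF PO] FX[OF PO] h(1) aX[OF PO]]])
            (simp add: ma_app[OF PO AO ph W h'(1), symmetric] h'(2) h x)
        show "Cmp D W (q P) (Fo G P) (e P) h' = Cmp D W (q P) (Fo G P) (e P) h"
          by (rule D.product_cone_ext[OF PG W D.Cmp_in_Hom[OF W qX[OF PO] GX[OF PO] h'(1) eX[OF PO]]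
                D.Cmp_in_Hom[OF W qX[OF PO] GX[OF PO] h(1) eX[OF PO]]])
            (simp add: me_app[OF PO AO ph W h'(1), symmetric] h'(2) h y)
      qed
      ultimately show "\<exists>!h. h \<in> Hom D W (q P) \<and> (\<forall>i \<in> I. Cmp D W (q P) (q (A i)) (m P (A i) (p i)) h = f i)"
        using h(1) by blast
    qed
  qed
  with functorial have Q: "Q \<in> Ob M" by (simp add: models_def)
  let ?a = "restrict a (Ob L)" and ?e = "restrict e (Ob L)"
  have a': "?a \<in> Hom M Q F" by (rule natI) (simp_all add: aX ma)
  have e': "?e \<in> Hom M Q G" by (rule natI) (simp_all add: eX me)
  have "pullback M F G H \<phi> \<psi> Q ?a ?e"
    unfolding pullback_def
  proof (intro conjI ballI impI Q a' e')
    show "Cmp M Q F H \<phi> ?a = Cmp M Q G H \<psi> ?e"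
      by (rule nat_eqI[OF M.Cmp_in_Hom[OF Q F H a' \<phi>] M.Cmp_in_Hom[OF Q G H e' \<psi>]]) (simp add: ae)
    fix V x y assume V: "V \<in> Ob M" and x: "x \<in> Hom M V F" and y: "y \<in> Hom M V G"
      and xy: "Cmp M V F H \<phi> x = Cmp M V G H \<psi> y"
    note VX = model_ob[OF V] and xX = nat_hom[OF x] and yX = nat_hom[OF y]
    have "\<exists>h. \<forall>X \<in> Ob L. h X \<in> Hom D (Fo V X) (q X) \<and> Cmp D (Fo V X) (q X) (Fo F X) (a X) (h X) = x X \<and>
        Cmp D (Fo V X) (q X) (Fo G X) (e X) (h X) = y X"
      by (intro bchoice ballI lift VX xX yX) (use fun_cong[OF xy] in \<open>simp_all split: if_splits\<close>, metis cmp_M)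
    then obtain h where h: "\<And>X. X \<in> Ob L \<Longrightarrow> h X \<in> Hom D (Fo V X) (q X)"
      "\<And>X. X \<in> Ob L \<Longrightarrow> Cmp D (Fo V X) (q X) (Fo F X) (a X) (h X) = x X"
      "\<And>X. X \<in> Ob L \<Longrightarrow> Cmp D (Fo V X) (q X) (Fo G X) (e X) (h X) = y X" by blast
    have h': "restrict h (Ob L) \<in> Hom M V Q"
    proof (rule natI; unfold Q_simps)
      fix X Y f assume X: "X \<in> Ob L" and Y: "Y \<in> Ob L" and f: "f \<in> Hom L X Y"
      note Vf = model_hom[OF V X Y f]
      show "Cmp D (Fo V X) (q X) (q Y) (m X Y f) (h X) = Cmp D (Fo V X) (Fo V Y) (q Y) (h Y) (Fm V X Y f)"
      proof (rule ext[OF Y VX[OF X] D.Cmp_in_Hom[OF VX[OF X] qX[OF X] qX[OF Y] h(1)[OF X] mh[OF X Y f]]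
            D.Cmp_in_Hom[OF VX[OF X] VX[OF Y] qX[OF Y] Vf h(1)[OF Y]]])
        show "Cmp D (Fo V X) (q Y) (Fo F Y) (a Y) (Cmp D (Fo V X) (q X) (q Y) (m X Y f) (h X)) =
            Cmp D (Fo V X) (q Y) (Fo F Y) (a Y) (Cmp D (Fo V X) (Fo V Y) (q Y) (h Y) (Fm V X Y f))"
          unfolding ma_app[OF X Y f VX[OF X] h(1)[OF X]]
            D.Cmp_assoc[OF VX[OF X] VX[OF Y] qX[OF Y] FX[OF Y] Vf h(1)[OF Y] aX[OF Y], symmetric] h(2)[OF X] h(2)[OF Y]
          by (rule nat_natural[OF x X Y f])
        show "Cmp D (Fo V X) (q Y) (Fo G Y) (e Y) (Cmp D (Fo V X) (q X) (q Y) (m X Y f) (h X)) =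
            Cmp D (Fo V X) (q Y) (Fo G Y) (e Y) (Cmp D (Fo V X) (Fo V Y) (q Y) (h Y) (Fm V X Y f))"
          unfolding me_app[OF X Y f VX[OF X] h(1)[OF X]]
            D.Cmp_assoc[OF VX[OF X] VX[OF Y] qX[OF Y] GX[OF Y] Vf h(1)[OF Y] eX[OF Y], symmetric] h(3)[OF X] h(3)[OF Y]
          by (rule nat_natural[OF y X Y f])
      qed
    qed (rule h)
    show "\<exists>!h. h \<in> Hom M V Q \<and> Cmp M V Q F ?a h = x \<and> Cmp M V Q G ?e h = y"
    proof (intro ex1I[of _ "restrict h (Ob L)"] conjI h')
      show "Cmp M V Q F ?a (restrict h (Ob L)) = x"
        by (rule nat_eqI[OF M.Cmp_in_Hom[OF V Q F h' a'] x]) (simp add: h)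
      show "Cmp M V Q G ?e (restrict h (Ob L)) = y"
        by (rule nat_eqI[OF M.Cmp_in_Hom[OF V Q G h' e'] y]) (simp add: h)
      fix k assume k: "k \<in> Hom M V Q \<and> Cmp M V Q F ?a k = x \<and> Cmp M V Q G ?e k = y"
      show "k = restrict h (Ob L)"
      proof (rule nat_eqI[OF conjunct1[OF k] h'])
        fix X assume X: "X \<in> Ob L"
        have "Cmp M V Q F ?a k X = x X" "Cmp M V Q G ?e k X = y X" using k by auto
        moreover have "k X \<in> Hom D (Fo V X) (q X)" using nat_hom[OF conjunct1[OF k] X] by simp
        ultimately show "k X = restrict h (Ob L) X"
          using ext[OF X VX[OF X] _ h(1)[OF X], of "k X"] X h by simp
      qed
    qed
  qed
  moreover have "pullback D (Fo F X) (Fo G X) (Fo H X) (\<phi> X) (\<psi> X) (Fo Q X) (?a X) (?e X)" if "X \<in> Ob L" for X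
    using pb[OF that] that by simp
  ultimately show thesis by (rule that)
qed

text \<open>Comparison with the pointwise pullback exhibits \<open>P(X)\<close> as a retract of a pullback, compatibly with the
  projections.\<close>

lemma pullback_pointwise:
  assumes F: "F \<in> Ob M" and G: "G \<in> Ob M" and H: "H \<in> Ob M"
    and \<phi>: "\<phi> \<in> Hom M F H" and \<psi>: "\<psi> \<in> Hom M G H"
    and pb: "pullback M F G H \<phi> \<psi> P a e" and X: "X \<in> Ob L"
  shows "pullback D (Fo F X) (Fo G X) (Fo H X) (\<phi> X) (\<psi> X) (Fo P X) (a X) (e X)"
proof -
  obtain Q b c where Q: "pullback M F G H \<phi> \<psi> Q b c"
    and QX: "pullback D (Fo F X) (Fo G X) (Fo H X) (\<phi> X) (\<psi> X) (Fo Q X) (b X) (c X)"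
    using pullback_models[OF F G H \<phi> \<psi>] X by metis
  note P' = pullbackD[OF pb] and Q' = pullbackD[OF Q]
  obtain u where u: "u \<in> Hom M P Q" "Cmp M P Q F b u = a" "Cmp M P Q G c u = e"
    using pullback_lift[OF Q P'] .
  obtain w where w: "w \<in> Hom M Q P" "Cmp M Q P F a w = b" "Cmp M Q P G e w = c"
    using pullback_lift[OF pb Q'] .
  have "Cmp M P Q P w u = Idn M P"
    by (rule M.pullback_ext[OF pb F G H \<phi> \<psi> P'(1) M.Cmp_in_Hom[OF P'(1) Q'(1) P'(1) u(1) w(1)] M.Idn_in_Hom[OF P'(1)]])
      (simp_all add: M.Cmp_assoc[OF P'(1) Q'(1) P'(1) _ u(1) w(1), symmetric] F G H P' Q' u w M.Cmp_Idn_right)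
  then have wu: "Cmp M P Q P w u X = Idn D (Fo P X)" using X by simp
  note PX = model_ob[OF P'(1) X] and QO = model_ob[OF Q'(1) X]
  show ?thesis
    unfolding pullback_def
  proof (intro conjI ballI impI PX nat_hom[OF P'(2) X] nat_hom[OF P'(3) X])
    show "Cmp D (Fo P X) (Fo F X) (Fo H X) (\<phi> X) (a X) = Cmp D (Fo P X) (Fo G X) (Fo H X) (\<psi> X) (e X)"
      using fun_cong[OF P'(4), of X] X by simp
    fix W x y assume W: "W \<in> Ob D" and x: "x \<in> Hom D W (Fo F X)" and y: "y \<in> Hom D W (Fo G X)"
      and xy: "Cmp D W (Fo F X) (Fo H X) (\<phi> X) x = Cmp D W (Fo G X) (Fo H X) (\<psi> X) y"
    obtain h where h: "h \<in> Hom D W (Fo Q X)" "Cmp D W (Fo Q X) (Fo F X) (b X) h = x" "Cmp D W (Fo Q X) (Fo G X) (c X) h = y"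
      using pullback_lift[OF QX W x y xy] .
    let ?h = "Cmp D W (Fo Q X) (Fo P X) (w X) h"
    have "?h \<in> Hom D W (Fo P X)" by (rule nat_app_closed[OF Q'(1) P'(1) w(1) X W h(1)])
    moreover have "Cmp D W (Fo P X) (Fo F X) (a X) ?h = x"
      using nat_cmp_app[OF Q'(1) P'(1) F w(1) P'(2) X W h(1)] w(2) h(2) by simp
    moreover have "Cmp D W (Fo P X) (Fo G X) (e X) ?h = y"
      using nat_cmp_app[OF Q'(1) P'(1) G w(1) P'(3) X W h(1)] w(3) h(3) by simp
    moreover have "k = k'" if k: "k \<in> Hom D W (Fo P X)" "k' \<in> Hom D W (Fo P X)"
      "Cmp D W (Fo P X) (Fo F X) (a X) k = Cmp D W (Fo P X) (Fo F X) (a X) k'"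
      "Cmp D W (Fo P X) (Fo G X) (e X) k = Cmp D W (Fo P X) (Fo G X) (e X) k'" for k k'
    proof -
      have "Cmp D W (Fo P X) (Fo Q X) (u X) k = Cmp D W (Fo P X) (Fo Q X) (u X) k'"
        by (rule D.pullback_ext[OF QX model_ob[OF F X] model_ob[OF G X] model_ob[OF H X] nat_hom[OF \<phi> X] nat_hom[OF \<psi> X] W
              nat_app_closed[OF P'(1) Q'(1) u(1) X W k(1)] nat_app_closed[OF P'(1) Q'(1) u(1) X W k(2)]])
          (simp_all only: nat_cmp_app[OF P'(1) Q'(1) F u(1) Q'(2) X W k(1)] nat_cmp_app[OF P'(1) Q'(1) G u(1) Q'(3) X W k(1)]
            nat_cmp_app[OF P'(1) Q'(1) F u(1) Q'(2) X W k(2)] nat_cmp_app[OF P'(1) Q'(1) G u(1) Q'(3) X W k(2)] u k)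
      then have "Cmp D W (Fo P X) (Fo P X) (Cmp M P Q P w u X) k = Cmp D W (Fo P X) (Fo P X) (Cmp M P Q P w u X) k'"
        by (simp only: nat_cmp_app[OF P'(1) Q'(1) P'(1) u(1) w(1) X W k(1), symmetric]
            nat_cmp_app[OF P'(1) Q'(1) P'(1) u(1) w(1) X W k(2), symmetric])
      then show ?thesis
        by (simp only: wu D.Cmp_Idn_left[OF W PX k(1)] D.Cmp_Idn_left[OF W PX k(2)])
    qed
    ultimately show "\<exists>!h. h \<in> Hom D W (Fo P X) \<and> Cmp D W (Fo P X) (Fo F X) (a X) h = x \<and>
        Cmp D W (Fo P X) (Fo G X) (e X) h = y" by metis
  qed
qed

end

section \<open>Protomodularity from generalised elements\<close>

locale models_of_theory = models_in_pullbacks L D + lawvere_theory L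
  for L :: "('o, 'm, 'y) lawvere_scheme" and D :: "('p, 'n, 'z) cat_scheme"
begin

abbreviation "pow_el F W n i x \<equiv> Cmp D W (Fo F (pow L n)) (Fo F (pow L 1)) (Fm F (pow L n) (pow L 1) (proj L n i)) x"
abbreviation "term_el F W n t x \<equiv> Cmp D W (Fo F (pow L n)) (Fo F (pow L 1)) (Fm F (pow L n) (pow L 1) t) x"
abbreviation "nat_el F G \<eta> W x \<equiv> Cmp D W (Fo F (pow L 1)) (Fo G (pow L 1)) (\<eta> (pow L 1)) x"

lemma pow_ob: "pow L n \<in> Ob L"
  by (simp add: Ob_eq_powers)

lemma proj_hom: "i < n \<Longrightarrow> proj L n i \<in> Hom L (pow L n) (pow L 1)"
  using product_coneD(3)[OF pow_product] by blast

lemma model_pow: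
  "F \<in> Ob M \<Longrightarrow> product_cone D {..<n} (\<lambda>_. Fo F (pow L 1)) (Fo F (pow L n)) (\<lambda>i. Fm F (pow L n) (pow L 1) (proj L n i))"
  using model_product[OF _ _ pow_product] by simp

lemma tuple:
  assumes "F \<in> Ob M" "W \<in> Ob D" "\<And>i. i < n \<Longrightarrow> x i \<in> Hom D W (Fo F (pow L 1))"
  shows "\<exists>d. d \<in> Hom D W (Fo F (pow L n)) \<and> (\<forall>i < n. pow_el F W n i d = x i)"
  using product_cone_lift[OF model_pow[OF assms(1)] assms(2), of n x] assms(3) by (metis lessThan_iff)

lemma tuple_eqI:
  assumes "F \<in> Ob M" "W \<in> Ob D" "d \<in> Hom D W (Fo F (pow L n))" "d' \<in> Hom D W (Fo F (pow L n))"
    "\<And>i. i < n \<Longrightarrow> pow_el F W n i d = pow_el F W n i d'"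
  shows "d = d'"
  by (rule D.product_cone_ext[OF model_pow[OF assms(1)] assms(2-4)]) (use assms(5) in auto)

text \<open>By the Yoneda lemma, a morphism of models is invertible once it acts bijectively on the
  generalised elements of the underlying object.\<close>

lemma isomorphism_models:
  assumes F: "F \<in> Ob M" and G: "G \<in> Ob M" and \<phi>: "\<phi> \<in> Hom M F G"
    and inj: "\<And>W x y. W \<in> Ob D \<Longrightarrow> x \<in> Hom D W (Fo F (pow L 1)) \<Longrightarrow> y \<in> Hom D W (Fo F (pow L 1)) \<Longrightarrow>
      nat_el F G \<phi> W x = nat_el F G \<phi> W y \<Longrightarrow> x = y"
    and surj: "\<And>W y. W \<in> Ob D \<Longrightarrow> y \<in> Hom D W (Fo G (pow L 1)) \<Longrightarrow>
      \<exists>x \<in> Hom D W (Fo F (pow L 1)). nat_el F G \<phi> W x = y"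
  shows "isomorphism M F G \<phi>"
proof -
  note FX = model_ob[OF F] and GX = model_ob[OF G] and \<phi>X = nat_hom[OF \<phi>]
  have inj': "h = h'"
    if S: "S \<in> Ob L" and W: "W \<in> Ob D" and h: "h \<in> Hom D W (Fo F S)" "h' \<in> Hom D W (Fo F S)"
      and eq: "Cmp D W (Fo F S) (Fo G S) (\<phi> S) h = Cmp D W (Fo F S) (Fo G S) (\<phi> S) h'" for S W h h'
  proof -
    obtain n where n: "S = pow L n" using S by (auto simp: Ob_eq_powers)
    show ?thesis
    proof (rule tuple_eqI[OF F W h[unfolded n]])
      fix i assume i: "i < n"
      show "pow_el F W n i h = pow_el F W n i h'"
      proof (rule inj[OF W])
        show "pow_el F W n i h \<in> Hom D W (Fo F (pow L 1))" "pow_el F W n i h' \<in> Hom D W (Fo F (pow L 1))"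
          by (rule model_app_closed[OF F pow_ob pow_ob proj_hom[OF i] W h(1)[unfolded n]],
              rule model_app_closed[OF F pow_ob pow_ob proj_hom[OF i] W h(2)[unfolded n]])
        show "nat_el F G \<phi> W (pow_el F W n i h) = nat_el F G \<phi> W (pow_el F W n i h')"
          unfolding nat_app[OF F G \<phi> pow_ob pow_ob proj_hom[OF i] W h(1)[unfolded n], symmetric]
            nat_app[OF F G \<phi> pow_ob pow_ob proj_hom[OF i] W h(2)[unfolded n], symmetric]
          using eq by (simp add: n)
      qed
    qed
  qed
  have surj': "\<exists>h. h \<in> Hom D W (Fo F S) \<and> Cmp D W (Fo F S) (Fo G S) (\<phi> S) h = k"
    if S: "S \<in> Ob L" and W: "W \<in> Ob D" and k: "k \<in> Hom D W (Fo G S)" for S W k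
  proof -
    obtain n where n: "S = pow L n" using S by (auto simp: Ob_eq_powers)
    have "\<exists>x. \<forall>i \<in> {..<n}. x i \<in> Hom D W (Fo F (pow L 1)) \<and> nat_el F G \<phi> W (x i) = pow_el G W n i k"
      by (rule bchoice) (use surj[OF W model_app_closed[OF G pow_ob pow_ob proj_hom W k[unfolded n]]] in blast)
    then obtain x where x: "\<And>i. i < n \<Longrightarrow> x i \<in> Hom D W (Fo F (pow L 1))"
      "\<And>i. i < n \<Longrightarrow> nat_el F G \<phi> W (x i) = pow_el G W n i k" by blast
    obtain h where h: "h \<in> Hom D W (Fo F (pow L n))" "\<And>i. i < n \<Longrightarrow> pow_el F W n i h = x i"
      using tuple[where n = n and x = x, OF F W x(1)] by blast
    have "Cmp D W (Fo F S) (Fo G S) (\<phi> S) h = k"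
      unfolding n
      by (rule tuple_eqI[OF G W nat_app_closed[OF F G \<phi> pow_ob W h(1)] k[unfolded n]])
        (simp only: nat_app[OF F G \<phi> pow_ob pow_ob proj_hom W h(1)] h(2) x(2))
    then show ?thesis using h(1) n by blast
  qed
  have "\<exists>\<psi>. \<forall>S \<in> Ob L. \<psi> S \<in> Hom D (Fo G S) (Fo F S) \<and> Cmp D (Fo G S) (Fo F S) (Fo G S) (\<phi> S) (\<psi> S) = Idn D (Fo G S)"
    by (intro bchoice ballI surj' GX D.Idn_in_Hom)
  then obtain \<psi> where \<psi>: "\<And>S. S \<in> Ob L \<Longrightarrow> \<psi> S \<in> Hom D (Fo G S) (Fo F S)"
    "\<And>S. S \<in> Ob L \<Longrightarrow> Cmp D (Fo G S) (Fo F S) (Fo G S) (\<phi> S) (\<psi> S) = Idn D (Fo G S)" by blast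
  have \<psi>\<phi>: "Cmp D (Fo F S) (Fo G S) (Fo F S) (\<psi> S) (\<phi> S) = Idn D (Fo F S)" if S: "S \<in> Ob L" for S
  proof (rule inj'[OF S FX[OF S] D.Cmp_in_Hom[OF FX[OF S] GX[OF S] FX[OF S] \<phi>X[OF S] \<psi>(1)[OF S]] D.Idn_in_Hom[OF FX[OF S]]])
    show "Cmp D (Fo F S) (Fo F S) (Fo G S) (\<phi> S) (Cmp D (Fo F S) (Fo G S) (Fo F S) (\<psi> S) (\<phi> S)) =
        Cmp D (Fo F S) (Fo F S) (Fo G S) (\<phi> S) (Idn D (Fo F S))"
      unfolding D.Cmp_assoc[OF FX[OF S] GX[OF S] FX[OF S] GX[OF S] \<phi>X[OF S] \<psi>(1)[OF S] \<phi>X[OF S], symmetric] \<psi>(2)[OF S]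
      by (simp only: D.Cmp_Idn_left[OF FX[OF S] GX[OF S] \<phi>X[OF S]] D.Cmp_Idn_right[OF FX[OF S] GX[OF S] \<phi>X[OF S]])
  qed
  have \<psi>': "restrict \<psi> (Ob L) \<in> Hom M G F"
  proof (rule natI[OF \<psi>(1)])
    fix X Y f assume X: "X \<in> Ob L" and Y: "Y \<in> Ob L" and f: "f \<in> Hom L X Y"
    note Ff = model_hom[OF F X Y f] and Gf = model_hom[OF G X Y f]
    show "Cmp D (Fo G X) (Fo F X) (Fo F Y) (Fm F X Y f) (\<psi> X) = Cmp D (Fo G X) (Fo G Y) (Fo F Y) (\<psi> Y) (Fm G X Y f)"
    proof (rule inj'[OF Y GX[OF X] D.Cmp_in_Hom[OF GX[OF X] FX[OF X] FX[OF Y] \<psi>(1)[OF X] Ff]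
          D.Cmp_in_Hom[OF GX[OF X] GX[OF Y] FX[OF Y] Gf \<psi>(1)[OF Y]]])
      show "Cmp D (Fo G X) (Fo F Y) (Fo G Y) (\<phi> Y) (Cmp D (Fo G X) (Fo F X) (Fo F Y) (Fm F X Y f) (\<psi> X)) =
          Cmp D (Fo G X) (Fo F Y) (Fo G Y) (\<phi> Y) (Cmp D (Fo G X) (Fo G Y) (Fo F Y) (\<psi> Y) (Fm G X Y f))"
        unfolding nat_app[OF F G \<phi> X Y f GX[OF X] \<psi>(1)[OF X], symmetric] \<psi>(2)[OF X]
          D.Cmp_assoc[OF GX[OF X] GX[OF Y] FX[OF Y] GX[OF Y] Gf \<psi>(1)[OF Y] \<phi>X[OF Y], symmetric] \<psi>(2)[OF Y]
        by (simp only: D.Cmp_Idn_left[OF GX[OF X] GX[OF Y] Gf] D.Cmp_Idn_right[OF GX[OF X] GX[OF Y] Gf])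
    qed
  qed
  have "Cmp M F G F (restrict \<psi> (Ob L)) \<phi> = Idn M F"
    by (rule nat_eqI[OF M.Cmp_in_Hom[OF F G F \<phi> \<psi>'] M.Idn_in_Hom[OF F]]) (simp add: \<psi>\<phi>)
  moreover have "Cmp M G F G \<phi> (restrict \<psi> (Ob L)) = Idn M G"
    by (rule nat_eqI[OF M.Cmp_in_Hom[OF G F G \<psi>' \<phi>] M.Idn_in_Hom[OF G]]) (simp add: \<psi>(2))
  ultimately show ?thesis
    unfolding isomorphism_def using \<phi> \<psi>' by blast
qed

text \<open>The generalised element \<open>d\<close> of \<open>T\<^sup>2\<close> is a pair \<open>(x, y)\<close>, and \<open>z\<close> is a tuple of \<open>n + 1\<close> elements. So the
  last two premises are \<open>\<alpha>\<^sub>i(x, x) = 0\<close> and \<open>\<beta>(\<alpha>\<^sub>1(x, y), \<dots>, \<alpha>\<^sub>n(x, y), y) = x\<close>, where \<open>0\<close> is the image of an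
  element of the zero object. Terms are natural in the model and \<open>0\<close> is preserved by all morphisms, so
  one can calculate with generalised elements as in a variety.\<close>

lemma protomodular_models:
  assumes U: "terminal_object D U" and Z: "zero_object M Z"
    and \<alpha>: "\<And>i. i < n \<Longrightarrow> \<alpha> i \<in> Hom L (pow L 2) (pow L 1)"
    and \<beta>: "\<beta> \<in> Hom L (pow L (n + 1)) (pow L 1)"
    and diagonal: "\<And>F \<eta> W d t i. F \<in> Ob M \<Longrightarrow> \<eta> \<in> Hom M Z F \<Longrightarrow> W \<in> Ob D \<Longrightarrow> d \<in> Hom D W (Fo F (pow L 2)) \<Longrightarrow>
      pow_el F W 2 0 d = pow_el F W 2 1 d \<Longrightarrow> t \<in> Hom D W (Fo Z (pow L 1)) \<Longrightarrow> i < n \<Longrightarrow>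
      term_el F W 2 (\<alpha> i) d = nat_el Z F \<eta> W t"
    and reconstruct: "\<And>F W d z. F \<in> Ob M \<Longrightarrow> W \<in> Ob D \<Longrightarrow> d \<in> Hom D W (Fo F (pow L 2)) \<Longrightarrow>
      z \<in> Hom D W (Fo F (pow L (n + 1))) \<Longrightarrow>
      (\<And>i. i < n \<Longrightarrow> pow_el F W (n + 1) i z = term_el F W 2 (\<alpha> i) d) \<Longrightarrow>
      pow_el F W (n + 1) n z = pow_el F W 2 1 d \<Longrightarrow>
      term_el F W (n + 1) \<beta> z = pow_el F W 2 0 d"
  shows "protomodular M"
proof -
  let ?T = "pow L 1"
  have Z_ob: "Z \<in> Ob M" and Z_term: "terminal_object M Z" and Z_init: "initial_object M Z"
    using Z by (auto simp: zero_object_def initial_object_def)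
  have complete: "finitely_complete M"
    unfolding finitely_complete_def
  proof (intro conjI ballI)
    show "\<exists>Z. terminal_object M Z" using Z_term by blast
    fix F G H \<phi> \<psi> assume "F \<in> Ob M" "G \<in> Ob M" "H \<in> Ob M" "\<phi> \<in> Hom M F H" "\<psi> \<in> Hom M G H"
    then show "\<exists>P a e. pullback M F G H \<phi> \<psi> P a e" by (metis pullback_models)
  qed
  \<comment> \<open>Writing \<open>\<alpha>\<^sub>i(x, y)\<close> and \<open>0\<close> for generalised elements.\<close>
  define pr where "pr F W x y = (SOME d. d \<in> Hom D W (Fo F (pow L 2)) \<and> pow_el F W 2 0 d = x \<and> pow_el F W 2 1 d = y)"
    for F :: "('o, 'm, 'p, 'n) cfunctor" and W x y
  define al where "al i F W x y = term_el F W 2 (\<alpha> i) (pr F W x y)" for i and F :: "('o, 'm, 'p, 'n) cfunctor" and W x y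
  define ze where "ze F W = nat_el Z F (SOME \<eta>. \<eta> \<in> Hom M Z F) W (SOME t. t \<in> Hom D W (Fo Z ?T))"
    for F :: "('o, 'm, 'p, 'n) cfunctor" and W
  have pr: "pr F W x y \<in> Hom D W (Fo F (pow L 2))" "pow_el F W 2 0 (pr F W x y) = x" "pow_el F W 2 1 (pr F W x y) = y"
    if F: "F \<in> Ob M" and W: "W \<in> Ob D" and x: "x \<in> Hom D W (Fo F ?T)" and y: "y \<in> Hom D W (Fo F ?T)" for F W x y
  proof -
    have "\<exists>d. d \<in> Hom D W (Fo F (pow L 2)) \<and> (\<forall>i < 2. pow_el F W 2 i d = (if i = 0 then x else y))"
      by (rule tuple[OF F W]) (simp add: x y del: One_nat_def)
    then have "\<exists>d. d \<in> Hom D W (Fo F (pow L 2)) \<and> pow_el F W 2 0 d = x \<and> pow_el F W 2 1 d = y"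
      by (metis one_less_numeral_iff semiring_norm(76) zero_less_numeral zero_neq_one)
    from someI_ex[OF this, folded pr_def]
    show "pr F W x y \<in> Hom D W (Fo F (pow L 2))" "pow_el F W 2 0 (pr F W x y) = x" "pow_el F W 2 1 (pr F W x y) = y"
      by auto
  qed
  have al_closed: "al i F W x y \<in> Hom D W (Fo F ?T)"
    if "F \<in> Ob M" "W \<in> Ob D" "x \<in> Hom D W (Fo F ?T)" "y \<in> Hom D W (Fo F ?T)" "i < n" for i F W x y
    unfolding al_def by (intro model_app_closed pow_ob \<alpha> pr that)
  have al_nat: "nat_el F G \<phi> W (al i F W x y) = al i G W (nat_el F G \<phi> W x) (nat_el F G \<phi> W y)"
    if F: "F \<in> Ob M" and G: "G \<in> Ob M" and \<phi>: "\<phi> \<in> Hom M F G" and W: "W \<in> Ob D"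
      and x: "x \<in> Hom D W (Fo F ?T)" and y: "y \<in> Hom D W (Fo F ?T)" and i: "i < n" for i F G \<phi> W x y
  proof -
    note p = pr[OF F W x y]
    note fx = nat_app_closed[OF F G \<phi> pow_ob W x] and fy = nat_app_closed[OF F G \<phi> pow_ob W y]
    note p' = pr[OF G W fx fy]
    have "Cmp D W (Fo F (pow L 2)) (Fo G (pow L 2)) (\<phi> (pow L 2)) (pr F W x y) =
        pr G W (nat_el F G \<phi> W x) (nat_el F G \<phi> W y)"
    proof (rule tuple_eqI[OF G W nat_app_closed[OF F G \<phi> pow_ob W p(1)] p'(1)])
      fix j :: nat assume j: "j < 2"
      then have "j = 0 \<or> j = 1" by auto
      then show "pow_el G W 2 j (Cmp D W (Fo F (pow L 2)) (Fo G (pow L 2)) (\<phi> (pow L 2)) (pr F W x y)) =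
          pow_el G W 2 j (pr G W (nat_el F G \<phi> W x) (nat_el F G \<phi> W y))"
        unfolding nat_app[OF F G \<phi> pow_ob pow_ob proj_hom[OF j] W p(1)]
        using p p' by (auto simp del: One_nat_def)
    qed
    then show ?thesis
      unfolding al_def using nat_app[OF F G \<phi> pow_ob pow_ob \<alpha>[OF i] W p(1)] by simp
  qed
  have some_t: "(SOME t. t \<in> Hom D W (Fo Z ?T)) \<in> Hom D W (Fo Z ?T)" if "W \<in> Ob D" for W
    using terminal_models[OF U Z_term pow_ob] that unfolding terminal_object_def by (metis someI)
  have some_\<eta>: "(SOME \<eta>. \<eta> \<in> Hom M Z F) \<in> Hom M Z F" if "F \<in> Ob M" for F
    using Z_init that unfolding initial_object_def by (metis someI)
  have ze_closed: "ze F W \<in> Hom D W (Fo F ?T)" if F: "F \<in> Ob M" and W: "W \<in> Ob D" for F W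
    unfolding ze_def by (rule nat_app_closed[OF Z_ob F some_\<eta>[OF F] pow_ob W some_t[OF W]])
  have ze_nat: "nat_el F G \<phi> W (ze F W) = ze G W"
    if F: "F \<in> Ob M" and G: "G \<in> Ob M" and \<phi>: "\<phi> \<in> Hom M F G" and W: "W \<in> Ob D" for F G \<phi> W
  proof -
    have "Cmp M Z F G \<phi> (SOME \<eta>. \<eta> \<in> Hom M Z F) = (SOME \<eta>. \<eta> \<in> Hom M Z G)"
      using Z_init G M.Cmp_in_Hom[OF Z_ob F G some_\<eta>[OF F] \<phi>] some_\<eta>[OF G] unfolding initial_object_def by blast
    then show ?thesis
      unfolding ze_def nat_cmp_app[OF Z_ob F G some_\<eta>[OF F] \<phi> pow_ob W some_t[OF W]] by simp
  qed
  have al_diag: "al i F W x x = ze F W" if "F \<in> Ob M" "W \<in> Ob D" "x \<in> Hom D W (Fo F ?T)" "i < n" for i F W x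
    unfolding al_def ze_def
    using pr[OF that(1,2,3,3)] by (intro diagonal that some_\<eta> some_t) auto
  \<comment> \<open>\<open>\<beta>\<close> recovers \<open>x\<close> from \<open>y\<close> and all \<open>\<alpha>\<^sub>i(x, y)\<close>.\<close>
  have determined: "x = x'"
    if F: "F \<in> Ob M" and W: "W \<in> Ob D" and x: "x \<in> Hom D W (Fo F ?T)" and x': "x' \<in> Hom D W (Fo F ?T)"
      and y: "y \<in> Hom D W (Fo F ?T)" and eq: "\<And>i. i < n \<Longrightarrow> al i F W x y = al i F W x' y" for F W x x' y
  proof -
    have "\<exists>z. z \<in> Hom D W (Fo F (pow L (n + 1))) \<and>
        (\<forall>i < n + 1. pow_el F W (n + 1) i z = (if i < n then al i F W x y else y))"
      by (rule tuple[OF F W]) (simp add: al_closed[OF F W x y] y del: One_nat_def)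
    then obtain z where z: "z \<in> Hom D W (Fo F (pow L (n + 1)))"
      "\<And>i. i < n + 1 \<Longrightarrow> pow_el F W (n + 1) i z = (if i < n then al i F W x y else y)" by blast
    have "term_el F W (n + 1) \<beta> z = x"
      using reconstruct[OF F W pr(1)[OF F W x y] z(1)] z(2) pr[OF F W x y] by (simp add: al_def del: One_nat_def)
    moreover have "term_el F W (n + 1) \<beta> z = x'"
      using reconstruct[OF F W pr(1)[OF F W x' y] z(1)] z(2) pr[OF F W x' y] eq by (simp add: al_def del: One_nat_def)
    ultimately show ?thesis by simp
  qed
  show ?thesis
    unfolding protomodular_def
  proof (intro conjI complete allI impI, elim conjE)
    fix B E v A p s A' p' s' f P a e P' a' e' g
    assume E: "E \<in> Ob M" and v: "v \<in> Hom M E B" and pt: "point_over M B A p s" and pt': "point_over M B A' p' s'"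
      and f: "point_morphism M B A p s A' p' s' f"
      and P: "pullback M A E B p v P a e" and P': "pullback M A' E B p' v P' a' e'"
      and g: "g \<in> Hom M P P'" and ag: "Cmp M P P' A' a' g = Cmp M P A A' f a" and eg: "Cmp M P P' E e' g = e"
      and iso: "isomorphism M P P' g"
    have A: "A \<in> Ob M" and B: "B \<in> Ob M" and p: "p \<in> Hom M A B" and s: "s \<in> Hom M B A"
      using pt by (auto simp: point_over_def)
    have A': "A' \<in> Ob M" and p': "p' \<in> Hom M A' B" and s': "s' \<in> Hom M B A'" and ps': "Cmp M B A' B p' s' = Idn M B"
      using pt' by (auto simp: point_over_def)
    have f': "f \<in> Hom M A A'" and pf: "Cmp M A A' B p' f = p" and fs: "Cmp M B A A' f s = s'"
      using f by (auto simp: point_morphism_def)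
    note PD = pullbackD[OF P] and PD' = pullbackD[OF P']
    obtain k where k: "k \<in> Hom M P' P" "Cmp M P P' P k g = Idn M P" "Cmp M P' P P' g k = Idn M P'"
      using iso by (auto simp: isomorphism_def)
    note PT = pullback_pointwise[OF A E B p v P pow_ob[of 1]] and PT' = pullback_pointwise[OF A' E B p' v P' pow_ob[of 1]]
    \<comment> \<open>An element of the kernel, paired with \<open>0\<close>, is an element of the pullback, as \<open>v\<close> preserves \<open>0\<close>.\<close>
    have lift: "\<exists>h. h \<in> Hom D W (Fo P ?T) \<and> nat_el P A a W h = x \<and> nat_el P E e W h = ze E W"
      if W: "W \<in> Ob D" and x: "x \<in> Hom D W (Fo A ?T)" and px: "nat_el A B p W x = ze B W" for W x
      using pullback_lift[OF PT W x ze_closed[OF E W]] px ze_nat[OF E B v W] by metis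
    have lift': "\<exists>h. h \<in> Hom D W (Fo P' ?T) \<and> nat_el P' A' a' W h = x \<and> nat_el P' E e' W h = ze E W"
      if W: "W \<in> Ob D" and x: "x \<in> Hom D W (Fo A' ?T)" and px: "nat_el A' B p' W x = ze B W" for W x
      using pullback_lift[OF PT' W x ze_closed[OF E W]] px ze_nat[OF E B v W] by metis
    have pf_el: "nat_el A' B p' W (nat_el A A' f W x) = nat_el A B p W x"
      if W: "W \<in> Ob D" and x: "x \<in> Hom D W (Fo A ?T)" for W x
      using nat_cmp_app[OF A A' B f' p' pow_ob W x] by (simp only: pf)
    have ag_el: "nat_el P' A' a' W (nat_el P P' g W h) = nat_el A A' f W (nat_el P A a W h)"
      and eg_el: "nat_el P' E e' W (nat_el P P' g W h) = nat_el P E e W h"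
      if W: "W \<in> Ob D" and h: "h \<in> Hom D W (Fo P ?T)" for W h
      using nat_cmp_app[OF PD(1) PD'(1) A' g PD'(2) pow_ob W h] nat_cmp_app[OF PD(1) A A' PD(2) f' pow_ob W h]
        nat_cmp_app[OF PD(1) PD'(1) E g PD'(3) pow_ob W h] by (simp_all only: ag eg)
    have kg_el: "nat_el P' P k W (nat_el P P' g W h) = h" if W: "W \<in> Ob D" and h: "h \<in> Hom D W (Fo P ?T)" for W h
      using nat_cmp_app[OF PD(1) PD'(1) PD(1) g k(1) pow_ob W h] D.Cmp_Idn_left[OF W model_ob[OF PD(1) pow_ob] h]
      by (simp only: k(2) idn_M[OF pow_ob])
    have gk_el: "nat_el P P' g W (nat_el P' P k W h) = h" if W: "W \<in> Ob D" and h: "h \<in> Hom D W (Fo P' ?T)" for W h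
      using nat_cmp_app[OF PD'(1) PD(1) PD'(1) k(1) g pow_ob W h] D.Cmp_Idn_left[OF W model_ob[OF PD'(1) pow_ob] h]
      by (simp only: k(3) idn_M[OF pow_ob])
    show "isomorphism M A A' f"
    proof (rule isomorphism_models[OF A A' f'])
      fix W x y
      assume W: "W \<in> Ob D" and x: "x \<in> Hom D W (Fo A ?T)" and y: "y \<in> Hom D W (Fo A ?T)"
        and eq: "nat_el A A' f W x = nat_el A A' f W y"
      show "x = y"
      proof (rule determined[OF A W x y y])
        fix i assume i: "i < n"
        note al = al_closed[OF A W x y i]
        have "nat_el A B p W x = nat_el A B p W y"
          using pf_el[OF W x] pf_el[OF W y] eq by simp
        then have "nat_el A B p W (al i A W x y) = ze B W"
          using al_nat[OF A B p W x y i] al_diag[OF B W nat_app_closed[OF A B p pow_ob W y] i] by simp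
        then obtain h where h: "h \<in> Hom D W (Fo P ?T)" "nat_el P A a W h = al i A W x y" "nat_el P E e W h = ze E W"
          using lift[OF W al] by blast
        obtain h0 where h0: "h0 \<in> Hom D W (Fo P ?T)" "nat_el P A a W h0 = ze A W" "nat_el P E e W h0 = ze E W"
          using lift[OF W ze_closed[OF A W] ze_nat[OF A B p W]] by blast
        have f_al: "nat_el A A' f W (al i A W x y) = nat_el A A' f W (ze A W)"
          using al_nat[OF A A' f' W x y i] al_diag[OF A' W nat_app_closed[OF A A' f' pow_ob W y] i] eq
            ze_nat[OF A A' f' W] by simp
        have "nat_el P P' g W h = nat_el P P' g W h0"
          by (rule D.pullback_ext[OF PT' model_ob[OF A' pow_ob] model_ob[OF E pow_ob] model_ob[OF B pow_ob]
                nat_hom[OF p' pow_ob] nat_hom[OF v pow_ob] W nat_app_closed[OF PD(1) PD'(1) g pow_ob W h(1)]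
                nat_app_closed[OF PD(1) PD'(1) g pow_ob W h0(1)]])
            (simp_all only: ag_el[OF W h(1)] ag_el[OF W h0(1)] eg_el[OF W h(1)] eg_el[OF W h0(1)] h h0 f_al)
        then have "h = h0" using kg_el[OF W h(1)] kg_el[OF W h0(1)] by metis
        then show "al i A W x y = al i A W y y"
          using h h0 al_diag[OF A W y i] by simp
      qed
    next
      fix W x' assume W: "W \<in> Ob D" and x': "x' \<in> Hom D W (Fo A' ?T)"
      define b where "b = nat_el A' B p' W x'"
      have b: "b \<in> Hom D W (Fo B ?T)" unfolding b_def by (rule nat_app_closed[OF A' B p' pow_ob W x'])
      define y where "y = nat_el B A s W b"
      have y: "y \<in> Hom D W (Fo A ?T)" unfolding y_def by (rule nat_app_closed[OF B A s pow_ob W b])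
      define y' where "y' = nat_el A A' f W y"
      have y': "y' \<in> Hom D W (Fo A' ?T)" unfolding y'_def by (rule nat_app_closed[OF A A' f' pow_ob W y])
      have "y' = nat_el B A' s' W b"
        unfolding y'_def y_def using nat_cmp_app[OF B A A' s f' pow_ob W b] by (simp only: fs)
      then have p'y': "nat_el A' B p' W y' = b"
        using nat_cmp_app[OF B A' B s' p' pow_ob W b] D.Cmp_Idn_left[OF W model_ob[OF B pow_ob] b]
        by (simp only: ps' idn_M[OF pow_ob])
      have "\<exists>w. w \<in> Hom D W (Fo A ?T) \<and> nat_el A A' f W w = al i A' W x' y'" if i: "i < n" for i
      proof -
        note al = al_closed[OF A' W x' y' i]
        have "nat_el A' B p' W (al i A' W x' y') = ze B W"
          using al_nat[OF A' B p' W x' y' i] al_diag[OF B W b i] p'y' by (simp only: b_def[symmetric])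
        then obtain h where h: "h \<in> Hom D W (Fo P' ?T)" "nat_el P' A' a' W h = al i A' W x' y'"
          using lift'[OF W al] by blast
        note kh = nat_app_closed[OF PD'(1) PD(1) k(1) pow_ob W h(1)]
        have "nat_el A A' f W (nat_el P A a W (nat_el P' P k W h)) = al i A' W x' y'"
          using ag_el[OF W kh] gk_el[OF W h(1)] h(2) by simp
        then show ?thesis using nat_app_closed[OF PD(1) A PD(2) pow_ob W kh] by blast
      qed
      then obtain w where w: "\<And>i. i < n \<Longrightarrow> w i \<in> Hom D W (Fo A ?T)"
        "\<And>i. i < n \<Longrightarrow> nat_el A A' f W (w i) = al i A' W x' y'" by metis
      have "\<exists>z. z \<in> Hom D W (Fo A (pow L (n + 1))) \<and>
          (\<forall>i < n + 1. pow_el A W (n + 1) i z = (if i < n then w i else y))"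
        by (rule tuple[OF A W]) (simp add: w(1) y del: One_nat_def)
      then obtain z where z: "z \<in> Hom D W (Fo A (pow L (n + 1)))"
        "\<And>i. i < n + 1 \<Longrightarrow> pow_el A W (n + 1) i z = (if i < n then w i else y)" by blast
      let ?z' = "Cmp D W (Fo A (pow L (n + 1))) (Fo A' (pow L (n + 1))) (f (pow L (n + 1))) z"
      have z': "?z' \<in> Hom D W (Fo A' (pow L (n + 1)))" by (rule nat_app_closed[OF A A' f' pow_ob W z(1)])
      have "pow_el A' W (n + 1) i ?z' = (if i < n then al i A' W x' y' else y')" if "i < n + 1" for i
        using that by (simp only: nat_app[OF A A' f' pow_ob pow_ob proj_hom W z(1)] z(2)) (simp add: w(2) y'_def del: One_nat_def)
      then have "term_el A' W (n + 1) \<beta> ?z' = x'"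
        using reconstruct[OF A' W pr(1)[OF A' W x' y'] z'] pr[OF A' W x' y'] by (simp add: al_def del: One_nat_def)
      then have "nat_el A A' f W (term_el A W (n + 1) \<beta> z) = x'"
        using nat_app[OF A A' f' pow_ob pow_ob \<beta> W z(1)] by simp
      moreover have "term_el A W (n + 1) \<beta> z \<in> Hom D W (Fo A ?T)"
        by (rule model_app_closed[OF A pow_ob pow_ob \<beta> W z(1)])
      ultimately show "\<exists>x \<in> Hom D W (Fo A ?T). nat_el A A' f W x = x'" by blast
    qed
  qed
qed

end

section \<open>Iterated comultiplications\<close>

lemma tensor_productI: "cring K \<Longrightarrow> \<forall>M \<in> set Ms. module K M \<Longrightarrow> tensor_product K Ms"
  by (intro tensor_product.intro tensor_product_axioms.intro)

lemma vectors_snoc: "ys \<in> vectors Ms \<Longrightarrow> z \<in> carrier M \<Longrightarrow> ys @ [z] \<in> vectors (Ms @ [M])"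
  unfolding vectors_iff by (auto simp: nth_append less_Suc_eq)

abbreviation snoc_tensor where
  "snoc_tensor K Ms M Y z \<equiv> tensor_lift (tensor K (Ms @ [M])) (\<lambda>ys. pure_tensor K (Ms @ [M]) (ys @ [z])) Y"

context
  fixes K :: "('k, 'r) ring_scheme" and Ms :: "('k, 'v, 'z) module_scheme list" and M :: "('k, 'v, 'z) module_scheme"
  assumes K: "cring K" and Ms: "\<forall>M \<in> set Ms. module K M" and M: "module K M"
begin

interpretation Ms: tensor_product K Ms
  by (rule tensor_productI[OF K Ms])

interpretation snoc: tensor_product K "Ms @ [M]"
  by (rule tensor_productI[OF K]) (use Ms M in auto)

lemma multilinear_snoc:
  assumes z: "z \<in> carrier M"
  shows "multilinear K Ms snoc.T (\<lambda>ys. pure_tensor K (Ms @ [M]) (ys @ [z]))"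
  unfolding multilinear_def
proof (intro conjI ballI allI impI)
  fix ys assume ys: "ys \<in> vectors Ms"
  then have len: "length ys = length Ms" by (simp add: vectors_iff)
  show "pure_tensor K (Ms @ [M]) (ys @ [z]) \<in> carrier snoc.T"
    by (rule snoc.pure_closed[OF vectors_snoc[OF ys z]])
  fix i assume i: "i < length Ms"
  have "linear_map K ((Ms @ [M]) ! i) snoc.T (\<lambda>x. pure_tensor K (Ms @ [M]) ((ys @ [z])[i := x]))"
    by (rule multilinearD[OF snoc.multilinear_pure vectors_snoc[OF ys z]]) (use i in simp)
  then show "linear_map K (Ms ! i) snoc.T (\<lambda>x. pure_tensor K (Ms @ [M]) (ys[i := x] @ [z]))"
    using i len by (simp add: nth_append list_update_append)
qed

lemma bilinear_snoc: "bilinear K Ms.T M snoc.T (snoc_tensor K Ms M)"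
proof (rule bilinearI)
  fix Y assume Y: "Y \<in> carrier Ms.T"
  show "linear_map K M snoc.T (\<lambda>z. snoc_tensor K Ms M Y z)"
  proof (rule Ms.lift_linear_param[OF Y snoc.module_tensor])
    fix ys assume ys: "ys \<in> vectors Ms"
    then have len: "length ys = length Ms" by (simp add: vectors_iff)
    interpret M: module K M by (rule M)
    have "linear_map K ((Ms @ [M]) ! length Ms) snoc.T
        (\<lambda>x. pure_tensor K (Ms @ [M]) ((ys @ [\<zero>\<^bsub>M\<^esub>])[length Ms := x]))"
      by (rule multilinearD[OF snoc.multilinear_pure vectors_snoc[OF ys M.M.zero_closed]]) simp
    then show "linear_map K M snoc.T (\<lambda>z. pure_tensor K (Ms @ [M]) (ys @ [z]))"
      using len by (simp add: nth_append list_update_append)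
  qed
next
  fix z assume "z \<in> carrier M"
  then show "linear_map K Ms.T snoc.T (\<lambda>Y. snoc_tensor K Ms M Y z)"
    by (rule Ms.lift_linear[OF snoc.module_tensor multilinear_snoc])
qed

lemma snoc_pure:
  "ys \<in> vectors Ms \<Longrightarrow> z \<in> carrier M \<Longrightarrow>
    snoc_tensor K Ms M (pure_tensor K Ms ys) z = pure_tensor K (Ms @ [M]) (ys @ [z])"
  by (rule Ms.lift_pure[OF snoc.module_tensor multilinear_snoc])

end

lemma tensor_map_linear:
  fixes Ms :: "('k, 'v, 'y) module_scheme list" and Ns :: "('k, 'w, 'z) module_scheme list"
  assumes K: "cring K" and Ms: "\<forall>M \<in> set Ms. module K M" and Ns: "\<forall>M \<in> set Ns. module K M"
    and len: "length Ms = length Ns" "length fs = length Ns"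
    and fs: "\<And>i. i < length Ns \<Longrightarrow> linear_map K (Ms ! i) (Ns ! i) (fs ! i)"
  shows "linear_map K (tensor K Ms) (tensor K Ns) (tensor_map K Ns fs)"
    and "xs \<in> vectors Ms \<Longrightarrow> tensor_map K Ns fs (pure_tensor K Ms xs) = pure_tensor K Ns (map2 (\<lambda>f x. f x) fs xs)"
proof -
  interpret Ms: tensor_product K Ms by (rule tensor_productI[OF K Ms])
  interpret Ns: tensor_product K Ns by (rule tensor_productI[OF K Ns])
  have vec: "map2 (\<lambda>f x. f x) fs xs \<in> vectors Ns" if "xs \<in> vectors Ms" for xs
    using that len linear_map_closed[OF fs] unfolding vectors_iff by auto
  have "multilinear K Ms Ns.T (\<lambda>xs. pure_tensor K Ns (map2 (\<lambda>f x. f x) fs xs))"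
    unfolding multilinear_def
  proof (intro conjI ballI allI impI Ns.pure_closed vec)
    fix xs i assume xs: "xs \<in> vectors Ms" and i: "i < length Ms"
    have *: "map2 (\<lambda>f x. f x) fs (xs[i := x]) = (map2 (\<lambda>f x. f x) fs xs)[i := (fs ! i) x]" for x
      using i len xs by (auto intro!: nth_equalityI simp: nth_list_update vectors_iff)
    have "linear_map K (Ns ! i) Ns.T (\<lambda>x. pure_tensor K Ns ((map2 (\<lambda>f x. f x) fs xs)[i := x]))"
      by (rule multilinearD[OF Ns.multilinear_pure vec[OF xs]]) (use i len in simp)
    from linear_map_comp[OF this fs[of i]]
    show "linear_map K (Ms ! i) Ns.T (\<lambda>x. pure_tensor K Ns (map2 (\<lambda>f x. f x) fs (xs[i := x])))"
      unfolding * using i len by simp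
  qed
  note m = this
  show "linear_map K Ms.T Ns.T (tensor_map K Ns fs)"
    unfolding tensor_map_def by (rule Ms.lift_linear[OF Ns.module_tensor m])
  show "xs \<in> vectors Ms \<Longrightarrow> tensor_map K Ns fs (pure_tensor K Ms xs) = pure_tensor K Ns (map2 (\<lambda>f x. f x) fs xs)"
    unfolding tensor_map_def by (rule Ms.lift_pure[OF Ns.module_tensor m])
qed

text \<open>In Sweedler's notation \<open>x \<mapsto> \<Sum> f\<^sub>1(x\<^sub>1) \<otimes> \<dots> \<otimes> f\<^sub>m(x\<^sub>m)\<close>, for homomorphisms the
  morphism into the \<open>m\<close>-th power with components \<open>f\<^sub>i\<close>.\<close>

definition tuple_map ::
  "('k, 'r) ring_scheme \<Rightarrow> ('k, 'v, 'y) coalgebra_scheme \<Rightarrow> ('k, 'w, 'z) coalgebra_scheme \<Rightarrow>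
   ('v \<Rightarrow> 'w) list \<Rightarrow> 'v \<Rightarrow> ('k, 'w) tensor" where
  "tuple_map K C H fs x = tensor_map K (replicate (length fs) H) fs (iterated_comult K C (length fs - 1) x)"

lemma replicate_snoc: "replicate (Suc n) x = replicate n x @ [x]"
  by (simp add: replicate_append_same)

context cocommutative_coalgebra
begin

lemma modules_replicate: "\<forall>M \<in> set (replicate n H). module K M"
  using is_module by auto

lemma iterated_comult_Suc:
  "iterated_comult K H (Suc n) x =
    sw H (tensor K (replicate (Suc (Suc n)) H)) (\<lambda>y z. snoc_tensor K (replicate (Suc n) H) H (iterated_comult K H n y) z) x"
  by (simp add: sw_def Let_def replicate_append_same)

lemma tensor_replicate: "module K (tensor K (replicate n H))"
  by (rule tensor_product.module_tensor[OF tensor_productI[OF R.is_cring modules_replicate]])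

lemma bilinear_snoc_replicate:
  "bilinear K (tensor K (replicate n H)) H (tensor K (replicate (Suc n) H)) (snoc_tensor K (replicate n H) H)"
  unfolding replicate_snoc by (rule bilinear_snoc[OF R.is_cring modules_replicate is_module])

lemma iterated_comult_linear: "linear_map K H (tensor K (replicate (Suc n) H)) (iterated_comult K H n)"
proof (induction n)
  case 0
  interpret T: tensor_product K "[H]" by (rule tensor_productI[OF R.is_cring]) (simp add: is_module)
  have "linear_map K H T.T (\<lambda>x. pure_tensor K [H] ([\<zero>\<^bsub>H\<^esub>][0 := x]))"
    using multilinearD[OF T.multilinear_pure, of "[\<zero>\<^bsub>H\<^esub>]" 0] by simp
  then show ?case by (simp add: linear_map_def)
next
  case (Suc n)
  show ?case
    unfolding iterated_comult_Suc[abs_def]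
    by (rule sw_linear[OF tensor_replicate bilinear_precomp[OF bilinear_snoc_replicate Suc linear_map_id]])
qed

end

context
  fixes K :: "('k, 'r) ring_scheme" and C :: "('k, 'v, 'y) coalgebra_scheme" and H :: "('k, 'w, 'z) coalgebra_scheme"
  assumes C: "cocommutative_coalgebra K C" and H: "cocommutative_coalgebra K H"
begin

interpretation C: cocommutative_coalgebra K C by (rule C)
interpretation H: cocommutative_coalgebra K H by (rule H)

lemma tensor_map_replicate:
  assumes "\<forall>f \<in> set fs. linear_map K C H f" "length fs = n"
  shows "linear_map K (tensor K (replicate n C)) (tensor K (replicate n H)) (tensor_map K (replicate n H) fs)"
    and "xs \<in> vectors (replicate n C) \<Longrightarrow>
      tensor_map K (replicate n H) fs (pure_tensor K (replicate n C) xs) = pure_tensor K (replicate n H) (map2 (\<lambda>f x. f x) fs xs)"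
proof -
  have lin: "linear_map K (replicate n C ! i) (replicate n H ! i) (fs ! i)" if "i < length (replicate n H)" for i
    using assms that by simp
  note tm = tensor_map_linear[OF C.R.is_cring C.modules_replicate[of n] H.modules_replicate[of n] _ _ lin, simplified, OF assms(2)]
  show "linear_map K (tensor K (replicate n C)) (tensor K (replicate n H)) (tensor_map K (replicate n H) fs)"
    by (rule tm(1))
  show "xs \<in> vectors (replicate n C) \<Longrightarrow>
      tensor_map K (replicate n H) fs (pure_tensor K (replicate n C) xs) = pure_tensor K (replicate n H) (map2 (\<lambda>f x. f x) fs xs)"
    using tm(2)[of xs] by simp
qed

lemma tuple_map_linear:
  assumes "\<forall>f \<in> set fs. linear_map K C H f" "fs \<noteq> []"
  shows "linear_map K C (tensor K (replicate (length fs) H)) (tuple_map K C H fs)"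
proof -
  obtain n where n: "length fs = Suc n" using assms(2) by (cases fs) auto
  show ?thesis
    unfolding tuple_map_def[abs_def] n
    using linear_map_comp[OF tensor_map_replicate(1)[OF assms(1) n] C.iterated_comult_linear] by simp
qed

lemma tuple_map_single:
  assumes "linear_map K C H f" "x \<in> carrier C"
  shows "tuple_map K C H [f] x = pure_tensor K [H] [f x]"
  using tensor_map_replicate(2)[of "[f]" 1 "[x]"] assms by (simp add: tuple_map_def)

text \<open>The recursion on which all inductions over the number of factors rest. Both sides agree because
  \<open>f\<^sub>1 \<otimes> \<dots> \<otimes> f\<^sub>m\<close> commutes with appending a factor, which is checked on pure tensors.\<close>

lemma tuple_map_snoc:
  assumes fs: "\<forall>f \<in> set fs. linear_map K C H f" "fs \<noteq> []" and f: "linear_map K C H f" and x: "x \<in> carrier C"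
  shows "tuple_map K C H (fs @ [f]) x = sw C (tensor K (replicate (Suc (length fs)) H))
    (\<lambda>y z. snoc_tensor K (replicate (length fs) H) H (tuple_map K C H fs y) (f z)) x"
proof -
  obtain n where n: "length fs = Suc n" using fs(2) by (cases fs) auto
  let ?RC = "replicate (Suc n) C" and ?RH = "replicate (Suc n) H"
  let ?tm = "tensor_map K (replicate (Suc (Suc n)) H) (fs @ [f])"
  have ffs: "\<forall>f \<in> set (fs @ [f]). linear_map K C H f" "length (fs @ [f]) = Suc (Suc n)" using fs f n by auto
  note tm = tensor_map_replicate(1)[OF ffs] and tm' = tensor_map_replicate(1)[OF fs(1) n]
  interpret RC: tensor_product K ?RC by (rule tensor_productI[OF C.R.is_cring C.modules_replicate])
  interpret RH: tensor_product K ?RH by (rule tensor_productI[OF C.R.is_cring H.modules_replicate])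
  have key: "?tm (snoc_tensor K ?RC C Y z) = snoc_tensor K ?RH H (tensor_map K ?RH fs Y) (f z)"
    if Y: "Y \<in> carrier RC.T" and z: "z \<in> carrier C" for Y z
  proof (rule RC.linear_map_ext[OF H.tensor_replicate[of "Suc (Suc n)"] _ _ _ Y])
    have fz: "f z \<in> carrier H" by (rule linear_map_closed[OF f z])
    show "linear_map K RC.T (tensor K (replicate (Suc (Suc n)) H)) (\<lambda>Y. ?tm (snoc_tensor K ?RC C Y z))"
      by (rule linear_map_comp[OF tm bilinearD(2)[OF C.bilinear_snoc_replicate z]])
    show "linear_map K RC.T (tensor K (replicate (Suc (Suc n)) H)) (\<lambda>Y. snoc_tensor K ?RH H (tensor_map K ?RH fs Y) (f z))"
      by (rule linear_map_comp[OF bilinearD(2)[OF H.bilinear_snoc_replicate fz] tm'])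
    fix ys assume ys: "ys \<in> vectors ?RC"
    have len: "length ys = length fs" using ys[unfolded vectors_iff] n by simp
    have vec: "map2 (\<lambda>f x. f x) fs ys \<in> vectors ?RH"
      using ys n fs(1) unfolding vectors_iff by (auto intro!: linear_map_closed[of K C H] simp del: replicate.simps)
    have "?tm (snoc_tensor K ?RC C (pure_tensor K ?RC ys) z) = ?tm (pure_tensor K (replicate (Suc (Suc n)) C) (ys @ [z]))"
      using snoc_pure[OF C.R.is_cring C.modules_replicate C.is_module ys z] by (simp add: replicate_append_same)
    also have "\<dots> = pure_tensor K (replicate (Suc (Suc n)) H) (map2 (\<lambda>f x. f x) (fs @ [f]) (ys @ [z]))"
      by (rule tensor_map_replicate(2)[OF ffs])
        (use vectors_snoc[OF ys z] in \<open>simp only: replicate_snoc[of "Suc n"]\<close>)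
    also have "map2 (\<lambda>f x. f x) (fs @ [f]) (ys @ [z]) = map2 (\<lambda>f x. f x) fs ys @ [f z]"
      using len by simp
    also have "pure_tensor K (replicate (Suc (Suc n)) H) (map2 (\<lambda>f x. f x) fs ys @ [f z]) =
        snoc_tensor K ?RH H (pure_tensor K ?RH (map2 (\<lambda>f x. f x) fs ys)) (f z)"
      using snoc_pure[OF C.R.is_cring H.modules_replicate H.is_module vec fz] by (simp add: replicate_append_same)
    also have "pure_tensor K ?RH (map2 (\<lambda>f x. f x) fs ys) = tensor_map K ?RH fs (pure_tensor K ?RC ys)"
      by (rule tensor_map_replicate(2)[OF fs(1) n ys, symmetric])
    finally show "?tm (snoc_tensor K ?RC C (pure_tensor K ?RC ys) z) =
        snoc_tensor K ?RH H (tensor_map K ?RH fs (pure_tensor K ?RC ys)) (f z)" .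
  qed
  have ic: "iterated_comult K C n y \<in> carrier RC.T" if "y \<in> carrier C" for y
    by (rule linear_map_closed[OF C.iterated_comult_linear that])
  have "tuple_map K C H (fs @ [f]) x = ?tm (iterated_comult K C (Suc n) x)"
    by (simp add: tuple_map_def n)
  also have "\<dots> = sw C (tensor K (replicate (Suc (Suc n)) H)) (\<lambda>y z. ?tm (snoc_tensor K ?RC C (iterated_comult K C n y) z)) x"
    unfolding C.iterated_comult_Suc
    by (rule C.sw_comp[OF x C.tensor_replicate H.tensor_replicate tm])
      (rule bilinearD(3)[OF C.bilinear_snoc_replicate ic])
  also have "\<dots> = sw C (tensor K (replicate (Suc (Suc n)) H)) (\<lambda>y z. snoc_tensor K ?RH H (tuple_map K C H fs y) (f z)) x"
    by (intro C.sw_cong x) (simp only: key ic tuple_map_def n diff_Suc_1)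
  finally show ?thesis by (simp only: n)
qed

lemma tuple_map_pair:
  assumes f: "linear_map K C H f" and g: "linear_map K C H g" and x: "x \<in> carrier C"
  shows "tuple_map K C H [f, g] x = sw C (tensor K [H, H]) (\<lambda>y z. pure_tensor K [H, H] [f y, g z]) x"
proof -
  have "snoc_tensor K [H] H (pure_tensor K [H] [f y]) (g z) = pure_tensor K [H, H] [f y, g z]"
    if "y \<in> carrier C" "z \<in> carrier C" for y z
    using snoc_pure[of K "[H]" H "[f y]" "g z"] that linear_map_closed[OF f] linear_map_closed[OF g]
    by (simp add: C.R.is_cring H.is_module)
  then have eq: "snoc_tensor K [H] H (tuple_map K C H [f] y) (g z) = pure_tensor K [H, H] [f y, g z]"
    if "y \<in> carrier C" "z \<in> carrier C" for y z
    using that by (simp only: tuple_map_single[OF f])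
  have "tuple_map K C H [f, g] x = sw C (tensor K [H, H]) (\<lambda>y z. snoc_tensor K [H] H (tuple_map K C H [f] y) (g z)) x"
    using tuple_map_snoc[of "[f]" g x] assms by simp
  also have "\<dots> = sw C (tensor K [H, H]) (\<lambda>y z. pure_tensor K [H, H] [f y, g z]) x"
    by (intro C.sw_cong x eq)
  finally show ?thesis .
qed

lemma tuple_map_cong:
  assumes "length fs = length gs" "\<forall>f \<in> set fs. linear_map K C H f" "fs \<noteq> []" "x \<in> carrier C"
    "\<And>i x. i < length fs \<Longrightarrow> x \<in> carrier C \<Longrightarrow> (fs ! i) x = (gs ! i) x"
  shows "tuple_map K C H fs x = tuple_map K C H gs x"
proof -
  obtain n where n: "length fs = Suc n" using assms(3) by (cases fs) auto
  interpret RC: tensor_product K "replicate (Suc n) C" by (rule tensor_productI[OF C.R.is_cring C.modules_replicate])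
  have "pure_tensor K (replicate (Suc n) H) (map2 (\<lambda>f x. f x) fs xs) = pure_tensor K (replicate (Suc n) H) (map2 (\<lambda>f x. f x) gs xs)"
    if "xs \<in> vectors (replicate (Suc n) C)" for xs
  proof -
    have "map2 (\<lambda>f x. f x) fs xs = map2 (\<lambda>f x. f x) gs xs"
      using that n assms(1,5) unfolding vectors_iff by (intro nth_equalityI) (auto simp del: replicate.simps)
    then show ?thesis by simp
  qed
  then show ?thesis
    unfolding tuple_map_def tensor_map_def using n assms(1) linear_map_closed[OF C.iterated_comult_linear assms(4)]
    by (auto intro!: RC.lift_cong)
qed

end

lemma tuple_map_natural:
  assumes C: "cocommutative_coalgebra K C" and C': "cocommutative_coalgebra K C'" and H: "cocommutative_coalgebra K H"
    and t: "coalgebra_hom K C C' t" and fs: "\<forall>f \<in> set fs. linear_map K C' H f" "fs \<noteq> []" and x: "x \<in> carrier C"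
  shows "tuple_map K C' H fs (t x) = tuple_map K C H (map (\<lambda>f x. f (t x)) fs) x"
  using fs x
proof (induction fs arbitrary: x rule: rev_induct)
  case (snoc f fs)
  interpret C: cocommutative_coalgebra K C by (rule C)
  interpret C': cocommutative_coalgebra K C' by (rule C')
  interpret H: cocommutative_coalgebra K H by (rule H)
  note tc = coalgebra_hom_closed[OF t] and tl = coalgebra_hom_linear[OF t]
  have f: "linear_map K C' H f" and fs: "\<forall>f \<in> set fs. linear_map K C' H f" using snoc.prems by auto
  show ?case
  proof (cases "fs = []")
    case True
    then show ?thesis
      using tuple_map_single[OF C' H f tc[OF snoc.prems(3)]]
        tuple_map_single[OF C H linear_map_comp[OF f tl] snoc.prems(3)] by simp
  next
    case False
    let ?m = "length fs"
    let ?gs = "map (\<lambda>f x. f (t x)) fs"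
    have gs: "\<forall>g \<in> set ?gs. linear_map K C H g" using fs linear_map_comp[OF _ tl] by auto
    note bil = H.bilinear_snoc_replicate[of ?m]
    have "tuple_map K C' H (fs @ [f]) (t x) = sw C' (tensor K (replicate (Suc ?m) H))
        (\<lambda>y z. snoc_tensor K (replicate ?m H) H (tuple_map K C' H fs y) (f z)) (t x)"
      by (rule tuple_map_snoc[OF C' H fs False f tc[OF snoc.prems(3)]])
    also have "\<dots> = sw C (tensor K (replicate (Suc ?m) H))
        (\<lambda>y z. snoc_tensor K (replicate ?m H) H (tuple_map K C' H fs (t y)) (f (t z))) x"
      by (rule sw_hom[OF C C' t snoc.prems(3) H.tensor_replicate
            bilinear_precomp[OF bil tuple_map_linear[OF C' H fs False] f]])
    also have "\<dots> = sw C (tensor K (replicate (Suc ?m) H))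
        (\<lambda>y z. snoc_tensor K (replicate ?m H) H (tuple_map K C H ?gs y) (f (t z))) x"
      by (intro C.sw_cong snoc.prems(3)) (simp only: snoc.IH[OF fs False])
    also have "\<dots> = tuple_map K C H (?gs @ [\<lambda>x. f (t x)]) x"
      using tuple_map_snoc[OF C H gs _ linear_map_comp[OF f tl] snoc.prems(3)] False by simp
    finally show ?thesis by simp
  qed
qed simp

section \<open>Powers of a coalgebra are tensor powers\<close>

lemma product_cone_coalgebra_lift:
  fixes X H P :: "('k, 'u) coalgebra"
  assumes P: "product_cone (Coalg_coc K) I (\<lambda>_. H) P p" and X: "cocommutative_coalgebra K X"
    and f: "\<And>i. i \<in> I \<Longrightarrow> coalgebra_hom K X H (f i)"
  shows "\<exists>h. coalgebra_hom K X P h \<and> (\<forall>i \<in> I. \<forall>x \<in> carrier X. p i (h x) = f i x)"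
proof -
  have X': "X \<in> Ob (Coalg_coc K)" using X by simp
  have f': "restrict (f i) (carrier X) \<in> Hom (Coalg_coc K) X H" if "i \<in> I" for i
    by (rule restrict_in_Hom[OF X f[OF that]])
  obtain h where h: "h \<in> Hom (Coalg_coc K) X P"
    "\<And>i. i \<in> I \<Longrightarrow> Cmp (Coalg_coc K) X P H (p i) h = restrict (f i) (carrier X)"
    using product_cone_lift[where f = "\<lambda>i. restrict (f i) (carrier X)", OF P X' f'] by blast
  have "p i (h x) = f i x" if "i \<in> I" "x \<in> carrier X" for i x
    using fun_cong[OF h(2)[OF that(1)], of x] that(2) by (simp add: compose_def)
  then show ?thesis using Hom_Coalg_hom[OF h(1)] by blast
qed

lemma product_cone_coalgebra_ext:
  fixes X H P :: "('k, 'u) coalgebra"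
  assumes P: "product_cone (Coalg_coc K) I (\<lambda>_. H) P p" and X: "cocommutative_coalgebra K X"
    and h: "coalgebra_hom K X P h" and h': "coalgebra_hom K X P h'"
    and eq: "\<And>i x. i \<in> I \<Longrightarrow> x \<in> carrier X \<Longrightarrow> p i (h x) = p i (h' x)" and x: "x \<in> carrier X"
  shows "h x = h' x"
proof -
  have X': "X \<in> Ob (Coalg_coc K)" using X by simp
  have "restrict h (carrier X) = restrict h' (carrier X)"
    by (rule category.product_cone_ext[OF category_Coalg P X' restrict_in_Hom[OF X h] restrict_in_Hom[OF X h']])
      (auto simp: compose_def eq intro!: restrict_ext)
  then show ?thesis using x by (metis restrict_apply')
qed

lemma product_cone_coalgebra:
  assumes "product_cone (Coalg_coc K) I (\<lambda>_. H) P p"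
  shows "cocommutative_coalgebra K P" "i \<in> I \<Longrightarrow> coalgebra_hom K P H (p i)"
  using product_coneD[OF assms] by (auto simp: Hom_Coalg)

text \<open>The powers start with the first one, as do the iterated comultiplications. The next power
  is the product of \<open>Q\<close> and \<open>H\<close>. The left inverse takes the last factor off a pure tensor,
  applies \<open>\<rho>\<close> to the others, and identifies \<open>Q \<otimes> H\<close> with the product.\<close>

lemma power_with_inverse:
  fixes H :: "('k, 'u) coalgebra"
  assumes inf: "infinite (UNIV :: 'u set)" and small: "carrier K \<lesssim> (UNIV :: 'u set)"
    and H: "cocommutative_coalgebra K H"
  shows "\<exists>Q q \<rho>. product_cone (Coalg_coc K) {..<Suc m} (\<lambda>_. H) Q q \<and>
    linear_map K (tensor K (replicate (Suc m) H)) Q \<rho> \<and>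
    (\<forall>x \<in> carrier Q. \<rho> (tuple_map K Q H (map q [0..<Suc m]) x) = x)"
proof (induction m)
  case 0
  interpret H: cocommutative_coalgebra K H by (rule H)
  interpret C: category "Coalg_coc K :: (('k, 'u) coalgebra, 'u \<Rightarrow> 'u) cat" by (rule category_Coalg)
  interpret T: tensor_product K "[H]" by (rule tensor_productI[OF H.R.is_cring]) (simp add: H.is_module)
  define e where "e = (\<lambda>x \<in> carrier H. x)"
  let ?\<rho> = "tensor_lift H (\<lambda>ys. ys ! 0)"
  have H': "H \<in> Ob (Coalg_coc K)" using H by simp
  have i: "e \<in> Hom (Coalg_coc K) H H" unfolding e_def by (rule restrict_in_Hom[OF H coalgebra_hom_id[OF H]])
  have left: "Cmp (Coalg_coc K) X H H e f = f" if "X \<in> Ob (Coalg_coc K)" "f \<in> Hom (Coalg_coc K) X H" for X f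
    using C.Cmp_Idn_left[OF that(1) H' that(2)] by (simp only: Idn_Coalg e_def)
  have "product_cone (Coalg_coc K) {..<Suc 0} (\<lambda>_. H) H (\<lambda>_. e)"
    unfolding product_cone_def
  proof (intro conjI ballI allI impI H' i)
    fix X f assume X: "X \<in> Ob (Coalg_coc K)" and f: "\<forall>i \<in> {..<Suc 0}. f i \<in> Hom (Coalg_coc K) X H"
    then have f0: "f 0 \<in> Hom (Coalg_coc K) X H" by simp
    show "\<exists>!h. h \<in> Hom (Coalg_coc K) X H \<and> (\<forall>i \<in> {..<Suc 0}. Cmp (Coalg_coc K) X H H e h = f i)"
    proof (rule ex1I[of _ "f 0"])
      show "f 0 \<in> Hom (Coalg_coc K) X H \<and> (\<forall>i \<in> {..<Suc 0}. Cmp (Coalg_coc K) X H H e (f 0) = f i)"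
        using f0 left[OF X f0] by simp
      fix h assume h: "h \<in> Hom (Coalg_coc K) X H \<and> (\<forall>i \<in> {..<Suc 0}. Cmp (Coalg_coc K) X H H e h = f i)"
      then have "Cmp (Coalg_coc K) X H H e h = f 0" by blast
      then show "h = f 0" unfolding left[OF X conjunct1[OF h]] .
    qed
  qed
  moreover have m: "multilinear K [H] H (\<lambda>ys. ys ! 0)"
    by (auto simp: multilinear_def linear_map_id)
  have "linear_map K T.T H ?\<rho>" by (rule T.lift_linear[OF H.is_module m])
  moreover have "?\<rho> (tuple_map K H H [e] x) = x" if x: "x \<in> carrier H" for x
  proof -
    have "tuple_map K H H [e] x = pure_tensor K [H] [x]"
      using tuple_map_single[OF H H coalgebra_hom_linear[OF Hom_Coalg_hom[OF i]] x] x by (simp add: e_def)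
    then show ?thesis using T.lift_pure[OF H.is_module m, of "[x]"] x by simp
  qed
  ultimately show ?case by (intro exI[of _ H] exI[of _ "\<lambda>_. e"] exI[of _ ?\<rho>]) simp
next
  case (Suc m)
  then obtain Q q \<rho> where Q: "product_cone (Coalg_coc K) {..<Suc m} (\<lambda>_. H) Q q"
    and \<rho>: "linear_map K (tensor K (replicate (Suc m) H)) Q \<rho>"
    and inv: "\<And>x. x \<in> carrier Q \<Longrightarrow> \<rho> (tuple_map K Q H (map q [0..<Suc m]) x) = x" by blast
  interpret H: cocommutative_coalgebra K H by (rule H)
  note Qc = product_cone_coalgebra(1)[OF Q] and qh = product_cone_coalgebra(2)[OF Q]
  interpret Q: cocommutative_coalgebra K Q by (rule Qc)
  interpret QH: binary_tensor K Q H
    by (intro binary_tensor.intro binary_tensor_axioms.intro Q.is_module H.is_module H.R.is_cring)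
  obtain P p r j where prod: "coalgebra_product K Q H P p r" and j: "linear_map K QH.T P j"
    and jP: "\<And>x. x \<in> carrier P \<Longrightarrow> j (sw P QH.T (\<lambda>x y. QH.pt (p x) (r y)) x) = x"
    by (rule binary_product[OF inf small Qc H]) blast
  note Pc = coalgebra_productD(1)[OF prod] and ph = coalgebra_productD(2)[OF prod] and rh = coalgebra_productD(3)[OF prod]
  interpret P: cocommutative_coalgebra K P by (rule Pc)
  define s where "s i = (if i < Suc m then restrict (\<lambda>x. q i (p x)) (carrier P) else restrict r (carrier P))" for i
  have s_hom: "s i \<in> Hom (Coalg_coc K) P H" for i
    unfolding s_def using restrict_in_Hom[OF Pc coalgebra_hom_comp[OF Pc Qc H ph qh]] restrict_in_Hom[OF Pc rh] by simp
  have s_el: "i < Suc m \<Longrightarrow> x \<in> carrier P \<Longrightarrow> s i x = q i (p x)" "x \<in> carrier P \<Longrightarrow> s (Suc m) x = r x" for i x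
    by (simp_all add: s_def)
  have cone: "product_cone (Coalg_coc K) {..<Suc (Suc m)} (\<lambda>_. H) P s"
    unfolding product_cone_def
  proof (intro conjI ballI allI impI s_hom)
    show "P \<in> Ob (Coalg_coc K)" "H \<in> Ob (Coalg_coc K)" using Pc H by simp_all
    fix X f assume X: "X \<in> Ob (Coalg_coc K)" and f: "\<forall>i \<in> {..<Suc (Suc m)}. f i \<in> Hom (Coalg_coc K) X H"
    have X': "cocommutative_coalgebra K X" using X by simp
    have fh: "coalgebra_hom K X H (f i)" if "i < Suc (Suc m)" for i using f that by (auto simp: Hom_Coalg)
    obtain u where u: "coalgebra_hom K X Q u" "\<And>i x. i < Suc m \<Longrightarrow> x \<in> carrier X \<Longrightarrow> q i (u x) = f i x"
      using product_cone_coalgebra_lift[OF Q X', of f] fh by auto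
    obtain h where h: "coalgebra_hom K X P h" "\<And>x. x \<in> carrier X \<Longrightarrow> p (h x) = u x \<and> r (h x) = f (Suc m) x"
      using coalgebra_productD(4)[OF prod X' u(1) fh[of "Suc m"]] by auto
    note hc = coalgebra_hom_closed[OF h(1)]
    have sh: "s i (h x) = f i x" if "i < Suc (Suc m)" "x \<in> carrier X" for i x
      using that s_el(1)[OF _ hc[OF that(2)]] s_el(2)[OF hc[OF that(2)]] h(2) u(2) by (cases "i = Suc m") auto
    have "Cmp (Coalg_coc K) X P H (s i) (restrict h (carrier X)) = f i" if i: "i < Suc (Suc m)" for i
    proof -
      have fi: "f i \<in> extensional (carrier X)" using f i by (auto simp: Hom_Coalg)
      show ?thesis by (rule extensionalityI[OF _ fi]) (auto simp: compose_def sh[OF i])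
    qed
    moreover have "k = restrict h (carrier X)"
      if k: "k \<in> Hom (Coalg_coc K) X P" "\<forall>i \<in> {..<Suc (Suc m)}. Cmp (Coalg_coc K) X P H (s i) k = f i" for k
    proof (rule Hom_Coalg_eqI[OF k(1) restrict_in_Hom[OF X' h(1)]])
      fix x assume x: "x \<in> carrier X"
      note kh = Hom_Coalg_hom[OF k(1)]
      note kc = coalgebra_hom_closed[OF kh]
      have sk: "s i (k x) = f i x" if "i < Suc (Suc m)" "x \<in> carrier X" for i x
        using fun_cong[OF k(2)[rule_format, of i], of x] that by (simp add: compose_def)
      have pk: "p (k x) = p (h x)" if "x \<in> carrier X" for x
        by (rule product_cone_coalgebra_ext[OF Q X' coalgebra_hom_comp[OF X' Pc Qc kh ph]
              coalgebra_hom_comp[OF X' Pc Qc h(1) ph] _ that])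
          (use sk s_el(1)[OF _ kc] s_el(1)[OF _ hc] sh in auto)
      have rk: "r (k x) = r (h x)" if "x \<in> carrier X" for x
        using sk[of "Suc m" x] sh[of "Suc m" x] s_el(2)[OF kc[OF that]] s_el(2)[OF hc[OF that]] that by simp
      show "k x = restrict h (carrier X) x"
        using coalgebra_productD(5)[OF prod X' kh h(1) _ x] pk rk x by simp
    qed
    ultimately show "\<exists>!h. h \<in> Hom (Coalg_coc K) X P \<and> (\<forall>i \<in> {..<Suc (Suc m)}. Cmp (Coalg_coc K) X P H (s i) h = f i)"
      using restrict_in_Hom[OF X' h(1)] by blast
  qed
  let ?R = "replicate (Suc m) H" and ?R' = "replicate (Suc (Suc m)) H"
  interpret R: tensor_product K ?R by (rule tensor_productI[OF H.R.is_cring H.modules_replicate])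
  interpret R': tensor_product K ?R' by (rule tensor_productI[OF H.R.is_cring H.modules_replicate])
  define \<sigma> where "\<sigma> Y = j (tensor_lift QH.T (\<lambda>ys. QH.pt (\<rho> (pure_tensor K ?R (take (Suc m) ys))) (ys ! Suc m)) Y)" for Y
  have take_vec: "take (Suc m) ys \<in> vectors ?R" if "ys \<in> vectors ?R'" for ys
    using that unfolding vectors_iff by (auto simp del: replicate.simps)
  have last_vec: "ys ! Suc m \<in> carrier H" if "ys \<in> vectors ?R'" for ys
    using that unfolding vectors_iff by (auto simp del: replicate.simps)
  have \<rho>c: "\<rho> (pure_tensor K ?R ys) \<in> carrier Q" if "ys \<in> vectors ?R" for ys
    by (rule linear_map_closed[OF \<rho> R.pure_closed[OF that]])
  have mult: "multilinear K ?R' QH.T (\<lambda>ys. QH.pt (\<rho> (pure_tensor K ?R (take (Suc m) ys))) (ys ! Suc m))"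
    unfolding multilinear_def
  proof (intro conjI ballI allI impI)
    fix ys assume ys: "ys \<in> vectors ?R'"
    have len: "length ys = Suc (Suc m)" using ys[unfolded vectors_iff] by simp
    show "QH.pt (\<rho> (pure_tensor K ?R (take (Suc m) ys))) (ys ! Suc m) \<in> carrier QH.T"
      by (intro QH.pt_closed \<rho>c take_vec last_vec ys)
    fix i assume i: "i < length ?R'"
    show "linear_map K (?R' ! i) QH.T (\<lambda>x. QH.pt (\<rho> (pure_tensor K ?R (take (Suc m) (ys[i := x])))) (ys[i := x] ! Suc m))"
    proof (cases "i = Suc m")
      case True
      then have "take (Suc m) (ys[i := x]) = take (Suc m) ys" "ys[i := x] ! Suc m = x" for x
        using len by simp_all
      then show ?thesis
        using bilinearD(1)[OF QH.bilinear_pt \<rho>c[OF take_vec[OF ys]]] True by (simp del: replicate.simps)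
    next
      case False
      then have im: "i < Suc m" using i by simp
      have "take (Suc m) (ys[i := x]) = (take (Suc m) ys)[i := x]" "ys[i := x] ! Suc m = ys ! Suc m" for x
        using im by (simp_all add: take_update_swap)
      moreover have "linear_map K H R.T (\<lambda>x. pure_tensor K ?R ((take (Suc m) ys)[i := x]))"
        using multilinearD[OF R.multilinear_pure take_vec[OF ys], of i] im
        by (simp del: replicate.simps)
      from linear_map_comp[OF bilinearD(2)[OF QH.bilinear_pt last_vec[OF ys]] linear_map_comp[OF \<rho> this]]
      have "linear_map K H QH.T (\<lambda>x. QH.pt (\<rho> (pure_tensor K ?R ((take (Suc m) ys)[i := x]))) (ys ! Suc m))" .
      ultimately show ?thesis using im by (simp del: replicate.simps)
    qed
  qed
  have \<sigma>: "linear_map K R'.T P \<sigma>"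
    unfolding \<sigma>_def[abs_def] by (rule linear_map_comp[OF j R'.lift_linear[OF QH.module_tensor mult]])
  have \<sigma>_snoc: "\<sigma> (snoc_tensor K ?R H Y z) = j (QH.pt (\<rho> Y) z)" if Y: "Y \<in> carrier R.T" and z: "z \<in> carrier H" for Y z
  proof (rule R.linear_map_ext[OF P.is_module _ _ _ Y])
    show "linear_map K R.T P (\<lambda>Y. \<sigma> (snoc_tensor K ?R H Y z))"
      by (rule linear_map_comp[OF \<sigma> bilinearD(2)[OF H.bilinear_snoc_replicate z]])
    show "linear_map K R.T P (\<lambda>Y. j (QH.pt (\<rho> Y) z))"
      by (rule linear_map_comp[OF j linear_map_comp[OF bilinearD(2)[OF QH.bilinear_pt z] \<rho>]])
    fix ys assume ys: "ys \<in> vectors ?R"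
    have len: "length ys = Suc m" using ys[unfolded vectors_iff] by simp
    have vec: "ys @ [z] \<in> vectors ?R'" using vectors_snoc[OF ys z] by (simp only: replicate_snoc[of "Suc m"])
    have "snoc_tensor K ?R H (pure_tensor K ?R ys) z = pure_tensor K ?R' (ys @ [z])"
      using snoc_pure[OF H.R.is_cring H.modules_replicate H.is_module ys z] by (simp only: replicate_snoc[of "Suc m"])
    then have "\<sigma> (snoc_tensor K ?R H (pure_tensor K ?R ys) z) = \<sigma> (pure_tensor K ?R' (ys @ [z]))" by simp
    also have "\<dots> = j (QH.pt (\<rho> (pure_tensor K ?R (take (Suc m) (ys @ [z])))) ((ys @ [z]) ! Suc m))"
      unfolding \<sigma>_def by (simp only: R'.lift_pure[OF QH.module_tensor mult vec])
    also have "\<dots> = j (QH.pt (\<rho> (pure_tensor K ?R ys)) z)"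
      using len by (simp add: nth_append)
    finally show "\<sigma> (snoc_tensor K ?R H (pure_tensor K ?R ys) z) = j (QH.pt (\<rho> (pure_tensor K ?R ys)) z)" .
  qed
  let ?s = "map s [0..<Suc m]" and ?q = "map q [0..<Suc m]"
  have sl: "linear_map K P H (s i)" for i by (rule coalgebra_hom_linear[OF Hom_Coalg_hom[OF s_hom]])
  have s_all: "\<forall>f \<in> set ?s. linear_map K P H f" "?s \<noteq> []" "length ?s = Suc m" using sl by auto
  have q_all: "\<forall>f \<in> set ?q. linear_map K Q H f" "?q \<noteq> []" using coalgebra_hom_linear[OF qh] by auto
  have tuple_s: "tuple_map K P H ?s y = tuple_map K Q H ?q (p y)" if y: "y \<in> carrier P" for y
  proof -
    have "tuple_map K P H ?s y = tuple_map K P H (map (\<lambda>f x. f (p x)) ?q) y"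
      by (rule tuple_map_cong[OF Pc H _ s_all(1,2) y]) (auto simp: s_el simp del: upt_Suc)
    also have "\<dots> = tuple_map K Q H ?q (p y)"
      by (rule tuple_map_natural[OF Pc Qc H ph q_all y, symmetric])
    finally show ?thesis .
  qed
  have tc: "tuple_map K P H ?s y \<in> carrier R.T" if "y \<in> carrier P" for y
    using linear_map_closed[OF tuple_map_linear[OF Pc H s_all(1,2)] that] by (simp only: s_all(3))
  have "\<sigma> (tuple_map K P H (map s [0..<Suc (Suc m)]) x) = x" if x: "x \<in> carrier P" for x
  proof -
    have "tuple_map K P H (map s [0..<Suc (Suc m)]) x = tuple_map K P H (?s @ [s (Suc m)]) x" by simp
    also have "\<dots> = sw P R'.T (\<lambda>y z. snoc_tensor K ?R H (tuple_map K P H ?s y) (s (Suc m) z)) x"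
      using tuple_map_snoc[OF Pc H s_all(1,2) sl x] by (simp only: s_all(3))
    finally have "\<sigma> (tuple_map K P H (map s [0..<Suc (Suc m)]) x) =
        \<sigma> (sw P R'.T (\<lambda>y z. snoc_tensor K ?R H (tuple_map K P H ?s y) (s (Suc m) z)) x)" by simp
    also have "\<dots> = sw P P (\<lambda>y z. \<sigma> (snoc_tensor K ?R H (tuple_map K P H ?s y) (s (Suc m) z))) x"
      by (rule P.sw_comp[OF x R'.module_tensor P.is_module \<sigma>])
        (rule bilinearD(3)[OF H.bilinear_snoc_replicate tc linear_map_closed[OF sl]])
    also have "\<dots> = sw P P (\<lambda>y z. j (QH.pt (p y) (r z))) x"
    proof (intro P.sw_cong x)
      fix y z assume y: "y \<in> carrier P" and z: "z \<in> carrier P"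
      have "\<sigma> (snoc_tensor K ?R H (tuple_map K P H ?s y) (s (Suc m) z)) = j (QH.pt (\<rho> (tuple_map K P H ?s y)) (s (Suc m) z))"
        by (rule \<sigma>_snoc[OF tc[OF y] linear_map_closed[OF sl z]])
      also have "\<dots> = j (QH.pt (p y) (r z))"
        by (simp only: tuple_s[OF y] inv[OF coalgebra_hom_closed[OF ph y]] s_el(2)[OF z])
      finally show "\<sigma> (snoc_tensor K ?R H (tuple_map K P H ?s y) (s (Suc m) z)) = j (QH.pt (p y) (r z))" .
    qed
    also have "\<dots> = j (sw P QH.T (\<lambda>y z. QH.pt (p y) (r z)) x)"
      by (rule P.sw_comp[OF x QH.module_tensor P.is_module j, symmetric])
        (intro QH.pt_closed coalgebra_hom_closed[OF ph] coalgebra_hom_closed[OF rh])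
    also have "\<dots> = x" by (rule jP[OF x])
    finally show ?thesis .
  qed
  then show ?case using cone \<sigma> by blast
qed

text \<open>Any two products are isomorphic, and the isomorphism is compatible with the tuple maps. So it suffices
  that one of the tuple maps has a left inverse.\<close>

lemma tuple_map_inj:
  fixes H :: "('k, 'u) coalgebra"
  assumes inf: "infinite (UNIV :: 'u set)" and small: "carrier K \<lesssim> (UNIV :: 'u set)"
    and H: "cocommutative_coalgebra K H" and P: "product_cone (Coalg_coc K) {..<Suc m} (\<lambda>_. H) P p"
  shows "inj_on (tuple_map K P H (map p [0..<Suc m])) (carrier P)"
proof -
  obtain Q q \<rho> where Q: "product_cone (Coalg_coc K) {..<Suc m} (\<lambda>_. H) Q q"
    and inv: "\<And>x. x \<in> carrier Q \<Longrightarrow> \<rho> (tuple_map K Q H (map q [0..<Suc m]) x) = x"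
    using power_with_inverse[OF inf small H, of m] by blast
  note Pc = product_cone_coalgebra(1)[OF P] and ph = product_cone_coalgebra(2)[OF P]
  note Qc = product_cone_coalgebra(1)[OF Q] and qh = product_cone_coalgebra(2)[OF Q]
  obtain u where u: "coalgebra_hom K P Q u" "\<forall>i \<in> {..<Suc m}. \<forall>x \<in> carrier P. q i (u x) = p i x"
    using product_cone_coalgebra_lift[where f = p, OF Q Pc ph] by blast
  obtain v where v: "coalgebra_hom K Q P v" "\<forall>i \<in> {..<Suc m}. \<forall>x \<in> carrier Q. p i (v x) = q i x"
    using product_cone_coalgebra_lift[where f = q, OF P Qc qh] by blast
  note uc = coalgebra_hom_closed[OF u(1)]
  have vu: "v (u x) = x" if x: "x \<in> carrier P" for x
    by (rule product_cone_coalgebra_ext[OF P Pc coalgebra_hom_comp[OF Pc Qc Pc u(1) v(1)] coalgebra_hom_id[OF Pc] _ x])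
      (use u(2) v(2) uc in auto)
  have eq: "tuple_map K P H (map p [0..<Suc m]) x = tuple_map K Q H (map q [0..<Suc m]) (u x)" if x: "x \<in> carrier P" for x
  proof -
    have "tuple_map K P H (map p [0..<Suc m]) x = tuple_map K P H (map (\<lambda>f x. f (u x)) (map q [0..<Suc m])) x"
      by (rule tuple_map_cong[OF Pc H _ _ _ x]) (use coalgebra_hom_linear[OF ph] u(2) in \<open>auto simp del: upt_Suc\<close>)
    also have "\<dots> = tuple_map K Q H (map q [0..<Suc m]) (u x)"
      by (rule tuple_map_natural[OF Pc Qc H u(1) _ _ x, symmetric]) (use coalgebra_hom_linear[OF qh] in auto)
    finally show ?thesis .
  qed
  have "v (\<rho> (tuple_map K P H (map p [0..<Suc m]) x)) = x" if "x \<in> carrier P" for x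
    by (simp only: eq[OF that] inv[OF uc[OF that]] vu[OF that])
  then show ?thesis by (rule inj_on_inverseI)
qed

text \<open>With injectivity, this makes the inverse of the tuple map linear on all of \<open>H \<otimes> H\<close>, and with it
  the linearized binary terms.\<close>

lemma tuple_map_surj:
  fixes H :: "('k, 'u) coalgebra"
  assumes inf: "infinite (UNIV :: 'u set)" and small: "carrier K \<lesssim> (UNIV :: 'u set)"
    and H: "cocommutative_coalgebra K H" and P: "product_cone (Coalg_coc K) {..<2} (\<lambda>_. H) P p"
    and Y: "Y \<in> carrier (tensor K [H, H])"
  shows "\<exists>x \<in> carrier P. tuple_map K P H [p 0, p 1] x = Y"
proof -
  obtain Q q r j where prod: "coalgebra_product K H H Q q r" and j: "linear_map K (tensor K [H, H]) Q j"
    and jQ: "\<And>y. y \<in> carrier (tensor K [H, H]) \<Longrightarrow> sw Q (tensor K [H, H]) (\<lambda>x y. pure_tensor K [H, H] [q x, r y]) (j y) = y"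
    by (rule binary_product[OF inf small H H]) blast
  note Qc = coalgebra_productD(1)[OF prod] and qh = coalgebra_productD(2)[OF prod] and rh = coalgebra_productD(3)[OF prod]
  note Pc = product_cone_coalgebra(1)[OF P] and ph = product_cone_coalgebra(2)[OF P]
  interpret H: cocommutative_coalgebra K H by (rule H)
  interpret Q: cocommutative_coalgebra K Q by (rule Qc)
  have "coalgebra_hom K Q H (if i = (0 :: nat) then q else r)" for i using qh rh by simp
  from product_cone_coalgebra_lift[where f = "\<lambda>i. if i = 0 then q else r", OF P Qc this]
  obtain v where v: "coalgebra_hom K Q P v" "\<forall>i \<in> {..<2}. \<forall>x \<in> carrier Q. p i (v x) = (if i = 0 then q else r) x"
    by blast
  have jY: "j Y \<in> carrier Q" by (rule linear_map_closed[OF j Y])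
  have pl: "linear_map K P H (p 0)" "linear_map K P H (p 1)" using coalgebra_hom_linear[OF ph] by auto
  have "tuple_map K P H [p 0, p 1] (v (j Y)) = tuple_map K Q H (map (\<lambda>f x. f (v x)) [p 0, p 1]) (j Y)"
    by (rule tuple_map_natural[OF Qc Pc H v(1) _ _ jY]) (use pl in auto)
  also have "\<dots> = sw Q (tensor K [H, H]) (\<lambda>x y. pure_tensor K [H, H] [p 0 (v x), p 1 (v y)]) (j Y)"
    using tuple_map_pair[OF Qc H linear_map_comp[OF pl(1) coalgebra_hom_linear[OF v(1)]]
        linear_map_comp[OF pl(2) coalgebra_hom_linear[OF v(1)]] jY] by simp
  also have "\<dots> = sw Q (tensor K [H, H]) (\<lambda>x y. pure_tensor K [H, H] [q x, r y]) (j Y)"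
    by (intro Q.sw_cong jY) (use v(2) in auto)
  also have "\<dots> = Y" by (rule jQ[OF Y])
  finally show ?thesis using coalgebra_hom_closed[OF v(1) jY] by blast
qed

section \<open>Linearized terms\<close>

lemma linear_map_inverse:
  assumes M: "module K M" and f: "linear_map K M N f" and bij: "bij_betw f (carrier M) (carrier N)"
  shows "linear_map K N M (inv_into (carrier M) f)"
proof -
  interpret M: module K M by fact
  let ?g = "inv_into (carrier M) f"
  have gc: "?g y \<in> carrier M" and fg: "f (?g y) = y" if "y \<in> carrier N" for y
    using bij that by (auto simp: bij_betw_def inv_into_into f_inv_into_f)
  have gf: "?g (f x) = x" if "x \<in> carrier M" for x
    using bij that by (simp add: bij_betw_def)
  show ?thesis
  proof (rule linear_mapI[OF gc])
    fix x y assume xy: "x \<in> carrier N" "y \<in> carrier N"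
    have "f (?g x \<oplus>\<^bsub>M\<^esub> ?g y) = x \<oplus>\<^bsub>N\<^esub> y"
      using linear_map_add[OF f gc[OF xy(1)] gc[OF xy(2)]] fg xy by simp
    then show "?g (x \<oplus>\<^bsub>N\<^esub> y) = ?g x \<oplus>\<^bsub>M\<^esub> ?g y"
      using gf[of "?g x \<oplus>\<^bsub>M\<^esub> ?g y"] gc xy by simp
  next
    fix a x assume a: "a \<in> carrier K" and x: "x \<in> carrier N"
    have "f (a \<odot>\<^bsub>M\<^esub> ?g x) = a \<odot>\<^bsub>N\<^esub> x"
      using linear_map_smult[OF f a gc[OF x]] fg x by simp
    then show "?g (a \<odot>\<^bsub>N\<^esub> x) = a \<odot>\<^bsub>M\<^esub> ?g x"
      using gf[of "a \<odot>\<^bsub>M\<^esub> ?g x"] gc x a by simp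
  qed
qed

locale coalgebra_models = field K + models_of_theory L "Coalg_coc K :: (('k, 'u) coalgebra, 'u \<Rightarrow> 'u) cat"
  for K :: "('k, 'r) ring_scheme" and L :: "('o, 'm, 'z) lawvere_scheme" +
  assumes universe_infinite: "infinite (UNIV :: 'u set)"
    and universe_field: "carrier K \<lesssim> (UNIV :: 'u set)"
begin

abbreviation proj_map where "proj_map F m i \<equiv> Fm F (pow L m) (pow L 1) (proj L m i)"

lemma model_coalgebra: "F \<in> Ob M \<Longrightarrow> X \<in> Ob L \<Longrightarrow> cocommutative_coalgebra K (Fo F X)"
  using model_ob by simp

lemma model_coalgebra_hom:
  "F \<in> Ob M \<Longrightarrow> X \<in> Ob L \<Longrightarrow> Y \<in> Ob L \<Longrightarrow> f \<in> Hom L X Y \<Longrightarrow> coalgebra_hom K (Fo F X) (Fo F Y) (Fm F X Y f)"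
  using model_hom by (simp add: Hom_Coalg)

lemma power_comparison_eq:
  "power_comparison K L F m = tuple_map K (Fo F (pow L m)) (underlying L F) (map (proj_map F m) [0..<m])"
  by (simp add: power_comparison_def tuple_map_def fun_eq_iff)

lemma power_comparison_inj:
  assumes "F \<in> Ob M"
  shows "inj_on (power_comparison K L F (Suc m)) (carrier (Fo F (pow L (Suc m))))"
  unfolding power_comparison_eq
  by (rule tuple_map_inj[OF universe_infinite universe_field model_coalgebra[OF assms pow_ob] model_pow[OF assms]])

lemma linearized_term_power:
  assumes "F \<in> Ob M" "x \<in> carrier (Fo F (pow L (Suc m)))"
  shows "linearized_term K L F (Suc m) t (power_comparison K L F (Suc m) x) = Fm F (pow L (Suc m)) (pow L 1) t x"
  unfolding linearized_term_def using power_comparison_inj[OF assms(1)] assms(2) by simp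

context
  fixes F :: "('o, 'm, 'k, 'u) coalgebra_model"
  assumes F: "F \<in> Ob M"
begin

abbreviation "H \<equiv> underlying L F"
abbreviation "HH \<equiv> tensor_coalgebra K H H"

interpretation H: cocommutative_coalgebra K H
  by (rule model_coalgebra[OF F pow_ob])

interpretation HH: coalgebra_pair K H H
  by unfold_locales

lemma proj_coalgebra_hom: "i < m \<Longrightarrow> coalgebra_hom K (Fo F (pow L m)) H (proj_map F m i)"
  by (rule model_coalgebra_hom[OF F pow_ob pow_ob proj_hom])

lemma power_comparison_2:
  assumes "x \<in> carrier (Fo F (pow L 2))"
  shows "power_comparison K L F 2 x =
    sw (Fo F (pow L 2)) HH (\<lambda>y z. pure_tensor K [H, H] [proj_map F 2 0 y, proj_map F 2 1 z]) x"
proof -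
  have l: "linear_map K (Fo F (pow L 2)) H (proj_map F 2 0)" "linear_map K (Fo F (pow L 2)) H (proj_map F 2 1)"
    by (rule coalgebra_hom_linear[OF proj_coalgebra_hom], simp)+
  have "map (proj_map F 2) [0..<2] = [proj_map F 2 0, proj_map F 2 1]" by (simp add: numeral_2_eq_2)
  then show ?thesis
    unfolding power_comparison_eq
    using tuple_map_pair[OF model_coalgebra[OF F pow_ob] model_coalgebra[OF F pow_ob] l assms]
    by (simp only: HH.sw_into_C)
qed

lemma power_comparison_2_hom: "coalgebra_hom K (Fo F (pow L 2)) HH (power_comparison K L F 2)"
proof -
  have "coalgebra_hom K (Fo F (pow L 2)) HH
      (sw (Fo F (pow L 2)) HH (\<lambda>y z. pure_tensor K [H, H] [proj_map F 2 0 y, proj_map F 2 1 z]))"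
    by (rule HH.pairing(1)[OF model_coalgebra[OF F pow_ob] proj_coalgebra_hom proj_coalgebra_hom]) simp_all
  then show ?thesis
    by (subst coalgebra_hom_cong[OF model_coalgebra[OF F pow_ob]]) (rule power_comparison_2)
qed

lemma counits_power_comparison_2:
  assumes x: "x \<in> carrier (Fo F (pow L 2))"
  shows "id_counit H (power_comparison K L F 2 x) = proj_map F 2 0 x"
    and "counit_id H (power_comparison K L F 2 x) = proj_map F 2 1 x"
proof -
  note p = HH.pairing(2,3)[OF model_coalgebra[OF F pow_ob[of 2]] proj_coalgebra_hom[of 0 2] proj_coalgebra_hom[of 1 2]]
  show "id_counit H (power_comparison K L F 2 x) = proj_map F 2 0 x"
    unfolding power_comparison_2[OF x] id_counit_def HH.\<pi>1_def[symmetric] by (rule p(1)) (use x in simp_all)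
  show "counit_id H (power_comparison K L F 2 x) = proj_map F 2 1 x"
    unfolding power_comparison_2[OF x] counit_id_def HH.\<pi>2_def[symmetric] by (rule p(2)) (use x in simp_all)
qed

text \<open>The comparison of \<open>H(T\<^sup>2)\<close> with \<open>H \<otimes> H\<close> is a linear bijection, so that its inverse is linear.\<close>

lemma linearized_term_linear:
  assumes t: "t \<in> Hom L (pow L 2) (pow L 1)"
  shows "linear_map K HH H (linearized_term K L F 2 t)"
proof -
  note C2 = model_coalgebra[OF F pow_ob[of 2]]
  interpret C2: cocommutative_coalgebra K "Fo F (pow L 2)" by (rule C2)
  have inj: "inj_on (power_comparison K L F 2) (carrier (Fo F (pow L 2)))"
    using power_comparison_inj[OF F, of 1] by (simp only: Suc_1)
  have surj: "\<exists>x \<in> carrier (Fo F (pow L 2)). power_comparison K L F 2 x = Y" if "Y \<in> carrier HH" for Y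
  proof -
    have "map (proj_map F 2) [0..<2] = [proj_map F 2 0, proj_map F 2 1]" by (simp add: numeral_2_eq_2)
    then show ?thesis
      using tuple_map_surj[OF universe_infinite universe_field H.cocommutative_coalgebra_axioms model_pow[OF F], of Y] that
      unfolding power_comparison_eq by (simp only: HH.C_simps)
  qed
  note hom = power_comparison_2_hom
  have "bij_betw (power_comparison K L F 2) (carrier (Fo F (pow L 2))) (carrier HH)"
    unfolding bij_betw_def using inj surj coalgebra_hom_closed[OF hom] by blast
  from linear_map_inverse[OF C2.is_module coalgebra_hom_linear[OF hom] this]
  show ?thesis
    unfolding linearized_term_def[abs_def]
    by (rule linear_map_comp[OF coalgebra_hom_linear[OF model_coalgebra_hom[OF F pow_ob pow_ob t]]])
qed

text \<open>A generalised element \<open>(x, x)\<close> of \<open>H \<otimes> H\<close> factors through the comultiplication.\<close>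

lemma power_comparison_diagonal:
  assumes W: "cocommutative_coalgebra K W" and d: "coalgebra_hom K W (Fo F (pow L 2)) d"
    and eq: "\<And>w. w \<in> carrier W \<Longrightarrow> proj_map F 2 0 (d w) = proj_map F 2 1 (d w)" and w: "w \<in> carrier W"
  shows "power_comparison K L F 2 (d w) = comult H (proj_map F 2 0 (d w))"
proof -
  interpret W: cocommutative_coalgebra K W by (rule W)
  note C2 = model_coalgebra[OF F pow_ob[of 2]]
  have p0: "coalgebra_hom K (Fo F (pow L 2)) H (proj_map F 2 0)" and p1: "coalgebra_hom K (Fo F (pow L 2)) H (proj_map F 2 1)"
    by (rule proj_coalgebra_hom, simp)+
  note pd = coalgebra_hom_comp[OF W C2 H.cocommutative_coalgebra_axioms d p0]
  have "power_comparison K L F 2 (d w) = sw (Fo F (pow L 2)) H.HH.T (\<lambda>y z. H.HH.pt (proj_map F 2 0 y) (proj_map F 2 1 z)) (d w)"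
    by (simp only: power_comparison_2[OF coalgebra_hom_closed[OF d w]] HH.sw_into_C)
  also have "\<dots> = sw W H.HH.T (\<lambda>y z. H.HH.pt (proj_map F 2 0 (d y)) (proj_map F 2 1 (d z))) w"
    by (rule sw_hom[OF W C2 d w H.HH.module_tensor
        bilinear_precomp[OF H.HH.bilinear_pt coalgebra_hom_linear[OF p0] coalgebra_hom_linear[OF p1]]])
  also have "\<dots> = sw W H.HH.T (\<lambda>y z. H.HH.pt (proj_map F 2 0 (d y)) (proj_map F 2 0 (d z))) w"
    by (intro W.sw_cong w) (simp only: eq)
  also have "\<dots> = comult H (proj_map F 2 0 (d w))"
    using pd w unfolding coalgebra_hom_iff[OF W] by simp
  finally show ?thesis .
qed

text \<open>The argument of the linearized \<open>\<beta>\<close> in the second identity is the power comparison of the tuple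
  \<open>(\<alpha>\<^sub>1(x, y), \<dots>, \<alpha>\<^sub>n(x, y), y)\<close>.\<close>

lemma power_comparison_tuple:
  assumes W: "cocommutative_coalgebra K W" and d: "coalgebra_hom K W (Fo F (pow L 2)) d"
    and z: "coalgebra_hom K W (Fo F (pow L (n + 1))) z"
    and \<alpha>: "\<And>i. i < n \<Longrightarrow> \<alpha> i \<in> Hom L (pow L 2) (pow L 1)"
    and eq: "\<And>i w. i < n \<Longrightarrow> w \<in> carrier W \<Longrightarrow>
      proj_map F (n + 1) i (z w) = Fm F (pow L 2) (pow L 1) (\<alpha> i) (d w)"
    and last: "\<And>w. w \<in> carrier W \<Longrightarrow> proj_map F (n + 1) n (z w) = proj_map F 2 1 (d w)"
    and w: "w \<in> carrier W"
  shows "tensor_map K (replicate (n + 1) H) (map (\<lambda>i. linearized_term K L F 2 (\<alpha> i)) [0..<n] @ [counit_id H])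
      (iterated_comult K HH n (power_comparison K L F 2 (d w))) = power_comparison K L F (n + 1) (z w)"
proof -
  note Hc = H.cocommutative_coalgebra_axioms
  note C2 = model_coalgebra[OF F pow_ob[of 2]]
  let ?fs = "map (\<lambda>i. linearized_term K L F 2 (\<alpha> i)) [0..<n] @ [counit_id H]"
  have cl: "linear_map K HH H (counit_id H)"
    using HH.linear_projections(2) unfolding HH.\<pi>2_def counit_id_def .
  have fs: "\<forall>f \<in> set ?fs. linear_map K HH H f" "?fs \<noteq> []"
    using linearized_term_linear[OF \<alpha>] cl by auto
  note pd = coalgebra_hom_comp[OF W C2 HH.coalgebra_C d power_comparison_2_hom]
  have dc: "d v \<in> carrier (Fo F (pow L 2))" if "v \<in> carrier W" for v by (rule coalgebra_hom_closed[OF d that])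
  have lin: "linearized_term K L F 2 t (power_comparison K L F 2 (d v)) = Fm F (pow L 2) (pow L 1) t (d v)"
    if "v \<in> carrier W" for t v
    using linearized_term_power[OF F, of "d v" 1 t] dc[OF that] by (simp only: Suc_1)
  let ?gs = "map (\<lambda>f x. f (z x)) (map (proj_map F (n + 1)) [0..<n + 1])"
  have ps: "\<forall>f \<in> set (map (proj_map F (n + 1)) [0..<n + 1]). linear_map K (Fo F (pow L (n + 1))) H f"
    using coalgebra_hom_linear[OF proj_coalgebra_hom] by (auto simp del: upt_Suc)
  have "tensor_map K (replicate (n + 1) H) ?fs (iterated_comult K HH n (power_comparison K L F 2 (d w))) =
      tuple_map K HH H ?fs (power_comparison K L F 2 (d w))"
    by (simp add: tuple_map_def)
  also have "\<dots> = tuple_map K W H (map (\<lambda>f x. f (power_comparison K L F 2 (d x))) ?fs) w"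
    by (rule tuple_map_natural[OF W HH.coalgebra_C Hc pd fs w])
  also have "\<dots> = tuple_map K W H ?gs w"
  proof (rule tuple_map_cong[OF W Hc _ _ _ w])
    show "\<forall>f \<in> set (map (\<lambda>f x. f (power_comparison K L F 2 (d x))) ?fs). linear_map K W H f"
      using fs(1) linear_map_comp[OF _ coalgebra_hom_linear[OF pd]] by auto
    fix i v assume i: "i < length (map (\<lambda>f x. f (power_comparison K L F 2 (d x))) ?fs)" and v: "v \<in> carrier W"
    show "(map (\<lambda>f x. f (power_comparison K L F 2 (d x))) ?fs ! i) v = (?gs ! i) v"
    proof (cases "i < n")
      case True
      then show ?thesis using eq[OF True v] lin[OF v] by (simp add: nth_append del: upt_Suc)
    next
      case False
      then have "i = n" using i by simp
      then show ?thesis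
        using last[OF v] counits_power_comparison_2(2)[OF dc[OF v]] by (simp add: nth_append del: upt_Suc)
    qed
  qed simp_all
  also have "\<dots> = power_comparison K L F (n + 1) (z w)"
    unfolding power_comparison_eq
    by (rule tuple_map_natural[OF W model_coalgebra[OF F pow_ob] Hc z ps _ w, symmetric]) simp
  finally show ?thesis .
qed

end

text \<open>The map \<open>0\<close> sends an element to the image under \<open>\<eta>\<close> of the element of \<open>Z(T)\<close> with the same counit. The
  latter is unique because \<open>Z(T)\<close> is terminal, and homomorphisms preserve counits.\<close>

lemma zero_map_eq:
  assumes F: "F \<in> Ob M" and Z: "zero_object M (SOME Z. zero_object M Z)"
    and \<eta>: "\<eta> \<in> Hom M (SOME Z. zero_object M Z) F"
    and W: "cocommutative_coalgebra K W" and w: "w \<in> carrier W"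
    and x: "coalgebra_hom K W (underlying L F) x" and t: "coalgebra_hom K W (underlying L (SOME Z. zero_object M Z)) t"
  shows "zero_map K L F F (x w) = \<eta> (pow L 1) (t w)"
proof -
  let ?Z = "SOME Z. zero_object M Z"
  obtain U :: "('k, 'u) coalgebra" where U: "terminal_object (Coalg_coc K) U"
    using terminal_coalgebra[OF is_cring universe_field] .
  have "terminal_object M ?Z" using Z by (simp add: zero_object_def)
  note ZT = terminal_models[OF U this pow_ob[of 1]]
  have inj: "inj_on (counit (underlying L ?Z)) (carrier (underlying L ?Z))"
    by (rule terminal_counit_inj[OF is_cring universe_field ZT])
  have "\<exists>!\<eta>. \<eta> \<in> Hom M ?Z F"
    using Z F unfolding zero_object_def initial_object_def by blast
  from the1_equality[OF this, OF \<eta>] have "(THE \<eta>. \<eta> \<in> Hom M ?Z F) = \<eta>" .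
  moreover have "counit (underlying L F) (x w) = counit (underlying L ?Z) (t w)"
    using coalgebra_hom_counit[OF x w] coalgebra_hom_counit[OF t w] by simp
  ultimately show ?thesis
    unfolding zero_map_def unit_map_def Let_def
    using inj coalgebra_hom_closed[OF t w] by simp
qed

end

theorem proposition3p5:
  fixes K :: "('k, 'r) ring_scheme"
    and L :: "('o, 'm, 'z) lawvere_scheme"
    and n :: nat
    and \<alpha> :: "nat \<Rightarrow> 'm"
    and \<beta> :: 'm
  assumes K: "field K"
    and L: "lawvere_theory L"
    and universe_infinite: "infinite (UNIV :: 'u set)"
    and universe_field: "carrier K \<lesssim> (UNIV :: 'u set)"
    and universe_theory: "\<And>X Y. X \<in> Ob L \<Longrightarrow> Y \<in> Ob L \<Longrightarrow> Hom L X Y \<lesssim> (UNIV :: 'u set)"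
    and pointed_Set: "pointed (models L (Set_cat :: ('u set, 'u \<Rightarrow> 'u) cat))"
    and pointed_Coalg: "pointed (models L (Coalg_coc K :: (('k, 'u) coalgebra, 'u \<Rightarrow> 'u) cat))"
    and n: "n > 0"
    and \<alpha>: "\<And>i. i < n \<Longrightarrow> \<alpha> i \<in> Hom L (pow L 2) (pow L 1)"
    and \<beta>: "\<beta> \<in> Hom L (pow L (n + 1)) (pow L 1)"
    and \<alpha>_diagonal: "\<And>(F :: ('o, 'm, 'k, 'u) coalgebra_model) H i x.
        F \<in> Ob (models L (Coalg_coc K)) \<Longrightarrow> H = underlying L F \<Longrightarrow> i < n \<Longrightarrow> x \<in> carrier H \<Longrightarrow>
        linearized_term K L F 2 (\<alpha> i) (comult H x) = zero_map K L F F x"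
    and \<beta>_identity: "\<And>(F :: ('o, 'm, 'k, 'u) coalgebra_model) H x.
        F \<in> Ob (models L (Coalg_coc K)) \<Longrightarrow> H = underlying L F \<Longrightarrow> x \<in> carrier (tensor K [H, H]) \<Longrightarrow>
        linearized_term K L F (n + 1) \<beta>
          (tensor_map K (replicate (n + 1) H)
             (map (\<lambda>i. linearized_term K L F 2 (\<alpha> i)) [0..<n] @ [counit_id H])
             (iterated_comult K (tensor_coalgebra K H H) n x)) =
        id_counit H x"
  shows "protomodular (models L (Coalg_coc K :: (('k, 'u) coalgebra, 'u \<Rightarrow> 'u) cat))"
proof -
  let ?D = "Coalg_coc K :: (('k, 'u) coalgebra, 'u \<Rightarrow> 'u) cat"
  let ?M = "models L ?D"
  interpret coalgebra_models K L
    by (intro coalgebra_models.intro K models_of_theory.intro models_in_pullbacks.intro models_in.intro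
        lawvere_theory.axioms(1)[OF L] L category_Coalg models_in_pullbacks_axioms.intro
        coalgebra_models_axioms.intro universe_infinite universe_field)
      (rule pullback_coalgebra[OF K universe_infinite universe_field])
  let ?Z = "SOME Z. zero_object ?M Z"
  have Z: "zero_object ?M ?Z" using pointed_Coalg unfolding pointed_def by (rule someI_ex)
  obtain U :: "('k, 'u) coalgebra" where U: "terminal_object ?D U"
    using terminal_coalgebra[OF is_cring universe_field] .
  show ?thesis
  proof (rule protomodular_models[OF U Z \<alpha> \<beta>])
    fix F \<eta> W d t i
    assume F: "F \<in> Ob ?M" and \<eta>: "\<eta> \<in> Hom ?M ?Z F" and W: "W \<in> Ob ?D" and d: "d \<in> Hom ?D W (Fo F (pow L 2))"
      and eq: "pow_el F W 2 0 d = pow_el F W 2 1 d" and t: "t \<in> Hom ?D W (Fo ?Z (pow L 1))" and i: "i < n"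
    have W': "cocommutative_coalgebra K W" using W by simp
    note d' = Hom_Coalg_hom[OF d] and t' = Hom_Coalg_hom[OF t]
    have Z_ob: "?Z \<in> Ob ?M" using Z by (simp add: zero_object_def initial_object_def)
    have eq': "proj_map F 2 0 (d w) = proj_map F 2 1 (d w)" if "w \<in> carrier W" for w
      using fun_cong[OF eq, of w] that by (simp add: compose_def)
    show "term_el F W 2 (\<alpha> i) d = nat_el ?Z F \<eta> W t"
    proof (rule Hom_Coalg_eqI[OF model_app_closed[OF F pow_ob pow_ob \<alpha>[OF i] W d] nat_app_closed[OF Z_ob F \<eta> pow_ob W t]])
      fix w assume w: "w \<in> carrier W"
      note x = coalgebra_hom_comp[OF W' model_coalgebra[OF F pow_ob] model_coalgebra[OF F pow_ob] d'
          proj_coalgebra_hom[OF F zero_less_numeral]]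
      have "Fm F (pow L 2) (pow L 1) (\<alpha> i) (d w) = linearized_term K L F 2 (\<alpha> i) (power_comparison K L F 2 (d w))"
        using linearized_term_power[OF F, of "d w" 1 "\<alpha> i"] coalgebra_hom_closed[OF d' w] by (simp only: Suc_1)
      also have "power_comparison K L F 2 (d w) = comult (underlying L F) (proj_map F 2 0 (d w))"
        by (rule power_comparison_diagonal[OF F W' d' _ w]) (rule eq')
      also have "linearized_term K L F 2 (\<alpha> i) \<dots> = zero_map K L F F (proj_map F 2 0 (d w))"
        by (rule \<alpha>_diagonal[OF F HOL.refl i coalgebra_hom_closed[OF x w]])
      also have "\<dots> = \<eta> (pow L 1) (t w)"
        by (rule zero_map_eq[OF F Z \<eta> W' w x t'])
      finally show "term_el F W 2 (\<alpha> i) d w = nat_el ?Z F \<eta> W t w"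
        using w by (simp add: compose_def)
    qed
  next
    fix F W d z
    assume F: "F \<in> Ob ?M" and W: "W \<in> Ob ?D" and d: "d \<in> Hom ?D W (Fo F (pow L 2))"
      and z: "z \<in> Hom ?D W (Fo F (pow L (n + 1)))"
      and eq: "\<And>i. i < n \<Longrightarrow> pow_el F W (n + 1) i z = term_el F W 2 (\<alpha> i) d"
      and last: "pow_el F W (n + 1) n z = pow_el F W 2 1 d"
    have W': "cocommutative_coalgebra K W" using W by simp
    note d' = Hom_Coalg_hom[OF d] and z' = Hom_Coalg_hom[OF z]
    have eq': "proj_map F (n + 1) i (z w) = Fm F (pow L 2) (pow L 1) (\<alpha> i) (d w)" if "i < n" "w \<in> carrier W" for i w
      using fun_cong[OF eq[OF that(1)], of w] that(2) by (simp add: compose_def)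
    have last': "proj_map F (n + 1) n (z w) = proj_map F 2 1 (d w)" if "w \<in> carrier W" for w
      using fun_cong[OF last, of w] that by (simp add: compose_def)
    show "term_el F W (n + 1) \<beta> z = pow_el F W 2 0 d"
    proof (rule Hom_Coalg_eqI[OF model_app_closed[OF F pow_ob pow_ob \<beta> W z]
          model_app_closed[OF F pow_ob pow_ob proj_hom[OF zero_less_numeral] W d]])
      fix w assume w: "w \<in> carrier W"
      note dw = coalgebra_hom_closed[OF d' w]
      have X: "power_comparison K L F 2 (d w) \<in> carrier (tensor K [underlying L F, underlying L F])"
        using coalgebra_hom_closed[OF power_comparison_2_hom[OF F] dw]
          coalgebra_pair.C_simps(1)[OF coalgebra_pair.intro[OF model_coalgebra[OF F pow_ob] model_coalgebra[OF F pow_ob]]]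
        by simp
      have "Fm F (pow L (n + 1)) (pow L 1) \<beta> (z w) = linearized_term K L F (n + 1) \<beta> (power_comparison K L F (n + 1) (z w))"
        using linearized_term_power[OF F, of "z w" n \<beta>] coalgebra_hom_closed[OF z' w] by simp
      also have "\<dots> = id_counit (underlying L F) (power_comparison K L F 2 (d w))"
      proof -
        have "power_comparison K L F (n + 1) (z w) =
          tensor_map K (replicate (n + 1) (underlying L F))
            (map (\<lambda>i. linearized_term K L F 2 (\<alpha> i)) [0..<n] @ [counit_id (underlying L F)])
            (iterated_comult K (tensor_coalgebra K (underlying L F) (underlying L F)) n (power_comparison K L F 2 (d w)))"
          by (rule power_comparison_tuple[OF F W' d' z' _ _ _ w, symmetric]) (rule \<alpha> eq' last'; assumption)+
        then show ?thesis
          by (simp only: \<beta>_identity[OF F HOL.refl X])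
      qed
      also have "\<dots> = proj_map F 2 0 (d w)"
        by (rule counits_power_comparison_2(1)[OF F dw])
      finally show "term_el F W (n + 1) \<beta> z w = pow_el F W 2 0 d w"
        using w by (simp add: compose_def)
    qed
  qed
qed

end
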